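(* Let $k\ge3$, $m=k-2$, and let $X_h:=\{v\in L^2(\Omega): v|_K\in\mathbb P_k(K)\ \forall K\in\mathcal T_h\}$ be the space of discontinuous finite elements of degree $k$. Let $H_h$ be the elementwise Hessian, $(H_hv_h)|_K:=D^2(v_h|_K)$ for $K\in\mathcal T_h$, and $$J_h(v_h,w_h):=\sum_{F\in\mathcal F_h^i}h_F^{-1}\int_F\llbracket\nabla v_h\rrbracket\,\llbracket\nabla w_h\rrbracket\,ds+\sum_{F\in\mathcal F_h}h_F^{-3}\int_F\llbracket v_h\rrbracket\cdot\llbracket w_h\rrbracket\,ds.$$ Then the linear problem: given $\mathbf P_h\in Z_h(\mathbb S^2)$, find $u_h=u_h(\mathbf P_h)\in X_h$ with $$a_h(u_h,v_h)=(\mathbf P_h,H_hv_h)_h\qquad\forall v_h\in X_h,$$ is well posed. Moreover, let $u$ satisfy (A.1) (stated in the context). Then, for $h$ sufficiently small, with $\mathbf P_h^\star$ the locally unique fixed point of $T_h$ near $\widehat{\mathbf P}_h$ (see context) and $u_h^\star:=u_h(\mathbf P_h^\star)$, the function $u_h^\star$ is elementwise convex and $$\|H_hu_h^\star-D^2u\|_{L^2(\mathcal T_h)}+\sigma^{1/2}J_h(u_h^\star-u,u_h^\star-u)^{1/2}\le C\,h^{1+m},$$ with $C>0$ independent of $h$.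
   Context: Mesh and discrete spaces. $\Omega\subset\mathbb R^2$ is a convex polygonal domain and $\{\mathcal T_h\}$ is a shape-regular, quasi-uniform family of triangulations of $\Omega$, with $h_K=\operatorname{diam}(K)$, $h=\max_{K\in\mathcal T_h}h_K$. "Independent of $h$" means uniform over the family. $\mathcal F_h^i$, $\mathcal F_h^b$ and $\mathcal F_h=\mathcal F_h^i\cup\mathcal F_h^b$ are the sets of interior, boundary and all edges, $h_F$ the length of the edge $F$. For an interior edge $F=\partial K^+\cap\partial K^-$ with outward unit normals $\mathbf n_\pm$ to $K^\pm$: the jump of a piecewise vector field is $\llbracket\mathbf w\rrbracket|_F:=\mathbf w^+\cdot\mathbf n_++\mathbf w^-\cdot\mathbf n_-$ and the jump of a piecewise scalar function is the vector $\llbracket w\rrbracket|_F:=w^+\mathbf n_++w^-\mathbf n_-$; on a boundary edge $\llbracket w\rrbracket|_F:=w\,\mathbf n$ with $\mathbf n$ the outward unit normal to $\Omega$. The form $J_h$ is evaluated by the same formula on functions $v_h-u$ with $v_h\in X_h$. $\mathbb S^2$ is the space of symmetric $2\times2$ real matrices, $\mathbb S^2_{++}$ the positive definite ones, $A:B=\operatorname{tr}(A^\top B)$. $Z_h$ is the space of $v_h\in L^2(\Omega)$ with $v_h|_K\in\mathbb P_m(K)$ for all $K\in\mathcal T_h$ (no continuity across elements); $Z_h(\mathbb S^2)$ is its $\mathbb S^2$-valued analogue. For each $K$, $\{x_{K,j}\}_{j=1}^{N_m}$, $N_m=\dim\mathbb P_m(K)$, are local nodes obtained from a fixed unisolvent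 nodal configuration for $\mathbb P_m$ on the reference triangle by the affine map; nodes of different elements are treated as distinct and $v_h(x_{K,j}):=(v_h|_K)(x_{K,j})$. Positive weights $w_{K,j}$ satisfy $w_{K,j}\simeq h_K^2$ uniformly in $K,j,h$. Set $(v_h,z_h)_h=\sum_K\sum_j w_{K,j}v_h(x_{K,j})z_h(x_{K,j})$ (with $:$ in place of the product for matrix fields) and $\|v_h\|_h^2=(v_h,v_h)_h$. $\|v\|_{L^2(\mathcal T_h)}^2=\sum_K\|v\|_{L^2(K)}^2$. $I_h^Z:C^0(\overline\Omega)\to Z_h$ is the nodal interpolation operator at the local nodes, extended componentwise to matrix fields. "Elementwise convex" means convex on each $K\in\mathcal T_h$. (A.1) Exact solution (homogeneous Dirichlet datum). $f\in C^0(\overline\Omega)$ with $0<c_0\le f\le c_1<\infty$, and $u\in W^{3,\infty}(\Omega)\cap H^{m+3}(\Omega)$ is a convex solution of $\det D^2u=f$ in $\Omega$, $u=0$ on $\partial\Omega$, and there are $\nu_1\ge\nu_2>0$ with $\nu_2|\xi|^2\le\xi^TD^2u(x)\xi\le\nu_1|\xi|^2$ for all $\xi\in\mathbb R^2$, $x\in\Omega$. Set $\widehat{\mathbf P}_h:=I_h^Z(D^2u)$. Scheme. $a_h(w_h,v_h):=(H_hw_h,H_hv_h)_h+\sigma J_h(w_h,v_h)$ with fixed $\sigma>0$; $R_h\mathbf P_h:=H_hu_h(\mathbf P_h)$. $\mathcal B_h:=\{\mathbf Q_h\in Z_h(\mathbb S^2):\ \mathbf Q_h(x_{K,j})\in\mathbb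 S^2_{++},\ \det\mathbf Q_h(x_{K,j})=f(x_{K,j})\ \forall K,j\}$, $\Pi^{(h)}_{\mathcal B_h}$ is the nearest point projection onto $\mathcal B_h$ with respect to $\|\cdot\|_h$, and $T_h:=\Pi^{(h)}_{\mathcal B_h}\circ R_h$. There are $\kappa_0,h_0>0$ independent of $h$ such that for $h\le h_0$ the map $T_h$ is single-valued and a contraction (with $h$-independent constant $<1$) of $\{\mathbf Q_h\in Z_h(\mathbb S^2):\|\mathbf Q_h-\widehat{\mathbf P}_h\|_h\le\kappa_0h\}$ into itself; $\mathbf P_h^\star$ denotes its unique fixed point in this set. *)

theory Defs
  imports "HOL-Analysis.Analysis"
begin

type_synonym pt = "real^2"
type_synonym mat = "real^2^2"

text \<open>Gradient and Hessian are taken relative to a set \<open>S\<close>. On a convex set with nonempty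
  interior they are unique, and at boundary points of \<open>S\<close> they give the one-sided traces.\<close>

definition grad_on :: "pt set \<Rightarrow> (pt \<Rightarrow> real) \<Rightarrow> pt \<Rightarrow> pt" where
  "grad_on S w x = (THE g. (w has_derivative (\<lambda>d. g \<bullet> d)) (at x within S))"

definition hess_on :: "pt set \<Rightarrow> (pt \<Rightarrow> real) \<Rightarrow> pt \<Rightarrow> mat" where
  "hess_on S w x = (THE A. (grad_on S w has_derivative (\<lambda>d. A *v d)) (at x within S))"

definition C2_on :: "pt set \<Rightarrow> (pt \<Rightarrow> real) \<Rightarrow> bool" where
  "C2_on S w \<longleftrightarrow>
     (\<forall>x\<in>S. w differentiable (at x within S)) \<and>
     (\<forall>x\<in>S. grad_on S w differentiable (at x within S)) \<and>
     continuous_on S (hess_on S w)"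

text \<open>Multi-indices are lists of coordinate directions.\<close>

primrec iter_pd :: "2 list \<Rightarrow> (pt \<Rightarrow> real) \<Rightarrow> pt \<Rightarrow> real" where
  "iter_pd [] \<phi> = \<phi>"
| "iter_pd (i # \<alpha>) \<phi> = (\<lambda>x. frechet_derivative (iter_pd \<alpha> \<phi>) (at x) (axis i 1))"

definition test_function :: "pt set \<Rightarrow> (pt \<Rightarrow> real) \<Rightarrow> bool" where
  "test_function \<Omega> \<phi> \<longleftrightarrow>
     (\<forall>\<alpha> x. iter_pd \<alpha> \<phi> differentiable (at x)) \<and>
     compact (closure {x. \<phi> x \<noteq> 0}) \<and> closure {x. \<phi> x \<noteq> 0} \<subseteq> \<Omega>"

definition weak_deriv :: "pt set \<Rightarrow> 2 list \<Rightarrow> (pt \<Rightarrow> real) \<Rightarrow> (pt \<Rightarrow> real) \<Rightarrow> bool" where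
  "weak_deriv \<Omega> \<alpha> u w \<longleftrightarrow>
     (\<forall>\<phi>. test_function \<Omega> \<phi> \<longrightarrow>
        (LINT x:\<Omega>|lebesgue. u x * iter_pd \<alpha> \<phi> x) =
        (- 1) ^ length \<alpha> * (LINT x:\<Omega>|lebesgue. w x * \<phi> x))"

definition L2_space :: "pt set \<Rightarrow> (pt \<Rightarrow> real) set" where
  "L2_space \<Omega> = {w. w \<in> borel_measurable (lebesgue_on \<Omega>) \<and>
     set_integrable lebesgue \<Omega> (\<lambda>x. (w x)\<^sup>2)}"

definition Linf_space :: "pt set \<Rightarrow> (pt \<Rightarrow> real) set" where
  "Linf_space \<Omega> = {w. w \<in> borel_measurable (lebesgue_on \<Omega>) \<and>
     (\<exists>M. AE x in lebesgue_on \<Omega>. \<bar>w x\<bar> \<le> M)}"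

definition sobolev_H :: "pt set \<Rightarrow> nat \<Rightarrow> (pt \<Rightarrow> real) set" where
  "sobolev_H \<Omega> s = {u. u \<in> L2_space \<Omega> \<and>
     (\<forall>\<alpha>. length \<alpha> \<le> s \<longrightarrow> (\<exists>w\<in>L2_space \<Omega>. weak_deriv \<Omega> \<alpha> u w))}"

definition sobolev_Winf :: "pt set \<Rightarrow> nat \<Rightarrow> (pt \<Rightarrow> real) set" where
  "sobolev_Winf \<Omega> s = {u. u \<in> Linf_space \<Omega> \<and>
     (\<forall>\<alpha>. length \<alpha> \<le> s \<longrightarrow> (\<exists>w\<in>Linf_space \<Omega>. weak_deriv \<Omega> \<alpha> u w))}"

definition convex_polygonal_domain :: "pt set \<Rightarrow> bool" where
  "convex_polygonal_domain \<Omega> \<longleftrightarrow> open \<Omega> \<and> convex \<Omega> \<and> \<Omega> \<noteq> {} \<and> polytope (closure \<Omega>)"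

definition ref_triangle :: "pt set" where
  "ref_triangle = convex hull {0, axis 1 1, axis 2 1}"

text \<open>A discretization consists of the triangles, for each triangle the chosen affine map from
  the reference triangle (the map is unique only up to the ordering of the vertices), and
  the nodal weights \<open>w\<^bsub>K,j\<^esub>\<close>.\<close>

record disc =
  elems :: "pt set set"
  refmap :: "pt set \<Rightarrow> pt \<Rightarrow> pt"
  wt :: "pt set \<Rightarrow> nat \<Rightarrow> real"

definition mesh_of :: "pt set \<Rightarrow> disc \<Rightarrow> bool" where
  "mesh_of \<Omega> D \<longleftrightarrow>
     triangulation (elems D) \<and> (\<forall>K\<in>elems D. 2 simplex K) \<and> \<Union>(elems D) = closure \<Omega> \<and>
     (\<forall>K\<in>elems D. (\<exists>B b. \<forall>x. refmap D K x = B *v x + b) \<and> refmap D K ` ref_triangle = K)"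

definition mesh_size :: "disc \<Rightarrow> real" where
  "mesh_size D = Max (diameter ` elems D)"

definition shape_regular :: "('i \<Rightarrow> disc) \<Rightarrow> bool" where
  "shape_regular mesh \<longleftrightarrow>
     (\<exists>\<gamma>. \<forall>i. \<forall>K\<in>elems (mesh i). \<exists>x r. 0 < r \<and> ball x r \<subseteq> K \<and> diameter K \<le> \<gamma> * r)"

definition quasi_uniform :: "('i \<Rightarrow> disc) \<Rightarrow> bool" where
  "quasi_uniform mesh \<longleftrightarrow>
     (\<exists>\<theta>>0. \<forall>i. \<forall>K\<in>elems (mesh i). \<theta> * mesh_size (mesh i) \<le> diameter K)"

definition interior_edges :: "disc \<Rightarrow> pt set set" where
  "interior_edges D = {F. \<exists>K\<in>elems D. \<exists>K'\<in>elems D. K \<noteq> K' \<and> F edge_of K \<and> F edge_of K'}"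

definition boundary_edges :: "pt set \<Rightarrow> disc \<Rightarrow> pt set set" where
  "boundary_edges \<Omega> D = {F. (\<exists>K\<in>elems D. F edge_of K) \<and> F \<subseteq> frontier \<Omega>}"

definition edges :: "pt set \<Rightarrow> disc \<Rightarrow> pt set set" where
  "edges \<Omega> D = interior_edges D \<union> boundary_edges \<Omega> D"

definition outer_normal :: "pt set \<Rightarrow> pt set \<Rightarrow> pt" where
  "outer_normal K F = (THE n. norm n = 1 \<and> (\<forall>x\<in>F. \<forall>y\<in>K. n \<bullet> (y - x) \<le> 0))"

text \<open>Arc-length integral over a segment; the value does not depend on the orientation chosen.\<close>

definition edge_integral :: "pt set \<Rightarrow> (pt \<Rightarrow> real) \<Rightarrow> real" where
  "edge_integral F g =
     (let (a, b) = (SOME (a, b). F = closed_segment a b)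
      in dist a b * integral {0..1} (\<lambda>t. g (linepath a b t)))"

text \<open>A piecewise function is a family indexed by the elements, so that its traces on an edge from
  the two sides are unambiguous. A broken polynomial is represented by the polynomials (on the
  whole plane) that extend its restrictions to the elements, and by \<open>0\<close> at indices that are
  not elements. Since the elements have nonempty interior, this is a bijective
  representation of the piecewise polynomials in \<open>L\<^sup>2\<close>.\<close>

type_synonym 'a broken = "pt set \<Rightarrow> pt \<Rightarrow> 'a"

definition Pk :: "nat \<Rightarrow> (pt \<Rightarrow> real) set" where
  "Pk k = {p. \<exists>c. \<forall>x. p x = (\<Sum>i\<le>k. \<Sum>j\<le>k - i. c i j * (x $ 1) ^ i * (x $ 2) ^ j)}"

definition broken_poly :: "nat \<Rightarrow> disc \<Rightarrow> real broken set" where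
  "broken_poly k D = {v. (\<forall>K\<in>elems D. v K \<in> Pk k) \<and> (\<forall>K. K \<notin> elems D \<longrightarrow> v K = (\<lambda>_. 0))}"

definition broken_sym_poly :: "nat \<Rightarrow> disc \<Rightarrow> mat broken set" where
  "broken_sym_poly m D = {Q. (\<forall>a b. (\<lambda>K x. Q K x $ a $ b) \<in> broken_poly m D) \<and>
     (\<forall>K x. transpose (Q K x) = Q K x)}"

text \<open>Jumps. Summing over all elements having \<open>F\<close> as an edge yields both contributions on an interior
  edge and the single contribution \<open>w n\<close> on a boundary edge, where the outer normal of the
  element is that of the domain.\<close>

definition jump :: "disc \<Rightarrow> real broken \<Rightarrow> pt set \<Rightarrow> pt \<Rightarrow> pt" where
  "jump D w F x = (\<Sum>K | K \<in> elems D \<and> F edge_of K. w K x *\<^sub>R outer_normal K F)"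

definition vjump :: "disc \<Rightarrow> pt broken \<Rightarrow> pt set \<Rightarrow> pt \<Rightarrow> real" where
  "vjump D w F x = (\<Sum>K | K \<in> elems D \<and> F edge_of K. w K x \<bullet> outer_normal K F)"

definition bgrad :: "real broken \<Rightarrow> pt broken" where
  "bgrad w K = grad_on K (w K)"

definition J_h :: "pt set \<Rightarrow> disc \<Rightarrow> real broken \<Rightarrow> real broken \<Rightarrow> real" where
  "J_h \<Omega> D v w =
     (\<Sum>F\<in>interior_edges D. inverse (diameter F) *
        edge_integral F (\<lambda>x. vjump D (bgrad v) F x * vjump D (bgrad w) F x)) +
     (\<Sum>F\<in>edges \<Omega> D. inverse (diameter F ^ 3) *
        edge_integral F (\<lambda>x. jump D v F x \<bullet> jump D w F x))"

text \<open>The Hessian is taken in the whole plane because \<open>v K\<close> is the polynomial extension of the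
  restriction to \<open>K\<close>; thus the elementwise Hessian is again a broken polynomial.\<close>

definition H_h :: "real broken \<Rightarrow> mat broken" where
  "H_h v K = hess_on UNIV (v K)"

definition elementwise_convex :: "disc \<Rightarrow> real broken \<Rightarrow> bool" where
  "elementwise_convex D v \<longleftrightarrow> (\<forall>K\<in>elems D. convex_on K (v K))"

definition L2_broken_norm :: "disc \<Rightarrow> mat broken \<Rightarrow> real" where
  "L2_broken_norm D V = sqrt (\<Sum>K\<in>elems D. LINT x:K|lebesgue. (norm (V K x))\<^sup>2)"

text \<open>Dimension of the polynomials of degree at most \<open>m\<close> in two variables.\<close>

definition n_nodes :: "nat \<Rightarrow> nat" where
  "n_nodes m = (m + 2) choose 2"

definition unisolvent :: "nat \<Rightarrow> (nat \<Rightarrow> pt) \<Rightarrow> bool" where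
  "unisolvent m \<xi> \<longleftrightarrow> (\<forall>j<n_nodes m. \<xi> j \<in> ref_triangle) \<and>
     (\<forall>y :: nat \<Rightarrow> real. \<exists>!p. p \<in> Pk m \<and> (\<forall>j<n_nodes m. p (\<xi> j) = y j))"

definition node :: "(nat \<Rightarrow> pt) \<Rightarrow> disc \<Rightarrow> pt set \<Rightarrow> nat \<Rightarrow> pt" where
  "node \<xi> D K j = refmap D K (\<xi> j)"

definition uniform_weights :: "nat \<Rightarrow> ('i \<Rightarrow> disc) \<Rightarrow> bool" where
  "uniform_weights m mesh \<longleftrightarrow>
     (\<exists>c>0. \<exists>C. \<forall>i. \<forall>K\<in>elems (mesh i). \<forall>j<n_nodes m.
        c * (diameter K)\<^sup>2 \<le> wt (mesh i) K j \<and> wt (mesh i) K j \<le> C * (diameter K)\<^sup>2)"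

definition frob :: "mat \<Rightarrow> mat \<Rightarrow> real" where
  "frob A B = trace (transpose A ** B)"

definition inner_h :: "nat \<Rightarrow> (nat \<Rightarrow> pt) \<Rightarrow> disc \<Rightarrow> mat broken \<Rightarrow> mat broken \<Rightarrow> real" where
  "inner_h m \<xi> D V W =
     (\<Sum>K\<in>elems D. \<Sum>j<n_nodes m.
        wt D K j * frob (V K (node \<xi> D K j)) (W K (node \<xi> D K j)))"

definition norm_h :: "nat \<Rightarrow> (nat \<Rightarrow> pt) \<Rightarrow> disc \<Rightarrow> mat broken \<Rightarrow> real" where
  "norm_h m \<xi> D V = sqrt (inner_h m \<xi> D V V)"

definition interp :: "nat \<Rightarrow> (nat \<Rightarrow> pt) \<Rightarrow> disc \<Rightarrow> (pt \<Rightarrow> real) \<Rightarrow> real broken" where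
  "interp m \<xi> D g K =
     (if K \<in> elems D
      then (THE p. p \<in> Pk m \<and> (\<forall>j<n_nodes m. p (node \<xi> D K j) = g (node \<xi> D K j)))
      else (\<lambda>_. 0))"

definition interp_mat :: "nat \<Rightarrow> (nat \<Rightarrow> pt) \<Rightarrow> disc \<Rightarrow> (pt \<Rightarrow> mat) \<Rightarrow> mat broken" where
  "interp_mat m \<xi> D G K x = (\<chi> a b. interp m \<xi> D (\<lambda>y. G y $ a $ b) K x)"

definition a_h :: "pt set \<Rightarrow> nat \<Rightarrow> (nat \<Rightarrow> pt) \<Rightarrow> real \<Rightarrow> disc \<Rightarrow> real broken \<Rightarrow> real broken \<Rightarrow> real"
  where
  "a_h \<Omega> m \<xi> \<sigma> D w v = inner_h m \<xi> D (H_h w) (H_h v) + \<sigma> * J_h \<Omega> D w v"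

definition is_solution ::
  "pt set \<Rightarrow> nat \<Rightarrow> nat \<Rightarrow> (nat \<Rightarrow> pt) \<Rightarrow> real \<Rightarrow> disc \<Rightarrow> mat broken \<Rightarrow> real broken \<Rightarrow> bool" where
  "is_solution \<Omega> k m \<xi> \<sigma> D P u \<longleftrightarrow>
     u \<in> broken_poly k D \<and>
     (\<forall>v\<in>broken_poly k D. a_h \<Omega> m \<xi> \<sigma> D u v = inner_h m \<xi> D P (H_h v))"

text \<open>Unique solvability and continuous dependence on the datum, the solution being measured in
  the energy norm of the scheme.\<close>

definition well_posed :: "pt set \<Rightarrow> nat \<Rightarrow> nat \<Rightarrow> (nat \<Rightarrow> pt) \<Rightarrow> real \<Rightarrow> disc \<Rightarrow> bool" where
  "well_posed \<Omega> k m \<xi> \<sigma> D \<longleftrightarrow>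
     (\<forall>P\<in>broken_sym_poly m D. \<exists>!u. is_solution \<Omega> k m \<xi> \<sigma> D P u) \<and>
     (\<exists>C. \<forall>P\<in>broken_sym_poly m D. \<forall>u. is_solution \<Omega> k m \<xi> \<sigma> D P u \<longrightarrow>
        sqrt (a_h \<Omega> m \<xi> \<sigma> D u u) \<le> C * norm_h m \<xi> D P)"

definition u_h ::
  "pt set \<Rightarrow> nat \<Rightarrow> nat \<Rightarrow> (nat \<Rightarrow> pt) \<Rightarrow> real \<Rightarrow> disc \<Rightarrow> mat broken \<Rightarrow> real broken" where
  "u_h \<Omega> k m \<xi> \<sigma> D P = (THE u. is_solution \<Omega> k m \<xi> \<sigma> D P u)"

definition R_h ::
  "pt set \<Rightarrow> nat \<Rightarrow> nat \<Rightarrow> (nat \<Rightarrow> pt) \<Rightarrow> real \<Rightarrow> disc \<Rightarrow> mat broken \<Rightarrow> mat broken" where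
  "R_h \<Omega> k m \<xi> \<sigma> D P = H_h (u_h \<Omega> k m \<xi> \<sigma> D P)"

definition posdef :: "mat \<Rightarrow> bool" where
  "posdef A \<longleftrightarrow> transpose A = A \<and> (\<forall>z. z \<noteq> 0 \<longrightarrow> 0 < z \<bullet> (A *v z))"

definition B_h :: "nat \<Rightarrow> (nat \<Rightarrow> pt) \<Rightarrow> (pt \<Rightarrow> real) \<Rightarrow> disc \<Rightarrow> mat broken set" where
  "B_h m \<xi> f D = {Q \<in> broken_sym_poly m D. \<forall>K\<in>elems D. \<forall>j<n_nodes m.
     posdef (Q K (node \<xi> D K j)) \<and> det (Q K (node \<xi> D K j)) = f (node \<xi> D K j)}"

text \<open>The nearest point projection onto the nonconvex set \<open>B_h\<close> is set-valued in general; so is the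
  iteration map \<open>T_h\<close>.\<close>

definition proj_B :: "nat \<Rightarrow> (nat \<Rightarrow> pt) \<Rightarrow> (pt \<Rightarrow> real) \<Rightarrow> disc \<Rightarrow> mat broken \<Rightarrow> mat broken set" where
  "proj_B m \<xi> f D R = {Q \<in> B_h m \<xi> f D. \<forall>Q'\<in>B_h m \<xi> f D.
     norm_h m \<xi> D (\<lambda>K x. R K x - Q K x) \<le> norm_h m \<xi> D (\<lambda>K x. R K x - Q' K x)}"

definition T_h ::
  "pt set \<Rightarrow> nat \<Rightarrow> nat \<Rightarrow> (nat \<Rightarrow> pt) \<Rightarrow> real \<Rightarrow> (pt \<Rightarrow> real) \<Rightarrow> disc \<Rightarrow> mat broken \<Rightarrow> mat broken set"
  where
  "T_h \<Omega> k m \<xi> \<sigma> f D P = proj_B m \<xi> f D (R_h \<Omega> k m \<xi> \<sigma> D P)"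

definition P_hat :: "pt set \<Rightarrow> nat \<Rightarrow> (nat \<Rightarrow> pt) \<Rightarrow> (pt \<Rightarrow> real) \<Rightarrow> disc \<Rightarrow> mat broken" where
  "P_hat \<Omega> m \<xi> u D = interp_mat m \<xi> D (hess_on (closure \<Omega>) u)"

definition cball_h ::
  "nat \<Rightarrow> (nat \<Rightarrow> pt) \<Rightarrow> disc \<Rightarrow> mat broken \<Rightarrow> real \<Rightarrow> mat broken set" where
  "cball_h m \<xi> D P r = {Q \<in> broken_sym_poly m D. norm_h m \<xi> D (\<lambda>K x. Q K x - P K x) \<le> r}"

definition T_contraction ::
  "pt set \<Rightarrow> nat \<Rightarrow> nat \<Rightarrow> (nat \<Rightarrow> pt) \<Rightarrow> real \<Rightarrow> (pt \<Rightarrow> real) \<Rightarrow> disc \<Rightarrow> real \<Rightarrow> mat broken set \<Rightarrow> bool"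
  where
  "T_contraction \<Omega> k m \<xi> \<sigma> f D q S \<longleftrightarrow>
     (\<forall>P\<in>S. \<exists>Q\<in>S. T_h \<Omega> k m \<xi> \<sigma> f D P = {Q}) \<and>
     (\<forall>P\<in>S. \<forall>P'\<in>S. \<forall>Q\<in>T_h \<Omega> k m \<xi> \<sigma> f D P. \<forall>Q'\<in>T_h \<Omega> k m \<xi> \<sigma> f D P'.
        norm_h m \<xi> D (\<lambda>K x. Q K x - Q' K x) \<le> q * norm_h m \<xi> D (\<lambda>K x. P K x - P' K x))"

definition P_star ::
  "pt set \<Rightarrow> nat \<Rightarrow> nat \<Rightarrow> (nat \<Rightarrow> pt) \<Rightarrow> real \<Rightarrow> (pt \<Rightarrow> real) \<Rightarrow> disc \<Rightarrow> mat broken set \<Rightarrow> mat broken"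
  where
  "P_star \<Omega> k m \<xi> \<sigma> f D S = (THE P. P \<in> S \<and> T_h \<Omega> k m \<xi> \<sigma> f D P = {P})"

text \<open>On a convex domain every class in \<open>W\<^sup>3\<^sup>,\<^sup>\<infinity>\<close> has a representative that is twice continuously
  differentiable up to the boundary; \<open>u\<close> denotes this representative, which gives a meaning
  to the pointwise conditions and to the nodal values of the Hessian.\<close>

definition exact_solution :: "pt set \<Rightarrow> nat \<Rightarrow> (pt \<Rightarrow> real) \<Rightarrow> (pt \<Rightarrow> real) \<Rightarrow> bool" where
  "exact_solution \<Omega> m f u \<longleftrightarrow>
     continuous_on (closure \<Omega>) f \<and>
     (\<exists>c0>0. \<exists>c1. \<forall>x\<in>closure \<Omega>. c0 \<le> f x \<and> f x \<le> c1) \<and>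
     C2_on (closure \<Omega>) u \<and> u \<in> sobolev_Winf \<Omega> 3 \<and> u \<in> sobolev_H \<Omega> (m + 3) \<and>
     convex_on \<Omega> u \<and>
     (\<forall>x\<in>\<Omega>. det (hess_on (closure \<Omega>) u x) = f x) \<and>
     (\<forall>x\<in>frontier \<Omega>. u x = 0) \<and>
     (\<exists>\<nu>1 \<nu>2. \<nu>1 \<ge> \<nu>2 \<and> \<nu>2 > 0 \<and> (\<forall>x\<in>\<Omega>. \<forall>z.
        \<nu>2 * (norm z)\<^sup>2 \<le> z \<bullet> (hess_on (closure \<Omega>) u x *v z) \<and>
        z \<bullet> (hess_on (closure \<Omega>) u x *v z) \<le> \<nu>1 * (norm z)\<^sup>2))"

end

theory Submission
  imports Defs "HOL-Computational_Algebra.Polynomial"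
begin

text \<open>The jumps of the exact solution \<open>u\<close> vanish, so \<open>J_h(u, v) = 0\<close> for every
  broken polynomial \<open>v\<close>. Tested with the difference of two discrete functions, the
  discrete equation for a datum \<open>P\<close> therefore says that \<open>u_h(P)\<close>
  minimizes \<open>|H_h v - P|\<^sup>2 + \<sigma> J_h(v - u, v - u)\<close> over the discrete
  space, where \<open>|.|\<close> is the nodal norm (\<open>galerkin_best_approximation\<close>).
  The whole error analysis is played with this functional.

  Let \<open>PH\<close> be the nodal interpolant of the Hessian of \<open>u\<close>, and suppose
  that some broken polynomial \<open>v\<close> makes the functional for the datum
  \<open>PH\<close> at most \<open>e\<^sup>2\<close>. Then the Hessian of \<open>u_h(PH)\<close>
  is within \<open>e\<close> of \<open>PH\<close>. As \<open>PH\<close> itself satisfies the nodal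
  determinant equations, projecting that Hessian onto the constraint set moves it by at most
  \<open>e\<close>, so the iteration map moves \<open>PH\<close> by at most \<open>2 e\<close>
  (\<open>fixed_point_close\<close>), and the contraction property places the fixed point within
  \<open>2 e / (1 - q)\<close> of \<open>PH\<close>. Comparing \<open>u_h\<close> of the fixed
  point with the same \<open>v\<close> in its own minimization problem bounds its jumps and its
  nodal Hessian error by a multiple of \<open>e\<close> (\<open>fixed_point_energy\<close>).

  It remains to find \<open>v\<close> with \<open>e\<close> of order \<open>m + 1\<close> in the
  mesh size, although the derivatives of \<open>u\<close> of order \<open>m + 3\<close> exist only
  in \<open>L\<^sup>2\<close> (\<open>element_approx\<close>). On a triangle, \<open>v\<close>
  comes from a Taylor polynomial of a mollification of \<open>u\<close>. For a fixed point
  \<open>x\<close> and centre \<open>y\<close>, the integral remainder involves the highest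
  derivatives on the segment from \<open>y\<close> to \<open>x\<close>; averaged over the centres
  \<open>y\<close> in a square, its square becomes an area integral of squares of highest
  derivatives. The Jacobian \<open>(1 - s)\<^sup>2\<close> of the contraction of the square
  towards \<open>x\<close> is supplied by the square of the factor \<open>(1 - s)^m\<close> of the
  remainder, because \<open>m \<ge> 1\<close> (\<open>taylor_poly_average_error\<close>). One
  centre thus serves finitely many points, the nodes among them, and the boundedness of nodal
  interpolation extends the estimate to the whole triangle. Summed over the triangles, the squares
  of these elementwise errors are controlled by the Sobolev norm of \<open>u\<close>.

  Convexity: quasi-uniformity turns the nodal Hessian error into a uniform one of order
  \<open>m\<close> (\<open>fixed_point_error\<close>), which for small mesh sizes is below the
  lower ellipticity constant of the Hessian of \<open>u\<close>.

  Well-posedness is Riesz representation on a finitely generated space, once the form is definite.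
  If \<open>a_h(v, v) = 0\<close>, then \<open>v\<close> is affine on each triangle, the jump
  terms force the affine functions of adjacent triangles to coincide, and removing the finitely
  many vertices leaves the domain connected; so \<open>v\<close> is one affine function, and it
  vanishes on the boundary (\<open>broken_affine_zero\<close>).\<close>

section \<open>Smooth bump functions\<close>

text \<open>Every derivative of \<open>exp (- 1 / t)\<close>, extended by \<open>0\<close> to \<open>t \<le>
  0\<close>, has this form. The class is closed under differentiation, which makes smoothness an
  induction on the polynomial.\<close>

definition flat :: "real poly \<Rightarrow> real \<Rightarrow> real" where
  "flat p t = (if t > 0 then poly p (1 / t) * exp (- (1 / t)) else 0)"

lemma poly_times_exp_minus_tendsto_0:
  "((\<lambda>y::real. poly p y * exp (- y)) \<longlongrightarrow> 0) at_top"
proof -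
  have "((\<lambda>y::real. \<Sum>i\<le>degree p. coeff p i * (y ^ i / exp y)) \<longlongrightarrow> (\<Sum>i\<le>degree p. coeff p i * 0)) at_top"
    by (intro tendsto_sum tendsto_mult tendsto_const tendsto_power_div_exp_0)
  then show ?thesis
    by (simp add: poly_altdef exp_minus sum_distrib_right divide_inverse mult.assoc)
qed

lemma flat_tendsto_0: "(flat p \<longlongrightarrow> 0) (at 0)"
proof (rule filterlim_split_at)
  show "(flat p \<longlongrightarrow> 0) (at_left 0)"
    by (rule tendsto_eventually) (auto simp: flat_def eventually_at_filter)
  have "((\<lambda>t. poly p (inverse t) * exp (- inverse t)) \<longlongrightarrow> 0) (at_right (0::real))"
    by (rule filterlim_compose[OF poly_times_exp_minus_tendsto_0 filterlim_inverse_at_top_right])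
  then show "(flat p \<longlongrightarrow> 0) (at_right 0)"
    by (rule Lim_transform_eventually)
      (auto simp: flat_def eventually_at_filter inverse_eq_divide)
qed

text \<open>Away from \<open>0\<close> this is the chain rule. At \<open>0\<close> the difference quotient of
  \<open>flat p\<close> is again of the form \<open>flat\<close>, with the polynomial multiplied
  by its argument, and so tends to \<open>0\<close>.\<close>

lemma flat_has_derivative:
  "(flat p has_real_derivative flat ([:0, 0, 1:] * (p - pderiv p)) t) (at t)"
proof -
  consider "t > 0" | "t < 0" | "t = 0" by linarith
  then show ?thesis
  proof cases
    case 1
    have "((\<lambda>t. poly p (1 / t) * exp (- (1 / t))) has_real_derivative
        flat ([:0, 0, 1:] * (p - pderiv p)) t) (at t)"
      using 1 by (auto intro!: derivative_eq_intros simp: flat_def field_simps power2_eq_square)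
    then show ?thesis
      by (rule has_field_derivative_transform_within_open[where S = "{0<..}"])
        (use 1 in \<open>auto simp: flat_def\<close>)
  next
    case 2
    have "((\<lambda>_. 0) has_real_derivative flat ([:0, 0, 1:] * (p - pderiv p)) t) (at t)"
      using 2 by (simp add: flat_def)
    then show ?thesis
      by (rule has_field_derivative_transform_within_open[where S = "{..<0}"])
        (use 2 in \<open>auto simp: flat_def\<close>)
  next
    case 3
    have "(flat ([:0, 1:] * p) \<longlongrightarrow> 0) (at 0)" by (rule flat_tendsto_0)
    then have "((\<lambda>h. (flat p (0 + h) - flat p 0) / h) \<longlongrightarrow> 0) (at 0)"
      by (rule Lim_transform_eventually) (auto simp: flat_def eventually_at_filter)
    then show ?thesis using 3 by (simp add: DERIV_def flat_def)
  qed
qed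

text \<open>\<open>flat (flat_poly n)\<close> is the \<open>n\<close>-th derivative of \<open>exp (- 1 /
  t)\<close> extended by \<open>0\<close>.\<close>

primrec flat_poly :: "nat \<Rightarrow> real poly" where
  "flat_poly 0 = 1"
| "flat_poly (Suc n) = [:0, 0, 1:] * (flat_poly n - pderiv (flat_poly n))"

text \<open>For sequences \<open>b\<close> and \<open>c\<close> of successive derivatives, \<open>leibniz b c
  n 0 0\<close> is the \<open>n\<close>-th derivative of the product \<open>b 0 * c 0\<close>; the
  indices \<open>i\<close> and \<open>j\<close> count the derivatives that have already fallen on
  each factor. The recursion replaces binomial coefficients.\<close>

primrec leibniz :: "(nat \<Rightarrow> real \<Rightarrow> real) \<Rightarrow> (nat \<Rightarrow> real \<Rightarrow> real) \<Rightarrow> nat \<Rightarrow> nat \<Rightarrow> nat \<Rightarrow> real \<Rightarrow> real" where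
  "leibniz b c 0 i j t = b i t * c j t"
| "leibniz b c (Suc n) i j t = leibniz b c n (Suc i) j t + leibniz b c n i (Suc j) t"

lemma leibniz_has_derivative:
  assumes "\<And>n t. (b n has_real_derivative b (Suc n) t) (at t)"
    and "\<And>n t. (c n has_real_derivative c (Suc n) t) (at t)"
  shows "(leibniz b c n i j has_real_derivative leibniz b c (Suc n) i j t) (at t)"
proof (induction n arbitrary: i j)
  case 0
  show ?case
    by (auto intro!: derivative_eq_intros assms)
next
  case (Suc n)
  have "((\<lambda>t. leibniz b c n (Suc i) j t + leibniz b c n i (Suc j) t) has_real_derivative
     leibniz b c (Suc n) (Suc i) j t + leibniz b c (Suc n) i (Suc j) t) (at t)"
    by (intro derivative_intros Suc.IH)
  then show ?case by simp
qed

lemma leibniz_eq_0: "(\<forall>n. b n t = 0) \<or> (\<forall>n. c n t = 0) \<Longrightarrow> leibniz b c n i j t = 0"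
  by (induction n arbitrary: i j) auto

text \<open>The product of a flat function that starts at \<open>-\<epsilon>\<close> and the reflection of
  one, which ends at \<open>\<epsilon>\<close>. All derivatives are provided at once, as a
  sequence, since the mollifier is assembled from them.\<close>

lemma smooth_bump_exists:
  fixes \<epsilon> :: real
  assumes "\<epsilon> > 0"
  obtains b :: "nat \<Rightarrow> real \<Rightarrow> real"
  where "\<And>n t. (b n has_real_derivative b (Suc n) t) (at t)"
    and "\<And>t. 0 \<le> b 0 t" and "0 < b 0 0" and "\<And>n t. \<epsilon> \<le> \<bar>t\<bar> \<Longrightarrow> b n t = 0"
proof -
  \<comment> \<open>\<open>l\<close> vanishes to the left of \<open>-\<epsilon>\<close>, \<open>r\<close> to
    the right of \<open>\<epsilon>\<close>.\<close>
  define l where "l n t = flat (flat_poly n) (\<epsilon> + t)" for n t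
  define r where "r n t = (- 1) ^ n * flat (flat_poly n) (\<epsilon> - t)" for n t
  have fl: "(flat (flat_poly n) has_real_derivative flat (flat_poly (Suc n)) t) (at t)" for n t
    using flat_has_derivative[of "flat_poly n" t] by simp
  have l: "(l n has_real_derivative l (Suc n) t) (at t)" for n t
  proof -
    have "((\<lambda>t. flat (flat_poly n) (\<epsilon> + t)) has_real_derivative
         flat (flat_poly (Suc n)) (\<epsilon> + t) * 1) (at t)"
      by (rule DERIV_chain2[OF fl]) (auto intro!: derivative_eq_intros)
    then show ?thesis
      by (simp add: l_def [abs_def])
  qed
  have r: "(r n has_real_derivative r (Suc n) t) (at t)" for n t
  proof -
    have "((\<lambda>t. flat (flat_poly n) (\<epsilon> - t)) has_real_derivative
         flat (flat_poly (Suc n)) (\<epsilon> - t) * (- 1)) (at t)"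
      by (rule DERIV_chain2[OF fl]) (auto intro!: derivative_eq_intros)
    from DERIV_cmult[OF this, of "(- 1) ^ n"] show ?thesis
      by (simp add: r_def [abs_def])
  qed
  show ?thesis
  proof (rule that[of "\<lambda>n. leibniz l r n 0 0"])
    show "(leibniz l r n 0 0 has_real_derivative leibniz l r (Suc n) 0 0 t) (at t)" for n t
      by (rule leibniz_has_derivative) (rule l, rule r)
    show "0 \<le> leibniz l r 0 0 0 t" for t
      by (simp add: l_def r_def flat_def)
    show "0 < leibniz l r 0 0 0 0"
      using assms by (simp add: l_def r_def flat_def)
    show "leibniz l r n 0 0 t = 0" if "\<epsilon> \<le> \<bar>t\<bar>" for n t
    proof (rule leibniz_eq_0)
      show "(\<forall>n. l n t = 0) \<or> (\<forall>n. r n t = 0)"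
        using that by (auto simp: l_def r_def flat_def abs_le_iff abs_if split: if_splits)
    qed
  qed
qed

section \<open>Families of partial derivatives\<close>

text \<open>A smooth function \<open>V 0 0\<close> together with all its partial derivatives, \<open>V i
  j\<close> being differentiated \<open>i\<close> times in the first and \<open>j\<close> times in
  the second variable. Carrying the derivatives along avoids choosing them repeatedly, and the
  indexing builds in that their order is irrelevant.\<close>

definition pd_family :: "(nat \<Rightarrow> nat \<Rightarrow> pt \<Rightarrow> real) \<Rightarrow> bool" where
  "pd_family V \<longleftrightarrow> (\<forall>i j x. (V i j has_derivative
     (\<lambda>d. d $ 1 * V (Suc i) j x + d $ 2 * V i (Suc j) x)) (at x))"

lemma pd_familyD:
  "pd_family V \<Longrightarrow>
    (V i j has_derivative (\<lambda>d. d $ 1 * V (Suc i) j x + d $ 2 * V i (Suc j) x)) (at x within S)"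
  unfolding pd_family_def by (blast intro: has_derivative_at_withinI)

lemma pd_family_continuous: "pd_family V \<Longrightarrow> continuous_on S (V i j)"
  by (rule has_derivative_continuous_on) (rule pd_familyD)

lemma pd_family_continuous_compose:
  "pd_family V \<Longrightarrow> continuous_on S g \<Longrightarrow> continuous_on S (\<lambda>x. V i j (g x))"
  using continuous_on_compose2[OF pd_family_continuous[of V UNIV]] by blast

lemma iter_pd_pd_family:
  assumes "pd_family V"
  shows "iter_pd \<alpha> (V 0 0) = V (count_list \<alpha> 1) (count_list \<alpha> 2)"
proof (induction \<alpha>)
  case (Cons a \<alpha>)
  have "frechet_derivative (V i j) (at x) = (\<lambda>d. d $ 1 * V (Suc i) j x + d $ 2 * V i (Suc j) x)"
    for i j x
    using frechet_derivative_at[OF pd_familyD[OF assms, of i j x UNIV]] by simp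
  then show ?case
    using Cons exhaust_2[of a] by (auto simp: axis_def)
qed auto

text \<open>The sign is the one produced by differentiating \<open>V 0 0 (x - y)\<close> with respect to
  \<open>y\<close>.\<close>

lemma pd_family_reflect:
  assumes "pd_family V"
  shows "pd_family (\<lambda>i j y. (- 1) ^ (i + j) * V i j (x - y))"
  unfolding pd_family_def
proof (intro allI)
  fix i j y
  have "((\<lambda>y. V i j (x - y)) has_derivative
     (\<lambda>d. (- d) $ 1 * V (Suc i) j (x - y) + (- d) $ 2 * V i (Suc j) (x - y))) (at y)"
    by (rule has_derivative_compose[OF _ pd_familyD[OF assms]])
       (auto intro!: derivative_eq_intros)
  from has_derivative_mult_right[OF this, of "(- 1) ^ (i + j)"]
  show "((\<lambda>y. (- 1) ^ (i + j) * V i j (x - y)) has_derivative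
       (\<lambda>d. d $ 1 * ((- 1) ^ (Suc i + j) * V (Suc i) j (x - y)) +
            d $ 2 * ((- 1) ^ (i + Suc j) * V i (Suc j) (x - y)))) (at y)"
    by (simp add: algebra_simps)
qed

text \<open>A mollifier centred at \<open>x\<close> is an admissible test function as long as its support,
  reflected and shifted to \<open>x\<close>, stays inside the domain. This is how weak derivatives
  act on convolutions.\<close>

lemma test_function_reflect_pd_family:
  assumes \<rho>: "pd_family \<rho>"
    and supp: "\<And>z. \<rho> 0 0 z \<noteq> 0 \<Longrightarrow> z \<in> S" and S: "compact S" "\<And>z. z \<in> S \<Longrightarrow> x - z \<in> \<Omega>"
  shows "test_function \<Omega> (\<lambda>y. \<rho> 0 0 (x - y))"
    and "iter_pd \<alpha> (\<lambda>y. \<rho> 0 0 (x - y)) y =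
      (- 1) ^ length \<alpha> * \<rho> (count_list \<alpha> 1) (count_list \<alpha> 2) (x - y)"
proof -
  let ?V = "\<lambda>i j y. (- 1) ^ (i + j) * \<rho> i j (x - y)"
  note fam = pd_family_reflect[OF \<rho>, of x]
  have "(\<lambda>y. \<rho> 0 0 (x - y)) = ?V 0 0" by simp
  note it = iter_pd_pd_family[OF fam, folded this]
  have len: "count_list \<alpha> 1 + count_list \<alpha> 2 = length \<alpha>" for \<alpha> :: "2 list"
  proof (induction \<alpha>)
    case (Cons a \<alpha>)
    then show ?case using exhaust_2[of a] by auto
  qed auto
  show "iter_pd \<alpha> (\<lambda>y. \<rho> 0 0 (x - y)) y =
      (- 1) ^ length \<alpha> * \<rho> (count_list \<alpha> 1) (count_list \<alpha> 2) (x - y)" for \<alpha> y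
    unfolding it by (simp add: len)
  have diff: "iter_pd \<alpha> (\<lambda>y. \<rho> 0 0 (x - y)) differentiable (at y)" for \<alpha> y
    unfolding it using pd_familyD[OF fam] unfolding differentiable_def by blast
  let ?T = "(\<lambda>z. x - z) ` S"
  have T: "compact ?T"
    by (intro compact_continuous_image S(1) continuous_intros)
  have "{y. \<rho> 0 0 (x - y) \<noteq> 0} \<subseteq> ?T"
    using supp by (force intro: image_eqI[where x = "x - y" for y])
  then have cl: "closure {y. \<rho> 0 0 (x - y) \<noteq> 0} \<subseteq> ?T"
    by (rule closure_minimal) (rule compact_imp_closed[OF T])
  moreover have "compact (closure {y. \<rho> 0 0 (x - y) \<noteq> 0})"
    using compact_Int_closed[OF T closed_closure] cl by (metis inf.absorb2)
  moreover have "?T \<subseteq> \<Omega>" using S(2) by auto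
  ultimately show "test_function \<Omega> (\<lambda>y. \<rho> 0 0 (x - y))"
    unfolding test_function_def using diff by blast
qed

definition square :: "real \<Rightarrow> pt set" where
  "square \<epsilon> = cbox (vec (- \<epsilon>)) (vec \<epsilon>)"

lemma mem_square: "x \<in> square \<epsilon> \<longleftrightarrow> (\<forall>i. \<bar>x $ i\<bar> \<le> \<epsilon>)"
  by (auto simp: square_def mem_box_cart abs_le_iff minus_le_iff)

text \<open>A tensor product of one-dimensional bumps, normalized. Squares as supports fit the integrals over
  boxes.\<close>

lemma mollifier_exists:
  assumes \<epsilon>: "\<epsilon> > 0"
  obtains \<rho> where "pd_family \<rho>" "\<And>x. 0 \<le> \<rho> 0 0 x"
    "\<And>i j x. x \<notin> square \<epsilon> \<Longrightarrow> \<rho> i j x = 0" "integral (square \<epsilon>) (\<rho> 0 0) = 1"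
proof -
  obtain b :: "nat \<Rightarrow> real \<Rightarrow> real"
  where b: "\<And>n t. (b n has_real_derivative b (Suc n) t) (at t)"
    and b0: "\<And>t. 0 \<le> b 0 t" "0 < b 0 0" and supp: "\<And>n t. \<epsilon> \<le> \<bar>t\<bar> \<Longrightarrow> b n t = 0"
    using smooth_bump_exists[OF \<epsilon>] by metis
  define p where "p i j x = b i (x $ 1) * b j (x $ 2)" for i j and x :: pt
  have p: "pd_family p"
    unfolding pd_family_def p_def
  proof (intro allI)
    fix i j and x :: pt
    have *: "((\<lambda>x::pt. b n (x $ a)) has_derivative (\<lambda>d. d $ a * b (Suc n) (x $ a))) (at x)" for n a
      by (rule DERIV_compose_FDERIV[OF b]) (intro bounded_linear_imp_has_derivative bounded_linear_vec_nth)
    show "((\<lambda>x. b i (x $ 1) * b j (x $ 2)) has_derivative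
         (\<lambda>d. d $ 1 * (b (Suc i) (x $ 1) * b j (x $ 2)) + d $ 2 * (b i (x $ 1) * b (Suc j) (x $ 2)))) (at x)"
      by (rule has_derivative_eq_rhs, rule has_derivative_mult[OF * *]) (simp add: algebra_simps)
  qed
  have vec0: "\<And>x. 0 \<le> p 0 0 x" by (simp add: p_def b0)
  define c where "c = integral (square \<epsilon>) (p 0 0)"
  have box: "box (vec (- \<epsilon>)) (vec \<epsilon> :: pt) \<noteq> {}"
    using \<epsilon> by (subst box_ne_empty) (simp add: Basis_vec_def inner_axis)
  have "c \<noteq> 0"
  proof
    assume "c = 0"
    then have "\<forall>x\<in>square \<epsilon>. p 0 0 x = 0"
      unfolding c_def square_def
      by (subst (asm) integral_cbox_eq_0_iff) (use vec0 box pd_family_continuous[OF p] in auto)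
    moreover have "0 \<in> square \<epsilon>" using \<epsilon> by (simp add: mem_square)
    ultimately show False using b0 by (auto simp: p_def)
  qed
  moreover have "c \<ge> 0"
    unfolding c_def square_def
    using vec0 by (intro integral_nonneg integrable_continuous pd_family_continuous[OF p])
  ultimately have c: "c > 0" by simp
  show ?thesis
  proof (rule that[of "\<lambda>i j x. p i j x / c"])
    show "pd_family (\<lambda>i j x. p i j x / c)"
      unfolding pd_family_def
    proof (intro allI)
      fix i j x
      from has_derivative_mult_right[OF pd_familyD[OF p, of i j x UNIV], of "1 / c"]
      show "((\<lambda>x. p i j x / c) has_derivative (\<lambda>d. d $ 1 * (p (Suc i) j x / c) + d $ 2 * (p i (Suc j) x / c))) (at x)"
        by (simp add: add_divide_distrib)
    qed
    show "0 \<le> p 0 0 x / c" for x using c vec0[of x] by simp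
    show "p i j x / c = 0" if "x \<notin> square \<epsilon>" for i j x
    proof -
      have "\<epsilon> \<le> \<bar>x $ 1\<bar> \<or> \<epsilon> \<le> \<bar>x $ 2\<bar>"
        using that by (auto simp: mem_square forall_2)
      then show ?thesis by (auto simp: p_def supp)
    qed
    show "integral (square \<epsilon>) (\<lambda>x. p 0 0 x / c) = 1"
      using c by (simp add: c_def[symmetric])
  qed
qed

section \<open>Taylor expansion in the plane\<close>

text \<open>The \<open>n\<close>-th order Taylor form \<open>(d \<bullet> \<nabla>)^n\<close> of \<open>V i
  j\<close> at \<open>y\<close>, expanded recursively.\<close>

primrec taylor_form :: "(nat \<Rightarrow> nat \<Rightarrow> pt \<Rightarrow> real) \<Rightarrow> nat \<Rightarrow> nat \<Rightarrow> nat \<Rightarrow> pt \<Rightarrow> pt \<Rightarrow> real" where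
  "taylor_form V 0 i j y d = V i j y"
| "taylor_form V (Suc n) i j y d =
     d $ 1 * taylor_form V n (Suc i) j y d + d $ 2 * taylor_form V n i (Suc j) y d"

definition taylor_poly :: "(nat \<Rightarrow> nat \<Rightarrow> pt \<Rightarrow> real) \<Rightarrow> nat \<Rightarrow> nat \<Rightarrow> nat \<Rightarrow> pt \<Rightarrow> pt \<Rightarrow> real" where
  "taylor_poly V k i j y x = (\<Sum>n\<le>k. taylor_form V n i j y (x - y) / fact n)"

lemma taylor_form_has_derivative:
  "((taylor_form V (Suc n) i j y) has_derivative
     (\<lambda>e. real (Suc n) * (e $ 1 * taylor_form V n (Suc i) j y d + e $ 2 * taylor_form V n i (Suc j) y d))) (at d)"
proof (induction n arbitrary: i j)
  case 0
  have "bounded_linear (\<lambda>d::pt. d $ 1 * V (Suc i) j y + d $ 2 * V i (Suc j) y)"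
    by (intro bounded_linear_add bounded_linear_compose[OF bounded_linear_mult_left] bounded_linear_vec_nth)
  then show ?case by (simp add: bounded_linear_imp_has_derivative)
next
  case (Suc n)
  have nth: "((\<lambda>d::pt. d $ a) has_derivative (\<lambda>e. e $ a)) (at d)" for a
    by (intro bounded_linear_imp_has_derivative bounded_linear_vec_nth)
  have "taylor_form V (Suc (Suc n)) i j y =
      (\<lambda>d. d $ 1 * taylor_form V (Suc n) (Suc i) j y d + d $ 2 * taylor_form V (Suc n) i (Suc j) y d)"
    by (rule ext) (simp only: taylor_form.simps(2)[of V "Suc n"])
  then show ?case
    apply (simp only:)
    apply (rule has_derivative_eq_rhs)
     apply (rule has_derivative_add has_derivative_mult nth Suc.IH)+
    apply (simp add: algebra_simps)
    done
qed

text \<open>Differentiating a Taylor polynomial of a function gives the Taylor polynomial, one degree lower,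
  of the corresponding derivative of the function; hence an error bound for the second derivatives
  only requires the Taylor expansion of the second derivatives.\<close>

lemma taylor_poly_has_derivative:
  "(taylor_poly V (Suc k) i j y has_derivative
     (\<lambda>e. e $ 1 * taylor_poly V k (Suc i) j y x + e $ 2 * taylor_poly V k i (Suc j) y x)) (at x)"
proof -
  have sh: "((\<lambda>x. taylor_form V (Suc n) i j y (x - y) / fact (Suc n)) has_derivative
     (\<lambda>e. e $ 1 * (taylor_form V n (Suc i) j y (x - y) / fact n) +
          e $ 2 * (taylor_form V n i (Suc j) y (x - y) / fact n))) (at x)" for n
  proof -
    have "((\<lambda>x. taylor_form V (Suc n) i j y (x - y)) has_derivative
     (\<lambda>e. real (Suc n) * (e $ 1 * taylor_form V n (Suc i) j y (x - y) +
          e $ 2 * taylor_form V n i (Suc j) y (x - y)))) (at x)"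
      by (rule has_derivative_compose[OF _ taylor_form_has_derivative])
        (auto intro!: derivative_eq_intros)
    from has_derivative_mult_right[OF this, of "1 / fact (Suc n)"]
    show ?thesis
      by (simp add: divide_simps fact_Suc del: taylor_form.simps of_nat_Suc)
  qed
  have *: "taylor_poly V (Suc k) i j y =
     (\<lambda>x. V i j y + (\<Sum>n\<le>k. taylor_form V (Suc n) i j y (x - y) / fact (Suc n)))"
    by (rule ext) (simp add: taylor_poly_def sum.atMost_Suc_shift del: sum.atMost_Suc)
  have "((\<lambda>x. \<Sum>n\<le>k. taylor_form V (Suc n) i j y (x - y) / fact (Suc n)) has_derivative
     (\<lambda>e. \<Sum>n\<le>k. e $ 1 * (taylor_form V n (Suc i) j y (x - y) / fact n) +
          e $ 2 * (taylor_form V n i (Suc j) y (x - y) / fact n))) (at x)"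
    by (rule has_derivative_sum) (rule sh)
  from has_derivative_add[OF has_derivative_const this, of "V i j y"]
  show ?thesis
    unfolding * unfolding taylor_poly_def by (simp add: sum_distrib_left sum.distrib del: taylor_form.simps(2))
qed

lemma taylor_form_line_has_derivative:
  assumes "pd_family V"
  shows "((\<lambda>s. taylor_form V n i j (y + s *\<^sub>R d) d) has_real_derivative
     taylor_form V (Suc n) i j (y + s *\<^sub>R d) d) (at s within S)"
proof (induction n arbitrary: i j)
  case 0
  have "((\<lambda>s. V i j (y + s *\<^sub>R d)) has_derivative
     (\<lambda>t. (t *\<^sub>R d) $ 1 * V (Suc i) j (y + s *\<^sub>R d) + (t *\<^sub>R d) $ 2 * V i (Suc j) (y + s *\<^sub>R d))) (at s within S)"
    by (rule has_derivative_compose[OF _ pd_familyD[OF assms]])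
      (auto intro!: derivative_eq_intros)
  moreover have "(\<lambda>t. (t *\<^sub>R d) $ 1 * V (Suc i) j (y + s *\<^sub>R d) + (t *\<^sub>R d) $ 2 * V i (Suc j) (y + s *\<^sub>R d))
     = (*) (taylor_form V (Suc 0) i j (y + s *\<^sub>R d) d)"
    by (simp add: fun_eq_iff algebra_simps)
  ultimately show ?case
    unfolding has_field_derivative_def by simp
next
  case (Suc n)
  show ?case
    by (subst (1 2) taylor_form.simps(2)) (intro DERIV_add DERIV_cmult Suc.IH)
qed

text \<open>The one-dimensional Taylor formula with integral remainder along the segment from \<open>y\<close>
  to \<open>x\<close>.\<close>

lemma taylor_remainder:
  assumes V: "pd_family V"
  shows "V i j x - taylor_poly V n i j y x =
    integral {0..1} (\<lambda>s. (1 - s) ^ n / fact n * taylor_form V (Suc n) i j (y + s *\<^sub>R (x - y)) (x - y))"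
proof -
  let ?D = "\<lambda>l s. taylor_form V l i j (y + s *\<^sub>R (x - y)) (x - y)"
  have "?D 0 1 = (\<Sum>l<Suc n. ((1 - 0) ^ l / fact l) *\<^sub>R ?D l 0) +
     integral {0..1} (\<lambda>s. ((1 - s) ^ (Suc n - 1) / fact (Suc n - 1)) *\<^sub>R ?D (Suc n) s)"
    by (rule Taylor_integral)
      (use taylor_form_line_has_derivative[OF V] in
        \<open>auto simp: has_real_derivative_iff_has_vector_derivative simp del: taylor_form.simps\<close>)
  then show ?thesis
    by (simp add: taylor_poly_def lessThan_Suc_atMost[symmetric] del: sum.lessThan_Suc taylor_form.simps(2))
qed

text \<open>Each of the \<open>n\<close> steps of the recursion doubles the number of terms and contributes
  one component of \<open>d\<close>; all terms are derivatives of total order \<open>i + j +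
  n\<close>.\<close>

lemma taylor_form_bound:
  "\<bar>taylor_form V n i j z d\<bar> \<le> (2 * norm d) ^ n * (\<Sum>l\<le>i + j + n. \<bar>V l (i + j + n - l) z\<bar>)"
proof (induction n arbitrary: i j)
  case 0
  have "\<bar>V i (i + j - i) z\<bar> \<le> (\<Sum>l\<le>i + j. \<bar>V l (i + j - l) z\<bar>)"
    by (rule member_le_sum) auto
  then show ?case by simp
next
  case (Suc n)
  let ?G = "\<Sum>l\<le>i + j + Suc n. \<bar>V l (i + j + Suc n - l) z\<bar>"
  have "\<bar>taylor_form V (Suc n) i j z d\<bar> \<le>
     \<bar>d $ 1\<bar> * \<bar>taylor_form V n (Suc i) j z d\<bar> + \<bar>d $ 2\<bar> * \<bar>taylor_form V n i (Suc j) z d\<bar>"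
    by (simp add: abs_mult[symmetric])
  also have "\<dots> \<le> norm d * ((2 * norm d) ^ n * ?G) + norm d * ((2 * norm d) ^ n * ?G)"
    using Suc.IH[of "Suc i" j] Suc.IH[of i "Suc j"]
    by (intro add_mono mult_mono component_le_norm_cart) auto
  finally show ?case by (simp add: algebra_simps)
qed

section \<open>Mollification\<close>

text \<open>Differentiation under the integral sign, in the coordinates in which families of partial
  derivatives are written.\<close>

lemma integral_has_grad:
  fixes f f1 f2 :: "pt \<Rightarrow> pt \<Rightarrow> real"
  assumes N: "open N" "convex N" "x0 \<in> N"
    and der: "\<And>x t. x \<in> N \<Longrightarrow> t \<in> cbox a b \<Longrightarrow>
      ((\<lambda>x. f x t) has_derivative (\<lambda>d. d $ 1 * f1 x t + d $ 2 * f2 x t)) (at x)"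
    and c: "continuous_on (N \<times> cbox a b) (\<lambda>(x, t). f x t)"
    and c1: "continuous_on (N \<times> cbox a b) (\<lambda>(x, t). f1 x t)"
    and c2: "continuous_on (N \<times> cbox a b) (\<lambda>(x, t). f2 x t)"
  shows "((\<lambda>x. integral (cbox a b) (f x)) has_derivative
     (\<lambda>d. d $ 1 * integral (cbox a b) (f1 x0) + d $ 2 * integral (cbox a b) (f2 x0))) (at x0)"
proof -
  let ?e = "\<lambda>i. blinfun_inner_left (axis i 1 :: pt)"
  have app: "blinfun_apply (r *\<^sub>R ?e 1 + s *\<^sub>R ?e 2) = (\<lambda>d. d $ 1 * r + d $ 2 * s)" for r s
    by (rule ext) (simp add: blinfun.add_left blinfun.scaleR_left inner_axis)
  have slice: "continuous_on (cbox a b) (g x)"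
    if "continuous_on (N \<times> cbox a b) (\<lambda>(x, t). g x t)" "x \<in> N" for g :: "pt \<Rightarrow> pt \<Rightarrow> real" and x
  proof -
    have "continuous_on (cbox a b) (\<lambda>t. case (x, t) of (x, t) \<Rightarrow> g x t)"
      by (rule continuous_on_compose2[OF that(1)]) (use that(2) in \<open>auto intro!: continuous_intros\<close>)
    then show ?thesis by simp
  qed
  have "((\<lambda>x. integral (cbox a b) (f x)) has_derivative
      blinfun_apply (integral (cbox a b) (\<lambda>t. f1 x0 t *\<^sub>R ?e 1 + f2 x0 t *\<^sub>R ?e 2))) (at x0 within N)"
  proof (rule leibniz_rule[where fx = "\<lambda>x t. f1 x t *\<^sub>R ?e 1 + f2 x t *\<^sub>R ?e 2"])
    show "((\<lambda>x. f x t) has_derivative blinfun_apply (f1 x t *\<^sub>R ?e 1 + f2 x t *\<^sub>R ?e 2)) (at x within N)"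
      if "x \<in> N" "t \<in> cbox a b" for x t
      unfolding app using der[OF that] by (rule has_derivative_at_withinI)
    show "f x integrable_on cbox a b" if "x \<in> N" for x
      using slice[OF c that] by (rule integrable_continuous)
    show "continuous_on (N \<times> cbox a b) (\<lambda>(x, t). f1 x t *\<^sub>R ?e 1 + f2 x t *\<^sub>R ?e 2)"
      using c1 c2 unfolding split_beta by (intro continuous_intros)
  qed (use N in auto)
  moreover have "integral (cbox a b) (\<lambda>t. f1 x0 t *\<^sub>R ?e 1 + f2 x0 t *\<^sub>R ?e 2) =
      integral (cbox a b) (f1 x0) *\<^sub>R ?e 1 + integral (cbox a b) (f2 x0) *\<^sub>R ?e 2"
    using slice[OF c1 N(3)] slice[OF c2 N(3)]
    by (intro integral_unique has_integral_add has_integral_scaleR_left integrable_integral integrable_continuous)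
  ultimately show ?thesis
    using at_within_open[OF N(3,1)] by (simp add: app)
qed

text \<open>Derivatives of the convolution fall on the mollifier, so that mere continuity of \<open>U\<close>
  suffices for smoothness. The integral runs over a fixed box containing the domain; near its
  boundary the convolution has no meaning for \<open>u\<close>.\<close>

lemma mollify_pd_family:
  assumes \<rho>: "pd_family \<rho>" and U: "continuous_on (cbox a b) U"
  shows "pd_family (\<lambda>i j x. integral (cbox a b) (\<lambda>y. \<rho> i j (x - y) * U y))"
  unfolding pd_family_def
proof (intro allI)
  fix i j and x0 :: pt
  have cont: "continuous_on (UNIV \<times> cbox a b) (\<lambda>(x, y). \<rho> i j (x - y) * U y)" for i j
    unfolding split_beta
    by (intro continuous_intros pd_family_continuous_compose[OF \<rho>]
        continuous_on_compose2[OF U continuous_on_snd[OF continuous_on_id]]) auto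
  show "((\<lambda>x. integral (cbox a b) (\<lambda>y. \<rho> i j (x - y) * U y)) has_derivative
      (\<lambda>d. d $ 1 * integral (cbox a b) (\<lambda>y. \<rho> (Suc i) j (x0 - y) * U y) +
           d $ 2 * integral (cbox a b) (\<lambda>y. \<rho> i (Suc j) (x0 - y) * U y))) (at x0)"
  proof (rule integral_has_grad[where N = UNIV])
    fix x y
    have "((\<lambda>x. \<rho> i j (x - y)) has_derivative
        (\<lambda>d. d $ 1 * \<rho> (Suc i) j (x - y) + d $ 2 * \<rho> i (Suc j) (x - y))) (at x)"
      by (rule has_derivative_compose[OF _ pd_familyD[OF \<rho>]]) (auto intro!: derivative_eq_intros)
    from has_derivative_mult_left[OF this, of "U y"]
    show "((\<lambda>x. \<rho> i j (x - y) * U y) has_derivative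
        (\<lambda>d. d $ 1 * (\<rho> (Suc i) j (x - y) * U y) + d $ 2 * (\<rho> i (Suc j) (x - y) * U y))) (at x)"
      by (simp add: algebra_simps)
  qed (auto intro: cont)
qed

text \<open>Moves the argument shift from the mollifier to the function, after which classical derivatives of
  the function can be taken under the integral.\<close>

lemma mollify_shift:
  assumes \<rho>: "pd_family \<rho>" and supp: "\<And>z. z \<notin> square \<epsilon> \<Longrightarrow> \<rho> i j z = 0"
    and U: "continuous_on (cbox a b) U" and sub: "\<And>z. z \<in> square \<epsilon> \<Longrightarrow> x - z \<in> cbox a b"
  shows "integral (cbox a b) (\<lambda>y. \<rho> i j (x - y) * U y) = integral (square \<epsilon>) (\<lambda>z. \<rho> i j z * U (x - z))"
proof -
  have "continuous_on (square \<epsilon>) (\<lambda>z. \<rho> i j z * U (x - z))"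
    by (intro continuous_intros pd_family_continuous_compose[OF \<rho>] continuous_on_compose2[OF U])
      (use sub in auto)
  then have "((\<lambda>z. \<rho> i j z * U (x - z)) has_integral integral (square \<epsilon>) (\<lambda>z. \<rho> i j z * U (x - z))) (square \<epsilon>)"
    unfolding square_def by (intro integrable_integral integrable_continuous)
  from has_integral_affinity[OF this[unfolded square_def], of "-1" x]
  have "((\<lambda>y. \<rho> i j (x - y) * U y) has_integral integral (square \<epsilon>) (\<lambda>z. \<rho> i j z * U (x - z)))
      ((\<lambda>z. x - z) ` square \<epsilon>)"
    by (simp add: square_def)
  then have "((\<lambda>y. \<rho> i j (x - y) * U y) has_integral integral (square \<epsilon>) (\<lambda>z. \<rho> i j z * U (x - z))) (cbox a b)"
  proof (rule has_integral_on_superset)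
    show "\<rho> i j (x - y) * U y = 0" if "y \<notin> (\<lambda>z. x - z) ` square \<epsilon>" for y
    proof -
      have "x - y \<notin> square \<epsilon>"
        using that by (metis diff_diff_eq2 add_diff_cancel_left' image_eqI)
      then show ?thesis using supp by simp
    qed
  qed (use sub in auto)
  then show ?thesis by (rule integral_unique)
qed

lemma grad_components_unique:
  fixes f :: "pt \<Rightarrow> real"
  assumes "(f has_derivative (\<lambda>d. d $ 1 * p + d $ 2 * q)) (at x)"
    and "(g has_derivative (\<lambda>d. d $ 1 * r + d $ 2 * s)) (at x)"
    and "open N" "x \<in> N" "\<And>y. y \<in> N \<Longrightarrow> f y = g y"
  shows "p = r" "q = s"
proof -
  have "(g has_derivative (\<lambda>d. d $ 1 * p + d $ 2 * q)) (at x)"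
    using has_derivative_transform_within_open[OF assms(1,3,4,5)] .
  from has_derivative_unique[OF this assms(2)]
  have *: "\<And>d::pt. d $ 1 * p + d $ 2 * q = d $ 1 * r + d $ 2 * s" by metis
  show "p = r" using *[of "axis 1 1"] by (simp add: axis_def)
  show "q = s" using *[of "axis 2 1"] by (simp add: axis_def)
qed

lemma mollify_has_grad:
  assumes \<rho>: "pd_family \<rho>"
    and N: "open N" "convex N" "\<And>x z. x \<in> N \<Longrightarrow> z \<in> square \<epsilon> \<Longrightarrow> x - z \<in> \<Omega>"
    and x0: "x0 \<in> N"
    and g: "\<And>y. y \<in> \<Omega> \<Longrightarrow> (g has_derivative (\<lambda>d. d $ 1 * g1 y + d $ 2 * g2 y)) (at y)"
    and c: "continuous_on \<Omega> g1" "continuous_on \<Omega> g2"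
  shows "((\<lambda>x. integral (square \<epsilon>) (\<lambda>z. \<rho> 0 0 z * g (x - z))) has_derivative
     (\<lambda>d. d $ 1 * integral (square \<epsilon>) (\<lambda>z. \<rho> 0 0 z * g1 (x0 - z)) +
          d $ 2 * integral (square \<epsilon>) (\<lambda>z. \<rho> 0 0 z * g2 (x0 - z)))) (at x0)"
proof -
  have cg: "continuous_on \<Omega> g"
    by (rule has_derivative_continuous_on[OF has_derivative_at_withinI[OF g]])
  have cont: "continuous_on (N \<times> square \<epsilon>) (\<lambda>(x, z). \<rho> 0 0 z * h (x - z))"
    if "continuous_on \<Omega> h" for h
    unfolding split_beta
    by (intro continuous_intros pd_family_continuous_compose[OF \<rho>] continuous_on_compose2[OF that])
      (use N(3) in auto)
  show ?thesis
    unfolding square_def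
  proof (rule integral_has_grad[OF N(1,2) x0])
    fix x z assume x: "x \<in> N" and "z \<in> cbox (vec (- \<epsilon>)) (vec \<epsilon> :: pt)"
    then have "x - z \<in> \<Omega>" using N(3) by (auto simp: square_def)
    then have "((\<lambda>x. g (x - z)) has_derivative
        (\<lambda>d. d $ 1 * g1 (x - z) + d $ 2 * g2 (x - z))) (at x)"
      by (intro has_derivative_compose[OF _ g]) (auto intro!: derivative_eq_intros)
    from has_derivative_mult_right[OF this, of "\<rho> 0 0 z"]
    show "((\<lambda>x. \<rho> 0 0 z * g (x - z)) has_derivative
        (\<lambda>d. d $ 1 * (\<rho> 0 0 z * g1 (x - z)) + d $ 2 * (\<rho> 0 0 z * g2 (x - z)))) (at x)"
      by (simp add: algebra_simps)
  qed (use cont cg c in \<open>auto simp: square_def\<close>)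
qed

text \<open>The second derivatives of the mollified function are the mollified classical second derivatives:
  both sides differentiate the same convolution, once with the derivative on the mollifier and
  once, after the shift, with the derivative on \<open>u\<close>. The mixed derivative appears
  twice because the Hessian of \<open>u\<close> is not yet known to be symmetric.\<close>

lemma mollify_hess:
  assumes \<rho>: "pd_family \<rho>" and supp: "\<And>i j z. z \<notin> square \<epsilon> \<Longrightarrow> \<rho> i j z = 0"
    and U: "continuous_on (cbox a b) U" "\<And>x. x \<in> \<Omega> \<Longrightarrow> U x = u x" and sub: "\<Omega> \<subseteq> cbox a b"
    and N: "open N" "convex N" "\<And>x z. x \<in> N \<Longrightarrow> z \<in> square \<epsilon> \<Longrightarrow> x - z \<in> \<Omega>" and x0: "x0 \<in> N"
    and u: "\<And>y. y \<in> \<Omega> \<Longrightarrow> (u has_derivative (\<lambda>d. d $ 1 * g1 y + d $ 2 * g2 y)) (at y)"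
    and g1: "\<And>y. y \<in> \<Omega> \<Longrightarrow> (g1 has_derivative (\<lambda>d. d $ 1 * h11 y + d $ 2 * h12 y)) (at y)"
    and g2: "\<And>y. y \<in> \<Omega> \<Longrightarrow> (g2 has_derivative (\<lambda>d. d $ 1 * h21 y + d $ 2 * h22 y)) (at y)"
    and h: "continuous_on \<Omega> h11" "continuous_on \<Omega> h12" "continuous_on \<Omega> h21" "continuous_on \<Omega> h22"
  defines "V \<equiv> \<lambda>i j x. integral (cbox a b) (\<lambda>y. \<rho> i j (x - y) * U y)"
    and "I \<equiv> \<lambda>g x. integral (square \<epsilon>) (\<lambda>z. \<rho> 0 0 z * g (x - z))"
  shows "V 2 0 x0 = I h11 x0" "V 1 1 x0 = I h12 x0" "V 1 1 x0 = I h21 x0" "V 0 2 x0 = I h22 x0"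
proof -
  have V: "pd_family V" unfolding V_def by (rule mollify_pd_family[OF \<rho> U(1)])
  have cg: "continuous_on \<Omega> g1" "continuous_on \<Omega> g2"
    by (rule has_derivative_continuous_on[OF has_derivative_at_withinI[OF g1]], assumption)
       (rule has_derivative_continuous_on[OF has_derivative_at_withinI[OF g2]], assumption)
  have V0: "V 0 0 x = I u x" if "x \<in> N" for x
  proof -
    have "V 0 0 x = integral (square \<epsilon>) (\<lambda>z. \<rho> 0 0 z * U (x - z))"
      unfolding V_def
      by (rule mollify_shift[OF \<rho> _ U(1)]) (use supp N(3)[OF that] sub in auto)
    also have "\<dots> = I u x"
      unfolding I_def by (rule integral_cong) (use N(3)[OF that] U(2) in auto)
    finally show ?thesis .
  qed
  have D: "(I g has_derivative (\<lambda>d. d $ 1 * I p x + d $ 2 * I q x)) (at x)"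
    if "x \<in> N" "\<And>y. y \<in> \<Omega> \<Longrightarrow> (g has_derivative (\<lambda>d. d $ 1 * p y + d $ 2 * q y)) (at y)"
      "continuous_on \<Omega> p" "continuous_on \<Omega> q" for g p q x
    unfolding I_def by (rule mollify_has_grad[where \<Omega> = \<Omega>, OF \<rho> N(1,2)]) (use N(3) that in auto)
  have V10: "V 1 0 x = I g1 x" and V01: "V 0 1 x = I g2 x" if "x \<in> N" for x
    using grad_components_unique[OF pd_familyD[OF V, of 0 0 x UNIV] D[OF that u cg] N(1) that V0] by auto
  show "V 2 0 x0 = I h11 x0" "V 1 1 x0 = I h12 x0"
    using grad_components_unique[OF pd_familyD[OF V, of 1 0 x0 UNIV] D[OF x0 g1 h(1,2)] N(1) x0 V10]
    by (auto simp: numeral_2_eq_2)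
  show "V 1 1 x0 = I h21 x0" "V 0 2 x0 = I h22 x0"
    using grad_components_unique[OF pd_familyD[OF V, of 0 1 x0 UNIV] D[OF x0 g2 h(3,4)] N(1) x0 V01]
    by (auto simp: numeral_2_eq_2)
qed

lemma mollify_close:
  assumes \<rho>: "pd_family \<rho>" "\<And>x. 0 \<le> \<rho> 0 0 x" "integral (square \<epsilon>) (\<rho> 0 0) = 1"
    and h: "continuous_on \<Omega> h" "\<And>z. z \<in> square \<epsilon> \<Longrightarrow> x - z \<in> \<Omega>"
    and close: "\<And>z. z \<in> square \<epsilon> \<Longrightarrow> \<bar>h (x - z) - h x\<bar> \<le> \<delta>"
  shows "\<bar>integral (square \<epsilon>) (\<lambda>z. \<rho> 0 0 z * h (x - z)) - h x\<bar> \<le> \<delta>"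
proof -
  have c: "continuous_on (square \<epsilon>) (\<rho> 0 0)" by (rule pd_family_continuous[OF \<rho>(1)])
  have ch: "continuous_on (square \<epsilon>) (\<lambda>z. h (x - z))"
    by (intro continuous_on_compose2[OF h(1)] continuous_intros) (use h(2) in auto)
  have i: "(\<lambda>z. \<rho> 0 0 z * h (x - z)) integrable_on square \<epsilon>" "(\<lambda>z. \<rho> 0 0 z * h x) integrable_on square \<epsilon>"
      "(\<lambda>z. \<rho> 0 0 z * \<delta>) integrable_on square \<epsilon>"
    unfolding square_def using c ch by (auto simp: square_def intro!: integrable_continuous continuous_intros)
  have "h x = integral (square \<epsilon>) (\<lambda>z. \<rho> 0 0 z * h x)" using \<rho>(3) by simp
  then have "integral (square \<epsilon>) (\<lambda>z. \<rho> 0 0 z * h (x - z)) - h x =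
     integral (square \<epsilon>) (\<lambda>z. \<rho> 0 0 z * h (x - z) - \<rho> 0 0 z * h x)"
    using Henstock_Kurzweil_Integration.integral_diff[OF i(1,2)] by simp
  also have "\<bar>\<dots>\<bar> \<le> integral (square \<epsilon>) (\<lambda>z. \<rho> 0 0 z * \<delta>)"
  proof -
    have "norm (integral (square \<epsilon>) (\<lambda>z. \<rho> 0 0 z * h (x - z) - \<rho> 0 0 z * h x)) \<le> integral (square \<epsilon>) (\<lambda>z. \<rho> 0 0 z * \<delta>)"
    proof (rule integral_norm_bound_integral)
      show "(\<lambda>z. \<rho> 0 0 z * h (x - z) - \<rho> 0 0 z * h x) integrable_on square \<epsilon>"
        using i(1,2) by (rule integrable_diff)
      show "norm (\<rho> 0 0 z * h (x - z) - \<rho> 0 0 z * h x) \<le> \<rho> 0 0 z * \<delta>" if "z \<in> square \<epsilon>" for z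
        using close[OF that] \<rho>(2)[of z]
        by (simp add: right_diff_distrib[symmetric] abs_mult mult_left_mono)
    qed (rule i)
    then show ?thesis by simp
  qed
  also have "\<dots> = \<delta>" using \<rho>(3) by simp
  finally show ?thesis .
qed

text \<open>The counterpart of \<open>mollify_hess\<close> for the highest order, where only weak derivatives
  exist: the definition of the weak derivative is tested with the mollifier centred at
  \<open>x\<close>.\<close>

lemma mollify_weak_deriv:
  assumes \<rho>: "pd_family \<rho>" and supp: "\<And>i j z. z \<notin> square \<epsilon> \<Longrightarrow> \<rho> i j z = 0"
    and U: "continuous_on (cbox a b) U" "\<And>x. x \<in> \<Omega> \<Longrightarrow> U x = u x" and sub: "\<Omega> \<subseteq> cbox a b"
    and x: "\<And>z. z \<in> square \<epsilon> \<Longrightarrow> x - z \<in> \<Omega>"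
    and w: "weak_deriv \<Omega> (replicate i 1 @ replicate j 2) u w"
  shows "integral (cbox a b) (\<lambda>y. \<rho> i j (x - y) * U y) = (LINT y:\<Omega>|lebesgue. w y * \<rho> 0 0 (x - y))"
proof -
  let ?\<alpha> = "replicate i 1 @ replicate j 2 :: 2 list"
  have cnt: "count_list ?\<alpha> 1 = i" "count_list ?\<alpha> 2 = j" "length ?\<alpha> = i + j"
  proof -
    have "count_list (replicate n c) d = (if c = d then n else 0)" for n and c d :: 2
      by (induction n) auto
    then show "count_list ?\<alpha> 1 = i" "count_list ?\<alpha> 2 = j" "length ?\<alpha> = i + j" by auto
  qed
  have sq: "compact (square \<epsilon>)" by (simp add: square_def)
  have tf: "test_function \<Omega> (\<lambda>y. \<rho> 0 0 (x - y))"
    and it: "\<And>y. iter_pd ?\<alpha> (\<lambda>y. \<rho> 0 0 (x - y)) y = (- 1) ^ (i + j) * \<rho> i j (x - y)"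
  proof -
    have s0: "z \<in> square \<epsilon>" if "\<rho> 0 0 z \<noteq> 0" for z using supp that by blast
    show "test_function \<Omega> (\<lambda>y. \<rho> 0 0 (x - y))"
      by (rule test_function_reflect_pd_family(1)[OF \<rho> s0 sq x])
    show "iter_pd ?\<alpha> (\<lambda>y. \<rho> 0 0 (x - y)) y = (- 1) ^ (i + j) * \<rho> i j (x - y)" for y
    proof -
      have "iter_pd ?\<alpha> (\<lambda>y. \<rho> 0 0 (x - y)) y =
          (- 1) ^ length ?\<alpha> * \<rho> (count_list ?\<alpha> 1) (count_list ?\<alpha> 2) (x - y)"
        by (rule test_function_reflect_pd_family(2)[OF \<rho> s0 sq x])
      then show ?thesis by (simp only: cnt)
    qed
  qed
  have "(LINT y:\<Omega>|lebesgue. u y * ((- 1) ^ (i + j) * \<rho> i j (x - y))) =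
      (- 1) ^ (i + j) * (LINT y:\<Omega>|lebesgue. w y * \<rho> 0 0 (x - y))"
    using w[unfolded weak_deriv_def, rule_format, OF tf] by (simp only: cnt(3) it)
  then have eq: "(LINT y:\<Omega>|lebesgue. u y * \<rho> i j (x - y)) = (LINT y:\<Omega>|lebesgue. w y * \<rho> 0 0 (x - y))"
    by (simp add: mult.left_commute[of _ "(- 1) ^ (i + j)"])
  have "continuous_on (cbox a b) (\<lambda>y. \<rho> i j (x - y) * U y)"
    by (intro continuous_intros pd_family_continuous_compose[OF \<rho>] U)
  then have "integral (cbox a b) (\<lambda>y. \<rho> i j (x - y) * U y) = (LINT y:cbox a b|lebesgue. \<rho> i j (x - y) * U y)"
    by (intro set_lebesgue_integral_eq_integral(2)[symmetric] absolutely_integrable_continuous)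
  also have "\<dots> = (LINT y:\<Omega>|lebesgue. u y * \<rho> i j (x - y))"
    unfolding set_lebesgue_integral_def
  proof (rule Bochner_Integration.integral_cong[OF refl])
    fix y
    show "indicat_real (cbox a b) y *\<^sub>R (\<rho> i j (x - y) * U y) = indicat_real \<Omega> y *\<^sub>R (u y * \<rho> i j (x - y))"
    proof (cases "y \<in> \<Omega>")
      case True
      then show ?thesis using sub U(2) by (auto simp: indicator_def)
    next
      case False
      then have "x - y \<notin> square \<epsilon>" using x[of "x - y"] by auto
      then show ?thesis using supp by simp
    qed
  qed
  finally show ?thesis using eq by simp
qed

text \<open>Mollification does not increase the \<open>L\<^sup>2\<close> norm: Jensen's inequality for the
  probability density \<open>r (x - y)\<close> in \<open>y\<close>, then Fubini. Localizing to
  \<open>G\<close> on the right is what makes the elementwise error bounds summable over a mesh.\<close>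

lemma mollify_L2:
  assumes w: "w \<in> L2_space \<Omega>" and \<Omega>: "open \<Omega>" and G: "open G" "G \<subseteq> \<Omega>"
    and r: "continuous_on UNIV r" "\<And>z. 0 \<le> r z" "\<And>z. z \<notin> square \<epsilon> \<Longrightarrow> r z = 0"
      "integral (square \<epsilon>) r = 1"
    and Q: "\<And>x z. x \<in> cbox p q \<Longrightarrow> z \<in> square \<epsilon> \<Longrightarrow> x - z \<in> G"
    and V: "continuous_on (cbox p q) V"
      "\<And>x. x \<in> cbox p q \<Longrightarrow> V x = (LINT y:\<Omega>|lebesgue. w y * r (x - y))"
  shows "integral (cbox p q) (\<lambda>x. (V x)\<^sup>2) \<le> (LINT y:G|lebesgue. (w y)\<^sup>2)"
proof -
  have [measurable]: "r \<in> borel_measurable borel" "G \<in> sets borel" "\<Omega> \<in> sets borel"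
    using r(1) \<Omega> G(1) by (auto intro: borel_measurable_continuous_onI)
  have wL: "w \<in> borel_measurable (lebesgue_on \<Omega>)" "set_integrable lebesgue \<Omega> (\<lambda>x. (w x)\<^sup>2)"
    using w by (auto simp: L2_space_def)
  \<comment> \<open>Fubini needs a Borel function, while \<open>w\<close> is only Lebesgue measurable.\<close>
  have w0[measurable]: "(\<lambda>y. if y \<in> \<Omega> then w y else 0) \<in> borel_measurable lebesgue"
    using wL(1) by (subst borel_measurable_if) auto
  then obtain w' where w'[measurable]: "w' \<in> borel_measurable lborel"
    and ae: "AE y in lborel. (if y \<in> \<Omega> then w y else 0) = w' y"
    using completion_ex_borel_measurable_real[OF w0] by blast
  have aeL: "AE y in lebesgue. (if y \<in> \<Omega> then w y else 0) = w' y"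
    using ae by (rule AE_completion)
  have swap: "(LINT y:S|lebesgue. g y (w y)) = (LINT y|lborel. indicator S y * g y (w' y))"
    if [measurable]: "S \<in> sets borel" and S: "S \<subseteq> \<Omega>"
      and g[measurable]: "(\<lambda>y. g y (w' y)) \<in> borel_measurable lborel"
      and g0: "(\<lambda>y. g y (if y \<in> \<Omega> then w y else 0)) \<in> borel_measurable lebesgue" for S and g :: "pt \<Rightarrow> real \<Rightarrow> real"
  proof -
    have "AE y in lebesgue. indicat_real S y *\<^sub>R g y (w y) = indicat_real S y * g y (w' y)"
      using aeL by eventually_elim (use S in \<open>auto simp: indicator_def\<close>)
    moreover have m: "(\<lambda>y. indicat_real S y * g y (w' y)) \<in> borel_measurable lborel" by measurable
    ultimately have "(LINT y:S|lebesgue. g y (w y)) = (LINT y|lebesgue. indicator S y * g y (w' y))"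
      unfolding set_lebesgue_integral_def
    proof (intro integral_cong_AE)
      have "(\<lambda>y. indicat_real S y * g y (if y \<in> \<Omega> then w y else 0)) \<in> borel_measurable lebesgue"
        by (intro borel_measurable_times g0 borel_measurable_indicator) auto
      moreover have "(\<lambda>y. indicat_real S y * g y (if y \<in> \<Omega> then w y else 0)) = (\<lambda>y. indicat_real S y *\<^sub>R g y (w y))"
        using S by (auto simp: indicator_def fun_eq_iff)
      ultimately show "(\<lambda>y. indicat_real S y *\<^sub>R g y (w y)) \<in> borel_measurable lebesgue" by simp
      show "(\<lambda>y. indicat_real S y * g y (w' y)) \<in> borel_measurable lebesgue"
        by (rule measurable_completion[OF m])
    qed
    also have "\<dots> = (LINT y|lborel. indicator S y * g y (w' y))"
      by (rule integral_completion[OF m])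
    finally show ?thesis .
  qed
  have w2: "integrable lborel (\<lambda>y. (w' y)\<^sup>2)"
  proof -
    have "integrable lebesgue (\<lambda>y. (w' y)\<^sup>2)"
    proof (rule integrable_cong_AE_imp[OF wL(2)[unfolded set_integrable_def]])
      show "AE y in lebesgue. indicat_real \<Omega> y *\<^sub>R (w y)\<^sup>2 = (w' y)\<^sup>2"
        using aeL by eventually_elim (auto simp: indicator_def)
    qed (auto intro: measurable_completion)
    then show ?thesis by (subst (asm) integrable_completion) auto
  qed
  have aeO: "AE y in lborel. y \<notin> \<Omega> \<longrightarrow> w' y = 0"
    using ae by eventually_elim auto
  have "continuous_on (square \<epsilon>) r" using r(1) continuous_on_subset by blast
  then have "(r has_integral 1) (square \<epsilon>)"
    using r(4) by (metis square_def integrable_continuous integrable_integral)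
  then have rint: "(r has_integral 1) UNIV"
    by (rule has_integral_on_superset) (use r(3) in auto)
  have r1: "(\<integral>\<^sup>+x. ennreal (r x) \<partial>lborel) = 1"
    using nn_integral_has_integral_lborel[OF _ r(2) rint] by simp
  have rx: "(\<integral>\<^sup>+x. ennreal (r (x - y)) \<partial>lborel) = 1" for y
  proof -
    have "(\<integral>\<^sup>+x. ennreal (r x) \<partial>lborel) = (\<integral>\<^sup>+x. ennreal (r x) \<partial>distr lborel borel ((+) (- y)))"
      by (simp add: lborel_distr_plus)
    also have "\<dots> = (\<integral>\<^sup>+x. ennreal (r (- y + x)) \<partial>lborel)"
      by (rule nn_integral_distr) auto
    finally show ?thesis using r1 by simp
  qed
  have ry: "(\<integral>\<^sup>+y. ennreal (r (x - y)) \<partial>lborel) = 1" for x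
  proof -
    have "(lborel :: pt measure) = density (distr lborel borel (\<lambda>y. x - y)) (\<lambda>_. 1)"
      using lborel_affine[of "-1" x] by simp
    then have "(\<integral>\<^sup>+z. ennreal (r z) \<partial>lborel) =
        (\<integral>\<^sup>+z. ennreal (r z) \<partial>density (distr lborel borel (\<lambda>y. x - y)) (\<lambda>_. 1))"
      by metis
    also have "\<dots> = (\<integral>\<^sup>+y. ennreal (r (x - y)) \<partial>lborel)"
      by (simp add: nn_integral_density nn_integral_distr)
    finally show ?thesis using r1 by simp
  qed
  obtain B where B: "\<And>z. r z \<le> B"
  proof -
    have "compact (r ` square \<epsilon>)"
      using \<open>continuous_on (square \<epsilon>) r\<close> by (intro compact_continuous_image) (auto simp: square_def)
    then obtain B where "\<forall>z\<in>square \<epsilon>. r z \<le> B"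
      by (metis (no_types, lifting) bounded_real compact_imp_bounded imageI abs_le_D1)
    then have "r z \<le> max B 0" for z using r(3)[of z] by (cases "z \<in> square \<epsilon>") (auto simp: le_max_iff_disj)
    then show ?thesis using that by blast
  qed
  \<comment> \<open>Jensen's inequality in the form that the variance about the mean \<open>c\<close> is nonnegative.\<close>
  have jensen: "(V x)\<^sup>2 \<le> (LINT y|lborel. r (x - y) * (w' y)\<^sup>2)"
    and int2: "integrable lborel (\<lambda>y. r (x - y) * (w' y)\<^sup>2)" if x: "x \<in> cbox p q" for x
  proof -
    have i0: "integrable lborel (\<lambda>y. r (x - y))" and e0: "(LINT y|lborel. r (x - y)) = 1"
    proof -
      show i0: "integrable lborel (\<lambda>y. r (x - y))"
        by (rule integrableI_nonneg) (use ry[of x] r(2) in auto)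
      have "ennreal (LINT y|lborel. r (x - y)) = 1"
        using nn_integral_eq_integral[OF i0] ry[of x] r(2) by simp
      then show "(LINT y|lborel. r (x - y)) = 1" by simp
    qed
    show i2: "integrable lborel (\<lambda>y. r (x - y) * (w' y)\<^sup>2)"
      by (rule Bochner_Integration.integrable_bound[OF integrable_mult_right[OF w2, of B]])
        (use B r(2) in \<open>auto simp: abs_mult intro!: mult_right_mono AE_I2 order_trans[OF B abs_ge_self]\<close>)
    have i1: "integrable lborel (\<lambda>y. r (x - y) * w' y)"
    proof (rule Bochner_Integration.integrable_bound[OF Bochner_Integration.integrable_add[OF i0 i2]])
      have "\<bar>w' y\<bar> \<le> 1 + (w' y)\<^sup>2" for y
      proof -
        have "0 \<le> (\<bar>w' y\<bar> - 1)\<^sup>2 + (w' y)\<^sup>2 + 1" by simp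
        then show ?thesis by (simp add: power2_eq_square algebra_simps)
      qed
      then have "r (x - y) * \<bar>w' y\<bar> \<le> r (x - y) * (1 + (w' y)\<^sup>2)" for y
        using r(2) by (intro mult_left_mono) auto
      then show "AE y in lborel. norm (r (x - y) * w' y) \<le> norm (r (x - y) + r (x - y) * (w' y)\<^sup>2)"
        using r(2) by (intro AE_I2) (simp add: abs_mult distrib_left)
    qed auto
    define c where "c = (LINT y|lborel. r (x - y) * w' y)"
    have "V x = (LINT y|lborel. indicator \<Omega> y * (w' y * r (x - y)))"
      unfolding V(2)[OF x]
    proof (rule swap)
      have "(\<lambda>y. r (x - y)) \<in> borel_measurable lebesgue"
        by (intro measurable_completion) measurable
      then show "(\<lambda>y. (if y \<in> \<Omega> then w y else 0) * r (x - y)) \<in> borel_measurable lebesgue"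
        by (intro borel_measurable_times w0)
    qed auto
    also have "\<dots> = c"
      unfolding c_def
    proof (rule integral_cong_AE)
      show "AE y in lborel. indicat_real \<Omega> y * (w' y * r (x - y)) = r (x - y) * w' y"
        using aeO by eventually_elim (auto simp: indicator_def)
    qed auto
    finally have Vc: "V x = c" .
    have "0 \<le> (LINT y|lborel. r (x - y) * (w' y - c)\<^sup>2)"
      using r(2) by (intro Bochner_Integration.integral_nonneg) auto
    also have "\<dots> = (LINT y|lborel. r (x - y) * (w' y)\<^sup>2 + (c\<^sup>2 * r (x - y) - 2 * c * (r (x - y) * w' y)))"
      by (rule Bochner_Integration.integral_cong) (auto simp: power2_eq_square algebra_simps)
    also have "\<dots> = (LINT y|lborel. r (x - y) * (w' y)\<^sup>2) + (c\<^sup>2 * 1 - 2 * c * c)"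
      using i0 i1 i2 by (simp add: e0 c_def[symmetric])
    finally show "(V x)\<^sup>2 \<le> (LINT y|lborel. r (x - y) * (w' y)\<^sup>2)"
      by (simp add: Vc power2_eq_square)
  qed
  have c2: "continuous_on (cbox p q) (\<lambda>x. (V x)\<^sup>2)" by (intro continuous_intros V)
  have "((\<lambda>x. (V x)\<^sup>2) has_integral integral (cbox p q) (\<lambda>x. (V x)\<^sup>2)) (cbox p q)"
    by (intro integrable_integral integrable_continuous c2)
  then have "((\<lambda>x. indicator (cbox p q) x * (V x)\<^sup>2) has_integral integral (cbox p q) (\<lambda>x. (V x)\<^sup>2)) UNIV"
  proof -
    have "(\<lambda>x. indicator (cbox p q) x * (V x)\<^sup>2) = (\<lambda>x. if x \<in> cbox p q then (V x)\<^sup>2 else 0)"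
      by (auto simp: indicator_def)
    then show ?thesis using \<open>(_ has_integral _) (cbox p q)\<close> by (simp only: has_integral_restrict_UNIV)
  qed
  then have "ennreal (integral (cbox p q) (\<lambda>x. (V x)\<^sup>2)) = (\<integral>\<^sup>+x. ennreal (indicator (cbox p q) x * (V x)\<^sup>2) \<partial>lborel)"
    by (intro nn_integral_has_integral_lborel[symmetric])
      (use borel_measurable_continuous_on_indicator[OF _ c2] in auto)
  also have "\<dots> \<le> (\<integral>\<^sup>+x. (\<integral>\<^sup>+y. ennreal (indicator (cbox p q) x * (r (x - y) * (w' y)\<^sup>2)) \<partial>lborel) \<partial>lborel)"
  proof (rule nn_integral_mono)
    fix x :: pt
    show "ennreal (indicator (cbox p q) x * (V x)\<^sup>2) \<le>
      (\<integral>\<^sup>+y. ennreal (indicator (cbox p q) x * (r (x - y) * (w' y)\<^sup>2)) \<partial>lborel)"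
    proof (cases "x \<in> cbox p q")
      case True
      then show ?thesis
        using jensen[OF True] nn_integral_eq_integral[OF int2[OF True]] r(2)
        by (auto intro!: ennreal_leI)
    qed auto
  qed
  also have "\<dots> = (\<integral>\<^sup>+y. (\<integral>\<^sup>+x. ennreal (indicator (cbox p q) x * (r (x - y) * (w' y)\<^sup>2)) \<partial>lborel) \<partial>lborel)"
    by (rule lborel_pair.Fubini') measurable
  also have "\<dots> \<le> (\<integral>\<^sup>+y. ennreal (indicator G y * (w' y)\<^sup>2) \<partial>lborel)"
  proof (rule nn_integral_mono)
    fix y :: pt
    show "(\<integral>\<^sup>+x. ennreal (indicator (cbox p q) x * (r (x - y) * (w' y)\<^sup>2)) \<partial>lborel) \<le> ennreal (indicator G y * (w' y)\<^sup>2)"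
    proof (cases "y \<in> G")
      case True
      have "(\<integral>\<^sup>+x. ennreal (indicator (cbox p q) x * (r (x - y) * (w' y)\<^sup>2)) \<partial>lborel) \<le>
          (\<integral>\<^sup>+x. ennreal ((w' y)\<^sup>2) * ennreal (r (x - y)) \<partial>lborel)"
        by (intro nn_integral_mono) (auto simp: indicator_def ennreal_mult[OF r(2)] mult.commute)
      also have "\<dots> = ennreal ((w' y)\<^sup>2)" by (subst nn_integral_cmult) (auto simp: rx)
      finally show ?thesis using True by simp
    next
      case False
      have "indicator (cbox p q) x * (r (x - y) * (w' y)\<^sup>2) = 0" for x
      proof (cases "x \<in> cbox p q")
        case True
        then have "x - y \<notin> square \<epsilon>" using Q[OF True, of "x - y"] False by auto
        then show ?thesis using r(3) by simp
      qed auto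
      then show ?thesis by (simp only: ennreal_0 nn_integral_const mult_zero_left zero_le)
    qed
  qed
  also have "\<dots> = ennreal (LINT y|lborel. indicator G y * (w' y)\<^sup>2)"
    using integrable_mult_indicator[OF _ w2, of G] by (intro nn_integral_eq_integral) auto
  also have "(LINT y|lborel. indicator G y * (w' y)\<^sup>2) = (LINT y:G|lebesgue. (w y)\<^sup>2)"
    by (rule swap[symmetric]) (use G in \<open>auto intro!: borel_measurable_power w0\<close>)
  finally show ?thesis
    by (subst (asm) ennreal_le_iff) (auto simp: set_lebesgue_integral_def intro!: Bochner_Integration.integral_nonneg)
qed

section \<open>Bivariate polynomials\<close>

lemma Pk_iff_sum_monomials:
  "p \<in> Pk n \<longleftrightarrow> (\<exists>c. \<forall>x. p x = (\<Sum>(i, j)\<in>(SIGMA i:{..n}. {..n - i}). c i j * (x $ 1) ^ i * (x $ 2) ^ j))"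
  by (simp add: Pk_def sum.Sigma)

lemma Pk_monom: "i + j \<le> n \<Longrightarrow> (\<lambda>x. c * (x $ 1) ^ i * (x $ 2) ^ j) \<in> Pk n"
proof -
  assume ij: "i + j \<le> n"
  show ?thesis
    unfolding Pk_iff_sum_monomials
  proof (intro exI allI)
    fix x :: pt
    let ?m = "\<lambda>(i', j'). (if (i', j') = (i, j) then c else 0) * (x $ 1) ^ i' * (x $ 2) ^ j'"
    have "(\<Sum>k\<in>(SIGMA i:{..n}. {..n - i}). ?m k) = (\<Sum>k\<in>{(i, j)}. ?m k)"
      by (rule sum.mono_neutral_right) (use ij in \<open>auto split: if_splits\<close>)
    then show "c * (x $ 1) ^ i * (x $ 2) ^ j =
       (\<Sum>(i', j')\<in>(SIGMA i:{..n}. {..n - i}). (if (i', j') = (i, j) then c else 0) * (x $ 1) ^ i' * (x $ 2) ^ j')"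
      by simp
  qed
qed

lemma Pk_const: "(\<lambda>x. c) \<in> Pk n"
  using Pk_monom[of 0 0 n c] by simp

lemma Pk_add: "p \<in> Pk n \<Longrightarrow> q \<in> Pk n \<Longrightarrow> (\<lambda>x. p x + q x) \<in> Pk n"
proof -
  assume "p \<in> Pk n" "q \<in> Pk n"
  then obtain c d where "\<And>x. p x = (\<Sum>i\<le>n. \<Sum>j\<le>n - i. c i j * (x $ 1) ^ i * (x $ 2) ^ j)"
    "\<And>x. q x = (\<Sum>i\<le>n. \<Sum>j\<le>n - i. d i j * (x $ 1) ^ i * (x $ 2) ^ j)"
    unfolding Pk_def by blast
  then have "p x + q x = (\<Sum>i\<le>n. \<Sum>j\<le>n - i. (c i j + d i j) * (x $ 1) ^ i * (x $ 2) ^ j)" for x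
    by (simp add: sum.distrib distrib_right)
  then show ?thesis unfolding Pk_def by (intro CollectI exI allI)
qed

lemma Pk_cmult: "p \<in> Pk n \<Longrightarrow> (\<lambda>x. a * p x) \<in> Pk n"
proof -
  assume "p \<in> Pk n"
  then obtain c where "\<And>x. p x = (\<Sum>i\<le>n. \<Sum>j\<le>n - i. c i j * (x $ 1) ^ i * (x $ 2) ^ j)"
    unfolding Pk_def by blast
  then have "a * p x = (\<Sum>i\<le>n. \<Sum>j\<le>n - i. (a * c i j) * (x $ 1) ^ i * (x $ 2) ^ j)" for x
    by (simp add: sum_distrib_left mult.assoc)
  then show ?thesis unfolding Pk_def by (intro CollectI exI allI)
qed

lemma Pk_diff: "p \<in> Pk n \<Longrightarrow> q \<in> Pk n \<Longrightarrow> (\<lambda>x. p x - q x) \<in> Pk n"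
  using Pk_add[OF _ Pk_cmult[of q n "-1"]] by simp

lemma Pk_sum: "(\<And>i. i \<in> I \<Longrightarrow> p i \<in> Pk n) \<Longrightarrow> (\<lambda>x. \<Sum>i\<in>I. p i x) \<in> Pk n"
  by (induction I rule: infinite_finite_induct) (auto intro: Pk_add Pk_const)

text \<open>Reduces statements about the polynomial space to single monomials and sums.\<close>

lemma Pk_induct [consumes 1, case_names monom add]:
  assumes "p \<in> Pk n"
    and monom: "\<And>c i j. i + j \<le> n \<Longrightarrow> Q (\<lambda>x. c * (x $ 1) ^ i * (x $ 2) ^ j)"
    and add: "\<And>p q. Q p \<Longrightarrow> Q q \<Longrightarrow> Q (\<lambda>x. p x + q x)"
  shows "Q p"
proof -
  let ?I = "SIGMA i:{..n}. {..n - i}"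
  obtain c where c: "\<And>x. p x = (\<Sum>(i, j)\<in>?I. c i j * (x $ 1) ^ i * (x $ 2) ^ j)"
    using assms(1) unfolding Pk_iff_sum_monomials by blast
  have "A \<subseteq> ?I \<Longrightarrow> Q (\<lambda>x. \<Sum>(i, j)\<in>A. c i j * (x $ 1) ^ i * (x $ 2) ^ j)" if "finite A" for A
    using that
  proof (induction A rule: finite_induct)
    case empty
    show ?case using monom[of 0 0 0] by simp
  next
    case (insert k A)
    obtain i j where k: "k = (i, j)" by force
    then have "i + j \<le> n" using insert.prems by auto
    from add[OF monom[OF this, of "c i j"]] insert show ?case
      by (simp add: k)
  qed
  moreover have "p = (\<lambda>x. \<Sum>(i, j)\<in>?I. c i j * (x $ 1) ^ i * (x $ 2) ^ j)"
    using c by (rule ext)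
  ultimately show ?thesis by simp
qed

lemma Pk_mono: "p \<in> Pk n \<Longrightarrow> n \<le> n' \<Longrightarrow> p \<in> Pk n'"
  by (induction rule: Pk_induct) (auto intro: Pk_monom Pk_add)

lemma Pk_times_affine:
  assumes "p \<in> Pk n"
  shows "(\<lambda>x. (a * x $ 1 + b * x $ 2 + c) * p x) \<in> Pk (Suc n)"
  using assms
proof (induction rule: Pk_induct)
  case (monom r i j)
  have "(\<lambda>x::pt. (a * r) * (x $ 1) ^ Suc i * (x $ 2) ^ j + ((b * r) * (x $ 1) ^ i * (x $ 2) ^ Suc j
        + (c * r) * (x $ 1) ^ i * (x $ 2) ^ j)) \<in> Pk (Suc n)"
    using monom by (intro Pk_add Pk_monom) auto
  then show ?case by (simp add: algebra_simps)
next
  case (add p q)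
  then show ?case using Pk_add by (fastforce simp: distrib_left)
qed

text \<open>Total degree is invariant under affine substitution, so polynomials and nodes can be transported
  between the reference triangle and the elements.\<close>

lemma Pk_compose_affine:
  fixes B :: mat and b :: pt
  assumes "p \<in> Pk n"
  shows "(\<lambda>x. p (B *v x + b)) \<in> Pk n"
  using assms
proof (induction rule: Pk_induct)
  case (monom c i j)
  let ?L = "\<lambda>r x. B $ r $ 1 * x $ 1 + B $ r $ 2 * x $ 2 + b $ r"
  have L: "(B *v x + b) $ r = ?L r x" for r x
    by (simp add: matrix_vector_mult_def sum_2)
  have 2: "(\<lambda>x. c * ?L 2 x ^ j) \<in> Pk j" for j
  proof (induction j)
    case (Suc j)
    from Pk_times_affine[OF this, of "B $ 2 $ 1" "B $ 2 $ 2" "b $ 2"] show ?case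
      by (simp add: algebra_simps)
  qed (simp add: Pk_const)
  have "(\<lambda>x. c * ?L 1 x ^ i * ?L 2 x ^ j) \<in> Pk (i + j)" for i
  proof (induction i)
    case (Suc i)
    from Pk_times_affine[OF this, of "B $ 1 $ 1" "B $ 1 $ 2" "b $ 1"] show ?case
      by (simp add: mult.left_commute mult.assoc)
  qed (simp add: 2)
  then show ?case unfolding L using monom Pk_mono by blast
qed (rule Pk_add)

lemma Pk_has_derivative:
  assumes "p \<in> Pk n"
  obtains p1 p2 where "p1 \<in> Pk (n - 1)" "p2 \<in> Pk (n - 1)"
    "\<And>x. (p has_derivative (\<lambda>d. d $ 1 * p1 x + d $ 2 * p2 x)) (at x)"
proof -
  have "\<exists>p1\<in>Pk (n - 1). \<exists>p2\<in>Pk (n - 1). \<forall>x. (p has_derivative (\<lambda>d. d $ 1 * p1 x + d $ 2 * p2 x)) (at x)"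
    using assms
  proof (induction rule: Pk_induct)
    case (monom c i j)
    have nth: "((\<lambda>x::pt. x $ a) has_derivative (\<lambda>d. d $ a)) (at x)" for a and x :: pt
      by (intro bounded_linear_imp_has_derivative bounded_linear_vec_nth)
    have 1: "(\<lambda>x::pt. (c * i) * (x $ 1) ^ (i - 1) * (x $ 2) ^ j) \<in> Pk (n - 1)"
      using monom by (cases i) (auto intro: Pk_const Pk_monom)
    have 2: "(\<lambda>x::pt. (c * j) * (x $ 1) ^ i * (x $ 2) ^ (j - 1)) \<in> Pk (n - 1)"
      using monom by (cases j) (auto intro: Pk_const Pk_monom)
    have "((\<lambda>x. c * (x $ 1) ^ i * (x $ 2) ^ j) has_derivative
       (\<lambda>d. d $ 1 * ((c * i) * (x $ 1) ^ (i - 1) * (x $ 2) ^ j) +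
            d $ 2 * ((c * j) * (x $ 1) ^ i * (x $ 2) ^ (j - 1)))) (at x)" for x :: pt
      by (rule has_derivative_eq_rhs, (rule has_derivative_mult has_derivative_const has_derivative_power nth)+)
        (simp add: algebra_simps)
    then show ?case by (intro bexI[OF _ 1] bexI[OF _ 2] allI)
  next
    case (add p q)
    then obtain p1 p2 q1 q2 where *: "p1 \<in> Pk (n - 1)" "p2 \<in> Pk (n - 1)" "q1 \<in> Pk (n - 1)" "q2 \<in> Pk (n - 1)"
      "\<And>x. (p has_derivative (\<lambda>d. d $ 1 * p1 x + d $ 2 * p2 x)) (at x)"
      "\<And>x. (q has_derivative (\<lambda>d. d $ 1 * q1 x + d $ 2 * q2 x)) (at x)"
      by blast
    have "((\<lambda>x. p x + q x) has_derivative (\<lambda>d. d $ 1 * (p1 x + q1 x) + d $ 2 * (p2 x + q2 x))) (at x)" for x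
      by (rule has_derivative_eq_rhs, rule has_derivative_add[OF *(5,6)]) (simp add: algebra_simps)
    then show ?case by (intro bexI[OF _ Pk_add[OF *(1,3)]] bexI[OF _ Pk_add[OF *(2,4)]] allI)
  qed
  then show ?thesis using that by blast
qed

lemma Pk_continuous: "p \<in> Pk n \<Longrightarrow> continuous_on S p"
proof -
  assume "p \<in> Pk n"
  then obtain p1 p2 where "\<And>x. (p has_derivative (\<lambda>d. d $ 1 * p1 x + d $ 2 * p2 x)) (at x)"
    by (rule Pk_has_derivative) blast
  from has_derivative_at_withinI[OF this] show ?thesis by (rule has_derivative_continuous_on)
qed

lemma taylor_poly_Pk: "taylor_poly V n i j y \<in> Pk n"
proof -
  have "(\<lambda>x. taylor_form V n i j y (x - y)) \<in> Pk n" for n i j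
  proof (induction n arbitrary: i j)
    case (Suc n)
    have "(\<lambda>x. (1 * x $ 1 + 0 * x $ 2 + (- y $ 1)) * taylor_form V n (Suc i) j y (x - y) +
          (0 * x $ 1 + 1 * x $ 2 + (- y $ 2)) * taylor_form V n i (Suc j) y (x - y)) \<in> Pk (Suc n)"
      by (intro Pk_add Pk_times_affine Suc)
    then show ?case by simp
  qed (simp add: Pk_const)
  then have "(\<lambda>x. (1 / fact l) * taylor_form V l i j y (x - y)) \<in> Pk n" if "l \<le> n" for l
    using Pk_mono[OF Pk_cmult that] by blast
  then have "(\<lambda>x. \<Sum>l\<le>n. (1 / fact l) * taylor_form V l i j y (x - y)) \<in> Pk n"
    by (intro Pk_sum) simp
  then show ?thesis by (simp add: taylor_poly_def [abs_def])
qed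

section \<open>Polynomial approximation of the Hessian\<close>

lemma square_integral_unit_interval_le:
  fixes f :: "real \<Rightarrow> real"
  assumes "continuous_on {0..1} f"
  shows "(integral {0..1} f)\<^sup>2 \<le> integral {0..1} (\<lambda>s. (f s)\<^sup>2)"
proof -
  define c where "c = integral {0..1} f"
  have f: "(f has_integral c) {0..1}" and f2: "((\<lambda>s. (f s)\<^sup>2) has_integral integral {0..1} (\<lambda>s. (f s)\<^sup>2)) {0..1}"
    unfolding c_def by (intro integrable_integral integrable_continuous_real continuous_intros assms)+
  have c2: "((\<lambda>s. c\<^sup>2) has_integral c\<^sup>2) {0..1::real}"
    using has_integral_const_real[of "c\<^sup>2" 0 1] by simp
  have "((\<lambda>s. (f s)\<^sup>2 - 2 * c * f s + c\<^sup>2) has_integral (integral {0..1} (\<lambda>s. (f s)\<^sup>2) - 2 * c * c + c\<^sup>2)) {0..1}"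
    by (intro has_integral_add has_integral_diff has_integral_mult_right f f2 c2)
  moreover have "(f s)\<^sup>2 - 2 * c * f s + c\<^sup>2 = (f s - c)\<^sup>2" for s by (simp add: power2_eq_square algebra_simps)
  ultimately have "((\<lambda>s. (f s - c)\<^sup>2) has_integral (integral {0..1} (\<lambda>s. (f s)\<^sup>2) - 2 * c * c + c\<^sup>2)) {0..1}"
    by simp
  then have "0 \<le> integral {0..1} (\<lambda>s. (f s)\<^sup>2) - 2 * c * c + c\<^sup>2"
    by (rule has_integral_nonneg) simp
  then show ?thesis by (simp add: c_def power2_eq_square)
qed

lemma exists_below_average:
  fixes f :: "pt \<Rightarrow> real"
  assumes f: "continuous_on (cbox p q) f" and pos: "measure lborel (cbox p q) > 0"
    and int: "integral (cbox p q) f \<le> M"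
  shows "\<exists>y\<in>cbox p q. f y \<le> M / measure lborel (cbox p q)"
proof -
  have "cbox p q \<noteq> {}" using pos by auto
  then obtain y where y: "y \<in> cbox p q" "\<And>z. z \<in> cbox p q \<Longrightarrow> f y \<le> f z"
    using continuous_attains_inf[OF compact_cbox _ f] by blast
  have "measure lborel (cbox p q) * f y = integral (cbox p q) (\<lambda>_. f y)" by simp
  also have "\<dots> \<le> integral (cbox p q) f"
    by (intro integral_le integrable_continuous f y(2)) auto
  finally have "f y \<le> M / measure lborel (cbox p q)"
    using int pos by (simp add: field_simps)
  with y(1) show ?thesis by blast
qed

text \<open>For fixed \<open>s\<close>, the map taking \<open>y\<close> to \<open>y + s (x - y)\<close>
  contracts the square towards \<open>x\<close> with Jacobian \<open>(1 - s)\<^sup>2\<close>. The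
  weight is exactly that Jacobian, so the substitution turns the inner integral into one of
  \<open>G\<close> over the contracted square. Without the weight, the contribution near \<open>s
  = 1\<close> would not be controlled by an area integral of \<open>G\<close>.\<close>

lemma average_along_rays_le:
  fixes G :: "pt \<Rightarrow> real"
  assumes G: "continuous_on UNIV G"
    and M: "0 \<le> M" "\<And>s. 0 \<le> s \<Longrightarrow> s < 1 \<Longrightarrow>
      integral (cbox ((1 - s) *\<^sub>R p + s *\<^sub>R x) ((1 - s) *\<^sub>R q + s *\<^sub>R x)) G \<le> M"
  shows "integral (cbox p q) (\<lambda>y. integral {0..1} (\<lambda>s. (1 - s)\<^sup>2 * G (y + s *\<^sub>R (x - y)))) \<le> M"
proof -
  let ?f = "\<lambda>y s. (1 - s)\<^sup>2 * G (y + s *\<^sub>R (x - y))"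
  have c: "continuous_on T (\<lambda>(y, s). ?f y s)" for T
    unfolding split_beta by (intro continuous_intros continuous_on_compose2[OF G]) auto
  have "integral (cbox p q) (\<lambda>y. integral (cbox 0 1) (?f y)) = integral (cbox 0 1) (\<lambda>s. integral (cbox p q) (\<lambda>y. ?f y s))"
    by (rule integral_swap_continuous[OF c])
  also have "\<dots> \<le> integral (cbox 0 1) (\<lambda>s::real. M)"
  proof (rule integral_le)
    have "continuous_on (cbox 0 1) (\<lambda>s. integral (cbox p q) (\<lambda>y. ?f y s))"
      by (rule integral_continuous_on_param)
        (unfold split_beta, intro continuous_intros continuous_on_compose2[OF G], auto)
    then show "(\<lambda>s. integral (cbox p q) (\<lambda>y. ?f y s)) integrable_on cbox 0 1"
      by (rule integrable_continuous)
  next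
    fix s :: real assume s: "s \<in> cbox 0 1"
    show "integral (cbox p q) (\<lambda>y. ?f y s) \<le> M"
    proof (cases "s = 1")
      case True
      then show ?thesis using M(1) by simp
    next
      case False
      let ?m = "1 - s"
      have m: "?m > 0" "s < 1" "0 \<le> s" using s False by auto
      let ?C = "cbox (?m *\<^sub>R p + s *\<^sub>R x) (?m *\<^sub>R q + s *\<^sub>R x)"
      have "(G has_integral integral ?C G) ?C"
        by (intro integrable_integral integrable_continuous continuous_on_subset[OF G]) auto
      from has_integral_affinity'[OF this m(1), of "s *\<^sub>R x"]
      have "((\<lambda>y. G (?m *\<^sub>R y + s *\<^sub>R x)) has_integral integral ?C G / ?m\<^sup>2) (cbox p q)"
        using m by (simp add: divide_inverse mult.commute power2_eq_square)
      from has_integral_mult_right[OF this, of "?m\<^sup>2"]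
      have "((\<lambda>y. ?f y s) has_integral integral ?C G) (cbox p q)"
        using m by (simp add: algebra_simps)
      from integral_unique[OF this] show ?thesis using M(2)[OF m(3,2)] by (simp only:)
    qed
  qed auto
  finally show ?thesis by simp
qed

text \<open>The square of the remainder is bounded by an integral along the segment, by the Cauchy-Schwarz
  inequality. Averaged over the centres \<open>y\<close>, this is
  \<open>average_along_rays_le\<close>; here \<open>m \<ge> 1\<close> is used, for \<open>(1 -
  s)^(2 m) \<le> (1 - s)\<^sup>2\<close>. Some centre is no worse than the average, and by summing
  over the points \<open>X\<close> first, one centre is obtained for all of them.\<close>

lemma taylor_poly_average_error:
  assumes V: "pd_family V" and X: "finite X" and B: "measure lborel (cbox p q) > 0" and m: "m \<ge> 1" and ij: "\<And>i j. (i, j) \<in> E \<Longrightarrow> i + j = r"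
    and W: "\<And>x s l. x \<in> X \<Longrightarrow> 0 \<le> s \<Longrightarrow> s < 1 \<Longrightarrow> l \<le> r + Suc m \<Longrightarrow>
      integral (cbox ((1 - s) *\<^sub>R p + s *\<^sub>R x) ((1 - s) *\<^sub>R q + s *\<^sub>R x)) (\<lambda>z. (V l (r + Suc m - l) z)\<^sup>2) \<le> W l"
    and W0: "\<And>l. 0 \<le> W l"
    and h: "\<And>x y. x \<in> X \<Longrightarrow> y \<in> cbox p q \<Longrightarrow> norm (x - y) \<le> h"
  shows "\<exists>y\<in>cbox p q. \<forall>x\<in>X. \<forall>(i, j)\<in>E. (V i j x - taylor_poly V m i j y x)\<^sup>2 \<le>
    (2 * h) ^ (2 * Suc m) * (real (card X) * (real (r + m + 2) * (\<Sum>l\<le>r + Suc m. W l)) / measure lborel (cbox p q))"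
proof -
  define N where "N = r + Suc m"
  define G where "G z = real (Suc N) * (\<Sum>l\<le>N. (V l (N - l) z)\<^sup>2)" for z
  define M where "M = real (Suc N) * (\<Sum>l\<le>N. W l)"
  have G: "continuous_on S G" for S
    unfolding G_def by (intro continuous_intros pd_family_continuous V)
  have G0: "0 \<le> G z" for z unfolding G_def by (intro mult_nonneg_nonneg sum_nonneg) auto
  have M0: "0 \<le> M" unfolding M_def using W0 by (intro mult_nonneg_nonneg sum_nonneg) auto
  define f where "f x y = integral {0..1} (\<lambda>s. (1 - s)\<^sup>2 * G (y + s *\<^sub>R (x - y)))" for x y
  have cs: "continuous_on S (\<lambda>s. (1 - s)\<^sup>2 * G (y + s *\<^sub>R (x - y)))" for S :: "real set" and x y
    by (intro continuous_intros continuous_on_compose2[OF G[of UNIV]]) auto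
  have f0: "0 \<le> f x y" for x y
    unfolding f_def by (intro integral_nonneg integrable_continuous_real cs) (auto simp: G0)
  have fc: "continuous_on S (f x)" for S x
    unfolding f_def cbox_interval[symmetric]
    by (rule integral_continuous_on_param)
      (unfold split_beta, intro continuous_intros continuous_on_compose2[OF G[of UNIV]], auto)
  have fM: "integral (cbox p q) (f x) \<le> M" if x: "x \<in> X" for x
    unfolding f_def
  proof (rule average_along_rays_le[OF G M0])
    fix s :: real assume s: "0 \<le> s" "s < 1"
    let ?C = "cbox ((1 - s) *\<^sub>R p + s *\<^sub>R x) ((1 - s) *\<^sub>R q + s *\<^sub>R x)"
    have "integral ?C G = real (Suc N) * (\<Sum>l\<le>N. integral ?C (\<lambda>z. (V l (N - l) z)\<^sup>2))"
      unfolding G_def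
      by (subst integral_mult_right, subst integral_sum)
        (auto intro!: integrable_continuous continuous_on_power pd_family_continuous[OF V])
    also have "\<dots> \<le> M"
      unfolding M_def N_def using W[OF x s] by (intro mult_left_mono sum_mono) auto
    finally show "integral ?C G \<le> M" .
  qed
  have "integral (cbox p q) (\<lambda>y. \<Sum>x\<in>X. f x y) = (\<Sum>x\<in>X. integral (cbox p q) (f x))"
    by (intro integral_sum X integrable_continuous fc)
  also have "\<dots> \<le> real (card X) * M"
    using sum_mono[of X, OF fM] by simp
  finally have "\<exists>y\<in>cbox p q. (\<Sum>x\<in>X. f x y) \<le> real (card X) * M / measure lborel (cbox p q)"
    by (intro exists_below_average continuous_on_sum fc B)
  then obtain y where y: "y \<in> cbox p q" "(\<Sum>x\<in>X. f x y) \<le> real (card X) * M / measure lborel (cbox p q)" by blast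
  show ?thesis
  proof (intro bexI[OF _ y(1)] ballI, safe)
    fix x i j assume x: "x \<in> X" and E: "(i, j) \<in> E"
    define d where "d = x - y"
    have dh: "norm d \<le> h" unfolding d_def using h[OF x y(1)] .
    have pw: "0 \<le> (2 * h) ^ (2 * Suc m)" by (rule zero_le_even_power) simp
    let ?tf = "\<lambda>s. taylor_form V (Suc m) i j (y + s *\<^sub>R d) d"
    have tfc: "continuous_on S ?tf" for S
      by (rule DERIV_continuous_on) (rule taylor_form_line_has_derivative[OF V])
    have "(V i j x - taylor_poly V m i j y x)\<^sup>2 = (integral {0..1} (\<lambda>s. (1 - s) ^ m / fact m * ?tf s))\<^sup>2"
      unfolding taylor_remainder[OF V] d_def by simp
    also have "\<dots> \<le> integral {0..1} (\<lambda>s. ((1 - s) ^ m / fact m * ?tf s)\<^sup>2)"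
      by (intro square_integral_unit_interval_le continuous_intros tfc) auto
    also have "\<dots> \<le> integral {0..1} (\<lambda>s. (2 * h) ^ (2 * Suc m) * ((1 - s)\<^sup>2 * G (y + s *\<^sub>R d)))"
    proof (rule integral_le)
      show "(\<lambda>s. ((1 - s) ^ m / fact m * ?tf s)\<^sup>2) integrable_on {0..1}"
        by (intro integrable_continuous_real continuous_intros tfc) auto
      show "(\<lambda>s. (2 * h) ^ (2 * Suc m) * ((1 - s)\<^sup>2 * G (y + s *\<^sub>R d))) integrable_on {0..1}"
        unfolding d_def by (intro integrable_continuous_real continuous_intros cs)
    next
      fix s :: real assume s: "s \<in> {0..1}"
      let ?z = "y + s *\<^sub>R d"
      have "\<bar>?tf s\<bar> \<le> (2 * norm d) ^ Suc m * (\<Sum>l\<le>N. \<bar>V l (N - l) ?z\<bar>)"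
        using taylor_form_bound[of V "Suc m" i j ?z d] ij[OF E] unfolding N_def by simp
      also have "\<dots> \<le> (2 * h) ^ Suc m * (\<Sum>l\<le>N. \<bar>V l (N - l) ?z\<bar>)"
        using dh by (intro mult_right_mono power_mono sum_nonneg) auto
      finally have "(?tf s)\<^sup>2 \<le> ((2 * h) ^ Suc m * (\<Sum>l\<le>N. \<bar>V l (N - l) ?z\<bar>))\<^sup>2"
        by (rule abs_le_square_iff[THEN iffD1, OF order_trans[OF _ abs_ge_self]])
      also have "\<dots> = (2 * h) ^ (2 * Suc m) * (\<Sum>l\<le>N. \<bar>V l (N - l) ?z\<bar>)\<^sup>2"
        by (simp only: power_mult_distrib power_mult[symmetric] mult.commute[of "Suc m" 2])
      also have "\<dots> \<le> (2 * h) ^ (2 * Suc m) * G ?z"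
        unfolding G_def using sum_squared_le_sum_of_squares[of "\<lambda>l. \<bar>V l (N - l) ?z\<bar>" "{..N}"]
        by (intro mult_left_mono[OF _ pw]) (simp add: mult.commute)
      finally have 1: "(?tf s)\<^sup>2 \<le> (2 * h) ^ (2 * Suc m) * G ?z" .
      have "(1 - s) ^ m / fact m \<le> (1 - s) ^ m"
        using divide_left_mono[of 1 "fact m" "(1 - s) ^ m"] s fact_ge_1[of m] by simp
      also have "\<dots> \<le> (1 - s) ^ 1" using s m by (intro power_decreasing) auto
      finally have "((1 - s) ^ m / fact m)\<^sup>2 \<le> (1 - s)\<^sup>2"
        using s by (intro power_mono) auto
      then have "((1 - s) ^ m / fact m)\<^sup>2 * (?tf s)\<^sup>2 \<le> (1 - s)\<^sup>2 * ((2 * h) ^ (2 * Suc m) * G ?z)"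
        using 1 by (intro mult_mono) auto
      then show "((1 - s) ^ m / fact m * ?tf s)\<^sup>2 \<le> (2 * h) ^ (2 * Suc m) * ((1 - s)\<^sup>2 * G ?z)"
        by (simp only: power_mult_distrib ac_simps)
    qed
    also have "\<dots> = (2 * h) ^ (2 * Suc m) * f x y"
      by (simp add: f_def d_def)
    also have "f x y \<le> (\<Sum>x\<in>X. f x y)" by (rule member_le_sum[OF x]) (auto simp: f0 X)
    also note y(2)
    finally show "(V i j x - taylor_poly V m i j y x)\<^sup>2 \<le> (2 * h) ^ (2 * Suc m) *
      (real (card X) * (real (r + m + 2) * (\<Sum>l\<le>r + Suc m. W l)) / measure lborel (cbox p q))"
      using pw by (simp add: M_def N_def mult_left_mono del: power_Suc mult_Suc_right)
  qed
qed

text \<open>The mollified function is smooth, and its derivatives of order \<open>m + 3\<close> are bounded in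
  \<open>L\<^sup>2(G)\<close> by the weak derivatives of \<open>u\<close>
  (\<open>mollify_weak_deriv\<close>, \<open>mollify_L2\<close>), uniformly in the radius. The
  Taylor polynomial of the mollification is the approximant; passing from the mollified to the
  true Hessian costs the arbitrarily small \<open>\<delta>\<close>, by continuity of the Hessian
  at the finitely many points of \<open>X\<close>.\<close>

lemma hessian_approx_interior:
  fixes u :: "pt \<Rightarrow> real"
  assumes \<Omega>: "open \<Omega>" "bounded \<Omega>" and cu: "continuous_on (closure \<Omega>) u"
    and u: "\<And>y. y \<in> \<Omega> \<Longrightarrow> (u has_derivative (\<lambda>d. d $ 1 * g1 y + d $ 2 * g2 y)) (at y)"
    and g1: "\<And>y. y \<in> \<Omega> \<Longrightarrow> (g1 has_derivative (\<lambda>d. d $ 1 * h11 y + d $ 2 * h12 y)) (at y)"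
    and g2: "\<And>y. y \<in> \<Omega> \<Longrightarrow> (g2 has_derivative (\<lambda>d. d $ 1 * h21 y + d $ 2 * h22 y)) (at y)"
    and hc: "continuous_on \<Omega> h11" "continuous_on \<Omega> h12" "continuous_on \<Omega> h21" "continuous_on \<Omega> h22"
    and m: "m \<ge> 1"
    and w: "\<And>l. l \<le> m + 3 \<Longrightarrow> w l \<in> L2_space \<Omega>"
      "\<And>l. l \<le> m + 3 \<Longrightarrow> weak_deriv \<Omega> (replicate l 1 @ replicate (m + 3 - l) 2) u (w l)"
    and G: "open G" "convex G" "G \<subseteq> \<Omega>" and X: "finite X" "X \<subseteq> G"
    and B: "cbox p q \<subseteq> G" "measure lborel (cbox p q) > 0"
    and h: "\<And>x y. x \<in> G \<Longrightarrow> y \<in> G \<Longrightarrow> norm (x - y) \<le> h" and \<delta>: "\<delta> > 0"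
  defines "E \<equiv> (2 * h) ^ (2 * Suc m) * (real (card X) *
      (real (m + 4) * (\<Sum>l\<le>m + 3. LINT y:G|lebesgue. (w l y)\<^sup>2)) / measure lborel (cbox p q))"
  shows "\<exists>P :: nat \<Rightarrow> nat \<Rightarrow> pt \<Rightarrow> real. P 0 0 \<in> Pk (m + 2) \<and>
    (\<forall>i j x. i + j \<le> 1 \<longrightarrow> (P i j has_derivative (\<lambda>d. d $ 1 * P (Suc i) j x + d $ 2 * P i (Suc j) x)) (at x)) \<and>
    (\<forall>x\<in>X. \<bar>h11 x - P 2 0 x\<bar> \<le> sqrt E + \<delta> \<and> \<bar>h12 x - P 1 1 x\<bar> \<le> sqrt E + \<delta> \<and>
            \<bar>h21 x - P 1 1 x\<bar> \<le> sqrt E + \<delta> \<and> \<bar>h22 x - P 0 2 x\<bar> \<le> sqrt E + \<delta>)"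
proof -
  \<comment> \<open>All segments between sample points and centres lie in this compact set, whose distance to
    the complement of \<open>G\<close> bounds the admissible radii.\<close>
  define S where "S = convex hull (X \<union> cbox p q)"
  have S: "compact S" unfolding S_def
    by (intro compact_convex_hull compact_Un finite_imp_compact X compact_cbox)
  have SG: "S \<subseteq> G" unfolding S_def using X B G by (intro hull_minimal) auto
  obtain e where e: "e > 0" "\<And>x. x \<in> S \<Longrightarrow> ball x e \<subseteq> G"
    using compact_subset_open_imp_ball_epsilon_subset[OF S G(1) SG] by (metis UN_subset_iff)
  have sq: "norm z < r" if "z \<in> square \<epsilon>" "2 * \<epsilon> < r" for z \<epsilon> r
  proof -
    have "\<bar>z $ 1\<bar> \<le> \<epsilon>" "\<bar>z $ 2\<bar> \<le> \<epsilon>" using that(1) by (auto simp: mem_square)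
    then show ?thesis using norm_le_l1_cart[of z] that(2) by (simp add: sum_2)
  qed
  have near: "\<forall>\<^sub>F \<epsilon> in at_right 0. \<forall>z\<in>square \<epsilon>. \<bar>h (x - z) - h x\<bar> \<le> \<delta>"
    if h: "continuous_on \<Omega> h" and x: "x \<in> X" for h x
  proof -
    have "x \<in> \<Omega>" using x X G by auto
    then have "isCont h x" using h \<Omega>(1) continuous_on_eq_continuous_at by blast
    then obtain d where d: "d > 0" "\<And>y. dist y x < d \<Longrightarrow> dist (h y) (h x) < \<delta>"
      using \<delta> unfolding continuous_at_eps_delta by blast
    have "\<forall>\<^sub>F \<epsilon> in at_right 0. 2 * \<epsilon> < d"
      using d(1) by (simp add: eventually_at_right_field) (intro exI[of _ "d / 2"], auto)
    then show ?thesis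
    proof eventually_elim
      case (elim \<epsilon>)
      show ?case
      proof
        fix z assume "z \<in> square \<epsilon>"
        then have "dist (x - z) x < d" using sq[OF _ elim] by (simp add: dist_norm)
        from d(2)[OF this] show "\<bar>h (x - z) - h x\<bar> \<le> \<delta>" by (simp add: dist_real_def)
      qed
    qed
  qed
  have "\<forall>\<^sub>F \<epsilon> in at_right 0. \<epsilon> > 0 \<and> 2 * \<epsilon> < e / 2 \<and> (\<forall>x\<in>X. \<forall>z\<in>square \<epsilon>.
      \<bar>h11 (x - z) - h11 x\<bar> \<le> \<delta> \<and> \<bar>h12 (x - z) - h12 x\<bar> \<le> \<delta> \<and>
      \<bar>h21 (x - z) - h21 x\<bar> \<le> \<delta> \<and> \<bar>h22 (x - z) - h22 x\<bar> \<le> \<delta>)"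
  proof (intro eventually_conj)
    show "\<forall>\<^sub>F \<epsilon> in at_right (0::real). \<epsilon> > 0" by (simp add: eventually_at_right_less)
    show "\<forall>\<^sub>F \<epsilon> in at_right (0::real). 2 * \<epsilon> < e / 2"
      using e(1) by (simp add: eventually_at_right_field) (intro exI[of _ "e / 4"], auto)
    show "\<forall>\<^sub>F \<epsilon> in at_right 0. \<forall>x\<in>X. \<forall>z\<in>square \<epsilon>.
      \<bar>h11 (x - z) - h11 x\<bar> \<le> \<delta> \<and> \<bar>h12 (x - z) - h12 x\<bar> \<le> \<delta> \<and>
      \<bar>h21 (x - z) - h21 x\<bar> \<le> \<delta> \<and> \<bar>h22 (x - z) - h22 x\<bar> \<le> \<delta>"
    proof (intro eventually_ball_finite X(1) ballI)
      fix x assume x: "x \<in> X"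
      from near[OF hc(1) x] near[OF hc(2) x] near[OF hc(3) x] near[OF hc(4) x]
      show "\<forall>\<^sub>F \<epsilon> in at_right 0. \<forall>z\<in>square \<epsilon>.
        \<bar>h11 (x - z) - h11 x\<bar> \<le> \<delta> \<and> \<bar>h12 (x - z) - h12 x\<bar> \<le> \<delta> \<and>
        \<bar>h21 (x - z) - h21 x\<bar> \<le> \<delta> \<and> \<bar>h22 (x - z) - h22 x\<bar> \<le> \<delta>"
        by eventually_elim blast
    qed
  qed
  from eventually_happens[OF this] obtain \<epsilon> where \<epsilon>: "\<epsilon> > 0" "2 * \<epsilon> < e / 2"
    and close: "\<And>x z. x \<in> X \<Longrightarrow> z \<in> square \<epsilon> \<Longrightarrow>
      \<bar>h11 (x - z) - h11 x\<bar> \<le> \<delta> \<and> \<bar>h12 (x - z) - h12 x\<bar> \<le> \<delta> \<and>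
      \<bar>h21 (x - z) - h21 x\<bar> \<le> \<delta> \<and> \<bar>h22 (x - z) - h22 x\<bar> \<le> \<delta>"
    by (auto simp: trivial_limit_at_right_real)
  obtain \<rho> where \<rho>: "pd_family \<rho>" "\<And>x. 0 \<le> \<rho> 0 0 x"
    "\<And>i j x. x \<notin> square \<epsilon> \<Longrightarrow> \<rho> i j x = 0" "integral (square \<epsilon>) (\<rho> 0 0) = 1"
    using mollifier_exists[OF \<epsilon>(1)] by metis
  have SsqG: "x - z \<in> G" if "x \<in> S" "z \<in> square \<epsilon>" for x z
    using e(2)[OF that(1)] sq[OF that(2), of e] \<epsilon> e(1) by (force simp: subset_iff dist_norm)
  obtain a b :: pt where ab: "\<Omega> \<subseteq> cbox a b"
    using bounded_subset_cbox_symmetric[OF \<Omega>(2)] by blast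
  have "compact (closure \<Omega>)" using \<Omega>(2) by simp
  then have "bounded (u ` closure \<Omega>)" using cu compact_continuous_image compact_imp_bounded by blast
  then obtain K where K: "\<And>x. x \<in> closure \<Omega> \<Longrightarrow> norm (u x) \<le> K" by (auto simp: bounded_iff)
  have K0: "norm (u x) \<le> \<bar>K\<bar>" if "x \<in> closure \<Omega>" for x using K[OF that] by linarith
  \<comment> \<open>The convolution integrates over a box that sticks out of the domain, so \<open>u\<close>
    is extended continuously.\<close>
  obtain U where U: "continuous_on UNIV U" "\<And>x. x \<in> closure \<Omega> \<Longrightarrow> U x = u x"
  proof (rule Tietze[OF cu _ abs_ge_zero K0, of UNIV])
    show "closedin (top_of_set UNIV) (closure \<Omega>)" by simp
  qed blast+
  have Uab: "continuous_on (cbox a b) U" using U(1) continuous_on_subset by blast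
  have U\<Omega>: "U x = u x" if "x \<in> \<Omega>" for x using U(2) closure_subset that by blast
  define V where "V i j x = integral (cbox a b) (\<lambda>y. \<rho> i j (x - y) * U y)" for i j x
  have V: "pd_family V" unfolding V_def [abs_def] by (rule mollify_pd_family[OF \<rho>(1) Uab])
  define W where "W l = (if l \<le> m + 3 then LINT y:G|lebesgue. (w l y)\<^sup>2 else 0)" for l
  have W0: "0 \<le> W l" for l
    by (auto simp: W_def set_lebesgue_integral_def intro!: Bochner_Integration.integral_nonneg)
  have VW: "integral (cbox ((1 - s) *\<^sub>R p + s *\<^sub>R x) ((1 - s) *\<^sub>R q + s *\<^sub>R x)) (\<lambda>z. (V l (2 + Suc m - l) z)\<^sup>2) \<le> W l"
    if x: "x \<in> X" and s: "0 \<le> s" "s < 1" and l: "l \<le> 2 + Suc m" for x s l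
  proof -
    let ?Q = "cbox ((1 - s) *\<^sub>R p + s *\<^sub>R x) ((1 - s) *\<^sub>R q + s *\<^sub>R x)"
    have QS: "?Q \<subseteq> S"
    proof
      fix z assume z: "z \<in> ?Q"
      define y where "y = (z - s *\<^sub>R x) /\<^sub>R (1 - s)"
      have "y \<in> cbox p q"
        unfolding mem_box_cart
      proof (intro allI conjI)
        fix i
        have "(1 - s) * p $ i \<le> z $ i - s * x $ i" "z $ i - s * x $ i \<le> (1 - s) * q $ i"
          using z unfolding mem_box_cart by (auto simp: algebra_simps dest!: spec[of _ i])
        moreover have yi: "y $ i = (z $ i - s * x $ i) / (1 - s)"
          by (simp add: y_def divide_inverse mult.commute)
        ultimately show "p $ i \<le> y $ i" "y $ i \<le> q $ i"
          using s by (simp_all add: yi pos_le_divide_eq pos_divide_le_eq mult.commute)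
      qed
      then have "y \<in> S" unfolding S_def using hull_subset[of "X \<union> cbox p q" convex] by blast
      moreover have "x \<in> S" using x hull_subset[of "X \<union> cbox p q" convex] by (auto simp: S_def)
      moreover have "z = (1 - s) *\<^sub>R y + s *\<^sub>R x" using s by (simp add: y_def)
      moreover have "convex S" by (simp add: S_def)
      ultimately show "z \<in> S" using s by (auto simp: convex_def)
    qed
    have l': "l \<le> m + 3" "2 + Suc m - l = m + 3 - l" using l by auto
    have "integral ?Q (\<lambda>z. (V l (m + 3 - l) z)\<^sup>2) \<le> (LINT y:G|lebesgue. (w l y)\<^sup>2)"
    proof (rule mollify_L2[OF w(1)[OF l'(1)] \<Omega>(1) G(1,3), where r = "\<rho> 0 0" and \<epsilon> = \<epsilon>])
      show "x - z \<in> G" if "x \<in> ?Q" "z \<in> square \<epsilon>" for x z using SsqG QS that by blast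
      show "V l (m + 3 - l) x' = (LINT y:\<Omega>|lebesgue. w l y * \<rho> 0 0 (x' - y))" if x': "x' \<in> ?Q" for x'
        unfolding V_def
      proof (rule mollify_weak_deriv[OF \<rho>(1) \<rho>(3) Uab _ ab _ w(2)[OF l'(1)]])
        show "x' - z \<in> \<Omega>" if "z \<in> square \<epsilon>" for z using SsqG[OF _ that] QS x' G(3) by blast
      qed (use U\<Omega> in auto)
    qed (use \<rho> pd_family_continuous[OF \<rho>(1)] pd_family_continuous[OF V] in auto)
    then show ?thesis using l' by (simp add: W_def)
  qed
  have XG: "norm (x - y) \<le> h" if "x \<in> X" "y \<in> cbox p q" for x y using h X(2) B(1) that by blast
  have "\<exists>y\<in>cbox p q. \<forall>x\<in>X. \<forall>(i, j)\<in>{(2, 0), (1, 1), (0, 2)}. (V i j x - taylor_poly V m i j y x)\<^sup>2 \<le>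
    (2 * h) ^ (2 * Suc m) * (real (card X) * (real (2 + m + 2) * (\<Sum>l\<le>2 + Suc m. W l)) / measure lborel (cbox p q))"
    by (rule taylor_poly_average_error[OF V X(1) B(2) m _ VW W0 XG]) auto
  moreover have "(2 * h) ^ (2 * Suc m) * (real (card X) * (real (2 + m + 2) * (\<Sum>l\<le>2 + Suc m. W l)) / measure lborel (cbox p q)) = E"
  proof -
    have 1: "(\<Sum>l\<le>2 + Suc m. W l) = (\<Sum>l\<le>m + 3. LINT y:G|lebesgue. (w l y)\<^sup>2)"
      by (intro sum.cong) (auto simp: W_def)
    have 2: "real (2 + m + 2) = real (m + 4)" by simp
    show ?thesis unfolding E_def 1 2 ..
  qed
  ultimately obtain y where y: "\<And>x. x \<in> X \<Longrightarrow> (V 2 0 x - taylor_poly V m 2 0 y x)\<^sup>2 \<le> E"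
    "\<And>x. x \<in> X \<Longrightarrow> (V 1 1 x - taylor_poly V m 1 1 y x)\<^sup>2 \<le> E"
    "\<And>x. x \<in> X \<Longrightarrow> (V 0 2 x - taylor_poly V m 0 2 y x)\<^sup>2 \<le> E"
    by auto
  define P where "P i j = taylor_poly V (m + 2 - (i + j)) i j y" for i j
  have P0: "P 0 0 \<in> Pk (m + 2)" unfolding P_def using taylor_poly_Pk by simp
  have Pd: "(P i j has_derivative (\<lambda>d. d $ 1 * P (Suc i) j x + d $ 2 * P i (Suc j) x)) (at x)"
    if "i + j \<le> 1" for i j x
  proof -
    have *: "m + 2 - (i + j) = Suc (m + 1 - (i + j))" using that by simp
    show ?thesis unfolding P_def * using taylor_poly_has_derivative[of V "m + 1 - (i + j)" i j y x] by simp
  qed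
  have final: "\<bar>h11 x - P 2 0 x\<bar> \<le> sqrt E + \<delta> \<and> \<bar>h12 x - P 1 1 x\<bar> \<le> sqrt E + \<delta> \<and>
            \<bar>h21 x - P 1 1 x\<bar> \<le> sqrt E + \<delta> \<and> \<bar>h22 x - P 0 2 x\<bar> \<le> sqrt E + \<delta>" if x: "x \<in> X" for x
  proof -
    have xS: "x \<in> S" using x hull_subset[of "X \<union> cbox p q" convex] by (auto simp: S_def)
    have N: "x' - z \<in> \<Omega>" if "x' \<in> ball x (e / 2)" "z \<in> square \<epsilon>" for x' z
    proof -
      have "dist x (x' - z) \<le> dist x x' + norm z" using norm_triangle_ineq[of "x - x'" z] by (simp add: dist_norm algebra_simps)
      also have "\<dots> < e" using that(1) sq[OF that(2) \<epsilon>(2)] by simp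
      finally show ?thesis using e(2)[OF xS] G(3) by auto
    qed
    have xN: "x \<in> ball x (e / 2)" using e(1) by simp
    have V2: "V 2 0 x = integral (square \<epsilon>) (\<lambda>z. \<rho> 0 0 z * h11 (x - z))"
        "V 1 1 x = integral (square \<epsilon>) (\<lambda>z. \<rho> 0 0 z * h12 (x - z))"
        "V 1 1 x = integral (square \<epsilon>) (\<lambda>z. \<rho> 0 0 z * h21 (x - z))"
        "V 0 2 x = integral (square \<epsilon>) (\<lambda>z. \<rho> 0 0 z * h22 (x - z))"
      unfolding V_def
      using mollify_hess[where \<rho> = \<rho> and U = U and a = a and b = b and ?x0.0 = x and \<epsilon> = \<epsilon> and \<Omega> = \<Omega> and N = "ball x (e / 2)" and u = u and ?g1.0 = g1 and ?g2.0 = g2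
            and ?h11.0 = h11 and ?h12.0 = h12 and ?h21.0 = h21 and ?h22.0 = h22]
        \<rho>(1,3) Uab U\<Omega> ab N xN u g1 g2 hc by auto
    have xs: "x - z \<in> \<Omega>" if "z \<in> square \<epsilon>" for z using N[OF xN that] .
    have cl: "\<bar>V 2 0 x - h11 x\<bar> \<le> \<delta>" "\<bar>V 1 1 x - h12 x\<bar> \<le> \<delta>" "\<bar>V 1 1 x - h21 x\<bar> \<le> \<delta>" "\<bar>V 0 2 x - h22 x\<bar> \<le> \<delta>"
    proof -
      show "\<bar>V 2 0 x - h11 x\<bar> \<le> \<delta>"
        unfolding V2(1) by (rule mollify_close[OF \<rho>(1,2,4) hc(1) xs]) (use close[OF x] in auto)
      show "\<bar>V 1 1 x - h12 x\<bar> \<le> \<delta>"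
        unfolding V2(2) by (rule mollify_close[OF \<rho>(1,2,4) hc(2) xs]) (use close[OF x] in auto)
      show "\<bar>V 1 1 x - h21 x\<bar> \<le> \<delta>"
        unfolding V2(3) by (rule mollify_close[OF \<rho>(1,2,4) hc(3) xs]) (use close[OF x] in auto)
      show "\<bar>V 0 2 x - h22 x\<bar> \<le> \<delta>"
        unfolding V2(4) by (rule mollify_close[OF \<rho>(1,2,4) hc(4) xs]) (use close[OF x] in auto)
    qed
    have p: "\<bar>V 2 0 x - P 2 0 x\<bar> \<le> sqrt E" "\<bar>V 1 1 x - P 1 1 x\<bar> \<le> sqrt E" "\<bar>V 0 2 x - P 0 2 x\<bar> \<le> sqrt E"
      using y(1)[OF x, THEN real_sqrt_le_mono] y(2)[OF x, THEN real_sqrt_le_mono]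
        y(3)[OF x, THEN real_sqrt_le_mono]
      by (simp_all add: P_def)
    have "\<bar>a - c\<bar> \<le> sqrt E + \<delta>" if "\<bar>b - a\<bar> \<le> \<delta>" "\<bar>b - c\<bar> \<le> sqrt E" for a b c
      using that by linarith
    with cl p show ?thesis by blast
  qed
  show ?thesis using P0 Pd final by blast
qed

section \<open>Gradients and Hessians on convex sets\<close>

text \<open>Two derivatives agree on all directions \<open>z - x\<close> with \<open>z\<close> in the set. As
  the set contains a ball, differences of such directions span the space. This covers boundary
  points, where the limit is one-sided.\<close>

lemma has_derivative_within_convex_unique:
  fixes f :: "'a::euclidean_space \<Rightarrow> 'b::real_normed_vector"
  assumes S: "convex S" "interior S \<noteq> {}" "x \<in> S"
    and D: "(f has_derivative D1) (at x within S)" "(f has_derivative D2) (at x within S)"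
  shows "D1 = D2"
proof -
  define L where "L d = D1 d - D2 d" for d
  have L: "((\<lambda>_. 0) has_derivative L) (at x within S)"
    using has_derivative_diff[OF D] by (simp add: L_def [abs_def])
  then have lin: "linear L" using has_derivative_linear by blast
  have zero: "L (z - x) = 0" if z: "z \<in> S" for z
  proof -
    have seg: "(\<lambda>t. x + t *\<^sub>R (z - x)) ` {0..1} \<subseteq> S"
    proof safe
      fix t :: real assume "t \<in> {0..1}"
      then show "x + t *\<^sub>R (z - x) \<in> S"
        using convexD_alt[OF S(1,3) z, of t] by (simp add: algebra_simps)
    qed
    have "((\<lambda>t. x + t *\<^sub>R (z - x)) has_derivative (\<lambda>t. t *\<^sub>R (z - x))) (at 0 within {0..1})"
      by (auto intro!: derivative_eq_intros)
    moreover have "((\<lambda>_. 0) has_derivative L) (at (x + 0 *\<^sub>R (z - x)) within (\<lambda>t. x + t *\<^sub>R (z - x)) ` {0..1})"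
      using has_derivative_subset[OF L seg] by simp
    ultimately have "((\<lambda>_. 0) has_derivative (\<lambda>t. L (t *\<^sub>R (z - x)))) (at 0 within {0..1::real})"
      by (rule has_derivative_in_compose)
    then have "((\<lambda>_. 0) has_vector_derivative L (z - x)) (at 0 within cbox 0 (1::real))"
      by (simp add: has_vector_derivative_def linear_scale[OF lin])
    moreover have "((\<lambda>_. 0) has_vector_derivative (0::'b)) (at 0 within cbox 0 (1::real))"
      by (rule has_vector_derivative_const)
    ultimately show ?thesis
      by (intro vector_derivative_unique_within_closed_interval[of 0 1 0]) auto
  qed
  obtain c e where e: "e > 0" "ball c e \<subseteq> S"
    using S(2) by (meson all_not_in_conv mem_interior)
  have "L d = 0" for d
  proof -
    define r where "r = e / (2 * (norm d + 1))"
    have r: "r > 0" using e(1) by (simp add: r_def add_nonneg_pos)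
    have "norm (r *\<^sub>R d) < e"
    proof -
      have "norm (r *\<^sub>R d) = e * (norm d / (2 * (norm d + 1)))" using e(1) by (simp add: r_def)
      also have "\<dots> < e * 1" using e(1) by (intro mult_strict_left_mono) (auto simp: divide_less_eq add_nonneg_pos)
      finally show ?thesis by simp
    qed
    then have "c \<in> S" "c + r *\<^sub>R d \<in> S" using e by (auto simp: subset_iff dist_norm)
    from zero[OF this(1)] zero[OF this(2)] have "L (r *\<^sub>R d) = 0"
      using linear_add[OF lin, of "c - x" "r *\<^sub>R d"] by (simp add: algebra_simps)
    then show ?thesis using r by (simp add: linear_scale[OF lin])
  qed
  then show ?thesis by (auto simp: L_def)
qed

lemma grad_on_eq:
  assumes "convex S" "interior S \<noteq> {}" "x \<in> S" "(w has_derivative (\<lambda>d. g \<bullet> d)) (at x within S)"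
  shows "grad_on S w x = g"
  unfolding grad_on_def
proof (rule the_equality)
  fix g' assume "(w has_derivative (\<lambda>d. g' \<bullet> d)) (at x within S)"
  from has_derivative_within_convex_unique[OF assms(1-3) this assms(4)]
  show "g' = g" by (metis vector_eq_rdot)
qed (rule assms)

lemma hess_on_eq:
  assumes "convex S" "interior S \<noteq> {}" "x \<in> S" "(grad_on S w has_derivative (\<lambda>d. A *v d)) (at x within S)"
  shows "hess_on S w x = A"
  unfolding hess_on_def
proof (rule the_equality)
  fix A' assume "(grad_on S w has_derivative (\<lambda>d. A' *v d)) (at x within S)"
  from has_derivative_within_convex_unique[OF assms(1-3) this assms(4)]
  show "A' = A" by (metis matrix_eq)
qed (rule assms)

lemma inner_2: "(x :: real^2) \<bullet> y = x $ 1 * y $ 1 + x $ 2 * y $ 2"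
  by (simp add: inner_vec_def sum_2)

lemma matrix_vector_mult_2: "(A *v (d :: real^2)) $ a = d $ 1 * A $ a $ 1 + d $ 2 * A $ a $ 2"
  by (simp add: matrix_vector_mult_def sum_2 mult.commute)

lemma has_derivative_vec2:
  fixes g :: "pt \<Rightarrow> pt"
  shows "(g has_derivative (\<lambda>d. A *v d)) (at x within S) \<longleftrightarrow>
    (\<forall>a. ((\<lambda>x. g x $ a) has_derivative (\<lambda>d. d $ 1 * A $ a $ 1 + d $ 2 * A $ a $ 2)) (at x within S))"
proof -
  have "(g has_derivative (\<lambda>d. A *v d)) (at x within S) \<longleftrightarrow>
    (\<forall>i\<in>Basis. ((\<lambda>x. g x \<bullet> i) has_derivative (\<lambda>d. (A *v d) \<bullet> i)) (at x within S))"
    by (rule has_derivative_componentwise_within)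
  also have "\<dots> \<longleftrightarrow> (\<forall>a. ((\<lambda>x. g x $ a) has_derivative (\<lambda>d. (A *v d) $ a)) (at x within S))"
    by (auto simp: Basis_vec_def inner_axis)
  finally show ?thesis by (simp only: matrix_vector_mult_2)
qed

text \<open>Reads off gradient and Hessian from a family in which only the derivatives of order at most two
  are provided. The mixed derivative has one index pair, which makes the Hessian symmetric.\<close>

lemma hess_on_UNIV_components:
  assumes P: "\<And>i j x. i + j \<le> 1 \<Longrightarrow>
    (P i j has_derivative (\<lambda>d. d $ 1 * P (Suc i) j x + d $ 2 * P i (Suc j) x)) (at x)"
  shows "grad_on UNIV (P 0 0) x $ 1 = P 1 0 x" "grad_on UNIV (P 0 0) x $ 2 = P 0 1 x"
    and "hess_on UNIV (P 0 0) x $ 1 $ 1 = P 2 0 x" "hess_on UNIV (P 0 0) x $ 1 $ 2 = P 1 1 x"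
    and "hess_on UNIV (P 0 0) x $ 2 $ 1 = P 1 1 x" "hess_on UNIV (P 0 0) x $ 2 $ 2 = P 0 2 x"
    and "(P 0 0 has_derivative (\<lambda>d. grad_on UNIV (P 0 0) x \<bullet> d)) (at x)"
    and "(grad_on UNIV (P 0 0) has_derivative (\<lambda>d. hess_on UNIV (P 0 0) x *v d)) (at x)"
proof -
  have g: "(P 0 0 has_derivative (\<lambda>d. (vector [P 1 0 x, P 0 1 x] :: pt) \<bullet> d)) (at x)" for x
    using P[of 0 0 x] by (simp add: inner_2 mult.commute)
  have G: "grad_on UNIV (P 0 0) = (\<lambda>x. vector [P 1 0 x, P 0 1 x])"
    using grad_on_eq[OF convex_UNIV _ UNIV_I g] by auto
  define A :: mat where "A = vector [vector [P 2 0 x, P 1 1 x], vector [P 1 1 x, P 0 2 x]]"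
  have h: "(grad_on UNIV (P 0 0) has_derivative (\<lambda>d. A *v d)) (at x)"
    unfolding has_derivative_vec2 G
    using P[of 1 0 x] P[of 0 1 x] by (simp add: forall_2 A_def numeral_2_eq_2)
  then have A: "hess_on UNIV (P 0 0) x = A"
    by (intro hess_on_eq) auto
  show "grad_on UNIV (P 0 0) x $ 1 = P 1 0 x" "grad_on UNIV (P 0 0) x $ 2 = P 0 1 x"
    "(P 0 0 has_derivative (\<lambda>d. grad_on UNIV (P 0 0) x \<bullet> d)) (at x)"
    unfolding G using g by simp_all
  show "hess_on UNIV (P 0 0) x $ 1 $ 1 = P 2 0 x" "hess_on UNIV (P 0 0) x $ 1 $ 2 = P 1 1 x"
    "hess_on UNIV (P 0 0) x $ 2 $ 1 = P 1 1 x" "hess_on UNIV (P 0 0) x $ 2 $ 2 = P 0 2 x"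
    "(grad_on UNIV (P 0 0) has_derivative (\<lambda>d. hess_on UNIV (P 0 0) x *v d)) (at x)"
    unfolding A using h by (simp_all add: A_def)
qed

text \<open>The coefficient produced by differentiating the \<open>i\<close>-th power \<open>a\<close> times.
  It vanishes for \<open>a > i\<close>, which matches the truncated exponent \<open>i - a\<close>.\<close>

definition falling :: "nat \<Rightarrow> nat \<Rightarrow> real" where
  "falling i a = (\<Prod>l<a. real (i - l))"

lemma falling_Suc: "falling i (Suc a) = falling i a * real (i - a)"
  by (simp add: falling_def)

lemma falling_eq_0: "i < a \<Longrightarrow> falling i a = 0"
  unfolding falling_def by (rule prod_zero) (auto intro!: bexI[of _ i])

lemma Pk_pd_family:
  assumes "p \<in> Pk n"
  obtains P where "pd_family P" "P 0 0 = p" "\<And>a b. P a b \<in> Pk (n - (a + b))"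
proof -
  have "\<exists>P. pd_family P \<and> P 0 0 = p \<and> (\<forall>a b. P a b \<in> Pk (n - (a + b)))"
    using assms
  proof (induction rule: Pk_induct)
    case (monom c i j)
    define P where "P a b x = (c * falling i a * falling j b) * (x $ 1) ^ (i - a) * (x $ 2) ^ (j - b)"
      for a b and x :: pt
    have nth: "((\<lambda>x::pt. x $ a) has_derivative (\<lambda>d. d $ a)) (at x)" for a and x :: pt
      by (intro bounded_linear_imp_has_derivative bounded_linear_vec_nth)
    have "pd_family P"
      unfolding pd_family_def
    proof (intro allI)
      fix a b and x :: pt
      have "i - a - 1 = i - Suc a" "j - b - 1 = j - Suc b" by auto
      then show "(P a b has_derivative (\<lambda>d. d $ 1 * P (Suc a) b x + d $ 2 * P a (Suc b) x)) (at x)"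
        unfolding P_def
        by - (rule has_derivative_eq_rhs, (rule has_derivative_mult has_derivative_const has_derivative_power nth)+,
          simp add: falling_Suc algebra_simps)
    qed
    moreover have "P a b \<in> Pk (n - (a + b))" for a b
    proof (cases "a \<le> i \<and> b \<le> j")
      case True
      then have "i - a + (j - b) \<le> n - (a + b)" using monom by linarith
      then show ?thesis unfolding P_def by (rule Pk_monom)
    next
      case False
      then have "P a b = (\<lambda>x. 0)" by (auto simp: P_def falling_eq_0 fun_eq_iff not_le)
      then show ?thesis by (simp add: Pk_const)
    qed
    moreover have "P 0 0 = (\<lambda>x. c * (x $ 1) ^ i * (x $ 2) ^ j)"
      by (simp add: P_def falling_def fun_eq_iff)
    ultimately show ?case by blast
  next
    case (add p q)
    then obtain P Q where P: "pd_family P" "P 0 0 = p" "\<And>a b. P a b \<in> Pk (n - (a + b))"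
      and Q: "pd_family Q" "Q 0 0 = q" "\<And>a b. Q a b \<in> Pk (n - (a + b))" by blast
    have "pd_family (\<lambda>a b x. P a b x + Q a b x)"
      unfolding pd_family_def
    proof (intro allI)
      fix a b x
      from has_derivative_add[OF pd_familyD[OF P(1), of a b x UNIV] pd_familyD[OF Q(1), of a b x UNIV]]
      show "((\<lambda>x. P a b x + Q a b x) has_derivative
        (\<lambda>d. d $ 1 * (P (Suc a) b x + Q (Suc a) b x) + d $ 2 * (P a (Suc b) x + Q a (Suc b) x))) (at x)"
        by (simp add: algebra_simps)
    qed
    then show ?case using P Q
      by (intro exI[of _ "\<lambda>a b x. P a b x + Q a b x"]) (auto intro: Pk_add)
  qed
  then show ?thesis using that by blast
qed

lemma
  assumes "p \<in> Pk n"
  shows Pk_has_grad: "(p has_derivative (\<lambda>d. grad_on UNIV p x \<bullet> d)) (at x)"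
    and Pk_has_hess: "(grad_on UNIV p has_derivative (\<lambda>d. hess_on UNIV p x *v d)) (at x)"
    and Pk_hess: "(\<lambda>x. hess_on UNIV p x $ a $ b) \<in> Pk (n - 2)"
    and Pk_hess_sym: "transpose (hess_on UNIV p x) = hess_on UNIV p x"
proof -
  obtain P where P: "pd_family P" "P 0 0 = p" "\<And>a b. P a b \<in> Pk (n - (a + b))"
    using Pk_pd_family[OF assms] by blast
  note H = hess_on_UNIV_components[of P, OF pd_familyD[OF P(1)], unfolded P(2)]
  show "(p has_derivative (\<lambda>d. grad_on UNIV p x \<bullet> d)) (at x)"
    "(grad_on UNIV p has_derivative (\<lambda>d. hess_on UNIV p x *v d)) (at x)"
    by (rule H)+
  show "(\<lambda>x. hess_on UNIV p x $ a $ b) \<in> Pk (n - 2)"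
    using exhaust_2[of a] exhaust_2[of b] P(3)[of 2 0] P(3)[of 1 1] P(3)[of 0 2] by (auto simp: H numeral_2_eq_2)
  show "transpose (hess_on UNIV p x) = hess_on UNIV p x"
    by (simp add: vec_eq_iff transpose_def forall_2 H)
qed

lemma linear_functional_inner:
  fixes f :: "'a::euclidean_space \<Rightarrow> real"
  assumes "linear f"
  obtains g where "f = (\<lambda>d. g \<bullet> d)"
proof -
  have "f d = adjoint f 1 \<bullet> d" for d
    using adjoint_works[OF assms, of d 1] by (simp add: inner_commute)
  then show ?thesis using that by blast
qed

text \<open>The gradient and the Hessian are defined by a definite description; on a convex set with interior
  points it denotes, by uniqueness of derivatives.\<close>

lemma
  assumes S: "convex S" "interior S \<noteq> {}" and C2: "C2_on S u" and x: "x \<in> S"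
  shows C2_on_has_grad: "(u has_derivative (\<lambda>d. grad_on S u x \<bullet> d)) (at x within S)"
    and C2_on_has_hess: "(grad_on S u has_derivative (\<lambda>d. hess_on S u x *v d)) (at x within S)"
proof -
  obtain D where D: "(u has_derivative D) (at x within S)"
    using C2 x unfolding C2_on_def differentiable_def by blast
  obtain g where g: "D = (\<lambda>d. g \<bullet> d)"
    using linear_functional_inner[OF has_derivative_linear[OF D]] by blast
  show "(u has_derivative (\<lambda>d. grad_on S u x \<bullet> d)) (at x within S)"
    using D grad_on_eq[OF S x D[unfolded g]] by (simp add: g)
  obtain D' where D': "(grad_on S u has_derivative D') (at x within S)"
    using C2 x unfolding C2_on_def differentiable_def by blast
  have "D' = (\<lambda>d. matrix D' *v d)"
    using matrix_works has_derivative_linear[OF D'] by (metis linear_matrix_vector_mul_eq)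
  then have M: "(grad_on S u has_derivative (\<lambda>d. matrix D' *v d)) (at x within S)"
    using D' by simp
  show "(grad_on S u has_derivative (\<lambda>d. hess_on S u x *v d)) (at x within S)"
    using M hess_on_eq[OF S x M] by simp
qed

section \<open>Approximation on an element\<close>

text \<open>Contracting the argument towards \<open>z\<close> and dividing by \<open>t\<^sup>2\<close> leaves
  the values of the Hessian unchanged, only evaluated at the contracted points. It transfers an
  estimate at interior points to points on the boundary of the element.\<close>

lemma Pk_shrink:
  assumes P0: "P 0 0 \<in> Pk n"
    and P: "\<And>i j x. i + j \<le> 1 \<Longrightarrow>
      (P i j has_derivative (\<lambda>d. d $ 1 * P (Suc i) j x + d $ 2 * P i (Suc j) x)) (at x)"
    and t: "t > 0"
  obtains p where "p \<in> Pk n"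
    "\<And>x. hess_on UNIV p x $ 1 $ 1 = P 2 0 (z + t *\<^sub>R (x - z))" "\<And>x. hess_on UNIV p x $ 1 $ 2 = P 1 1 (z + t *\<^sub>R (x - z))"
    "\<And>x. hess_on UNIV p x $ 2 $ 1 = P 1 1 (z + t *\<^sub>R (x - z))" "\<And>x. hess_on UNIV p x $ 2 $ 2 = P 0 2 (z + t *\<^sub>R (x - z))"
proof -
  define Q where "Q i j x = P i j (z + t *\<^sub>R (x - z)) * t ^ (i + j) / t\<^sup>2" for i j x
  have Q: "(Q i j has_derivative (\<lambda>d. d $ 1 * Q (Suc i) j x + d $ 2 * Q i (Suc j) x)) (at x)"
    if "i + j \<le> 1" for i j x
  proof -
    have "((\<lambda>x. P i j (z + t *\<^sub>R (x - z))) has_derivative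
      (\<lambda>d. (t *\<^sub>R d) $ 1 * P (Suc i) j (z + t *\<^sub>R (x - z)) + (t *\<^sub>R d) $ 2 * P i (Suc j) (z + t *\<^sub>R (x - z)))) (at x)"
      by (rule has_derivative_compose[OF _ P[OF that]]) (auto intro!: derivative_eq_intros)
    from has_derivative_mult_left[OF this, of "t ^ (i + j) / t\<^sup>2"] show ?thesis
      by (simp add: Q_def [abs_def] algebra_simps add_divide_distrib)
  qed
  have "(\<lambda>x. (1 / t\<^sup>2) * P 0 0 ((t *\<^sub>R mat 1) *v x + (z - t *\<^sub>R z))) \<in> Pk n"
    by (intro Pk_cmult Pk_compose_affine P0)
  moreover have "Q 0 0 x = (1 / t\<^sup>2) * P 0 0 ((t *\<^sub>R mat 1) *v x + (z - t *\<^sub>R z))" for x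
    by (simp add: Q_def scaleR_matrix_vector_assoc[symmetric] algebra_simps)
  ultimately have "Q 0 0 \<in> Pk n" by (metis (no_types, lifting) ext)
  then show ?thesis
    by (rule that) (use t in \<open>simp_all add: hess_on_UNIV_components[of Q, OF Q] Q_def power2_eq_square\<close>)
qed

text \<open>\<open>w l\<close> is the weak derivative of order \<open>n\<close> that is taken \<open>l\<close>
  times in the first variable. The directions are listed in this one order, as all rearrangements
  have the same test function derivatives.\<close>

definition has_Hm_derivs :: "pt set \<Rightarrow> nat \<Rightarrow> (pt \<Rightarrow> real) \<Rightarrow> (nat \<Rightarrow> pt \<Rightarrow> real) \<Rightarrow> bool" where
  "has_Hm_derivs \<Omega> n u w \<longleftrightarrow> (\<forall>l\<le>n. w l \<in> L2_space \<Omega> \<and>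
     weak_deriv \<Omega> (replicate l 1 @ replicate (n - l) 2) u (w l))"

definition Hm_energy :: "nat \<Rightarrow> (nat \<Rightarrow> pt \<Rightarrow> real) \<Rightarrow> pt set \<Rightarrow> real" where
  "Hm_energy n w G = (\<Sum>l\<le>n. LINT y:G|lebesgue. (w l y)\<^sup>2)"

lemma Hm_energy_nonneg: "0 \<le> Hm_energy n w G"
  unfolding Hm_energy_def set_lebesgue_integral_def
  by (intro sum_nonneg Bochner_Integration.integral_nonneg) auto

lemma sobolev_H_derivs:
  assumes "u \<in> sobolev_H \<Omega> n"
  obtains w where "has_Hm_derivs \<Omega> n u w"
proof -
  have "\<exists>w. l \<le> n \<longrightarrow> w \<in> L2_space \<Omega> \<and> weak_deriv \<Omega> (replicate l 1 @ replicate (n - l) 2) u w" for l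
    using assms unfolding sobolev_H_def by (cases "l \<le> n") (force, simp)
  then obtain w where "\<And>l. l \<le> n \<longrightarrow> w l \<in> L2_space \<Omega> \<and> weak_deriv \<Omega> (replicate l 1 @ replicate (n - l) 2) u (w l)"
    by metis
  then show ?thesis using that by (auto simp: has_Hm_derivs_def)
qed

lemma cube_in_ball:
  fixes z :: pt
  assumes r: "r > 0"
  defines "Q \<equiv> cbox (z - vec (r / 4)) (z + vec (r / 4))"
  shows "Q \<subseteq> ball z r" "measure lborel Q = (r / 2)\<^sup>2"
proof -
  show "Q \<subseteq> ball z r"
  proof
    fix x assume "x \<in> Q"
    then have "z $ 1 - r / 4 \<le> x $ 1" "x $ 1 \<le> z $ 1 + r / 4" "z $ 2 - r / 4 \<le> x $ 2" "x $ 2 \<le> z $ 2 + r / 4"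
      unfolding Q_def mem_box_cart by (auto simp: forall_2)
    then have "\<bar>(x - z) $ 1\<bar> \<le> r / 4" "\<bar>(x - z) $ 2\<bar> \<le> r / 4"
      unfolding vector_minus_component by linarith+
    then have "norm (x - z) < r" using norm_le_l1_cart[of "x - z"] r by (simp add: sum_2)
    then show "x \<in> ball z r" by (simp add: dist_norm norm_minus_commute)
  qed
  have "z - vec (r / 4) \<in> Q" using r by (simp add: Q_def mem_box_cart)
  then have "Q \<noteq> {}" by blast
  then show "measure lborel Q = (r / 2)\<^sup>2"
    unfolding Q_def by (subst content_cbox_cart) (auto simp: prod_constant power2_eq_square)
qed

text \<open>\<open>hessian_approx_interior\<close> for a set with an inscribed ball: the centres range over a
  square inside the ball, whose area is comparable to the square of the diameter, so that one
  power of the diameter in the bound is cancelled. Points on the boundary are first contracted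
  into the interior.\<close>

lemma hessian_approx_element:
  fixes u :: "pt \<Rightarrow> real"
  assumes \<Omega>: "open \<Omega>" "bounded \<Omega>" "convex \<Omega>" "\<Omega> \<noteq> {}"
    and u: "C2_on (closure \<Omega>) u" and m: "m \<ge> 1" and w: "has_Hm_derivs \<Omega> (m + 3) u w"
    and K: "compact K" "convex K" "K \<subseteq> closure \<Omega>"
    and r: "r > 0" "ball z r \<subseteq> K" "diameter K \<le> \<gamma> * r"
    and X: "finite X" "X \<subseteq> K" and \<delta>: "\<delta> > 0"
  shows "\<exists>p\<in>Pk (m + 2). \<forall>x\<in>X. \<forall>a b. \<bar>hess_on (closure \<Omega>) u x $ a $ b - hess_on UNIV p x $ a $ b\<bar> \<le>
    sqrt (2 ^ (2 * m + 4) * \<gamma>\<^sup>2 * real (m + 4) * real (card X) * Hm_energy (m + 3) w (interior K)) * diameter K ^ m + \<delta>"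
proof -
  let ?S = "closure \<Omega>" and ?d = "diameter K" and ?G = "interior K"
  let ?H = "hess_on ?S u" and ?g = "grad_on ?S u"
  have S: "convex ?S" using \<Omega>(3) by (rule convex_closure)
  have intS: "interior ?S = \<Omega>" using convex_interior_closure[OF \<Omega>(3)] \<Omega>(1) by (simp add: interior_open)
  have intS': "interior ?S \<noteq> {}" using intS \<Omega>(4) by simp
  have G\<Omega>: "?G \<subseteq> \<Omega>" using interior_mono[OF K(3)] intS by simp
  have cube: "cbox (z - vec (r / 4)) (z + vec (r / 4)) \<subseteq> ?G"
    using cube_in_ball(1)[OF r(1), of z] interior_maximal[OF r(2)] by auto
  have zG: "z \<in> ?G" using interior_maximal[OF r(2)] r(1) by auto
  have at_int: "at y within ?S = at y" if "y \<in> \<Omega>" for y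
    using intS that at_within_interior by blast
  have u1: "(u has_derivative (\<lambda>d. d $ 1 * ?g y $ 1 + d $ 2 * ?g y $ 2)) (at y)" if "y \<in> \<Omega>" for y
    using C2_on_has_grad[OF S intS' u, of y] closure_subset that
    by (auto simp: at_int inner_2 mult.commute)
  have u2: "((\<lambda>y. ?g y $ a) has_derivative (\<lambda>d. d $ 1 * ?H y $ a $ 1 + d $ 2 * ?H y $ a $ 2)) (at y)" if "y \<in> \<Omega>" for y a
    using C2_on_has_hess[OF S intS' u, of y] closure_subset that
    by (auto simp: at_int has_derivative_vec2)
  have Hc: "continuous_on ?S ?H" using u by (simp add: C2_on_def)
  have Hc': "continuous_on \<Omega> (\<lambda>x. ?H x $ a $ b)" for a b
    by (intro continuous_intros continuous_on_subset[OF Hc] closure_subset)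
  have uc: "continuous_on ?S u"
    by (rule has_derivative_continuous_on) (rule C2_on_has_grad[OF S intS' u])
  \<comment> \<open>Contracting towards \<open>z\<close> moves the points of \<open>K\<close> into the interior.\<close>
  have sh: "z + t *\<^sub>R (x - z) \<in> ?G" if "x \<in> K" "0 \<le> t" "t < 1" for x t
    using mem_interior_convex_shrink[OF K(2) zG that(1), of "1 - t"] that by (simp add: algebra_simps)
  have "\<forall>\<^sub>F t in at_left 1. \<forall>x\<in>X. norm (?H (z + t *\<^sub>R (x - z)) - ?H x) < \<delta> / 2"
  proof (intro eventually_ball_finite X(1) ballI)
    fix x assume x: "x \<in> X"
    then have xK: "x \<in> K" using X by auto
    have "((\<lambda>t. z + t *\<^sub>R (x - z)) \<longlongrightarrow> z + 1 *\<^sub>R (x - z)) (at_left 1)"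
      by (intro tendsto_intros)
    moreover have "\<forall>\<^sub>F t in at_left (1::real). z + t *\<^sub>R (x - z) \<in> ?S"
    proof -
      have "\<forall>\<^sub>F t in at_left (1::real). 0 < t \<and> t < 1"
        using eventually_at_left_field[of "\<lambda>t. 0 < t \<and> t < 1" "1::real"] by (auto intro: exI[of _ 0])
      then show ?thesis
        by eventually_elim (use sh[OF xK] K(3) interior_subset in force)
    qed
    ultimately have "((\<lambda>t. ?H (z + t *\<^sub>R (x - z))) \<longlongrightarrow> ?H x) (at_left 1)"
      using continuous_on_tendsto_compose[OF Hc, of "\<lambda>t. z + t *\<^sub>R (x - z)" x] xK K(3) by auto
    from tendstoD[OF this, of "\<delta> / 2"] \<delta>
    show "\<forall>\<^sub>F t in at_left 1. norm (?H (z + t *\<^sub>R (x - z)) - ?H x) < \<delta> / 2"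
      by (simp add: dist_norm)
  qed
  moreover have "\<forall>\<^sub>F t in at_left (1::real). 0 < t \<and> t < 1"
    using eventually_at_left_field[of "\<lambda>t. 0 < t \<and> t < 1" "1::real"] by (auto intro: exI[of _ 0])
  ultimately have "\<forall>\<^sub>F t in at_left 1. 0 < t \<and> t < 1 \<and> (\<forall>x\<in>X. norm (?H (z + t *\<^sub>R (x - z)) - ?H x) < \<delta> / 2)"
    by eventually_elim blast
  from eventually_happens[OF this] obtain t where t: "0 < t" "t < 1"
    and close: "\<And>x. x \<in> X \<Longrightarrow> norm (?H (z + t *\<^sub>R (x - z)) - ?H x) < \<delta> / 2"
    by (auto simp: trivial_limit_at_left_real)
  let ?X = "(\<lambda>x. z + t *\<^sub>R (x - z)) ` X"
  have X': "finite ?X" "?X \<subseteq> ?G" using X sh t by auto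
  have nd: "norm (x - y) \<le> ?d" if "x \<in> ?G" "y \<in> ?G" for x y
    using diameter_bounded_bound[OF compact_imp_bounded[OF K(1)], of x y] that interior_subset[of K]
    by (auto simp: dist_norm)
  define Q where "Q = cbox (z - vec (r / 4)) (z + vec (r / 4))"
  have Q: "measure lborel Q = (r / 2)\<^sup>2" "measure lborel Q > 0"
    unfolding Q_def using cube_in_ball(2)[OF r(1), of z] r(1) by simp_all
  define E where "E = (2 * ?d) ^ (2 * Suc m) * (real (card ?X) *
      (real (m + 4) * Hm_energy (m + 3) w ?G) / measure lborel Q)"
  have w': "w l \<in> L2_space \<Omega>" "weak_deriv \<Omega> (replicate l 1 @ replicate (m + 3 - l) 2) u (w l)"
    if "l \<le> m + 3" for l
    using w that by (auto simp: has_Hm_derivs_def)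
  obtain P :: "nat \<Rightarrow> nat \<Rightarrow> pt \<Rightarrow> real" where P0: "P 0 0 \<in> Pk (m + 2)"
    and P: "\<And>i j x. i + j \<le> 1 \<Longrightarrow> (P i j has_derivative (\<lambda>d. d $ 1 * P (Suc i) j x + d $ 2 * P i (Suc j) x)) (at x)"
    and PX: "\<And>x. x \<in> ?X \<Longrightarrow> \<bar>?H x $ 1 $ 1 - P 2 0 x\<bar> \<le> sqrt E + \<delta> / 2 \<and> \<bar>?H x $ 1 $ 2 - P 1 1 x\<bar> \<le> sqrt E + \<delta> / 2 \<and>
            \<bar>?H x $ 2 $ 1 - P 1 1 x\<bar> \<le> sqrt E + \<delta> / 2 \<and> \<bar>?H x $ 2 $ 2 - P 0 2 x\<bar> \<le> sqrt E + \<delta> / 2"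
    using hessian_approx_interior[OF \<Omega>(1,2) uc u1 u2[of _ 1] u2[of _ 2] Hc' Hc' Hc' Hc' m w'
      open_interior convex_interior[OF K(2)] G\<Omega> X' cube Q(2)[unfolded Q_def] nd half_gt_zero[OF \<delta>]]
    unfolding E_def Q_def Hm_energy_def by blast
  obtain p where p: "p \<in> Pk (m + 2)"
    "\<And>x. hess_on UNIV p x $ 1 $ 1 = P 2 0 (z + t *\<^sub>R (x - z))" "\<And>x. hess_on UNIV p x $ 1 $ 2 = P 1 1 (z + t *\<^sub>R (x - z))"
    "\<And>x. hess_on UNIV p x $ 2 $ 1 = P 1 1 (z + t *\<^sub>R (x - z))" "\<And>x. hess_on UNIV p x $ 2 $ 2 = P 0 2 (z + t *\<^sub>R (x - z))"
    using Pk_shrink[of P, OF P0 P t(1), where z = z] by blast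
  have d0: "0 \<le> ?d" by (rule diameter_ge_0) (rule compact_imp_bounded[OF K(1)])
  have "E \<le> 2 ^ (2 * m + 4) * \<gamma>\<^sup>2 * real (m + 4) * real (card X) * Hm_energy (m + 3) w ?G * (?d ^ m)\<^sup>2"
  proof -
    let ?A = "real (m + 4) * Hm_energy (m + 3) w ?G"
    have A: "0 \<le> ?A" using Hm_energy_nonneg by simp
    have c: "real (card ?X) \<le> real (card X)" using card_image_le[OF X(1)] by simp
    have "?d / r \<le> \<gamma>" using r by (simp add: divide_le_eq)
    then have dr: "(?d / r)\<^sup>2 \<le> \<gamma>\<^sup>2" using d0 r(1) by (intro power_mono) auto
    have "E = 2 ^ (2 * m + 4) * (?d ^ m)\<^sup>2 * (?d / r)\<^sup>2 * (real (card ?X) * ?A)"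
      unfolding E_def Q(1) by (simp add: power_mult_distrib power_add power_mult power2_eq_square field_simps)
    also have "\<dots> \<le> 2 ^ (2 * m + 4) * (?d ^ m)\<^sup>2 * \<gamma>\<^sup>2 * (real (card X) * ?A)"
      using dr c A Hm_energy_nonneg[of "m + 3" w ?G] by (intro mult_mono) auto
    finally show ?thesis by (simp add: ac_simps)
  qed
  from real_sqrt_le_mono[OF this]
  have sE: "sqrt E \<le> sqrt (2 ^ (2 * m + 4) * \<gamma>\<^sup>2 * real (m + 4) * real (card X) * Hm_energy (m + 3) w ?G) * ?d ^ m"
    using d0 by (simp add: real_sqrt_mult)
  show ?thesis
  proof (intro bexI[OF _ p(1)] ballI allI)
    fix x a b assume x: "x \<in> X"
    let ?y = "z + t *\<^sub>R (x - z)"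
    have "\<bar>?H ?y $ a $ b - hess_on UNIV p x $ a $ b\<bar> \<le> sqrt E + \<delta> / 2"
      using PX[of ?y, OF imageI[OF x]] exhaust_2[of a] exhaust_2[of b] by (auto simp only: p)
    moreover have "\<bar>?H ?y $ a $ b - ?H x $ a $ b\<bar> \<le> \<delta> / 2"
    proof -
      have "\<bar>(?H ?y - ?H x) $ a $ b\<bar> \<le> norm ((?H ?y - ?H x) $ a)" by (rule component_le_norm_cart)
      also have "\<dots> \<le> norm (?H ?y - ?H x)" by (rule Finite_Cartesian_Product.norm_nth_le)
      finally show ?thesis using close[OF x] by simp
    qed
    ultimately show "\<bar>?H x $ a $ b - hess_on UNIV p x $ a $ b\<bar> \<le>
      sqrt (2 ^ (2 * m + 4) * \<gamma>\<^sup>2 * real (m + 4) * real (card X) * Hm_energy (m + 3) w ?G) * ?d ^ m + \<delta>"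
      using sE by linarith
  qed
qed

section \<open>Elements, nodes and nodal interpolation\<close>

lemma frob_eq_inner: "frob A B = A \<bullet> B"
  by (simp add: frob_def trace_def matrix_matrix_mult_def transpose_def sum_2 inner_vec_def)

lemma norm_mat_le:
  fixes A :: mat
  assumes "\<And>a b. \<bar>A $ a $ b\<bar> \<le> M"
  shows "norm A \<le> 4 * M"
proof -
  have "norm A \<le> norm (A $ 1) + norm (A $ 2)"
    using norm_le_l1_cart[of "\<chi> i. norm (A $ i)"] norm_le_componentwise_cart[of A "\<chi> i. norm (A $ i)"]
    by (simp add: sum_2)
  also have "\<dots> \<le> (\<bar>A $ 1 $ 1\<bar> + \<bar>A $ 1 $ 2\<bar>) + (\<bar>A $ 2 $ 1\<bar> + \<bar>A $ 2 $ 2\<bar>)"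
    using norm_le_l1_cart[of "A $ 1"] norm_le_l1_cart[of "A $ 2"] by (simp add: sum_2)
  also have "\<dots> \<le> (M + M) + (M + M)" by (intro add_mono assms)
  finally show ?thesis by simp
qed

lemma onorm_mat_le:
  fixes A :: mat
  assumes "\<And>a b. \<bar>A $ a $ b\<bar> \<le> M"
  shows "onorm ((*v) A) \<le> 4 * M"
proof -
  have "onorm ((*v) A) \<le> (\<bar>A $ 1 $ 1\<bar> + \<bar>A $ 1 $ 2\<bar>) + (\<bar>A $ 2 $ 1\<bar> + \<bar>A $ 2 $ 2\<bar>)"
    using onorm_le_matrix_component_sum[of A] by (simp add: sum_2)
  also have "\<dots> \<le> (M + M) + (M + M)" by (intro add_mono assms)
  finally show ?thesis by simp
qed

lemma entry_le_norm: "\<bar>(A::mat) $ a $ b\<bar> \<le> norm A"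
  using component_le_norm_cart[of "A $ a" b] Finite_Cartesian_Product.norm_nth_le[of A a] by linarith

lemma interior_closure_domain:
  assumes "convex_polygonal_domain \<Omega>"
  shows "interior (closure \<Omega>) = \<Omega>"
  using assms convex_interior_closure[of \<Omega>] by (simp add: convex_polygonal_domain_def interior_open)

lemma domain_bounded: "convex_polygonal_domain \<Omega> \<Longrightarrow> bounded \<Omega>"
  unfolding convex_polygonal_domain_def using polytope_imp_bounded bounded_subset closure_subset by blast

lemma elems_finite: "mesh_of \<Omega> D \<Longrightarrow> finite (elems D)"
  by (simp add: mesh_of_def triangulation_def)

lemma
  assumes "mesh_of \<Omega> D" "K \<in> elems D"
  shows elem_simplex: "2 simplex K" and elem_compact: "compact K" and elem_convex: "convex K"
    and elem_interior: "interior K \<noteq> {}" and elem_subset: "K \<subseteq> closure \<Omega>"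
proof -
  show s: "2 simplex K" and "K \<subseteq> closure \<Omega>" using assms by (auto simp: mesh_of_def)
  then show "compact K" and c: "convex K" by (auto intro: compact_simplex convex_simplex)
  have "aff_dim K = 2" using s by (rule aff_dim_simplex)
  then have "affine hull K = UNIV" "K \<noteq> {}" using aff_dim_eq_full[of K] by auto
  then show "interior K \<noteq> {}"
    using rel_interior_eq_empty[OF c] rel_interior_interior[of K] by simp
qed

lemma elem_diameter_pos:
  assumes "mesh_of \<Omega> D" "K \<in> elems D"
  shows "0 < diameter K"
proof -
  obtain c e where e: "e > 0" "ball c e \<subseteq> K"
    using elem_interior[OF assms] by (meson all_not_in_conv mem_interior)
  have "diameter (ball c e) \<le> diameter K"
    by (rule diameter_subset[OF e(2) compact_imp_bounded[OF elem_compact[OF assms]]])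
  then show ?thesis using e(1) by simp
qed

lemma elem_diameter_le: "mesh_of \<Omega> D \<Longrightarrow> K \<in> elems D \<Longrightarrow> diameter K \<le> mesh_size D"
  unfolding mesh_size_def by (intro Max_ge) (auto dest: elems_finite)

lemma mesh_size_pos:
  assumes "convex_polygonal_domain \<Omega>" "mesh_of \<Omega> D"
  shows "0 < mesh_size D"
proof -
  have "\<Union>(elems D) \<noteq> {}" using assms by (auto simp: mesh_of_def convex_polygonal_domain_def)
  then obtain K where "K \<in> elems D" by auto
  with elem_diameter_pos elem_diameter_le assms(2) show ?thesis by force
qed

lemma elem_interiors_disjoint:
  assumes "mesh_of \<Omega> D" "K \<in> elems D" "K' \<in> elems D" "K \<noteq> K'"
  shows "interior K \<inter> interior K' = {}"
proof (rule ccontr)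
  assume ne: "interior K \<inter> interior K' \<noteq> {}"
  have tri: "T \<inter> T' face_of T" if "T \<in> elems D" "T' \<in> elems D" for T T'
    using assms(1) that by (simp add: mesh_of_def triangulation_def)
  have f: "(K \<inter> K') face_of K" "(K \<inter> K') face_of K'"
    using tri[OF assms(2,3)] tri[OF assms(3,2)] by (simp_all add: Int_commute)
  have "K \<inter> K' = K" "K \<inter> K' = K'"
    using face_of_disjoint_interior[OF f(1)] face_of_disjoint_interior[OF f(2)] ne interior_subset by blast+
  with assms(4) show False by simp
qed

lemma elem_interior_subset:
  assumes "convex_polygonal_domain \<Omega>" "mesh_of \<Omega> D" "K \<in> elems D"
  shows "interior K \<subseteq> \<Omega>"
  using interior_mono[OF elem_subset[OF assms(2,3)]] interior_closure_domain[OF assms(1)] by simp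

lemma elem_refmap:
  assumes "mesh_of \<Omega> D" "K \<in> elems D"
  obtains B b B' where "\<And>x. refmap D K x = B *v x + b" "B ** B' = mat 1" "B' ** B = mat 1"
proof -
  obtain B b where F: "\<And>x. refmap D K x = B *v x + b" and im: "refmap D K ` ref_triangle = K"
    using assms by (auto simp: mesh_of_def)
  obtain c e where e: "e > 0" "ball c e \<subseteq> K"
    using elem_interior[OF assms] by (meson all_not_in_conv mem_interior)
  have "surj ((*v) B)"
    unfolding surj_def
  proof
    fix y :: pt
    define r where "r = e / (2 * (norm y + 1))"
    have r: "r > 0" using e(1) by (simp add: r_def add_nonneg_pos)
    have "norm (r *\<^sub>R y) = e * (norm y / (2 * (norm y + 1)))" using e(1) by (simp add: r_def)
    also have "\<dots> < e * 1" using e(1) by (intro mult_strict_left_mono) (auto simp: divide_less_eq add_nonneg_pos)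
    finally have "c \<in> K" "c + r *\<^sub>R y \<in> K" using e by (auto simp: subset_iff dist_norm)
    then have "c \<in> refmap D K ` ref_triangle" "c + r *\<^sub>R y \<in> refmap D K ` ref_triangle"
      by (simp_all only: im)
    then obtain x0 x1 where "c = B *v x0 + b" "c + r *\<^sub>R y = B *v x1 + b"
      unfolding F by blast
    then have "r *\<^sub>R y = B *v (x1 - x0)" by (simp add: matrix_vector_mult_diff_distrib algebra_simps)
    then have "B *v ((1 / r) *\<^sub>R (x1 - x0)) = (1 / r) *\<^sub>R (r *\<^sub>R y)"
      by (simp only: matrix_vector_mult_scaleR)
    then have "y = B *v ((1 / r) *\<^sub>R (x1 - x0))"
      using r by simp
    then show "\<exists>x. y = B *v x" by blast
  qed
  then obtain B' where "B ** B' = mat 1" using matrix_right_invertible_surjective by blast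
  moreover from this have "B' ** B = mat 1" using matrix_left_right_inverse by blast
  ultimately show ?thesis using that F by blast
qed

lemma node_mem:
  assumes "mesh_of \<Omega> D" "K \<in> elems D" "unisolvent m \<xi>" "j < n_nodes m"
  shows "node \<xi> D K j \<in> K"
proof -
  have "refmap D K ` ref_triangle = K" "\<xi> j \<in> ref_triangle"
    using assms by (simp_all add: mesh_of_def unisolvent_def)
  then show ?thesis by (auto simp: node_def)
qed

lemma Pk_compose_refmap:
  assumes "mesh_of \<Omega> D" "K \<in> elems D" "p \<in> Pk m"
  shows "(\<lambda>x. p (refmap D K x)) \<in> Pk m"
proof -
  obtain B b B' where "\<And>x. refmap D K x = B *v x + b"
    using elem_refmap[OF assms(1,2)] by blast
  then show ?thesis using Pk_compose_affine[OF assms(3), of B b] by simp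
qed

lemma Pk_nodes_unisolvent:
  assumes D: "mesh_of \<Omega> D" "K \<in> elems D" and \<xi>: "unisolvent m \<xi>"
  shows "\<exists>!p. p \<in> Pk m \<and> (\<forall>j<n_nodes m. p (node \<xi> D K j) = y j)"
proof -
  obtain B b B' where F: "\<And>x. refmap D K x = B *v x + b" and B: "B ** B' = mat 1" "B' ** B = mat 1"
    using elem_refmap[OF D] by blast
  define F' where "F' x = B' *v x + - (B' *v b)" for x
  have FF': "refmap D K (F' x) = x" for x
    using B by (simp add: F F'_def matrix_vector_right_distrib matrix_vector_mul_assoc matrix_vector_mult_diff_distrib)
  have F'F: "F' (refmap D K x) = x" for x
    using B by (simp add: F F'_def matrix_vector_right_distrib matrix_vector_mul_assoc)
  obtain q where q: "q \<in> Pk m" "\<And>j. j < n_nodes m \<Longrightarrow> q (\<xi> j) = y j"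
    and uni: "\<And>q'. q' \<in> Pk m \<Longrightarrow> (\<forall>j<n_nodes m. q' (\<xi> j) = y j) \<Longrightarrow> q' = q"
    using \<xi> unfolding unisolvent_def by metis
  show ?thesis
  proof (rule ex1I[of _ "\<lambda>x. q (F' x)"])
    show "(\<lambda>x. q (F' x)) \<in> Pk m \<and> (\<forall>j<n_nodes m. q (F' (node \<xi> D K j)) = y j)"
      using Pk_compose_affine[OF q(1), of B' "- (B' *v b)"] q(2) by (simp add: node_def F'F) (simp add: F'_def)
  next
    fix p assume p: "p \<in> Pk m \<and> (\<forall>j<n_nodes m. p (node \<xi> D K j) = y j)"
    then have "(\<lambda>x. p (refmap D K x)) = q"
      using Pk_compose_refmap[OF D] by (intro uni) (auto simp: node_def)
    then show "p = (\<lambda>x. q (F' x))" using FF' by (metis ext)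
  qed
qed

lemma Pk_eq_nodes:
  assumes "mesh_of \<Omega> D" "K \<in> elems D" "unisolvent m \<xi>" "p \<in> Pk m" "q \<in> Pk m"
    "\<And>j. j < n_nodes m \<Longrightarrow> p (node \<xi> D K j) = q (node \<xi> D K j)"
  shows "p = q"
  using Pk_nodes_unisolvent[OF assms(1-3), of "\<lambda>j. q (node \<xi> D K j)"] assms(4-6) by blast

lemma
  assumes "mesh_of \<Omega> D" "K \<in> elems D" "unisolvent m \<xi>"
  shows interp_Pk: "interp m \<xi> D g K \<in> Pk m"
    and interp_node: "j < n_nodes m \<Longrightarrow> interp m \<xi> D g K (node \<xi> D K j) = g (node \<xi> D K j)"
  using theI'[OF Pk_nodes_unisolvent[OF assms, of "\<lambda>j. g (node \<xi> D K j)"]] assms(2)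
  by (auto simp: interp_def)

lemma interp_mat_node:
  assumes "mesh_of \<Omega> D" "K \<in> elems D" "unisolvent m \<xi>" "j < n_nodes m"
  shows "interp_mat m \<xi> D G K (node \<xi> D K j) = G (node \<xi> D K j)"
  by (simp add: vec_eq_iff interp_mat_def interp_node[OF assms])

text \<open>\<open>\<Lambda>\<close> bounds the Lebesgue constant of the reference nodes. Bounding it below by
  \<open>1\<close> simplifies later sums of constants.\<close>

definition nodal_bound :: "nat \<Rightarrow> (nat \<Rightarrow> pt) \<Rightarrow> real \<Rightarrow> bool" where
  "nodal_bound m \<xi> \<Lambda> \<longleftrightarrow> 1 \<le> \<Lambda> \<and> (\<forall>p\<in>Pk m. \<forall>M. (\<forall>j<n_nodes m. \<bar>p (\<xi> j)\<bar> \<le> M) \<longrightarrow>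
     (\<forall>x\<in>ref_triangle. \<bar>p x\<bar> \<le> \<Lambda> * M))"

lemma n_nodes_pos: "0 < n_nodes m"
  by (simp add: n_nodes_def)

text \<open>The Lagrange basis is bounded on the compact reference triangle.\<close>

lemma nodal_bound_exists:
  assumes \<xi>: "unisolvent m \<xi>"
  obtains \<Lambda> where "nodal_bound m \<xi> \<Lambda>"
proof -
  define N where "N = n_nodes m"
  have "\<exists>l. l \<in> Pk m \<and> (\<forall>j<N. l (\<xi> j) = (if j = i then 1 else 0))" for i
    using \<xi>[unfolded unisolvent_def, THEN conjunct2, rule_format, of "\<lambda>j. if j = i then 1 else 0"]
    unfolding N_def by blast
  then obtain l where l: "\<And>i. l i \<in> Pk m" "\<And>i j. j < N \<Longrightarrow> l i (\<xi> j) = (if j = i then 1 else 0)"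
    by metis
  have "compact ref_triangle"
    unfolding ref_triangle_def by (intro compact_convex_hull finite_imp_compact) auto
  then have "bounded ((\<lambda>x. \<Sum>i<N. \<bar>l i x\<bar>) ` ref_triangle)"
    by (intro compact_imp_bounded compact_continuous_image continuous_intros Pk_continuous[OF l(1)])
  then obtain C where C: "\<And>x. x \<in> ref_triangle \<Longrightarrow> (\<Sum>i<N. \<bar>l i x\<bar>) \<le> C"
    by (force simp: bounded_iff)
  show ?thesis
  proof (rule that[of "max 1 C"], unfold nodal_bound_def, intro conjI ballI allI impI)
    fix p M x assume p: "p \<in> Pk m" and M: "\<forall>j<n_nodes m. \<bar>p (\<xi> j)\<bar> \<le> M" and x: "x \<in> ref_triangle"
    have M0: "0 \<le> M" using M n_nodes_pos[of m] abs_ge_zero order_trans by blast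
    define q where "q x = (\<Sum>i<N. p (\<xi> i) * l i x)" for x
    have "q \<in> Pk m" unfolding q_def [abs_def] by (intro Pk_sum Pk_cmult l(1))
    moreover have "q (\<xi> j) = p (\<xi> j)" if "j < N" for j
      using that by (simp add: q_def l(2) if_distrib cong: if_cong)
    moreover have "\<exists>!r. r \<in> Pk m \<and> (\<forall>j<n_nodes m. r (\<xi> j) = p (\<xi> j))"
      using \<xi> by (simp add: unisolvent_def)
    ultimately have "p = q" using p unfolding N_def by blast
    then have "\<bar>p x\<bar> \<le> (\<Sum>i<N. \<bar>p (\<xi> i) * l i x\<bar>)" by (metis q_def sum_abs)
    also have "\<dots> \<le> (\<Sum>i<N. M * \<bar>l i x\<bar>)"
      using M by (intro sum_mono) (auto simp: abs_mult N_def intro!: mult_right_mono)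
    also have "\<dots> = M * (\<Sum>i<N. \<bar>l i x\<bar>)" by (simp add: sum_distrib_left)
    also have "\<dots> \<le> M * max 1 C" using C[OF x] M0 by (intro mult_left_mono) auto
    finally show "\<bar>p x\<bar> \<le> max 1 C * M" by (simp add: mult.commute)
  qed auto
qed

text \<open>The affine reference map preserves polynomial degree and maps nodes to nodes, so the reference
  constant holds on every element.\<close>

lemma nodal_bound_elem:
  assumes "nodal_bound m \<xi> \<Lambda>" "mesh_of \<Omega> D" "K \<in> elems D" "p \<in> Pk m"
    and "\<And>j. j < n_nodes m \<Longrightarrow> \<bar>p (node \<xi> D K j)\<bar> \<le> M" "x \<in> K"
  shows "\<bar>p x\<bar> \<le> \<Lambda> * M"
proof -
  have "refmap D K ` ref_triangle = K" using assms(2,3) by (simp add: mesh_of_def)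
  then obtain y where y: "y \<in> ref_triangle" "x = refmap D K y" using assms(6) by auto
  have "\<bar>p (refmap D K y)\<bar> \<le> \<Lambda> * M"
    using assms(1)[unfolded nodal_bound_def, THEN conjunct2, rule_format, OF Pk_compose_refmap[OF assms(2,3,4)], of M y]
      assms(5) y(1) by (simp add: node_def)
  then show ?thesis using y by simp
qed

section \<open>Broken polynomials approximating the solution\<close>

text \<open>For each \<open>x\<close> in the element there is a polynomial that is good at \<open>x\<close>
  and at all nodes. At the nodes its Hessian is close to the interpolant \<open>P_hat\<close>,
  hence it is close everywhere by \<open>nodal_bound_elem\<close>; so \<open>P_hat\<close> is
  close to the Hessian of \<open>u\<close> at \<open>x\<close>. Now one polynomial that is good at
  the nodes only is close to \<open>P_hat\<close>, and therefore to the Hessian of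
  \<open>u\<close>, on the whole element. After correcting it by an affine function, the mean
  value inequality gives the gradient and the values.\<close>

lemma element_approx:
  assumes \<Omega>: "convex_polygonal_domain \<Omega>" and D: "mesh_of \<Omega> D" "K \<in> elems D"
    and u: "C2_on (closure \<Omega>) u" and m: "m \<ge> 1" and w: "has_Hm_derivs \<Omega> (m + 3) u w"
    and r: "r > 0" "ball z r \<subseteq> K" "diameter K \<le> \<gamma> * r"
    and \<xi>: "unisolvent m \<xi>" "nodal_bound m \<xi> \<Lambda>" and \<delta>: "\<delta> > 0"
  defines "e \<equiv> 4 * (2 * \<Lambda> + 1) * (sqrt (2 ^ (2 * m + 4) * \<gamma>\<^sup>2 * real (m + 4) * real (n_nodes m + 1) *
      Hm_energy (m + 3) w (interior K)) * diameter K ^ m + \<delta>)"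
  shows "\<exists>p\<in>Pk (m + 2). \<forall>x\<in>K.
    norm (hess_on (closure \<Omega>) u x - hess_on UNIV p x) \<le> e \<and>
    norm (P_hat \<Omega> m \<xi> u D K x - hess_on (closure \<Omega>) u x) \<le> e \<and>
    norm (grad_on (closure \<Omega>) u x - grad_on UNIV p x) \<le> e * diameter K \<and>
    \<bar>u x - p x\<bar> \<le> e * (diameter K)\<^sup>2"
proof -
  let ?S = "closure \<Omega>" and ?d = "diameter K"
  let ?H = "hess_on ?S u"
  define \<epsilon> where "\<epsilon> = sqrt (2 ^ (2 * m + 4) * \<gamma>\<^sup>2 * real (m + 4) * real (n_nodes m + 1) *
      Hm_energy (m + 3) w (interior K)) * ?d ^ m + \<delta>"
  have \<Lambda>: "\<Lambda> \<ge> 1" using \<xi>(2) by (simp add: nodal_bound_def)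
  have d0: "0 < ?d" by (rule elem_diameter_pos[OF D])
  have \<epsilon>0: "\<epsilon> > 0" unfolding \<epsilon>_def using \<delta> d0 Hm_energy_nonneg
    by (intro add_nonneg_pos mult_nonneg_nonneg) auto
  have \<Omega>': "open \<Omega>" "bounded \<Omega>" "convex \<Omega>" "\<Omega> \<noteq> {}"
    using \<Omega> domain_bounded by (auto simp: convex_polygonal_domain_def)
  have S: "convex ?S" "interior ?S \<noteq> {}"
    using \<Omega>' convex_closure interior_closure_domain[OF \<Omega>] by auto
  note K = elem_compact[OF D] elem_convex[OF D] elem_subset[OF D]
  let ?N = "node \<xi> D K ` {..<n_nodes m}"
  have N: "?N \<subseteq> K" using node_mem[OF D \<xi>(1)] by auto
  have ex: "\<exists>p\<in>Pk (m + 2). \<forall>y\<in>insert x ?N. \<forall>a b. \<bar>?H y $ a $ b - hess_on UNIV p y $ a $ b\<bar> \<le> \<epsilon>" if x: "x \<in> K" for x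
  proof -
    have fin: "finite (insert x ?N)" and sub: "insert x ?N \<subseteq> K" using N x by auto
    obtain p where p: "p \<in> Pk (m + 2)"
      "\<And>y a b. y \<in> insert x ?N \<Longrightarrow> \<bar>?H y $ a $ b - hess_on UNIV p y $ a $ b\<bar> \<le>
        sqrt (2 ^ (2 * m + 4) * \<gamma>\<^sup>2 * real (m + 4) * real (card (insert x ?N)) * Hm_energy (m + 3) w (interior K)) * ?d ^ m + \<delta>"
      using hessian_approx_element[OF \<Omega>' u m w K r fin sub \<delta>] by blast
    have "card (insert x ?N) \<le> Suc (card ?N)" by (rule card_insert_le_m1) auto
    also have "\<dots> \<le> n_nodes m + 1" using card_image_le[of "{..<n_nodes m}" "node \<xi> D K"] by simp
    finally have c: "real (card (insert x ?N)) \<le> real (n_nodes m + 1)" by simp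
    have "sqrt (2 ^ (2 * m + 4) * \<gamma>\<^sup>2 * real (m + 4) * real (card (insert x ?N)) * Hm_energy (m + 3) w (interior K)) * ?d ^ m + \<delta> \<le> \<epsilon>"
      unfolding \<epsilon>_def using d0 Hm_energy_nonneg[of "m + 3" w "interior K"]
      by (intro add_right_mono mult_right_mono real_sqrt_le_mono mult_left_mono c) auto
    with p show ?thesis using order_trans by blast
  qed
  have hPk: "(\<lambda>x. hess_on UNIV p x $ a $ b) \<in> Pk m" if "p \<in> Pk (m + 2)" for p a b
    using Pk_hess[OF that, of a b] by simp
  let ?P = "\<lambda>a b x. P_hat \<Omega> m \<xi> u D K x $ a $ b"
  have PPk: "?P a b \<in> Pk m" for a b
    using interp_Pk[OF D \<xi>(1)] by (simp add: P_hat_def interp_mat_def)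
  have Pn: "?P a b (node \<xi> D K j) = ?H (node \<xi> D K j) $ a $ b" if "j < n_nodes m" for a b j
    using interp_mat_node[OF D \<xi>(1) that] by (simp add: P_hat_def)
  have near: "\<bar>?P a b x - hess_on UNIV p x $ a $ b\<bar> \<le> \<Lambda> * \<epsilon>"
    if p: "p \<in> Pk (m + 2)" "\<And>y a b. y \<in> ?N \<Longrightarrow> \<bar>?H y $ a $ b - hess_on UNIV p y $ a $ b\<bar> \<le> \<epsilon>" and x: "x \<in> K"
    for p a b x
    by (rule nodal_bound_elem[OF \<xi>(2) D Pk_diff[OF PPk hPk[OF p(1)]] _ x]) (use p(2) Pn in auto)
  have PH: "\<bar>?P a b x - ?H x $ a $ b\<bar> \<le> \<Lambda> * \<epsilon> + \<epsilon>" if x: "x \<in> K" for x a b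
  proof -
    obtain p where p: "p \<in> Pk (m + 2)"
      "\<And>y a b. y \<in> insert x ?N \<Longrightarrow> \<bar>?H y $ a $ b - hess_on UNIV p y $ a $ b\<bar> \<le> \<epsilon>"
      using ex[OF x] by blast
    have "\<bar>?P a b x - hess_on UNIV p x $ a $ b\<bar> \<le> \<Lambda> * \<epsilon>" by (rule near[OF p(1) _ x]) (use p(2) in auto)
    moreover have "\<bar>?H x $ a $ b - hess_on UNIV p x $ a $ b\<bar> \<le> \<epsilon>" using p(2) by auto
    ultimately show ?thesis by linarith
  qed
  have zK: "z \<in> K" using r by auto
  obtain p0 where p0: "p0 \<in> Pk (m + 2)"
      "\<And>y a b. y \<in> insert z ?N \<Longrightarrow> \<bar>?H y $ a $ b - hess_on UNIV p0 y $ a $ b\<bar> \<le> \<epsilon>"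
    using ex[OF zK] by blast
  have H0: "\<bar>?H x $ a $ b - hess_on UNIV p0 x $ a $ b\<bar> \<le> (2 * \<Lambda> + 1) * \<epsilon>" if x: "x \<in> K" for x a b
  proof -
    have "\<bar>?P a b x - hess_on UNIV p0 x $ a $ b\<bar> \<le> \<Lambda> * \<epsilon>" by (rule near[OF p0(1) _ x]) (use p0(2) in auto)
    moreover have "(2 * \<Lambda> + 1) * \<epsilon> = \<Lambda> * \<epsilon> + (\<Lambda> * \<epsilon> + \<epsilon>)" by (simp add: algebra_simps)
    ultimately show ?thesis using PH[OF x, of a b] by linarith
  qed
  \<comment> \<open>The affine correction makes the error and its gradient vanish at \<open>z\<close> and
    leaves the Hessian alone.\<close>
  define g0 where "g0 = grad_on ?S u z - grad_on UNIV p0 z"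
  define c0 where "c0 = u z - p0 z"
  define p where "p x = p0 x + (g0 \<bullet> (x - z) + c0)" for x
  have aff: "(\<lambda>x. g0 \<bullet> (x - z) + c0) \<in> Pk (m + 2)"
    using Pk_mono[OF Pk_times_affine[OF Pk_const[of 1 0], of "g0 $ 1" "g0 $ 2" "c0 - g0 \<bullet> z"], of "m + 2"]
    by (simp add: inner_2 algebra_simps)
  have p: "p \<in> Pk (m + 2)" unfolding p_def [abs_def] by (intro Pk_add p0 aff)
  have pd: "(p has_derivative (\<lambda>d. (grad_on UNIV p0 x + g0) \<bullet> d)) (at x)" for x
    unfolding p_def [abs_def]
    by (rule has_derivative_eq_rhs, rule has_derivative_add[OF Pk_has_grad[OF p0(1)]],
        rule has_derivative_add[OF has_derivative_inner_right has_derivative_const])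
      (auto intro!: derivative_eq_intros simp: inner_add_left)
  have gp: "grad_on UNIV p = (\<lambda>x. grad_on UNIV p0 x + g0)"
    using grad_on_eq[OF convex_UNIV _ UNIV_I pd] by auto
  have "(grad_on UNIV p has_derivative (\<lambda>d. hess_on UNIV p0 x *v d)) (at x)" for x
    unfolding gp by (rule has_derivative_eq_rhs, rule has_derivative_add[OF Pk_has_hess[OF p0(1)] has_derivative_const]) simp
  then have hp: "hess_on UNIV p x = hess_on UNIV p0 x" for x
    by (intro hess_on_eq) auto
  have eE: "e = 4 * ((2 * \<Lambda> + 1) * \<epsilon>)" by (simp add: e_def \<epsilon>_def)
  have e0: "0 \<le> e" using eE \<epsilon>0 \<Lambda> by simp
  have xz: "norm (x - z) \<le> ?d" if "x \<in> K" for x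
    using diameter_bounded_bound[OF compact_imp_bounded[OF K(1)] that zK] by (simp add: dist_norm)
  let ?v = "\<lambda>x. u x - p x" and ?g = "\<lambda>x. grad_on ?S u x - grad_on UNIV p x"
  have v1: "(?v has_derivative (\<lambda>d. ?g x \<bullet> d)) (at x within K)" if "x \<in> K" for x
  proof -
    have "x \<in> ?S" using that K by auto
    from has_derivative_subset[OF C2_on_has_grad[OF S u this] K(3)] has_derivative_at_withinI[OF Pk_has_grad[OF p], of x K]
    show ?thesis by (rule has_derivative_eq_rhs[OF has_derivative_diff]) (simp add: inner_diff_left)
  qed
  have v2: "(?g has_derivative (*v) (?H x - hess_on UNIV p x)) (at x within K)" if "x \<in> K" for x
  proof -
    have "x \<in> ?S" using that K by auto
    from has_derivative_subset[OF C2_on_has_hess[OF S u this] K(3)] has_derivative_at_withinI[OF Pk_has_hess[OF p], of x K]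
    show ?thesis by (rule has_derivative_eq_rhs[OF has_derivative_diff]) (simp add: fun_eq_iff matrix_vector_mult_diff_rdistrib)
  qed
  have gz: "?g z = 0" by (simp add: gp g0_def)
  have vz: "?v z = 0" by (simp add: p_def c0_def)
  have gb: "norm (?g x) \<le> e * ?d" if x: "x \<in> K" for x
  proof -
    have "norm (?g x - ?g z) \<le> e * norm (x - z)"
    proof (rule differentiable_bound[OF K(2) v2 _ x zK])
      fix y assume "y \<in> K"
      then show "onorm ((*v) (?H y - hess_on UNIV p y)) \<le> e"
        unfolding eE using H0 by (intro onorm_mat_le) (simp add: hp)
    qed
    also have "\<dots> \<le> e * ?d" using xz[OF x] e0 by (rule mult_left_mono)
    finally show ?thesis using gz by simp
  qed
  have vb: "\<bar>?v x\<bar> \<le> e * ?d\<^sup>2" if x: "x \<in> K" for x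
  proof -
    have "norm (?v x - ?v z) \<le> (e * ?d) * norm (x - z)"
    proof (rule differentiable_bound[OF K(2) v1 _ x zK])
      fix y assume y: "y \<in> K"
      show "onorm (\<lambda>d. ?g y \<bullet> d) \<le> e * ?d"
      proof (rule onorm_bound)
        show "norm (?g y \<bullet> d) \<le> e * ?d * norm d" for d
          using Cauchy_Schwarz_ineq2[of "?g y" d] mult_right_mono[OF gb[OF y], of "norm d"] by simp
      qed (use e0 d0 in auto)
    qed
    also have "\<dots> \<le> (e * ?d) * ?d" using xz[OF x] e0 d0 by (intro mult_left_mono) auto
    finally show ?thesis using vz by (simp add: power2_eq_square)
  qed
  show ?thesis
  proof (intro bexI[OF _ p] ballI conjI)
    fix x assume x: "x \<in> K"
    show "norm (?H x - hess_on UNIV p x) \<le> e"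
      unfolding eE using H0[OF x] by (intro norm_mat_le) (simp add: hp)
    show "norm (P_hat \<Omega> m \<xi> u D K x - ?H x) \<le> e"
      unfolding eE
    proof (intro norm_mat_le)
      fix a b
      have "\<Lambda> * \<epsilon> + \<epsilon> \<le> (2 * \<Lambda> + 1) * \<epsilon>" using \<Lambda> \<epsilon>0 by (simp add: algebra_simps)
      then show "\<bar>(P_hat \<Omega> m \<xi> u D K x - ?H x) $ a $ b\<bar> \<le> (2 * \<Lambda> + 1) * \<epsilon>"
        using PH[OF x, of a b] by simp
    qed
  qed (use gb vb in auto)
qed

lemma Hm_energy_sum_le:
  assumes \<Omega>: "open \<Omega>" and w: "has_Hm_derivs \<Omega> n u w" and I: "finite I"
    and G: "\<And>i. i \<in> I \<Longrightarrow> open (G i)" "\<And>i. i \<in> I \<Longrightarrow> G i \<subseteq> \<Omega>"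
    and disj: "\<And>i j. i \<in> I \<Longrightarrow> j \<in> I \<Longrightarrow> i \<noteq> j \<Longrightarrow> G i \<inter> G j = {}"
  shows "(\<Sum>i\<in>I. Hm_energy n w (G i)) \<le> Hm_energy n w \<Omega>"
proof -
  have "(\<Sum>i\<in>I. LINT y:G i|lebesgue. (w l y)\<^sup>2) \<le> (LINT y:\<Omega>|lebesgue. (w l y)\<^sup>2)" if l: "l \<le> n" for l
  proof -
    have int: "set_integrable lebesgue \<Omega> (\<lambda>y. (w l y)\<^sup>2)"
      using w l by (auto simp: has_Hm_derivs_def L2_space_def)
    have intG: "set_integrable lebesgue (G i) (\<lambda>y. (w l y)\<^sup>2)" if "i \<in> I" for i
      using set_integrable_subset[OF int _ G(2)[OF that]] G(1)[OF that] by auto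
    have "(\<Sum>i\<in>I. LINT y:G i|lebesgue. (w l y)\<^sup>2) = (LINT y|lebesgue. (\<Sum>i\<in>I. indicator (G i) y *\<^sub>R (w l y)\<^sup>2))"
      unfolding set_lebesgue_integral_def
      by (rule Bochner_Integration.integral_sum[symmetric]) (use intG in \<open>auto simp: set_integrable_def\<close>)
    also have "\<dots> \<le> (LINT y:\<Omega>|lebesgue. (w l y)\<^sup>2)"
      unfolding set_lebesgue_integral_def
    proof (rule integral_mono')
      show "integrable lebesgue (\<lambda>y. indicat_real \<Omega> y *\<^sub>R (w l y)\<^sup>2)"
        using int by (simp add: set_integrable_def)
      fix y
      show "(\<Sum>i\<in>I. indicat_real (G i) y *\<^sub>R (w l y)\<^sup>2) \<le> indicat_real \<Omega> y *\<^sub>R (w l y)\<^sup>2"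
      proof (cases "\<exists>i\<in>I. y \<in> G i")
        case True
        then obtain i where i: "i \<in> I" "y \<in> G i" by blast
        have "(\<Sum>j\<in>I. indicat_real (G j) y *\<^sub>R (w l y)\<^sup>2) = (\<Sum>j\<in>{i}. indicat_real (G j) y *\<^sub>R (w l y)\<^sup>2)"
          by (rule sum.mono_neutral_right[OF I]) (use i disj in \<open>auto simp: indicator_def\<close>)
        then show ?thesis using i G(2) by (auto simp: indicator_def)
      next
        case False
        then have "(\<Sum>j\<in>I. indicat_real (G j) y *\<^sub>R (w l y)\<^sup>2) = 0" by (intro sum.neutral) auto
        then show ?thesis by simp
      qed
    qed auto
    finally show ?thesis .
  qed
  then have "(\<Sum>l\<le>n. \<Sum>i\<in>I. LINT y:G i|lebesgue. (w l y)\<^sup>2) \<le> (\<Sum>l\<le>n. LINT y:\<Omega>|lebesgue. (w l y)\<^sup>2)"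
    by (intro sum_mono) auto
  then show ?thesis unfolding Hm_energy_def by (subst sum.swap)
qed

text \<open>Inside the domain, polynomials, whose Hessians are symmetric, approximate the Hessian at a point
  arbitrarily well on shrinking discs, by \<open>hessian_approx_element\<close>. Continuity
  extends the symmetry to the boundary.\<close>

lemma hess_symmetric:
  assumes \<Omega>: "convex_polygonal_domain \<Omega>" and u: "C2_on (closure \<Omega>) u"
    and m: "m \<ge> 1" and w: "has_Hm_derivs \<Omega> (m + 3) u w" and x: "x \<in> closure \<Omega>"
  shows "transpose (hess_on (closure \<Omega>) u x) = hess_on (closure \<Omega>) u x"
proof -
  let ?H = "hess_on (closure \<Omega>) u"
  have \<Omega>': "open \<Omega>" "bounded \<Omega>" "convex \<Omega>" "\<Omega> \<noteq> {}"
    using \<Omega> domain_bounded by (auto simp: convex_polygonal_domain_def)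
  define C where "C = sqrt (2 ^ (2 * m + 4) * 2\<^sup>2 * real (m + 4) * real (card {x}) * Hm_energy (m + 3) w \<Omega>)"
  have inner: "?H y $ 1 $ 2 = ?H y $ 2 $ 1" if y: "y \<in> \<Omega>" for y
  proof -
    obtain e where e: "e > 0" "cball y e \<subseteq> \<Omega>" using open_contains_cball \<Omega>'(1) y by blast
    have le: "\<bar>?H y $ 1 $ 2 - ?H y $ 2 $ 1\<bar> \<le> 2 * (C * (2 * r) ^ m + r)" if r: "0 < r" "r \<le> e" for r
    proof -
      have sub: "cball y r \<subseteq> \<Omega>" using e r by (meson dual_order.trans subset_cball)
      then have "cball y r \<subseteq> closure \<Omega>" using closure_subset by blast
      moreover have "diameter (cball y r) \<le> 2 * r" using r by simp
      ultimately obtain p where p: "p \<in> Pk (m + 2)"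
        "\<And>a b. \<bar>?H y $ a $ b - hess_on UNIV p y $ a $ b\<bar> \<le>
        sqrt (2 ^ (2 * m + 4) * 2\<^sup>2 * real (m + 4) * real (card {y}) * Hm_energy (m + 3) w (interior (cball y r)))
          * diameter (cball y r) ^ m + r"
        using hessian_approx_element[OF \<Omega>' u m w compact_cball convex_cball _ r(1) ball_subset_cball, where X = "{y}" and z = y and \<gamma> = 2 and \<delta> = r]
          r by auto
      have "Hm_energy (m + 3) w (interior (cball y r)) \<le> Hm_energy (m + 3) w \<Omega>"
        using Hm_energy_sum_le[OF \<Omega>'(1) w, of "{0::nat}" "\<lambda>_. interior (cball y r)"] order_trans[OF ball_subset_cball sub] by simp
      then have "sqrt (2 ^ (2 * m + 4) * 2\<^sup>2 * real (m + 4) * real (card {y}) * Hm_energy (m + 3) w (interior (cball y r))) \<le> C"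
        unfolding C_def by (intro real_sqrt_le_mono) (simp add: mult_left_mono)
      moreover have "diameter (cball y r) ^ m = (2 * r) ^ m" using r by simp
      ultimately have "sqrt (2 ^ (2 * m + 4) * 2\<^sup>2 * real (m + 4) * real (card {y}) * Hm_energy (m + 3) w (interior (cball y r)))
          * diameter (cball y r) ^ m + r \<le> C * (2 * r) ^ m + r"
        using r by (simp add: mult_right_mono)
      then have bd: "\<bar>?H y $ a $ b - hess_on UNIV p y $ a $ b\<bar> \<le> C * (2 * r) ^ m + r" for a b
        using p(2)[of a b] by linarith
      have sym: "hess_on UNIV p y $ 2 $ 1 = hess_on UNIV p y $ 1 $ 2"
        using arg_cong[OF Pk_hess_sym[OF p(1), of y], of "\<lambda>A. A $ 1 $ 2"] by (simp add: transpose_def)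
      have "\<bar>a - b\<bar> \<le> 2 * E" if "\<bar>a - c\<bar> \<le> E" "\<bar>b - c\<bar> \<le> E" for a b c E :: real
        using that by linarith
      from this[OF bd[of 1 2] bd[of 2 1, unfolded sym]] show ?thesis .
    qed
    have "((\<lambda>r. 2 * (C * (2 * r) ^ m + r)) \<longlongrightarrow> 2 * (C * (2 * 0) ^ m + 0)) (at_right 0)"
      by (intro tendsto_intros)
    moreover have "\<forall>\<^sub>F r in at_right 0. \<bar>?H y $ 1 $ 2 - ?H y $ 2 $ 1\<bar> \<le> 2 * (C * (2 * r) ^ m + r)"
      using le e(1) unfolding eventually_at_right_field by (intro exI[of _ e]) auto
    ultimately have "\<bar>?H y $ 1 $ 2 - ?H y $ 2 $ 1\<bar> \<le> 2 * (C * (2 * 0) ^ m + 0)"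
      by (intro tendsto_lowerbound) auto
    then show ?thesis using m by (simp add: power_0_left)
  qed
  have c: "continuous_on (closure \<Omega>) (\<lambda>y. ?H y $ 1 $ 2 - ?H y $ 2 $ 1)"
    using u by (intro continuous_intros) (auto simp: C2_on_def)
  have "?H x $ 1 $ 2 - ?H x $ 2 $ 1 = 0"
    by (rule continuous_constant_on_closure[OF c _ x]) (use inner in auto)
  then show ?thesis by (simp add: vec_eq_iff transpose_def forall_2)
qed

section \<open>Edges of a triangulation\<close>

text \<open>A quarter turn; it produces the normal directions of edges.\<close>

definition rot :: "pt \<Rightarrow> pt" where
  "rot d = vector [- d $ 2, d $ 1]"

lemma rot_inner: "rot d \<bullet> d = 0" and norm_rot: "norm (rot d) = norm d"
  by (simp_all add: rot_def inner_2 norm_eq_sqrt_inner add.commute)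

lemma orthogonal_multiple_rot:
  assumes "n \<bullet> d = 0" "d \<noteq> (0::pt)"
  obtains c where "n = c *\<^sub>R rot d"
proof -
  have dd: "d \<bullet> d \<noteq> 0" using assms(2) by simp
  have "n = ((rot d \<bullet> n) / (d \<bullet> d)) *\<^sub>R rot d"
  proof -
    have o: "n $ 1 * d $ 1 + n $ 2 * d $ 2 = 0" using assms(1) by (simp add: inner_2)
    have "n $ 1 * (d \<bullet> d) = (rot d \<bullet> n) * rot d $ 1"
      using o unfolding inner_2 rot_def by (simp add: algebra_simps) algebra
    moreover have "n $ 2 * (d \<bullet> d) = (rot d \<bullet> n) * rot d $ 2"
      using o unfolding inner_2 rot_def by (simp add: algebra_simps) algebra
    ultimately show ?thesis using dd by (simp add: vec_eq_iff forall_2 field_simps)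
  qed
  then show ?thesis using that by blast
qed

lemma hyperplane_no_interior:
  assumes "(n::pt) \<noteq> 0" "\<And>y. y \<in> K \<Longrightarrow> n \<bullet> y = c"
  shows "interior K = {}"
proof -
  have "K \<subseteq> {y. n \<bullet> y = c}" using assms(2) by auto
  then show ?thesis using interior_mono[of K] interior_hyperplane[OF assms(1), of c] by blast
qed

lemma edge_vertices:
  assumes D: "mesh_of \<Omega> D" "K \<in> elems D" and F: "F edge_of K"
  obtains a b c where "a \<noteq> b" "F = closed_segment a b" "K = convex hull {a, b, c}"
proof -
  obtain C where C: "\<not> affine_dependent C" "card C = 3" "K = convex hull C"
    using elem_simplex[OF D] by (auto simp: simplex_def)
  obtain E where E: "E \<subseteq> C" "F = convex hull E"
    using F C by (auto simp: edge_of_def face_of_convex_hull_affine_independent)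
  have "finite C" using C(2) card.infinite by fastforce
  have "\<not> affine_dependent E" using C(1) E(1) affine_independent_subset by blast
  then have "aff_dim E = int (card E) - 1" by (simp add: affine_independent_iff_card)
  moreover have "aff_dim E = 1" using F E(2) by (simp add: edge_of_def aff_dim_convex_hull)
  ultimately have "card E = 2" by simp
  then obtain a b where ab: "E = {a, b}" "a \<noteq> b" by (auto simp: card_2_iff)
  have "card (C - E) = 1" using card_Diff_subset[of E C] E(1) \<open>card E = 2\<close> C(2) \<open>finite C\<close>
    by (simp add: finite_subset)
  then obtain c where "C - E = {c}" by (auto simp: card_1_singleton_iff)
  then have "C = {a, b, c}" using E(1) ab by blast
  then show ?thesis using that ab C(3) E(2) by (simp add: segment_convex_hull)
qed

text \<open>Edges are convex hulls of subsets of the three vertices, whence the crude bound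
  \<open>2\<^sup>3\<close>.\<close>

lemma
  assumes D: "mesh_of \<Omega> D" "K \<in> elems D"
  shows finite_elem_edges: "finite {F. F edge_of K}" and card_elem_edges: "card {F. F edge_of K} \<le> 8"
proof -
  obtain C where C: "\<not> affine_dependent C" "card C = 3" "K = convex hull C"
    using elem_simplex[OF D] by (auto simp: simplex_def)
  have fin: "finite C" using C(2) card.infinite by fastforce
  have sub: "{F. F edge_of K} \<subseteq> (\<lambda>E. convex hull E) ` Pow C"
    using C by (auto simp: edge_of_def face_of_convex_hull_affine_independent)
  then show "finite {F. F edge_of K}" using fin finite_subset by blast
  have "card {F. F edge_of K} \<le> card ((\<lambda>E. convex hull E) ` Pow C)"
    using sub fin by (intro card_mono) auto
  also have "\<dots> \<le> card (Pow C)" by (rule card_image_le) (use fin in simp)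
  finally show "card {F. F edge_of K} \<le> 8" using C(2) fin by (simp add: card_Pow)
qed

lemma diameter_closed_segment: "diameter (closed_segment a b) = dist a (b::pt)"
proof (rule antisym)
  show "diameter (closed_segment a b) \<le> dist a b"
  proof (rule diameter_le)
    fix x y assume xy: "x \<in> closed_segment a b" "y \<in> closed_segment a b"
    have "norm (x - a) \<le> norm (b - a)" "norm (x - b) \<le> norm (b - a)" using segment_bound[OF xy(1)] by (simp_all add: norm_minus_commute)
    then show "norm (x - y) \<le> dist a b"
      using segment_furthest_le[OF xy(2), of x] by (auto simp: dist_norm norm_minus_commute)
  qed auto
  show "dist a b \<le> diameter (closed_segment a b)"
    by (rule diameter_bounded_bound) (use compact_imp_bounded[OF compact_segment] in auto)
qed

text \<open>The inscribed ball contains a segment of length \<open>r\<close> parallel to the edge. In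
  barycentric coordinates, the endpoints of a parallel segment differ by a multiple of \<open>b -
  a\<close> that is at most \<open>1\<close>, so its length is at most that of the edge. With
  shape regularity, this makes edge lengths and diameters comparable.\<close>

lemma edge_length_ge_inradius:
  assumes D: "mesh_of \<Omega> D" "K \<in> elems D" and F: "F edge_of K" and r: "r > 0" "ball z r \<subseteq> K"
  shows "r \<le> diameter F"
proof -
  obtain a b c where abc: "a \<noteq> b" "F = closed_segment a b" "K = convex hull {a, b, c}"
    using edge_vertices[OF D F] by blast
  let ?l = "norm (b - a)"
  have l: "?l > 0" using abc(1) by simp
  define e where "e = (r / (2 * ?l)) *\<^sub>R (b - a)"
  have ne: "norm e = r / 2" using l r(1) by (simp add: e_def)
  have "z - e \<in> K" "z + e \<in> K" using r ne by (auto simp: subset_iff dist_norm)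
  then obtain u v u' v' where
    1: "z - e = a + u *\<^sub>R (b - a) + v *\<^sub>R (c - a)" "0 \<le> u" "0 \<le> v" "u + v \<le> 1" and
    2: "z + e = a + u' *\<^sub>R (b - a) + v' *\<^sub>R (c - a)" "0 \<le> u'" "0 \<le> v'" "u' + v' \<le> 1"
    unfolding abc(3) convex_hull_3_alt by auto
  have "2 *\<^sub>R e = (z + e) - (z - e)" by (simp add: scaleR_2)
  also have "\<dots> = (u' - u) *\<^sub>R (b - a) + (v' - v) *\<^sub>R (c - a)"
    unfolding 1(1) 2(1) by (simp add: algebra_simps)
  finally have e2: "(r / ?l) *\<^sub>R (b - a) = (u' - u) *\<^sub>R (b - a) + (v' - v) *\<^sub>R (c - a)"
    by (simp add: e_def)
  let ?n = "rot (b - a)"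
  have n0: "?n \<noteq> 0" using l norm_rot[of "b - a"] by (metis norm_zero less_irrefl)
  have "?n \<bullet> (c - a) \<noteq> 0"
  proof
    assume z: "?n \<bullet> (c - a) = 0"
    have "?n \<bullet> y = ?n \<bullet> a" if "y \<in> K" for y
      using that z unfolding abc(3) convex_hull_3_alt by (auto simp: inner_add_right rot_inner)
    from hyperplane_no_interior[OF n0 this] show False using elem_interior[OF D] by simp
  qed
  moreover have "(v' - v) * (?n \<bullet> (c - a)) = 0"
  proof -
    have "?n \<bullet> ((r / ?l) *\<^sub>R (b - a)) = ?n \<bullet> ((u' - u) *\<^sub>R (b - a) + (v' - v) *\<^sub>R (c - a))"
      using e2 by simp
    then show ?thesis by (simp add: inner_add_right rot_inner)
  qed
  ultimately have "v' = v" by simp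
  with e2 have "(r / ?l - (u' - u)) *\<^sub>R (b - a) = 0" by (simp add: algebra_simps)
  then have "r / ?l = u' - u" using abc(1) by simp
  then have "r / ?l \<le> 1" using 1 2 by linarith
  then have "r \<le> ?l" using l by (simp add: divide_le_eq)
  then show ?thesis by (simp add: abc(2) diameter_closed_segment dist_norm norm_minus_commute)
qed

definition is_outer_normal :: "pt set \<Rightarrow> pt set \<Rightarrow> pt \<Rightarrow> bool" where
  "is_outer_normal K F n \<longleftrightarrow> norm n = 1 \<and> (\<forall>x\<in>F. \<forall>y\<in>K. n \<bullet> (y - x) \<le> 0)"

lemma edge_normal_cases:
  assumes D: "mesh_of \<Omega> D" "K \<in> elems D" "K' \<in> elems D" and F: "F edge_of K" "F edge_of K'"
    and n: "is_outer_normal K F n" "is_outer_normal K' F n'"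
  shows "n' = n \<or> n' = - n"
proof -
  obtain a b c where abc: "a \<noteq> b" "F = closed_segment a b"
    using edge_vertices[OF D(1,2) F(1)] by metis
  have sub: "F \<subseteq> K" "F \<subseteq> K'" using F edge_of_imp_subset by blast+
  have ab: "a \<in> F" "b \<in> F" using abc by auto
  have orth: "n \<bullet> (b - a) = 0" if "is_outer_normal K F n" "F \<subseteq> K" for n K
  proof -
    have "n \<bullet> (b - a) \<le> 0" "n \<bullet> (a - b) \<le> 0" using that ab by (auto simp: is_outer_normal_def)
    then show ?thesis by (simp add: inner_diff_right)
  qed
  have d: "b - a \<noteq> 0" using abc by simp
  obtain s where s: "n = s *\<^sub>R rot (b - a)" using orthogonal_multiple_rot[OF orth[OF n(1) sub(1)] d] .
  obtain t where t: "n' = t *\<^sub>R rot (b - a)" using orthogonal_multiple_rot[OF orth[OF n(2) sub(2)] d] .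
  have "norm n = 1" "norm n' = 1" using n by (auto simp: is_outer_normal_def)
  then have "\<bar>s\<bar> * norm (b - a) = 1" "\<bar>t\<bar> * norm (b - a) = 1" by (simp_all add: s t norm_rot)
  then have "\<bar>s\<bar> = \<bar>t\<bar>" using d by (metis mult_cancel_right norm_eq_zero)
  then show ?thesis by (auto simp: s t abs_eq_iff)
qed

lemma outer_normal_neg:
  assumes D: "mesh_of \<Omega> D" "K \<in> elems D" and F: "F edge_of K" and n: "is_outer_normal K F n"
  shows "\<not> is_outer_normal K F (- n)"
proof
  assume n': "is_outer_normal K F (- n)"
  have "F \<noteq> {}" using F by (auto simp: edge_of_def)
  then obtain x where x: "x \<in> F" by blast
  have "n \<bullet> y = n \<bullet> x" if "y \<in> K" for y
    using n n' x that by (fastforce simp: is_outer_normal_def inner_diff_right)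
  moreover have "n \<noteq> 0" using n by (auto simp: is_outer_normal_def)
  ultimately show False using hyperplane_no_interior elem_interior[OF D] by blast
qed

lemma is_outer_normal_outer_normal:
  assumes D: "mesh_of \<Omega> D" "K \<in> elems D" and F: "F edge_of K"
  shows "is_outer_normal K F (outer_normal K F)"
proof -
  obtain a b c where abc: "a \<noteq> b" "F = closed_segment a b" "K = convex hull {a, b, c}"
    using edge_vertices[OF D F] by blast
  let ?r = "rot (b - a)"
  define s where "s = (if ?r \<bullet> (c - a) \<le> 0 then 1 else - 1 :: real)"
  define n where "n = (s / norm (b - a)) *\<^sub>R ?r"
  have nn: "norm n = 1" using abc(1) by (simp add: n_def norm_rot s_def)
  have nb: "n \<bullet> (b - a) = 0" by (simp add: n_def rot_inner)
  have "s * (?r \<bullet> (c - a)) \<le> 0" by (simp add: s_def)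
  then have nc: "n \<bullet> (c - a) \<le> 0" by (simp add: n_def divide_nonpos_nonneg)
  have nF: "n \<bullet> x = n \<bullet> a" if "x \<in> F" for x
  proof -
    obtain t where "x = (1 - t) *\<^sub>R a + t *\<^sub>R b" using \<open>x \<in> F\<close> abc(2) by (auto simp: in_segment)
    then have "x - a = t *\<^sub>R (b - a)" by (simp add: algebra_simps)
    then have "n \<bullet> (x - a) = 0" using nb by simp
    then show ?thesis by (simp add: inner_diff_right)
  qed
  have nK: "n \<bullet> y \<le> n \<bullet> a" if "y \<in> K" for y
    using that nb nc unfolding abc(3) convex_hull_3_alt
    by (auto simp: inner_add_right mult_nonneg_nonpos)
  have out: "is_outer_normal K F n"
    unfolding is_outer_normal_def using nn nF nK by (simp add: inner_diff_right)
  have "outer_normal K F = (THE n. is_outer_normal K F n)"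
    unfolding outer_normal_def is_outer_normal_def ..
  also have "\<dots> = n"
    using edge_normal_cases[OF D D(2) F F out] outer_normal_neg[OF D F out] out
    by (intro the_equality) blast+
  finally show ?thesis using out by simp
qed

lemma is_outer_normal_normalize:
  assumes "a \<noteq> 0" "\<And>x y. x \<in> F \<Longrightarrow> y \<in> K \<Longrightarrow> a \<bullet> y \<le> a \<bullet> x"
  shows "is_outer_normal K F (a /\<^sub>R norm a)"
  using assms by (auto simp: is_outer_normal_def inner_diff_right mult_left_mono)

lemma outer_normal_eqI:
  assumes "mesh_of \<Omega> D" "K \<in> elems D" "F edge_of K" "is_outer_normal K F n"
  shows "outer_normal K F = n"
proof -
  note o = is_outer_normal_outer_normal[OF assms(1-3)]
  from edge_normal_cases[OF assms(1,2,2,3,3) o assms(4)] have "n = outer_normal K F \<or> n = - outer_normal K F" .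
  with outer_normal_neg[OF assms(1-3) o] assms(4) show ?thesis by metis
qed

text \<open>A line separating the interiors of the two triangles contains the edge; its two unit normals are
  the two outer normals.\<close>

lemma outer_normals_opposite:
  assumes D: "mesh_of \<Omega> D" "K \<in> elems D" "K' \<in> elems D" "K \<noteq> K'" and F: "F edge_of K" "F edge_of K'"
  shows "outer_normal K' F = - outer_normal K F"
proof -
  obtain a \<beta> where a: "a \<noteq> 0" "\<forall>x\<in>interior K. a \<bullet> x \<le> \<beta>" "\<forall>x\<in>interior K'. a \<bullet> x \<ge> \<beta>"
    using separating_hyperplane_sets[OF convex_interior[OF elem_convex[OF D(1,2)]] convex_interior[OF elem_convex[OF D(1,3)]]
        elem_interior[OF D(1,2)] elem_interior[OF D(1,3)] elem_interiors_disjoint[OF D]] by blast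
  have cl: "closure (interior K) = K" if "K \<in> elems D" for K
    using convex_closure_interior[OF elem_convex[OF D(1) that] elem_interior[OF D(1) that]]
      closure_closed[OF compact_imp_closed[OF elem_compact[OF D(1) that]]] by simp
  have "closure (interior K) \<subseteq> {x. a \<bullet> x \<le> \<beta>}"
    by (rule closure_minimal) (use a(2) closed_halfspace_le in auto)
  moreover have "closure (interior K') \<subseteq> {x. a \<bullet> x \<ge> \<beta>}"
    by (rule closure_minimal) (use a(3) closed_halfspace_ge in auto)
  ultimately have K: "\<And>x. x \<in> K \<Longrightarrow> a \<bullet> x \<le> \<beta>" "\<And>x. x \<in> K' \<Longrightarrow> a \<bullet> x \<ge> \<beta>"
    unfolding cl[OF D(2)] cl[OF D(3)] by auto
  have sub: "F \<subseteq> K" "F \<subseteq> K'" using F edge_of_imp_subset by blast+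
  then have eq: "a \<bullet> x = \<beta>" if "x \<in> F" for x using K that by (meson antisym subsetD)
  have "outer_normal K F = a /\<^sub>R norm a"
    by (intro outer_normal_eqI[OF D(1,2) F(1)] is_outer_normal_normalize a) (use K eq in auto)
  moreover have "outer_normal K' F = (- a) /\<^sub>R norm (- a)"
    by (intro outer_normal_eqI[OF D(1,3) F(2)] is_outer_normal_normalize) (use K eq a in auto)
  ultimately show ?thesis by simp
qed

lemma norm_outer_normal:
  assumes "mesh_of \<Omega> D" "K \<in> elems D" "F edge_of K"
  shows "norm (outer_normal K F) = 1"
  using is_outer_normal_outer_normal[OF assms] by (simp add: is_outer_normal_def)

text \<open>A third triangle would have an outer normal opposite to two opposite vectors.\<close>

lemma at_most_two_elems:
  assumes D: "mesh_of \<Omega> D" "K \<in> elems D" "K' \<in> elems D" "K \<noteq> K'" and F: "F edge_of K" "F edge_of K'"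
  shows "{T \<in> elems D. F edge_of T} = {K, K'}"
proof (rule ccontr)
  assume "{T \<in> elems D. F edge_of T} \<noteq> {K, K'}"
  then obtain T where T: "T \<in> elems D" "F edge_of T" "T \<noteq> K" "T \<noteq> K'" using D F by blast
  from outer_normals_opposite[OF D F] outer_normals_opposite[OF D(1,2) T(1) T(3)[symmetric] F(1) T(2)]
    outer_normals_opposite[OF D(1,3) T(1) T(4)[symmetric] F(2) T(2)]
  have "outer_normal K F = - outer_normal K F" by simp
  then have "2 *\<^sub>R outer_normal K F = 0" by (simp add: scaleR_2 eq_neg_iff_add_eq_0)
  then have "outer_normal K F = 0" by simp
  then show False using norm_outer_normal[OF D(1,2) F(1)] by simp
qed

lemma frontier_domain: "convex_polygonal_domain \<Omega> \<Longrightarrow> frontier \<Omega> = closure \<Omega> - \<Omega>"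
  by (simp add: frontier_def convex_polygonal_domain_def interior_open)

text \<open>Strictness on \<open>\<Omega>\<close> is what distinguishes faces on the frontier from chords of
  the domain.\<close>

lemma supporting_hyperplane_domain:
  assumes \<Omega>: "convex_polygonal_domain \<Omega>" and x: "x \<in> frontier \<Omega>"
  obtains a where "a \<noteq> 0" "\<And>y. y \<in> closure \<Omega> \<Longrightarrow> a \<bullet> x \<le> a \<bullet> y" "\<And>y. y \<in> \<Omega> \<Longrightarrow> a \<bullet> x < a \<bullet> y"
proof -
  have "open \<Omega>" "convex \<Omega>" using \<Omega> by (auto simp: convex_polygonal_domain_def)
  then have "rel_interior \<Omega> = \<Omega>" by (simp add: rel_interior_open)
  then show ?thesis
    using supporting_hyperplane_relative_frontier[OF \<open>convex \<Omega>\<close>, of x] x that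
    by (auto simp: frontier_domain[OF \<Omega>])
qed

text \<open>A supporting line of the domain at the midpoint contains the whole edge and determines the same
  outer normal for every triangle with that edge, whereas two triangles have opposite ones.\<close>

lemma boundary_edge_unique_elem:
  assumes \<Omega>: "convex_polygonal_domain \<Omega>" and D: "mesh_of \<Omega> D" "K \<in> elems D" "K' \<in> elems D"
    and F: "F edge_of K" "F edge_of K'" "F \<subseteq> frontier \<Omega>"
  shows "K = K'"
proof (rule ccontr)
  assume ne: "K \<noteq> K'"
  obtain a b c where abc: "a \<noteq> b" "F = closed_segment a b"
    using edge_vertices[OF D(1,2) F(1)] by metis
  let ?x = "midpoint a b"
  have "?x \<in> frontier \<Omega>" using F(3) abc(2) by auto
  then obtain g where g: "g \<noteq> 0" "\<And>y. y \<in> closure \<Omega> \<Longrightarrow> g \<bullet> ?x \<le> g \<bullet> y"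
    using supporting_hyperplane_domain[OF \<Omega>] by metis
  have cl: "F \<subseteq> closure \<Omega>" using F(3) by (auto simp: frontier_def)
  have "g \<bullet> ?x = (g \<bullet> a + g \<bullet> b) / 2" by (simp add: midpoint_def inner_add_right)
  moreover have "g \<bullet> ?x \<le> g \<bullet> a" "g \<bullet> ?x \<le> g \<bullet> b" using g(2) cl abc(2) by auto
  ultimately have ab: "g \<bullet> a = g \<bullet> ?x" "g \<bullet> b = g \<bullet> ?x" by argo+
  have gF: "g \<bullet> x = g \<bullet> ?x" if "x \<in> F" for x
  proof -
    obtain t where "x = (1 - t) *\<^sub>R a + t *\<^sub>R b" using \<open>x \<in> F\<close> abc(2) by (auto simp: in_segment)
    then have "g \<bullet> x = (1 - t) * (g \<bullet> a) + t * (g \<bullet> b)" by (simp add: inner_add_right)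
    then show ?thesis unfolding ab by (simp add: algebra_simps)
  qed
  have "is_outer_normal T F ((- g) /\<^sub>R norm (- g))" if "T \<in> elems D" for T
    by (intro is_outer_normal_normalize) (use g gF elem_subset[OF D(1) that] in auto)
  then have "outer_normal K F = outer_normal K' F"
    using outer_normal_eqI D F by metis
  with outer_normals_opposite[OF D ne F(1,2)] have "2 *\<^sub>R outer_normal K F = 0"
    by (simp add: scaleR_2 eq_neg_iff_add_eq_0)
  then have "outer_normal K F = 0" by simp
  then show False using norm_outer_normal[OF D(1,2) F(1)] by simp
qed

text \<open>The exceptional points of the mesh: away from them, triangles meet in whole edges. Only the
  finiteness of this set enters the connectedness argument.\<close>

definition vertices :: "disc \<Rightarrow> pt set" where
  "vertices D = (\<Union>K\<in>elems D. {x. x extreme_point_of K})"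

lemma finite_vertices:
  assumes "mesh_of \<Omega> D"
  shows "finite (vertices D)"
  unfolding vertices_def
proof (intro finite_UN_I elems_finite[OF assms])
  fix K assume "K \<in> elems D"
  from elem_simplex[OF assms this] obtain C where "finite C" "K = convex hull C"
    by (auto simp: simplex)
  then show "finite {x. x extreme_point_of K}"
    using extreme_points_of_convex_hull finite_subset by blast
qed

lemma proper_face_is_edge:
  assumes D: "mesh_of \<Omega> D" "K \<in> elems D" and T: "T face_of K" "T \<noteq> K" and x: "x \<in> T" "x \<notin> vertices D"
  shows "T edge_of K"
proof -
  have "aff_dim T < 2"
    using face_of_aff_dim_lt[OF elem_convex[OF D] T] aff_dim_simplex[OF elem_simplex[OF D]] by simp
  moreover have "aff_dim T \<noteq> 0"
  proof
    assume "aff_dim T = 0"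
    then have "T = {x}" using x(1) by (auto simp: aff_dim_eq_0)
    then have "x extreme_point_of K" using T(1) by (simp add: face_of_singleton)
    then show False using x(2) D(2) by (auto simp: vertices_def)
  qed
  moreover have "aff_dim T \<ge> 0" using x(1) aff_dim_geq[of T] aff_dim_empty[of T] by fastforce
  ultimately show ?thesis using T(1) by (simp add: edge_of_def)
qed

text \<open>The intersection of two triangles is a proper face of both; if it contains a point that is not a
  vertex, it is not a vertex, and hence an edge.\<close>

lemma common_point_common_edge:
  assumes D: "mesh_of \<Omega> D" "K \<in> elems D" "K' \<in> elems D" "K \<noteq> K'"
    and x: "x \<in> K" "x \<in> K'" "x \<notin> vertices D"
  shows "K \<inter> K' edge_of K" "K \<inter> K' edge_of K'"
proof -
  have tri: "T \<inter> T' face_of T" if "T \<in> elems D" "T' \<in> elems D" for T T'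
    using D(1) that by (simp add: mesh_of_def triangulation_def)
  have f: "(K \<inter> K') face_of K" "(K \<inter> K') face_of K'"
    using tri[OF D(2,3)] tri[OF D(3,2)] by (simp_all add: Int_commute)
  have "K \<inter> K' \<noteq> K"
  proof
    assume "K \<inter> K' = K"
    then have "interior K \<subseteq> interior K'" by (intro interior_mono) blast
    then show False using elem_interiors_disjoint[OF D] elem_interior[OF D(1,2)] by blast
  qed
  moreover have "K \<inter> K' \<noteq> K'"
  proof
    assume "K \<inter> K' = K'"
    then have "interior K' \<subseteq> interior K" by (intro interior_mono) blast
    then show False using elem_interiors_disjoint[OF D] elem_interior[OF D(1,3)] by blast
  qed
  ultimately show "K \<inter> K' edge_of K" "K \<inter> K' edge_of K'"
    using proper_face_is_edge[OF D(1,2) f(1) _ _ x(3)] proper_face_is_edge[OF D(1,3) f(2) _ _ x(3)] x by auto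
qed

text \<open>The supporting line at \<open>x\<close> cuts out a face of the triangle at \<open>x\<close>,
  proper because the triangle has interior points in \<open>\<Omega>\<close>.\<close>

lemma frontier_point_on_boundary_edge:
  assumes \<Omega>: "convex_polygonal_domain \<Omega>" and D: "mesh_of \<Omega> D" and x: "x \<in> frontier \<Omega>" "x \<notin> vertices D"
  obtains F K where "F \<in> boundary_edges \<Omega> D" "K \<in> elems D" "F edge_of K" "x \<in> F"
proof -
  have "x \<in> closure \<Omega>" using x(1) by (simp add: frontier_def)
  then obtain K where K: "K \<in> elems D" "x \<in> K" using D unfolding mesh_of_def by blast
  obtain a where a: "a \<noteq> 0" "\<And>y. y \<in> closure \<Omega> \<Longrightarrow> a \<bullet> x \<le> a \<bullet> y" "\<And>y. y \<in> \<Omega> \<Longrightarrow> a \<bullet> x < a \<bullet> y"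
    using supporting_hyperplane_domain[OF \<Omega> x(1)] by blast
  let ?F = "K \<inter> {y. a \<bullet> y = a \<bullet> x}"
  have F: "?F face_of K"
    by (rule face_of_Int_supporting_hyperplane_ge[OF elem_convex[OF D K(1)]]) (use a(2) elem_subset[OF D K(1)] in auto)
  obtain y where "y \<in> interior K" using elem_interior[OF D K(1)] by blast
  then have "y \<in> K" "a \<bullet> x < a \<bullet> y"
    using elem_interior_subset[OF \<Omega> D K(1)] interior_subset[of K] a(3) by blast+
  then have "?F \<noteq> K" by (metis (mono_tags, lifting) IntD2 mem_Collect_eq less_irrefl)
  then have e: "?F edge_of K" using proper_face_is_edge[OF D K(1) F _ _ x(2)] K(2) by auto
  have "?F \<subseteq> frontier \<Omega>"
    unfolding frontier_domain[OF \<Omega>] using elem_subset[OF D K(1)] a(3) by fastforce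
  then show ?thesis using that e K by (auto simp: boundary_edges_def)
qed

section \<open>Integrals over edges and the jump form\<close>

text \<open>The chosen parametrization is unspecified, but the same for all integrands.\<close>

lemma edge_integral_eq:
  assumes "F = closed_segment a0 b0"
  obtains a b where "F = closed_segment a b" "\<And>g. edge_integral F g = diameter F * integral {0..1} (\<lambda>t. g (linepath a b t))"
proof -
  let ?P = "\<lambda>(a, b). F = closed_segment a b"
  obtain a b where ab: "(SOME p. ?P p) = (a, b)" by force
  have "?P (SOME p. ?P p)" by (rule someI[of ?P "(a0, b0)"]) (use assms in simp)
  then have F: "F = closed_segment a b" using ab by simp
  then have "dist a b = diameter F" by (simp add: diameter_closed_segment)
  then have "edge_integral F g = diameter F * integral {0..1} (\<lambda>t. g (linepath a b t))" for g
    unfolding edge_integral_def ab by simp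
  with F show ?thesis using that by blast
qed

lemma edges_segment:
  assumes "mesh_of \<Omega> D" "F \<in> edges \<Omega> D"
  obtains a b where "F = closed_segment a b"
proof -
  obtain K where "K \<in> elems D" "F edge_of K"
    using assms(2) by (auto simp: edges_def interior_edges_def boundary_edges_def)
  then show ?thesis using edge_vertices[OF assms(1)] that by metis
qed

lemma continuous_on_edge_param:
  assumes "continuous_on F g" "F = closed_segment a b"
  shows "continuous_on {0..1} (\<lambda>t. g (linepath a b t))"
  by (rule continuous_on_compose2[OF assms(1)])
    (use assms(2) in \<open>auto intro!: continuous_on_linepath linepath_in_path\<close>)

context
  fixes \<Omega> D F assumes D: "mesh_of \<Omega> D" and F: "F \<in> edges \<Omega> D"
begin

lemma edge_integral_cong: "(\<And>x. x \<in> F \<Longrightarrow> g x = h x) \<Longrightarrow> edge_integral F g = edge_integral F h"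
proof -
  assume eq: "\<And>x. x \<in> F \<Longrightarrow> g x = h x"
  obtain a0 b0 where "F = closed_segment a0 b0" using edges_segment[OF D F] .
  from edge_integral_eq[OF this] obtain a b where F': "F = closed_segment a b"
    and I: "\<And>g. edge_integral F g = diameter F * integral {0..1} (\<lambda>t. g (linepath a b t))" by blast
  have "integral {0..1} (\<lambda>t. g (linepath a b t)) = integral {0..1} (\<lambda>t. h (linepath a b t))"
    by (rule integral_cong) (use eq F' linepath_in_path in auto)
  then show ?thesis by (simp add: I)
qed

lemma edge_integral_linear:
  assumes "continuous_on F g" "continuous_on F h"
  shows "edge_integral F (\<lambda>x. g x + t * h x) = edge_integral F g + t * edge_integral F h"
proof -
  obtain a0 b0 where "F = closed_segment a0 b0" using edges_segment[OF D F] .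
  from edge_integral_eq[OF this] obtain a b where F': "F = closed_segment a b"
    and I: "\<And>g. edge_integral F g = diameter F * integral {0..1} (\<lambda>t. g (linepath a b t))" by blast
  note c = continuous_on_edge_param[OF assms(1) F'] continuous_on_edge_param[OF assms(2) F']
  have "integral {0..1} (\<lambda>s. g (linepath a b s) + t * h (linepath a b s)) =
     integral {0..1} (\<lambda>s. g (linepath a b s)) + t * integral {0..1} (\<lambda>s. h (linepath a b s))"
    by (intro integral_unique has_integral_add has_integral_mult_right integrable_integral integrable_continuous_real c)
  then show ?thesis by (simp add: I algebra_simps)
qed

lemma edge_integral_nonneg:
  assumes "continuous_on F g" "\<And>x. x \<in> F \<Longrightarrow> 0 \<le> g x"
  shows "0 \<le> edge_integral F g"
    and "edge_integral F g = 0 \<Longrightarrow> diameter F \<noteq> 0 \<Longrightarrow> \<forall>x\<in>F. g x = 0"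
    and "(\<And>x. x \<in> F \<Longrightarrow> g x \<le> M) \<Longrightarrow> edge_integral F g \<le> diameter F * M"
proof -
  obtain a0 b0 where "F = closed_segment a0 b0" using edges_segment[OF D F] .
  from edge_integral_eq[OF this] obtain a b where F': "F = closed_segment a b"
    and I: "\<And>g. edge_integral F g = diameter F * integral {0..1} (\<lambda>t. g (linepath a b t))" by blast
  have c: "continuous_on {0..1} (\<lambda>t. g (linepath a b t))" by (rule continuous_on_edge_param[OF assms(1) F'])
  have lp: "linepath a b t \<in> F" if "t \<in> {0..1}" for t using that F' linepath_in_path by auto
  have d: "0 \<le> diameter F" unfolding F' diameter_closed_segment by simp
  show "0 \<le> edge_integral F g" unfolding I
    by (intro mult_nonneg_nonneg d integral_nonneg integrable_continuous_real c) (use lp assms(2) in auto)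
  show "edge_integral F g \<le> diameter F * M" if "\<And>x. x \<in> F \<Longrightarrow> g x \<le> M"
  proof -
    have "integral {0..1} (\<lambda>t. g (linepath a b t)) \<le> integral {0..1::real} (\<lambda>t. M)"
      by (intro integral_le integrable_continuous_real c continuous_on_const) (use lp that in auto)
    then show ?thesis unfolding I using d by (intro mult_left_mono) auto
  qed
  show "\<forall>x\<in>F. g x = 0" if "edge_integral F g = 0" "diameter F \<noteq> 0"
  proof -
    have "integral {0..1} (\<lambda>t. g (linepath a b t)) = 0" using that by (simp add: I)
    then have "\<forall>t\<in>{0..1}. g (linepath a b t) = 0"
      using integral_eq_0_iff[OF c] lp assms(2) by auto
    moreover have "F = linepath a b ` {0..1}" using F' by (metis path_image_def path_image_linepath)
    ultimately show ?thesis by auto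
  qed
qed

end

text \<open>The regularity on closed elements needed for jumps of values and gradients to be continuous along
  edges. It is shared by broken polynomials and by the exact solution, so that \<open>J_h\<close>
  can be expanded bilinearly on their differences.\<close>

definition C1_broken :: "disc \<Rightarrow> real broken \<Rightarrow> bool" where
  "C1_broken D v \<longleftrightarrow> (\<forall>K\<in>elems D.
     (\<forall>x\<in>K. (v K has_derivative (\<lambda>d. grad_on K (v K) x \<bullet> d)) (at x within K)) \<and>
     continuous_on K (grad_on K (v K)))"

lemma C1_brokenI:
  assumes D: "mesh_of \<Omega> D"
    and g: "\<And>K x. K \<in> elems D \<Longrightarrow> x \<in> K \<Longrightarrow> (v K has_derivative (\<lambda>d. g K x \<bullet> d)) (at x within K)"
    and c: "\<And>K. K \<in> elems D \<Longrightarrow> continuous_on K (g K)"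
  shows "C1_broken D v" "\<And>K x. K \<in> elems D \<Longrightarrow> x \<in> K \<Longrightarrow> grad_on K (v K) x = g K x"
proof -
  show eq: "grad_on K (v K) x = g K x" if "K \<in> elems D" "x \<in> K" for K x
    using grad_on_eq[OF elem_convex[OF D that(1)] elem_interior[OF D that(1)] that(2) g[OF that]] .
  have "continuous_on K (grad_on K (v K))" if K: "K \<in> elems D" for K
    using c[OF K] by (rule continuous_on_eq) (simp add: eq[OF K])
  then show "C1_broken D v"
    unfolding C1_broken_def using g eq by simp
qed

lemma
  assumes D: "mesh_of \<Omega> D" and v: "v \<in> broken_poly k D"
  shows C1_broken_poly: "C1_broken D v"
    and grad_on_broken_poly: "\<And>K x. K \<in> elems D \<Longrightarrow> x \<in> K \<Longrightarrow> grad_on K (v K) x = grad_on UNIV (v K) x"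
proof -
  have p: "v K \<in> Pk k" if "K \<in> elems D" for K using v that by (simp add: broken_poly_def)
  have g: "(v K has_derivative (\<lambda>d. grad_on UNIV (v K) x \<bullet> d)) (at x within K)" if "K \<in> elems D" "x \<in> K" for K x
    using Pk_has_grad[OF p[OF that(1)]] by (rule has_derivative_at_withinI)
  have c: "continuous_on K (grad_on UNIV (v K))" if "K \<in> elems D" for K
    by (rule has_derivative_continuous_on[OF has_derivative_at_withinI[OF Pk_has_hess[OF p[OF that]]]])
  show "C1_broken D v" by (rule C1_brokenI(1)[OF D g c])
  show "\<And>K x. K \<in> elems D \<Longrightarrow> x \<in> K \<Longrightarrow> grad_on K (v K) x = grad_on UNIV (v K) x"
    by (rule C1_brokenI(2)[OF D g c])
qed

lemma
  assumes \<Omega>: "convex_polygonal_domain \<Omega>" and D: "mesh_of \<Omega> D" and u: "C2_on (closure \<Omega>) u"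
  shows C1_broken_C2: "C1_broken D (\<lambda>_. u)"
    and grad_on_C2: "\<And>K x. K \<in> elems D \<Longrightarrow> x \<in> K \<Longrightarrow> grad_on K u x = grad_on (closure \<Omega>) u x"
proof -
  have S: "convex (closure \<Omega>)" "interior (closure \<Omega>) \<noteq> {}"
    using \<Omega> interior_closure_domain[OF \<Omega>] by (auto simp: convex_polygonal_domain_def convex_closure)
  have g: "(u has_derivative (\<lambda>d. grad_on (closure \<Omega>) u x \<bullet> d)) (at x within K)" if "K \<in> elems D" "x \<in> K" for K x
    using C2_on_has_grad[OF S u] elem_subset[OF D that(1)] that(2) has_derivative_subset by blast
  have c0: "continuous_on (closure \<Omega>) (grad_on (closure \<Omega>) u)"
    by (rule has_derivative_continuous_on) (rule C2_on_has_hess[OF S u])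
  have c: "continuous_on K (grad_on (closure \<Omega>) u)" if "K \<in> elems D" for K
    using continuous_on_subset[OF c0 elem_subset[OF D that]] .
  show "C1_broken D (\<lambda>_. u)" by (rule C1_brokenI(1)[OF D g c])
  show "\<And>K x. K \<in> elems D \<Longrightarrow> x \<in> K \<Longrightarrow> grad_on K u x = grad_on (closure \<Omega>) u x"
    by (rule C1_brokenI(2)[OF D g c])
qed

lemma
  assumes D: "mesh_of \<Omega> D" and v: "C1_broken D v" and w: "C1_broken D w"
  shows C1_broken_lincomb: "C1_broken D (\<lambda>K x. v K x + t * w K x)"
    and grad_on_lincomb: "\<And>K x. K \<in> elems D \<Longrightarrow> x \<in> K \<Longrightarrow>
      grad_on K (\<lambda>x. v K x + t * w K x) x = grad_on K (v K) x + t *\<^sub>R grad_on K (w K) x"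
proof -
  have g: "((\<lambda>x. v K x + t * w K x) has_derivative (\<lambda>d. (grad_on K (v K) x + t *\<^sub>R grad_on K (w K) x) \<bullet> d)) (at x within K)"
    if "K \<in> elems D" "x \<in> K" for K x
  proof -
    have "(v K has_derivative (\<lambda>d. grad_on K (v K) x \<bullet> d)) (at x within K)"
      "(w K has_derivative (\<lambda>d. grad_on K (w K) x \<bullet> d)) (at x within K)"
      using v w that by (auto simp: C1_broken_def)
    from has_derivative_add[OF this(1) has_derivative_mult_right[OF this(2)]]
    show ?thesis by (simp add: inner_add_left)
  qed
  have c: "continuous_on K (\<lambda>x. grad_on K (v K) x + t *\<^sub>R grad_on K (w K) x)" if "K \<in> elems D" for K
    using v w that by (intro continuous_intros) (auto simp: C1_broken_def)
  show "C1_broken D (\<lambda>K x. v K x + t * w K x)"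
    by (rule C1_brokenI(1)[OF D, where g = "\<lambda>K x. grad_on K (v K) x + t *\<^sub>R grad_on K (w K) x"]) (rule g c; assumption)+
  show "\<And>K x. K \<in> elems D \<Longrightarrow> x \<in> K \<Longrightarrow>
      grad_on K (\<lambda>x. v K x + t * w K x) x = grad_on K (v K) x + t *\<^sub>R grad_on K (w K) x"
    by (rule C1_brokenI(2)[OF D, where v = "\<lambda>K x. v K x + t * w K x"
          and g = "\<lambda>K x. grad_on K (v K) x + t *\<^sub>R grad_on K (w K) x"]) (rule g c; assumption)+
qed

lemma C1_broken_continuous: "C1_broken D v \<Longrightarrow> K \<in> elems D \<Longrightarrow> continuous_on K (v K)"
  by (rule has_derivative_continuous_on) (auto simp: C1_broken_def)

lemma
  assumes "C1_broken D v"
  shows jump_continuous: "continuous_on F (jump D v F)"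
    and vjump_continuous: "continuous_on F (vjump D (bgrad v) F)"
proof -
  have "continuous_on F (v K)" "continuous_on F (bgrad v K)" if "K \<in> elems D" "F edge_of K" for K
  proof -
    note sub = edge_of_imp_subset[OF that(2)]
    show "continuous_on F (v K)" by (rule continuous_on_subset[OF C1_broken_continuous[OF assms that(1)] sub])
    have "continuous_on K (bgrad v K)"
      using assms that(1) by (simp add: C1_broken_def bgrad_def)
    then show "continuous_on F (bgrad v K)" using sub by (rule continuous_on_subset)
  qed
  then show "continuous_on F (jump D v F)" "continuous_on F (vjump D (bgrad v) F)"
    unfolding jump_def [abs_def] vjump_def [abs_def]
    by (intro continuous_on_sum continuous_on_scaleR continuous_on_inner continuous_on_const; simp)+
qed

lemma jump_lincomb: "jump D (\<lambda>K x. v K x + t * w K x) F x = jump D v F x + t *\<^sub>R jump D w F x"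
  by (simp add: jump_def scaleR_add_left sum.distrib scaleR_sum_right)

lemma vjump_lincomb:
  assumes "mesh_of \<Omega> D" "C1_broken D v" "C1_broken D w" "x \<in> F"
  shows "vjump D (bgrad (\<lambda>K x. v K x + t * w K x)) F x = vjump D (bgrad v) F x + t * vjump D (bgrad w) F x"
proof -
  have "bgrad (\<lambda>K x. v K x + t * w K x) K x = bgrad v K x + t *\<^sub>R bgrad w K x" if "K \<in> elems D" "F edge_of K" for K
    using grad_on_lincomb[OF assms(1-3) that(1)] edge_of_imp_subset[OF that(2)] assms(4)
    by (auto simp: bgrad_def)
  then show ?thesis
    by (simp add: vjump_def inner_add_left sum.distrib sum_distrib_left)
qed

lemma interior_edges_subset: "interior_edges D \<subseteq> edges \<Omega> D"
  by (simp add: edges_def)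

lemma J_h_lincomb:
  assumes D: "mesh_of \<Omega> D" and v: "C1_broken D v" and w: "C1_broken D w" and z: "C1_broken D z"
  shows "J_h \<Omega> D (\<lambda>K x. v K x + t * w K x) z = J_h \<Omega> D v z + t * J_h \<Omega> D w z"
proof -
  have 1: "edge_integral F (\<lambda>x. vjump D (bgrad (\<lambda>K x. v K x + t * w K x)) F x * vjump D (bgrad z) F x) =
      edge_integral F (\<lambda>x. vjump D (bgrad v) F x * vjump D (bgrad z) F x) +
      t * edge_integral F (\<lambda>x. vjump D (bgrad w) F x * vjump D (bgrad z) F x)" if F: "F \<in> edges \<Omega> D" for F
  proof -
    have "edge_integral F (\<lambda>x. vjump D (bgrad (\<lambda>K x. v K x + t * w K x)) F x * vjump D (bgrad z) F x) =
      edge_integral F (\<lambda>x. vjump D (bgrad v) F x * vjump D (bgrad z) F x + t * (vjump D (bgrad w) F x * vjump D (bgrad z) F x))"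
      by (rule edge_integral_cong[OF D F]) (simp add: vjump_lincomb[OF D v w] algebra_simps)
    also have "\<dots> = edge_integral F (\<lambda>x. vjump D (bgrad v) F x * vjump D (bgrad z) F x) +
      t * edge_integral F (\<lambda>x. vjump D (bgrad w) F x * vjump D (bgrad z) F x)"
      by (intro edge_integral_linear[OF D F] continuous_intros vjump_continuous v w z)
    finally show ?thesis .
  qed
  have 2: "edge_integral F (\<lambda>x. jump D (\<lambda>K x. v K x + t * w K x) F x \<bullet> jump D z F x) =
      edge_integral F (\<lambda>x. jump D v F x \<bullet> jump D z F x) + t * edge_integral F (\<lambda>x. jump D w F x \<bullet> jump D z F x)"
    if F: "F \<in> edges \<Omega> D" for F
  proof -
    have "edge_integral F (\<lambda>x. jump D (\<lambda>K x. v K x + t * w K x) F x \<bullet> jump D z F x) =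
      edge_integral F (\<lambda>x. jump D v F x \<bullet> jump D z F x + t * (jump D w F x \<bullet> jump D z F x))"
      by (rule edge_integral_cong[OF D F]) (simp add: jump_lincomb inner_add_left)
    also have "\<dots> = edge_integral F (\<lambda>x. jump D v F x \<bullet> jump D z F x) + t * edge_integral F (\<lambda>x. jump D w F x \<bullet> jump D z F x)"
      by (intro edge_integral_linear[OF D F] continuous_intros jump_continuous v w z)
    finally show ?thesis .
  qed
  have "F \<in> edges \<Omega> D" if "F \<in> interior_edges D" for F using that interior_edges_subset by blast
  with 1 2 show ?thesis
    by (simp add: J_h_def distrib_left sum.distrib sum_distrib_left mult.left_commute)
qed

lemma J_h_sym: "J_h \<Omega> D v w = J_h \<Omega> D w v"
  by (simp add: J_h_def mult.commute inner_commute)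

lemma J_h_cong:
  assumes D: "mesh_of \<Omega> D"
    and "\<And>F x. F \<in> interior_edges D \<Longrightarrow> x \<in> F \<Longrightarrow>
      vjump D (bgrad v) F x * vjump D (bgrad w) F x = vjump D (bgrad v') F x * vjump D (bgrad w') F x"
    and "\<And>F x. F \<in> edges \<Omega> D \<Longrightarrow> x \<in> F \<Longrightarrow> jump D v F x \<bullet> jump D w F x = jump D v' F x \<bullet> jump D w' F x"
  shows "J_h \<Omega> D v w = J_h \<Omega> D v' w'"
proof -
  have "edge_integral F (\<lambda>x. vjump D (bgrad v) F x * vjump D (bgrad w) F x) =
     edge_integral F (\<lambda>x. vjump D (bgrad v') F x * vjump D (bgrad w') F x)" if "F \<in> interior_edges D" for F
    by (rule edge_integral_cong[OF D]) (use that interior_edges_subset assms(2) in blast)+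
  moreover have "edge_integral F (\<lambda>x. jump D v F x \<bullet> jump D w F x) =
     edge_integral F (\<lambda>x. jump D v' F x \<bullet> jump D w' F x)" if "F \<in> edges \<Omega> D" for F
    by (rule edge_integral_cong[OF D that]) (use that assms(3) in blast)
  ultimately show ?thesis by (simp add: J_h_def)
qed

lemma edge_diameter_nonneg: "mesh_of \<Omega> D \<Longrightarrow> F \<in> edges \<Omega> D \<Longrightarrow> 0 \<le> diameter F"
  by (metis edges_segment diameter_closed_segment zero_le_dist)

lemma finite_edges:
  assumes D: "mesh_of \<Omega> D"
  shows "finite (edges \<Omega> D)"
proof (rule finite_subset)
  show "edges \<Omega> D \<subseteq> (\<Union>K\<in>elems D. {F. F edge_of K})"
    by (auto simp: edges_def interior_edges_def boundary_edges_def)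
  show "finite (\<Union>K\<in>elems D. {F. F edge_of K})"
    using elems_finite[OF D] finite_elem_edges[OF D] by blast
qed

lemma
  assumes D: "mesh_of \<Omega> D" and v: "C1_broken D v"
  shows J_h_nonneg: "0 \<le> J_h \<Omega> D v v"
    and J_h_eq_0_vjump: "J_h \<Omega> D v v = 0 \<Longrightarrow> F \<in> interior_edges D \<Longrightarrow> x \<in> F \<Longrightarrow> diameter F \<noteq> 0 \<Longrightarrow> vjump D (bgrad v) F x = 0"
    and J_h_eq_0_jump: "J_h \<Omega> D v v = 0 \<Longrightarrow> F \<in> edges \<Omega> D \<Longrightarrow> x \<in> F \<Longrightarrow> diameter F \<noteq> 0 \<Longrightarrow> jump D v F x = 0"
proof -
  let ?A = "\<lambda>F. inverse (diameter F) * edge_integral F (\<lambda>x. vjump D (bgrad v) F x * vjump D (bgrad v) F x)"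
  let ?B = "\<lambda>F. inverse (diameter F ^ 3) * edge_integral F (\<lambda>x. jump D v F x \<bullet> jump D v F x)"
  note cA = continuous_on_mult[OF vjump_continuous[OF v] vjump_continuous[OF v]]
  note cB = continuous_on_inner[OF jump_continuous[OF v] jump_continuous[OF v]]
  have A: "0 \<le> ?A F" if "F \<in> interior_edges D" for F
  proof -
    have "F \<in> edges \<Omega> D" using that interior_edges_subset by blast
    from edge_integral_nonneg(1)[OF D this cA] edge_diameter_nonneg[OF D this] show ?thesis by auto
  qed
  have B: "0 \<le> ?B F" if "F \<in> edges \<Omega> D" for F
    using edge_integral_nonneg(1)[OF D that cB] edge_diameter_nonneg[OF D that] by auto
  have J: "J_h \<Omega> D v v = sum ?A (interior_edges D) + sum ?B (edges \<Omega> D)" by (simp add: J_h_def)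
  have fin: "finite (interior_edges D)" "finite (edges \<Omega> D)"
    using finite_edges[OF D] interior_edges_subset finite_subset by blast+
  have s: "0 \<le> sum ?A (interior_edges D)" "0 \<le> sum ?B (edges \<Omega> D)"
    using A B by (auto intro!: sum_nonneg)
  then show "0 \<le> J_h \<Omega> D v v" unfolding J by simp
  show "vjump D (bgrad v) F x = 0" if "J_h \<Omega> D v v = 0" and F: "F \<in> interior_edges D" "x \<in> F" "diameter F \<noteq> 0"
  proof -
    have "sum ?A (interior_edges D) = 0" using that(1) s unfolding J by linarith
    then have "?A F = 0" using sum_nonneg_eq_0_iff[OF fin(1), of ?A] A F(1) by blast
    then have "edge_integral F (\<lambda>x. vjump D (bgrad v) F x * vjump D (bgrad v) F x) = 0" using F(3) by simp
    moreover have Fe: "F \<in> edges \<Omega> D" using F(1) interior_edges_subset by blast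
    ultimately have "\<forall>x\<in>F. vjump D (bgrad v) F x * vjump D (bgrad v) F x = 0"
      by (intro edge_integral_nonneg(2)[OF D Fe cA _ _ F(3)]) simp_all
    with F(2) show ?thesis by simp
  qed
  show "jump D v F x = 0" if "J_h \<Omega> D v v = 0" and F: "F \<in> edges \<Omega> D" "x \<in> F" "diameter F \<noteq> 0"
  proof -
    have "sum ?B (edges \<Omega> D) = 0" using that(1) s unfolding J by linarith
    then have "?B F = 0" using sum_nonneg_eq_0_iff[OF fin(2), of ?B] B F(1) by blast
    then have "edge_integral F (\<lambda>x. jump D v F x \<bullet> jump D v F x) = 0" using F(3) by simp
    then have "\<forall>x\<in>F. jump D v F x \<bullet> jump D v F x = 0"
      by (intro edge_integral_nonneg(2)[OF D F(1) cB _ _ F(3)]) simp_all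
    with F(2) show ?thesis by simp
  qed
qed

lemma interior_edge_elems:
  assumes D: "mesh_of \<Omega> D" and F: "F \<in> interior_edges D"
  obtains K K' where "K \<in> elems D" "K' \<in> elems D" "K \<noteq> K'" "F edge_of K" "F edge_of K'"
    "{T \<in> elems D. F edge_of T} = {K, K'}" "outer_normal K' F = - outer_normal K F"
proof -
  obtain K K' where K: "K \<in> elems D" "K' \<in> elems D" "K \<noteq> K'" "F edge_of K" "F edge_of K'"
    using F unfolding interior_edges_def by blast
  from that[OF K at_most_two_elems[OF D K] outer_normals_opposite[OF D K]] show ?thesis .
qed

lemma boundary_edge_elem:
  assumes \<Omega>: "convex_polygonal_domain \<Omega>" and D: "mesh_of \<Omega> D" and F: "F \<in> boundary_edges \<Omega> D"
  obtains K where "K \<in> elems D" "F edge_of K" "{T \<in> elems D. F edge_of T} = {K}"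
proof -
  obtain K where K: "K \<in> elems D" "F edge_of K" and Ff: "F \<subseteq> frontier \<Omega>"
    using F unfolding boundary_edges_def by blast
  have "T = K" if "T \<in> elems D" "F edge_of T" for T
    using boundary_edge_unique_elem[OF \<Omega> D that(1) K(1) that(2) K(2) Ff] .
  then have "{T \<in> elems D. F edge_of T} = {K}" using K by blast
  with K show ?thesis by (rule that)
qed

lemma card_edge_elems:
  assumes \<Omega>: "convex_polygonal_domain \<Omega>" and D: "mesh_of \<Omega> D" and F: "F \<in> edges \<Omega> D"
  shows "card {T \<in> elems D. F edge_of T} \<le> 2"
proof (cases "F \<in> interior_edges D")
  case True
  then obtain K K' where "{T \<in> elems D. F edge_of T} = {K, K'}"
    by (rule interior_edge_elems[OF D])
  then show ?thesis using card_insert_le_m1[of 2 "{K'}" K] by simp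
next
  case False
  then have "F \<in> boundary_edges \<Omega> D" using F by (simp add: edges_def)
  then obtain K where "{T \<in> elems D. F edge_of T} = {K}"
    by (rule boundary_edge_elem[OF \<Omega> D])
  then show ?thesis by simp
qed

text \<open>On interior edges the two normals are opposite and the traces coincide; on boundary edges the
  Dirichlet datum is zero.\<close>

lemma exact_jumps:
  assumes \<Omega>: "convex_polygonal_domain \<Omega>" and D: "mesh_of \<Omega> D" and u: "C2_on (closure \<Omega>) u"
    and u0: "\<And>x. x \<in> frontier \<Omega> \<Longrightarrow> u x = 0"
  shows "F \<in> edges \<Omega> D \<Longrightarrow> x \<in> F \<Longrightarrow> jump D (\<lambda>_. u) F x = 0"
    and "F \<in> interior_edges D \<Longrightarrow> x \<in> F \<Longrightarrow> vjump D (bgrad (\<lambda>_. u)) F x = 0"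
proof -
  have int: "jump D (\<lambda>_. u) F x = 0 \<and> vjump D (bgrad (\<lambda>_. u)) F x = 0" if F: "F \<in> interior_edges D" "x \<in> F" for F x
  proof -
    obtain K K' where K: "K \<in> elems D" "K' \<in> elems D" "K \<noteq> K'" "F edge_of K" "F edge_of K'"
      "{T \<in> elems D. F edge_of T} = {K, K'}" "outer_normal K' F = - outer_normal K F"
      using interior_edge_elems[OF D F(1)] by blast
    have "x \<in> K" "x \<in> K'" using K F(2) edge_of_imp_subset by blast+
    then have "grad_on K u x = grad_on K' u x" using grad_on_C2[OF \<Omega> D u] K by metis
    then show ?thesis using K by (simp add: jump_def vjump_def bgrad_def)
  qed
  then show "F \<in> interior_edges D \<Longrightarrow> x \<in> F \<Longrightarrow> vjump D (bgrad (\<lambda>_. u)) F x = 0" by blast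
  show "jump D (\<lambda>_. u) F x = 0" if F: "F \<in> edges \<Omega> D" "x \<in> F"
  proof (cases "F \<in> interior_edges D")
    case True
    then show ?thesis using int F by blast
  next
    case False
    then have "x \<in> frontier \<Omega>" using F by (auto simp: edges_def boundary_edges_def)
    then show ?thesis by (simp add: jump_def u0)
  qed
qed

section \<open>Riesz representation on a finitely generated space of functions\<close>

text \<open>The span, generated by adding one multiple at a time, the form in which equality of functionals
  follows by induction.\<close>

inductive spanned :: "('k \<Rightarrow> 'x \<Rightarrow> real) set \<Rightarrow> ('k \<Rightarrow> 'x \<Rightarrow> real) \<Rightarrow> bool" for S where
  zero: "spanned S (\<lambda>_ _. 0)"
| step: "spanned S v \<Longrightarrow> s \<in> S \<Longrightarrow> spanned S (\<lambda>k x. v k x + t * s k x)"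

lemma spanned_lincomb:
  assumes v: "spanned S v" and w: "spanned S w"
  shows "spanned S (\<lambda>k x. v k x + t * w k x)"
  using w
proof (induction rule: spanned.induct)
  case zero
  then show ?case using v by simp
next
  case (step w s r)
  from spanned.step[OF step.IH step.hyps(2), of "t * r"] show ?case
    by (simp add: algebra_simps)
qed

lemma spanned_mono: "spanned S v \<Longrightarrow> S \<subseteq> S' \<Longrightarrow> spanned S' v"
  by (induction rule: spanned.induct) (auto intro: spanned.intros)

lemma spanned_sum: "(\<And>i. i \<in> I \<Longrightarrow> spanned S (f i)) \<Longrightarrow> spanned S (\<lambda>k x. \<Sum>i\<in>I. f i k x)"
proof (induction I rule: infinite_finite_induct)
  case (insert i I)
  then have "spanned S (\<lambda>k x. (\<Sum>i\<in>I. f i k x) + 1 * f i k x)" by (intro spanned_lincomb) auto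
  then show ?case using insert by (simp add: add.commute)
qed (auto intro: spanned.zero)

text \<open>A space of functions with a positive semidefinite form. Representation of functionals that vanish
  on the null vectors is a matter of algebra; definiteness of the discrete form is a separate,
  geometric fact.\<close>

locale semi_inner_space =
  fixes X :: "('k \<Rightarrow> 'x \<Rightarrow> real) set" and a :: "('k \<Rightarrow> 'x \<Rightarrow> real) \<Rightarrow> ('k \<Rightarrow> 'x \<Rightarrow> real) \<Rightarrow> real"
  assumes zero: "(\<lambda>_ _. 0) \<in> X"
    and lincomb: "\<And>v w t. v \<in> X \<Longrightarrow> w \<in> X \<Longrightarrow> (\<lambda>k x. v k x + t * w k x) \<in> X"
    and linear: "\<And>v w z t. v \<in> X \<Longrightarrow> w \<in> X \<Longrightarrow> z \<in> X \<Longrightarrow> a (\<lambda>k x. v k x + t * w k x) z = a v z + t * a w z"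
    and sym: "\<And>v w. a v w = a w v"
    and nonneg: "\<And>v. v \<in> X \<Longrightarrow> 0 \<le> a v v"
begin

lemma linear': "v \<in> X \<Longrightarrow> w \<in> X \<Longrightarrow> z \<in> X \<Longrightarrow> a z (\<lambda>k x. v k x + t * w k x) = a z v + t * a z w"
  using linear[of v w z t] by (simp add: sym[of z])

lemma expand_square:
  "v \<in> X \<Longrightarrow> w \<in> X \<Longrightarrow> a (\<lambda>k x. v k x + t * w k x) (\<lambda>k x. v k x + t * w k x) = a v v + 2 * t * a v w + t\<^sup>2 * a w w"
  using linear[of v w _ t] linear'[of v w _ t] lincomb[of v w t] sym[of v w]
  by (simp add: power2_eq_square algebra_simps)

text \<open>Cauchy-Schwarz in the degenerate case: otherwise \<open>a (w + t v) (w + t v)\<close>, linear in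
  \<open>t\<close>, would become negative.\<close>

lemma null_orthogonal:
  assumes v: "v \<in> X" "a v v = 0" and w: "w \<in> X"
  shows "a v w = 0"
proof (rule ccontr)
  assume ne: "a v w \<noteq> 0"
  define t where "t = - (a w w + 1) / (2 * a v w)"
  have "0 \<le> a w w + 2 * t * a w v + t\<^sup>2 * a v v"
    using nonneg[OF lincomb[OF w v(1)], of t] expand_square[OF w v(1), of t] by simp
  also have "\<dots> = - 1"
  proof -
    have "2 * t * a v w = - (a w w + 1)" using ne by (simp add: t_def)
    then show ?thesis using v(2) by (simp add: sym[of w v])
  qed
  finally show False by simp
qed

lemma spanned_subset: "spanned S v \<Longrightarrow> S \<subseteq> X \<Longrightarrow> v \<in> X"
  by (induction rule: spanned.induct) (auto intro: zero lincomb)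

definition linear_on :: "(('k \<Rightarrow> 'x \<Rightarrow> real) \<Rightarrow> real) \<Rightarrow> bool" where
  "linear_on l \<longleftrightarrow> (\<forall>v\<in>X. \<forall>w\<in>X. \<forall>t. l (\<lambda>k x. v k x + t * w k x) = l v + t * l w)"

lemma linear_on_zero: "linear_on l \<Longrightarrow> l (\<lambda>_ _. 0) = 0"
proof -
  assume "linear_on l"
  from this[unfolded linear_on_def, rule_format, OF zero zero, of "- 1"]
  show ?thesis by simp
qed

lemma linear_on_eq:
  assumes "linear_on l" "linear_on l'" "S \<subseteq> X" "\<And>s. s \<in> S \<Longrightarrow> l s = l' s" and v: "spanned S v"
  shows "l v = l' v"
  using v
proof (induction rule: spanned.induct)
  case zero
  show ?case using linear_on_zero[OF assms(1)] linear_on_zero[OF assms(2)] by simp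
next
  case (step v s t)
  then show ?case using assms spanned_subset[OF step.hyps(1)] unfolding linear_on_def by auto
qed

lemma linear_on_form: "z \<in> X \<Longrightarrow> linear_on (a z)"
  by (simp add: linear_on_def linear')

text \<open>Gram-Schmidt: the new generator \<open>e\<close> is split into its projection \<open>p\<close>
  onto the span of the others, which exists by the induction hypothesis applied to the functional
  \<open>a e\<close>, and an orthogonal residual \<open>r\<close>. The old solution is corrected
  by a multiple of \<open>r\<close>.\<close>

lemma riesz_spanned:
  assumes "finite S" "S \<subseteq> X" "linear_on l" "\<And>v. v \<in> X \<Longrightarrow> a v v = 0 \<Longrightarrow> l v = 0"
  shows "\<exists>u. spanned S u \<and> (\<forall>s\<in>S. a u s = l s)"
  using assms
proof (induction S arbitrary: l rule: finite_induct)
  case empty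
  then show ?case using spanned.zero by blast
next
  case (insert e S)
  have e: "e \<in> X" and S: "S \<subseteq> X" using insert.prems by auto
  obtain u where u: "spanned S u" "\<And>s. s \<in> S \<Longrightarrow> a u s = l s"
    using insert.IH[OF S insert.prems(2,3)] by blast
  have "v \<in> X \<Longrightarrow> a v v = 0 \<Longrightarrow> a e v = 0" for v
    using null_orthogonal[of v e] e sym by simp
  then obtain p where p: "spanned S p" "\<And>s. s \<in> S \<Longrightarrow> a p s = a e s"
    using insert.IH[OF S linear_on_form[OF e]] by blast
  have uX: "u \<in> X" and pX: "p \<in> X" using u p spanned_subset S by blast+
  define r where "r = (\<lambda>k x. e k x + (- 1) * p k x)"
  have rX: "r \<in> X" unfolding r_def by (rule lincomb[OF e pX])
  have rS: "a r s = 0" if "s \<in> S" for s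
    unfolding r_def using linear[OF e pX, of s "- 1"] p(2)[OF that] S that by auto
  have re: "a z e = a z r + a z p" "l e = l r + l p" if "z \<in> X" for z
  proof -
    have e': "e = (\<lambda>k x. r k x + 1 * p k x)" by (simp add: r_def)
    have "a z (\<lambda>k x. r k x + 1 * p k x) = a z r + 1 * a z p" by (rule linear'[OF rX pX that])
    then show "a z e = a z r + a z p" by (subst e') simp
    have "l (\<lambda>k x. r k x + 1 * p k x) = l r + 1 * l p"
      using insert.prems(2) rX pX unfolding linear_on_def by blast
    then show "l e = l r + l p" by (subst e') simp
  qed
  have r: "spanned (insert e S) r"
    unfolding r_def
    using spanned_lincomb[OF spanned.step[OF spanned.zero, of e "insert e S" 1] spanned_mono[OF p(1), of "insert e S"], of "- 1"]
    by auto
  have rp: "a r p = 0"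
    using linear_on_eq[OF linear_on_form[OF rX] _ S _ p(1), of "\<lambda>_. 0"] rS by (simp add: linear_on_def)
  \<comment> \<open>If the residual is null, then so is \<open>l r\<close> by hypothesis, and no correction is
    required.\<close>
  define c where "c = (if a r r = 0 then 0 else (l r - a u r) / a r r)"
  define u' where "u' = (\<lambda>k x. u k x + c * r k x)"
  have u'X: "u' \<in> X" unfolding u'_def by (rule lincomb[OF uX rX])
  have u'S: "a u' s = l s" if "s \<in> S" for s
    unfolding u'_def using linear[OF uX rX, of s c] rS[OF that] u(2)[OF that] S that by auto
  have "a u' r = l r"
  proof (cases "a r r = 0")
    case True
    then have "l r = 0" "a r u = 0" using insert.prems(3)[OF rX] null_orthogonal[OF rX _ uX] by auto
    then show ?thesis unfolding u'_def using linear[OF uX rX rX, of c] True sym[of u r] by simp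
  next
    case False
    then show ?thesis unfolding u'_def using linear[OF uX rX rX, of c] by (simp add: c_def)
  qed
  moreover have "a u' p = l p"
    using linear_on_eq[OF linear_on_form[OF u'X] insert.prems(2) S u'S p(1)] .
  ultimately have "a u' e = l e" using re[OF u'X] by simp
  moreover have "spanned (insert e S) u'"
    unfolding u'_def by (intro spanned_lincomb r spanned_mono[OF u(1)]) auto
  ultimately show ?case using u'S by blast
qed

lemma riesz:
  assumes S: "finite S" "S \<subseteq> X" "\<And>v. v \<in> X \<Longrightarrow> spanned S v"
    and l: "linear_on l" "\<And>v. v \<in> X \<Longrightarrow> a v v = 0 \<Longrightarrow> l v = 0"
  shows "\<exists>u\<in>X. \<forall>v\<in>X. a u v = l v"
proof -
  obtain u where u: "spanned S u" "\<And>s. s \<in> S \<Longrightarrow> a u s = l s"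
    using riesz_spanned[OF S(1,2) l] by blast
  have uX: "u \<in> X" using u S spanned_subset by blast
  have "a u v = l v" if "v \<in> X" for v
    using linear_on_eq[OF linear_on_form[OF uX] l(1) S(2) u(2) S(3)[OF that]] .
  with uX show ?thesis by blast
qed

end

section \<open>The discrete problem is well posed\<close>

lemma broken_poly_lincomb:
  "v \<in> broken_poly k D \<Longrightarrow> w \<in> broken_poly k D \<Longrightarrow> (\<lambda>K x. v K x + t * w K x) \<in> broken_poly k D"
  by (auto simp: broken_poly_def intro!: Pk_add Pk_cmult)

text \<open>The monomial is the polynomial extension of its restriction to \<open>K\<close>; on the other
  elements it is zero.\<close>

definition broken_monomial :: "pt set \<Rightarrow> nat \<Rightarrow> nat \<Rightarrow> real broken" where
  "broken_monomial K i j K' x = (if K' = K then (x $ 1) ^ i * (x $ 2) ^ j else 0)"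

definition broken_basis :: "nat \<Rightarrow> disc \<Rightarrow> real broken set" where
  "broken_basis k D = (\<Union>K\<in>elems D. \<Union>i\<le>k. \<Union>j\<le>k - i. {broken_monomial K i j})"

lemma
  assumes D: "finite (elems D)"
  shows finite_broken_basis: "finite (broken_basis k D)"
    and broken_basis_subset: "broken_basis k D \<subseteq> broken_poly k D"
    and spanned_broken_basis: "v \<in> broken_poly k D \<Longrightarrow> spanned (broken_basis k D) v"
proof -
  show "finite (broken_basis k D)" using D by (simp add: broken_basis_def)
  show "broken_basis k D \<subseteq> broken_poly k D"
  proof
    fix b assume "b \<in> broken_basis k D"
    then obtain K i j where b: "K \<in> elems D" "i \<le> k" "j \<le> k - i" "b = broken_monomial K i j"
      by (auto simp: broken_basis_def)
    then have "(\<lambda>x::pt. 1 * (x $ 1) ^ i * (x $ 2) ^ j) \<in> Pk k" by (intro Pk_monom) auto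
    then have "b K' \<in> Pk k" for K'
      using Pk_const[of 0 k] by (cases "K' = K") (simp_all add: b(4) broken_monomial_def [abs_def])
    moreover have "b K' = (\<lambda>_. 0)" if "K' \<notin> elems D" for K'
      using that b(1) by (auto simp: b(4) broken_monomial_def)
    ultimately show "b \<in> broken_poly k D" by (simp add: broken_poly_def)
  qed
  assume v: "v \<in> broken_poly k D"
  have "\<forall>K\<in>elems D. \<exists>c. \<forall>x. v K x = (\<Sum>i\<le>k. \<Sum>j\<le>k - i. c i j * (x $ 1) ^ i * (x $ 2) ^ j)"
    using v by (auto simp: broken_poly_def Pk_def)
  from bchoice[OF this]
  obtain c where c: "\<And>K x. K \<in> elems D \<Longrightarrow> v K x = (\<Sum>i\<le>k. \<Sum>j\<le>k - i. c K i j * (x $ 1) ^ i * (x $ 2) ^ j)"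
    by blast
  have "v K' x = (\<Sum>K\<in>elems D. \<Sum>i\<le>k. \<Sum>j\<le>k - i. 0 + c K i j * broken_monomial K i j K' x)" for K' x
  proof (cases "K' \<in> elems D")
    case True
    have "(\<Sum>K\<in>elems D. \<Sum>i\<le>k. \<Sum>j\<le>k - i. 0 + c K i j * broken_monomial K i j K' x) =
      (\<Sum>K\<in>{K'}. \<Sum>i\<le>k. \<Sum>j\<le>k - i. 0 + c K i j * broken_monomial K i j K' x)"
    proof (rule sum.mono_neutral_right[OF D])
      show "\<forall>K\<in>elems D - {K'}. (\<Sum>i\<le>k. \<Sum>j\<le>k - i. 0 + c K i j * broken_monomial K i j K' x) = 0"
        by (intro ballI sum.neutral) (auto simp: broken_monomial_def)
    qed (use True in auto)
    then show ?thesis using c[OF True] by (simp add: broken_monomial_def mult.assoc)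
  next
    case False
    then have "v K' x = 0" using v by (simp add: broken_poly_def)
    moreover have "(\<Sum>K\<in>elems D. \<Sum>i\<le>k. \<Sum>j\<le>k - i. 0 + c K i j * broken_monomial K i j K' x) = 0"
      using False by (intro sum.neutral ballI) (auto simp: broken_monomial_def)
    ultimately show ?thesis by simp
  qed
  then have "v = (\<lambda>K' x. \<Sum>K\<in>elems D. \<Sum>i\<le>k. \<Sum>j\<le>k - i. 0 + c K i j * broken_monomial K i j K' x)"
    by (intro ext)
  moreover have "spanned (broken_basis k D) (\<lambda>K' x. \<Sum>K\<in>elems D. \<Sum>i\<le>k. \<Sum>j\<le>k - i. 0 + c K i j * broken_monomial K i j K' x)"
    by (intro spanned_sum spanned.step spanned.zero) (auto simp: broken_basis_def)
  ultimately show "spanned (broken_basis k D) v" by simp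
qed

lemma H_h_lincomb:
  assumes v: "v \<in> broken_poly k D" and w: "w \<in> broken_poly k D" and K: "K \<in> elems D"
  shows "H_h (\<lambda>K x. v K x + t * w K x) K x = H_h v K x + t *\<^sub>R H_h w K x"
proof -
  have p: "v K \<in> Pk k" "w K \<in> Pk k" using v w K by (auto simp: broken_poly_def)
  have "((\<lambda>x. v K x + t * w K x) has_derivative (\<lambda>d. (grad_on UNIV (v K) x + t *\<^sub>R grad_on UNIV (w K) x) \<bullet> d)) (at x)" for x
    using has_derivative_add[OF Pk_has_grad[OF p(1)] has_derivative_mult_right[OF Pk_has_grad[OF p(2)]], of t]
    by (simp add: inner_add_left)
  then have g: "grad_on UNIV (\<lambda>x. v K x + t * w K x) = (\<lambda>x. grad_on UNIV (v K) x + t *\<^sub>R grad_on UNIV (w K) x)"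
    using grad_on_eq[OF convex_UNIV _ UNIV_I] by fastforce
  have "(grad_on UNIV (\<lambda>x. v K x + t * w K x) has_derivative (\<lambda>d. (hess_on UNIV (v K) x + t *\<^sub>R hess_on UNIV (w K) x) *v d)) (at x)"
    unfolding g
    using has_derivative_add[OF Pk_has_hess[OF p(1)] has_derivative_scaleR_right[OF Pk_has_hess[OF p(2)]], of t]
    by (simp add: matrix_vector_mult_add_rdistrib scaleR_matrix_vector_assoc)
  then show ?thesis unfolding H_h_def by (intro hess_on_eq) auto
qed

lemma inner_h_cong:
  "(\<And>K j. K \<in> elems D \<Longrightarrow> j < n_nodes m \<Longrightarrow> V K (node \<xi> D K j) = V' K (node \<xi> D K j)) \<Longrightarrow>
   (\<And>K j. K \<in> elems D \<Longrightarrow> j < n_nodes m \<Longrightarrow> W K (node \<xi> D K j) = W' K (node \<xi> D K j)) \<Longrightarrow>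
   inner_h m \<xi> D V W = inner_h m \<xi> D V' W'"
  unfolding inner_h_def by (intro sum.cong refl) auto

lemma inner_h_sym: "inner_h m \<xi> D V W = inner_h m \<xi> D W V"
  by (simp add: inner_h_def frob_eq_inner inner_commute)

lemma inner_h_linear:
  "inner_h m \<xi> D (\<lambda>K x. V K x + t *\<^sub>R W K x) Z = inner_h m \<xi> D V Z + t * inner_h m \<xi> D W Z"
  by (simp add: inner_h_def frob_eq_inner inner_add_left distrib_left sum.distrib sum_distrib_left mult.left_commute)

text \<open>The part of the weight assumption that enters the algebra of the scheme on a single mesh.\<close>

definition positive_weights :: "nat \<Rightarrow> disc \<Rightarrow> bool" where
  "positive_weights m D \<longleftrightarrow> (\<forall>K\<in>elems D. \<forall>j<n_nodes m. 0 < wt D K j)"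

lemma inner_h_nonneg: "positive_weights m D \<Longrightarrow> 0 \<le> inner_h m \<xi> D V V"
  unfolding inner_h_def frob_eq_inner positive_weights_def
  by (intro sum_nonneg mult_nonneg_nonneg) (auto intro: less_imp_le)

lemma inner_h_eq_0:
  assumes w: "positive_weights m D" and fin: "finite (elems D)" and z: "inner_h m \<xi> D V V = 0"
    and K: "K \<in> elems D" and j: "j < n_nodes m"
  shows "V K (node \<xi> D K j) = 0"
proof -
  let ?t = "\<lambda>K j. wt D K j * frob (V K (node \<xi> D K j)) (V K (node \<xi> D K j))"
  have t: "0 \<le> ?t K j" if "K \<in> elems D" "j < n_nodes m" for K j
    using w that by (auto simp: frob_eq_inner positive_weights_def intro!: mult_nonneg_nonneg intro: less_imp_le)
  have "0 \<le> (\<Sum>j<n_nodes m. ?t K j)" if "K \<in> elems D" for K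
    using t[OF that] by (intro sum_nonneg) simp
  then have "(\<Sum>j<n_nodes m. ?t K j) = 0"
    by (rule sum_nonneg_0[OF fin _ z[unfolded inner_h_def] K])
  then have "?t K j = 0"
    using sum_nonneg_eq_0_iff[of "{..<n_nodes m}" "?t K"] t[OF K] j by auto
  then show ?thesis
    using w[unfolded positive_weights_def, rule_format, OF K j] by (simp add: frob_eq_inner)
qed

lemma a_h_linear:
  assumes D: "mesh_of \<Omega> D" and v: "v \<in> broken_poly k D" and w: "w \<in> broken_poly k D" and z: "z \<in> broken_poly k D"
  shows "a_h \<Omega> m \<xi> \<sigma> D (\<lambda>K x. v K x + t * w K x) z = a_h \<Omega> m \<xi> \<sigma> D v z + t * a_h \<Omega> m \<xi> \<sigma> D w z"
proof -
  have "inner_h m \<xi> D (H_h (\<lambda>K x. v K x + t * w K x)) (H_h z) =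
     inner_h m \<xi> D (\<lambda>K x. H_h v K x + t *\<^sub>R H_h w K x) (H_h z)"
    by (rule inner_h_cong) (auto simp: H_h_lincomb[OF v w])
  then show ?thesis
    using J_h_lincomb[OF D C1_broken_poly[OF D v] C1_broken_poly[OF D w] C1_broken_poly[OF D z], of t]
    by (simp add: a_h_def inner_h_linear algebra_simps)
qed

lemma semi_inner_space_a_h:
  assumes D: "mesh_of \<Omega> D" and w: "positive_weights m D" and \<sigma>: "\<sigma> > 0"
  shows "semi_inner_space (broken_poly k D) (a_h \<Omega> m \<xi> \<sigma> D)"
proof
  show "(\<lambda>_ _. 0) \<in> broken_poly k D" by (simp add: broken_poly_def Pk_const)
  show "0 \<le> a_h \<Omega> m \<xi> \<sigma> D v v" if "v \<in> broken_poly k D" for v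
    unfolding a_h_def using inner_h_nonneg[OF w] J_h_nonneg[OF D C1_broken_poly[OF D that]] \<sigma> by simp
  show "a_h \<Omega> m \<xi> \<sigma> D v w = a_h \<Omega> m \<xi> \<sigma> D w v" for v w
    by (simp add: a_h_def inner_h_sym[of m \<xi> D "H_h v"] J_h_sym[of \<Omega> D v])
qed (auto intro: broken_poly_lincomb a_h_linear[OF D])

lemma hess_zero_affine:
  assumes p: "p \<in> Pk k" and H: "\<And>x. hess_on UNIV p x = 0"
  obtains g c where "p = (\<lambda>x. g \<bullet> x + c)" "\<And>x. grad_on UNIV p x = g"
proof -
  have "(grad_on UNIV p has_derivative (\<lambda>_. 0)) (at x within UNIV)" for x
    using Pk_has_hess[OF p, of x] by (simp add: H)
  from has_derivative_zero_constant[OF convex_UNIV this]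
  obtain g where g: "\<And>x. grad_on UNIV p x = g" by auto
  have "((\<lambda>x. p x - g \<bullet> x) has_derivative (\<lambda>_. 0)) (at x within UNIV)" for x
    by (rule has_derivative_eq_rhs[OF has_derivative_diff[OF Pk_has_grad[OF p]]])
      (auto intro!: derivative_eq_intros simp: g)
  from has_derivative_zero_constant[OF convex_UNIV this]
  obtain c where "\<And>x. p x - g \<bullet> x = c" by auto
  then have "p = (\<lambda>x. g \<bullet> x + c)" by (simp add: fun_eq_iff algebra_simps)
  with g show ?thesis using that by blast
qed

text \<open>Equality at both endpoints controls the tangential part of the gradients, the jump of normal
  derivatives the normal part.\<close>

lemma affine_eq_on_edge:
  fixes g g' n a b :: pt
  assumes ab: "a \<noteq> b" and n: "n \<bullet> (b - a) = 0" "n \<noteq> 0"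
    and eq: "g \<bullet> a + c = g' \<bullet> a + c'" "g \<bullet> b + c = g' \<bullet> b + c'" and gn: "(g - g') \<bullet> n = 0"
  shows "g = g'" "c = c'"
proof -
  have d: "b - a \<noteq> 0" using ab by simp
  have "(g - g') \<bullet> (b - a) = 0" using eq by (simp add: inner_diff_left inner_diff_right)
  then obtain s where s: "g - g' = s *\<^sub>R rot (b - a)" using orthogonal_multiple_rot[OF _ d] by blast
  obtain t where t: "n = t *\<^sub>R rot (b - a)" using orthogonal_multiple_rot[OF n(1) d] by blast
  have "s * (t * (rot (b - a) \<bullet> rot (b - a))) = 0" using gn by (auto simp: s t)
  moreover have "rot (b - a) \<noteq> 0" using norm_rot[of "b - a"] d by (metis norm_eq_zero)
  moreover have "t \<noteq> 0" using n(2) t by auto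
  ultimately have "s = 0" by (metis mult_eq_0_iff inner_eq_zero_iff)
  then show "g = g'" using s by simp
  then show "c = c'" using eq by simp
qed

text \<open>If the affine function were nonzero at \<open>x\<close>, follow infinitely many rays from
  \<open>x\<close> along which its modulus does not decrease. They leave the bounded set through
  distinct frontier points, all but finitely many of which lie outside \<open>V\<close>.\<close>

lemma affine_vanishing_on_frontier:
  fixes \<Omega> :: "pt set"
  assumes \<Omega>: "open \<Omega>" "bounded \<Omega>" and V: "finite V" and z: "\<And>x. x \<in> frontier \<Omega> \<Longrightarrow> x \<notin> V \<Longrightarrow> g \<bullet> x + c = 0"
    and x: "x \<in> \<Omega>"
  shows "g \<bullet> x + c = 0"
proof (rule ccontr)
  assume ne: "g \<bullet> x + c \<noteq> 0"
  \<comment> \<open>The directions \<open>d t\<close> have the same inner product with \<open>g\<close> for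
    all \<open>t\<close>, of the sign of the value at \<open>x\<close>.\<close>
  define e where "e = (if g = 0 then axis 1 1 else sgn (g \<bullet> x + c) *\<^sub>R g)"
  have e0: "e \<noteq> 0" using ne by (auto simp: e_def axis_eq_0_iff sgn_eq_0_iff)
  have ge: "0 \<le> sgn (g \<bullet> x + c) * (g \<bullet> e)"
    using ne by (auto simp: e_def mult.assoc[symmetric] sgn_mult_self_eq)
  have gf: "g \<bullet> rot e = 0" using rot_inner[of g] rot_inner[of e] by (auto simp: e_def rot_def inner_2)
  define d where "d t = e + t *\<^sub>R rot e" for t
  have de: "d t \<bullet> e = e \<bullet> e" for t by (simp add: d_def inner_add_left rot_inner)
  have d0: "d t \<noteq> 0" for t using de[of t] e0 by auto
  have gd: "g \<bullet> d t = g \<bullet> e" for t by (simp add: d_def inner_add_right gf)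
  have "\<exists>s>0. x + s *\<^sub>R d t \<in> frontier \<Omega>" for t
    using ray_to_frontier[OF \<Omega>(2), of x "d t"] x \<Omega>(1) d0 by (metis interior_open)
  then obtain s where s: "\<And>t. s t > 0" "\<And>t. x + s t *\<^sub>R d t \<in> frontier \<Omega>" by metis
  have "x + s t *\<^sub>R d t \<in> V" for t
  proof (rule ccontr)
    assume "x + s t *\<^sub>R d t \<notin> V"
    from z[OF s(2) this] have "g \<bullet> x + c = - (s t * (g \<bullet> e))" by (simp add: inner_add_right gd)
    then have "sgn (g \<bullet> x + c) * (g \<bullet> x + c) = - (s t * (sgn (g \<bullet> x + c) * (g \<bullet> e)))"
      by (metis mult.left_commute mult_minus_right)
    also have "- (s t * (sgn (g \<bullet> x + c) * (g \<bullet> e))) \<le> 0" using s(1)[of t] ge by simp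
    finally have "sgn (g \<bullet> x + c) * (g \<bullet> x + c) \<le> 0" .
    moreover have "sgn (g \<bullet> x + c) * (g \<bullet> x + c) = \<bar>g \<bullet> x + c\<bar>" by (metis abs_sgn mult.commute)
    ultimately show False using ne by linarith
  qed
  then have "range (\<lambda>t. x + s t *\<^sub>R d t) \<subseteq> V" by auto
  then have "finite (range (\<lambda>t. x + s t *\<^sub>R d t))" using V finite_subset by blast
  moreover have "inj (\<lambda>t. x + s t *\<^sub>R d t)"
  proof (rule injI)
    fix t t' assume "x + s t *\<^sub>R d t = x + s t' *\<^sub>R d t'"
    then have eq: "s t *\<^sub>R d t = s t' *\<^sub>R d t'" by simp
    then have "s t * (d t \<bullet> e) = s t' * (d t' \<bullet> e)" by (metis inner_scaleR_left)
    then have "s t = s t'" using e0 by (simp add: de)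
    then have "d t = d t'" using eq s(1)[of t'] by simp
    then have "(t - t') *\<^sub>R rot e = 0" by (simp add: d_def algebra_simps)
    moreover have "rot e \<noteq> 0" using norm_rot[of e] e0 by (metis norm_eq_zero)
    ultimately show "t = t'" by simp
  qed
  ultimately have "finite (UNIV :: real set)" using finite_imageD by blast
  then show False using infinite_UNIV_char_0 by blast
qed

lemma interior_not_finite:
  fixes V :: "pt set"
  assumes "interior K \<noteq> {}" "finite V"
  shows "interior K - V \<noteq> {}"
proof
  assume "interior K - V = {}"
  then have "finite (interior K)" using assms(2) by (metis Diff_eq_empty_iff finite_subset)
  then show False using finite_imp_not_open[of "interior K"] assms(1) by simp
qed

text \<open>The kernel of the form. Neighbours agree because the jump terms control values and normal
  derivatives on the common edge. If two classes of elements carried different affine functions,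
  their unions would split \<open>\<Omega>\<close> without its vertices into two disjoint closed
  parts.\<close>

lemma broken_affine_zero:
  assumes \<Omega>: "convex_polygonal_domain \<Omega>" and D: "mesh_of \<Omega> D" and v: "v \<in> broken_poly k D"
    and H: "\<And>K x. K \<in> elems D \<Longrightarrow> hess_on UNIV (v K) x = 0" and J: "J_h \<Omega> D v v = 0"
  shows "v = (\<lambda>_ _. 0)"
proof -
  note C1 = C1_broken_poly[OF D v]
  have "\<exists>g c. v K = (\<lambda>x. g \<bullet> x + c) \<and> (\<forall>x. grad_on UNIV (v K) x = g)" if "K \<in> elems D" for K
  proof -
    have "v K \<in> Pk k" using v that by (simp add: broken_poly_def)
    then show ?thesis by (rule hess_zero_affine[OF _ H[OF that]]) blast
  qed
  then obtain g c where gc: "\<And>K. K \<in> elems D \<Longrightarrow> v K = (\<lambda>x. g K \<bullet> x + c K)"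
    and gr: "\<And>K x. K \<in> elems D \<Longrightarrow> grad_on UNIV (v K) x = g K" by metis
  have dF: "diameter F \<noteq> 0" if "K \<in> elems D" "F edge_of K" for F K
    using edge_vertices[OF D that] diameter_closed_segment by (metis dist_eq_0_iff)
  have neighbours: "v K = v K'" if K: "K \<in> elems D" "K' \<in> elems D" "K \<noteq> K'" and F: "F edge_of K" "F edge_of K'" for K K' F
  proof -
    have Fi: "F \<in> interior_edges D" using K F by (auto simp: interior_edges_def)
    then have Fe: "F \<in> edges \<Omega> D" using interior_edges_subset by blast
    note two = at_most_two_elems[OF D K F] and opp = outer_normals_opposite[OF D K F]
    obtain a b where ab: "a \<noteq> b" "F = closed_segment a b"
      using edge_vertices[OF D K(1) F(1)] by metis
    let ?n = "outer_normal K F"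
    have n0: "?n \<noteq> 0" using norm_outer_normal[OF D K(1) F(1)] by auto
    have sub: "F \<subseteq> K" "F \<subseteq> K'" using F edge_of_imp_subset by blast+
    have "?n \<bullet> (b - a) \<le> 0" "?n \<bullet> (a - b) \<le> 0"
      using is_outer_normal_outer_normal[OF D K(1) F(1)] ab sub by (auto simp: is_outer_normal_def)
    then have nab: "?n \<bullet> (b - a) = 0" by (simp add: inner_diff_right)
    have val: "v K x = v K' x" if x: "x \<in> F" for x
    proof -
      have "jump D v F x = 0" using J_h_eq_0_jump[OF D C1 J Fe x dF[OF K(1) F(1)]] .
      then have "(v K x - v K' x) *\<^sub>R ?n = 0" unfolding jump_def two using K(3) opp by (simp add: algebra_simps)
      then show ?thesis using n0 by simp
    qed
    have aF: "a \<in> F" "b \<in> F" using ab by auto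
    have "vjump D (bgrad v) F a = 0" using J_h_eq_0_vjump[OF D C1 J Fi aF(1) dF[OF K(1) F(1)]] .
    moreover have "bgrad v K a = g K" "bgrad v K' a = g K'"
      using grad_on_broken_poly[OF D v] gr K aF sub by (auto simp: bgrad_def)
    ultimately have gn: "(g K - g K') \<bullet> ?n = 0"
      unfolding vjump_def two using K(3) opp by (simp add: inner_diff_left)
    have "g K = g K'" "c K = c K'"
      using affine_eq_on_edge[OF ab(1) nab n0 _ _ gn, of "c K" "c K'"] val[OF aF(1)] val[OF aF(2)] gc K by auto
    then show ?thesis using gc K by simp
  qed
  let ?V = "vertices D"
  have finV: "finite ?V" by (rule finite_vertices[OF D])
  have \<Omega>': "open \<Omega>" "convex \<Omega>" "bounded \<Omega>" using \<Omega> domain_bounded by (auto simp: convex_polygonal_domain_def)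
  have conn: "connected (\<Omega> - ?V)"
    by (rule connected_open_delete_finite) (use \<Omega>' finV convex_connected in auto)
  have cov: "\<Omega> \<subseteq> \<Union>(elems D)" using D closure_subset by (auto simp: mesh_of_def)
  have all_eq: "v K = v K0" if K0: "K0 \<in> elems D" and K: "K \<in> elems D" for K0 K
  proof (rule ccontr)
    assume ne: "v K \<noteq> v K0"
    \<comment> \<open>Both unions are closed and meet at vertices only.\<close>
    let ?A = "\<Union>{T \<in> elems D. v T = v K0}" and ?B = "\<Union>{T \<in> elems D. v T \<noteq> v K0}"
    have fin: "finite (elems D)" by (rule elems_finite[OF D])
    have "closed ?A" "closed ?B"
      using fin elem_compact[OF D] by (auto intro!: closed_Union compact_imp_closed)
    moreover have "\<Omega> - ?V \<subseteq> ?A \<union> ?B" using cov by blast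
    moreover have "?A \<inter> ?B \<inter> (\<Omega> - ?V) = {}"
    proof (rule ccontr)
      assume "?A \<inter> ?B \<inter> (\<Omega> - ?V) \<noteq> {}"
      then obtain x T T' where T: "T \<in> elems D" "v T = v K0" "T' \<in> elems D" "v T' \<noteq> v K0" "x \<in> T" "x \<in> T'" "x \<notin> ?V"
        by blast
      then have "T \<noteq> T'" by auto
      from common_point_common_edge[OF D T(1,3) this T(5-7)] neighbours[OF T(1,3) this] T show False by auto
    qed
    moreover have "T \<inter> (\<Omega> - ?V) \<noteq> {}" if "T \<in> elems D" for T
      using interior_not_finite[OF elem_interior[OF D that] finV] elem_interior_subset[OF \<Omega> D that] interior_subset[of T] by blast
    then have "?A \<inter> (\<Omega> - ?V) \<noteq> {}" "?B \<inter> (\<Omega> - ?V) \<noteq> {}" using K0 K ne by blast+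
    ultimately show False using conn unfolding connected_closed by blast
  qed
  have zero: "v K x = 0" if K: "K \<in> elems D" for K x
  proof -
    have bd: "g K \<bullet> y + c K = 0" if y: "y \<in> frontier \<Omega>" "y \<notin> ?V" for y
    proof -
      obtain F K' where F: "F \<in> boundary_edges \<Omega> D" "K' \<in> elems D" "F edge_of K'" "y \<in> F"
        using frontier_point_on_boundary_edge[OF \<Omega> D y] .
      obtain K'' where "{T \<in> elems D. F edge_of T} = {K''}"
        using boundary_edge_elem[OF \<Omega> D F(1)] by metis
      then have one: "{T \<in> elems D. F edge_of T} = {K'}" using F by blast
      have "F \<in> edges \<Omega> D" using F by (simp add: edges_def)
      from J_h_eq_0_jump[OF D C1 J this F(4) dF[OF F(2,3)]]
      have "v K' y *\<^sub>R outer_normal K' F = 0" unfolding jump_def one by simp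
      moreover have "outer_normal K' F \<noteq> 0" using norm_outer_normal[OF D F(2,3)] by auto
      ultimately have "v K' y = 0" by simp
      then have "v K y = 0" using all_eq[OF F(2) K] by simp
      then show ?thesis using gc[OF K] by simp
    qed
    have z: "g K \<bullet> y + c K = 0" if "y \<in> \<Omega>" for y
      by (rule affine_vanishing_on_frontier[OF \<Omega>'(1,3) finV bd that])
    obtain y e where e: "e > 0" "ball y e \<subseteq> interior K"
      using elem_interior[OF D K] open_interior open_contains_ball by (metis all_not_in_conv)
    have "p = g K \<bullet> x + c K \<Longrightarrow> p = 0" for p :: real and x
    proof -
      assume p: "p = g K \<bullet> x + c K"
      have sub: "ball y e \<subseteq> \<Omega>" using e(2) elem_interior_subset[OF \<Omega> D K] by blast
      have yz: "g K \<bullet> y + c K = 0" by (rule z) (use sub e(1) in auto)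
      define r where "r = e / (2 * (norm (x - y) + 1))"
      have r: "r > 0" using e(1) by (simp add: r_def add_nonneg_pos)
      have "norm (r *\<^sub>R (x - y)) = e * (norm (x - y) / (2 * (norm (x - y) + 1)))" using e(1) by (simp add: r_def)
      also have "\<dots> < e * 1" using e(1) by (intro mult_strict_left_mono) (auto simp: divide_less_eq add_nonneg_pos)
      finally have "y + r *\<^sub>R (x - y) \<in> \<Omega>" using sub by (auto simp: subset_iff dist_norm)
      from z[OF this] have "g K \<bullet> y + r * (g K \<bullet> (x - y)) + c K = 0" by (simp add: inner_add_right)
      with yz have "r * (g K \<bullet> (x - y)) = 0" by linarith
      then have "g K \<bullet> (x - y) = 0" using r by simp
      then show "p = 0" using yz p by (simp add: inner_diff_right)
    qed
    then show ?thesis using gc[OF K] by simp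
  qed
  have "v K x = 0" for K x
    using zero v by (cases "K \<in> elems D") (auto simp: broken_poly_def)
  then show ?thesis by (intro ext)
qed

text \<open>Vanishing of the nodal form gives a vanishing Hessian at the nodes, hence everywhere, since its
  entries have degree \<open>k - 2\<close> and the nodes are unisolvent for that degree.\<close>

lemma a_h_definite:
  assumes \<Omega>: "convex_polygonal_domain \<Omega>" and D: "mesh_of \<Omega> D" and w: "positive_weights (k - 2) D" and \<sigma>: "\<sigma> > 0"
    and \<xi>: "unisolvent (k - 2) \<xi>" and v: "v \<in> broken_poly k D" and z: "a_h \<Omega> (k - 2) \<xi> \<sigma> D v v = 0"
  shows "v = (\<lambda>_ _. 0)"
proof -
  let ?m = "k - 2"
  have "0 \<le> inner_h ?m \<xi> D (H_h v) (H_h v)" "0 \<le> \<sigma> * J_h \<Omega> D v v"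
    using inner_h_nonneg[OF w] J_h_nonneg[OF D C1_broken_poly[OF D v]] \<sigma> by auto
  then have i0: "inner_h ?m \<xi> D (H_h v) (H_h v) = 0" and "\<sigma> * J_h \<Omega> D v v = 0"
    using z unfolding a_h_def by linarith+
  then have J: "J_h \<Omega> D v v = 0" using \<sigma> by simp
  have "hess_on UNIV (v K) x = 0" if K: "K \<in> elems D" for K x
  proof -
    have p: "v K \<in> Pk k" using v K by (simp add: broken_poly_def)
    have "(\<lambda>x. hess_on UNIV (v K) x $ a $ b) = (\<lambda>x. 0)" for a b
    proof (rule Pk_eq_nodes[OF D K \<xi> Pk_hess[OF p] Pk_const])
      show "hess_on UNIV (v K) (node \<xi> D K j) $ a $ b = 0" if "j < n_nodes ?m" for j
        using inner_h_eq_0[OF w elems_finite[OF D] i0 K that] by (simp add: H_h_def)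
    qed
    then show ?thesis by (simp add: vec_eq_iff fun_eq_iff)
  qed
  then show ?thesis using broken_affine_zero[OF \<Omega> D v _ J] by blast
qed

lemma ex1_is_solution:
  assumes \<Omega>: "convex_polygonal_domain \<Omega>" and D: "mesh_of \<Omega> D" and w: "positive_weights (k - 2) D" and \<sigma>: "\<sigma> > 0"
    and \<xi>: "unisolvent (k - 2) \<xi>"
  shows "\<exists>!u. is_solution \<Omega> k (k - 2) \<xi> \<sigma> D P u"
proof -
  interpret semi_inner_space "broken_poly k D" "a_h \<Omega> (k - 2) \<xi> \<sigma> D"
    by (rule semi_inner_space_a_h[OF D w \<sigma>])
  let ?X = "broken_poly k D" and ?a = "a_h \<Omega> (k - 2) \<xi> \<sigma> D" and ?l = "\<lambda>v. inner_h (k - 2) \<xi> D P (H_h v)"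
  note fin = elems_finite[OF D]
  have lin: "linear_on ?l"
    unfolding linear_on_def
  proof (intro ballI allI)
    fix v w t assume vw: "v \<in> ?X" "w \<in> ?X"
    have "?l (\<lambda>K x. v K x + t * w K x) = inner_h (k - 2) \<xi> D (\<lambda>K x. H_h v K x + t *\<^sub>R H_h w K x) P"
      unfolding inner_h_sym[of _ _ _ P] by (rule inner_h_cong) (auto simp: H_h_lincomb[OF vw])
    then show "?l (\<lambda>K x. v K x + t * w K x) = ?l v + t * ?l w"
      by (simp add: inner_h_linear inner_h_sym[of _ _ _ P])
  qed
  have null: "v = (\<lambda>_ _. 0)" if "v \<in> ?X" "?a v v = 0" for v
    by (rule a_h_definite[OF \<Omega> D w \<sigma> \<xi> that])
  have "?l v = 0" if "v \<in> ?X" "?a v v = 0" for v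
    using null[OF that] linear_on_zero[OF lin] by simp
  then obtain u where u: "u \<in> ?X" "\<And>v. v \<in> ?X \<Longrightarrow> ?a u v = ?l v"
    using riesz[OF finite_broken_basis[OF fin] broken_basis_subset[OF fin] spanned_broken_basis[OF fin] lin] by blast
  show ?thesis
  proof (rule ex1I[of _ u])
    show "is_solution \<Omega> k (k - 2) \<xi> \<sigma> D P u" using u by (simp add: is_solution_def)
  next
    fix u' assume u': "is_solution \<Omega> k (k - 2) \<xi> \<sigma> D P u'"
    then have X: "u' \<in> ?X" by (simp add: is_solution_def)
    let ?d = "\<lambda>K x. u' K x + (- 1) * u K x"
    have dX: "?d \<in> ?X" using lincomb[OF X u(1)] .
    have "?a ?d ?d = ?a u' ?d + (- 1) * ?a u ?d" by (rule linear[OF X u(1) dX])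
    also have "\<dots> = 0" using u(2)[OF dX] u' dX by (simp add: is_solution_def)
    finally have "?d = (\<lambda>_ _. 0)" by (rule null[OF dX])
    then have "u' K x = u K x" for K x by (simp add: fun_eq_iff)
    then show "u' = u" by (intro ext)
  qed
qed

text \<open>Testing with the solution gives \<open>a_h(u, u) = (P, H_h u)\<close>, and expanding \<open>0
  \<le> |H_h u - P|\<^sup>2\<close> bounds the right-hand side.\<close>

lemma solution_energy_le:
  assumes D: "mesh_of \<Omega> D" and w: "positive_weights m D" and \<sigma>: "\<sigma> > 0" and u: "is_solution \<Omega> k m \<xi> \<sigma> D P u"
  shows "a_h \<Omega> m \<xi> \<sigma> D u u \<le> inner_h m \<xi> D P P"
proof -
  have uX: "u \<in> broken_poly k D" and e: "a_h \<Omega> m \<xi> \<sigma> D u u = inner_h m \<xi> D P (H_h u)"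
    using u by (auto simp: is_solution_def)
  let ?d = "\<lambda>K x. P K x + (- 1) *\<^sub>R H_h u K x"
  have "0 \<le> inner_h m \<xi> D ?d ?d" by (rule inner_h_nonneg[OF w])
  also have "\<dots> = inner_h m \<xi> D P P - 2 * inner_h m \<xi> D P (H_h u) + inner_h m \<xi> D (H_h u) (H_h u)"
  proof -
    have l: "inner_h m \<xi> D ?d Z = inner_h m \<xi> D P Z - inner_h m \<xi> D (H_h u) Z" for Z
      using inner_h_linear[of m \<xi> D P "- 1" "H_h u" Z] by simp
    have "inner_h m \<xi> D ?d ?d = inner_h m \<xi> D ?d P - inner_h m \<xi> D ?d (H_h u)"
      unfolding l[of ?d] by (simp only: inner_h_sym[of m \<xi> D P ?d] inner_h_sym[of m \<xi> D "H_h u" ?d])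
    then show ?thesis unfolding l inner_h_sym[of m \<xi> D "H_h u" P] by linarith
  qed
  also have "inner_h m \<xi> D (H_h u) (H_h u) \<le> a_h \<Omega> m \<xi> \<sigma> D u u"
    using J_h_nonneg[OF D C1_broken_poly[OF D uX]] \<sigma> by (simp add: a_h_def)
  finally show ?thesis using e by simp
qed

lemma discrete_problem_well_posed:
  assumes "convex_polygonal_domain \<Omega>" and D: "mesh_of \<Omega> D" and w: "positive_weights (k - 2) D" and \<sigma>: "\<sigma> > 0"
    and "unisolvent (k - 2) \<xi>"
  shows "well_posed \<Omega> k (k - 2) \<xi> \<sigma> D"
  unfolding well_posed_def
proof (intro conjI ballI exI[of _ "1::real"] allI impI)
  show "\<exists>!u. is_solution \<Omega> k (k - 2) \<xi> \<sigma> D P u" for P by (rule ex1_is_solution[OF assms])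
  show "sqrt (a_h \<Omega> (k - 2) \<xi> \<sigma> D u u) \<le> 1 * norm_h (k - 2) \<xi> D P" if "is_solution \<Omega> k (k - 2) \<xi> \<sigma> D P u" for P u
    using solution_energy_le[OF D w \<sigma> that] by (simp add: norm_h_def)
qed

section \<open>The discrete norm\<close>

text \<open>Exhibits the discrete norm as a weighted Euclidean norm of nodal values, from which the triangle
  inequality follows.\<close>

lemma norm_h_eq_L2_set:
  assumes w: "positive_weights m D"
  shows "norm_h m \<xi> D V = L2_set (\<lambda>(K, j). sqrt (wt D K j) * norm (V K (node \<xi> D K j))) (elems D \<times> {..<n_nodes m})"
proof -
  have "inner_h m \<xi> D V V = (\<Sum>(K, j)\<in>elems D \<times> {..<n_nodes m}. (sqrt (wt D K j) * norm (V K (node \<xi> D K j)))\<^sup>2)"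
    unfolding inner_h_def sum.cartesian_product[symmetric]
  proof (intro sum.cong refl)
    fix K j assume "K \<in> elems D" "j \<in> {..<n_nodes m}"
    then have "0 < wt D K j" using w by (simp add: positive_weights_def)
    then show "wt D K j * frob (V K (node \<xi> D K j)) (V K (node \<xi> D K j)) =
        (sqrt (wt D K j) * norm (V K (node \<xi> D K j)))\<^sup>2"
      by (simp add: frob_eq_inner power_mult_distrib power2_norm_eq_inner)
  qed
  then show ?thesis by (simp add: norm_h_def L2_set_def split_beta)
qed

lemma norm_h_nonneg: "positive_weights m D \<Longrightarrow> 0 \<le> norm_h m \<xi> D V"
  by (simp add: norm_h_eq_L2_set L2_set_nonneg)

lemma norm_h_square: "positive_weights m D \<Longrightarrow> (norm_h m \<xi> D V)\<^sup>2 = inner_h m \<xi> D V V"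
  by (simp add: norm_h_def inner_h_nonneg)

lemma norm_h_triangle:
  assumes w: "positive_weights m D"
  shows "norm_h m \<xi> D (\<lambda>K x. V K x + W K x) \<le> norm_h m \<xi> D V + norm_h m \<xi> D W"
proof -
  let ?s = "\<lambda>V. \<lambda>(K, j). sqrt (wt D K j) * norm (V K (node \<xi> D K j))"
  let ?I = "elems D \<times> {..<n_nodes m}"
  have "norm_h m \<xi> D (\<lambda>K x. V K x + W K x) \<le> L2_set (\<lambda>i. ?s V i + ?s W i) ?I"
    unfolding norm_h_eq_L2_set[OF w]
  proof (rule L2_set_mono)
    fix i assume "i \<in> ?I"
    then obtain K j where i: "i = (K, j)" "0 < wt D K j" using w by (auto simp: positive_weights_def)
    then have "sqrt (wt D K j) * norm (V K (node \<xi> D K j) + W K (node \<xi> D K j)) \<le>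
        sqrt (wt D K j) * (norm (V K (node \<xi> D K j)) + norm (W K (node \<xi> D K j)))"
      by (intro mult_left_mono norm_triangle_ineq) simp
    then show "?s (\<lambda>K x. V K x + W K x) i \<le> ?s V i + ?s W i"
      by (simp add: i(1) distrib_left)
    show "0 \<le> ?s (\<lambda>K x. V K x + W K x) i" using i by simp
  qed
  also have "\<dots> \<le> L2_set (?s V) ?I + L2_set (?s W) ?I" by (rule L2_set_triangle_ineq)
  finally show ?thesis by (simp only: norm_h_eq_L2_set[OF w])
qed

lemma norm_h_triangle_diff:
  assumes w: "positive_weights m D"
  shows "norm_h m \<xi> D (\<lambda>K x. U K x - W K x) \<le>
    norm_h m \<xi> D (\<lambda>K x. U K x - V K x) + norm_h m \<xi> D (\<lambda>K x. V K x - W K x)"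
  using norm_h_triangle[OF w, of \<xi> "\<lambda>K x. U K x - V K x" "\<lambda>K x. V K x - W K x"] by simp

lemma norm_h_commute: "norm_h m \<xi> D (\<lambda>K x. V K x - W K x) = norm_h m \<xi> D (\<lambda>K x. W K x - V K x)"
  by (simp add: norm_h_def inner_h_def frob_eq_inner power2_norm_eq_inner[symmetric] norm_minus_commute)

lemma node_value_le_norm_h:
  assumes w: "positive_weights m D" and fin: "finite (elems D)" and K: "K \<in> elems D" and j: "j < n_nodes m"
  shows "sqrt (wt D K j) * norm (V K (node \<xi> D K j)) \<le> norm_h m \<xi> D V"
proof -
  let ?s = "\<lambda>(K, j). sqrt (wt D K j) * norm (V K (node \<xi> D K j))"
  have "?s (K, j) \<le> L2_set ?s (elems D \<times> {..<n_nodes m})"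
    by (rule member_le_L2_set) (use fin K j in auto)
  then show ?thesis by (simp add: norm_h_eq_L2_set[OF w])
qed

section \<open>Fixed points of contractions of the nodal ball\<close>

text \<open>Banach's theorem on a subset of a type, for a distance that is a metric only on that subset. Off
  \<open>S\<close>, distinct broken functions with equal nodal values have distance zero.\<close>

lemma contraction_fixed_point:
  fixes d :: "'a \<Rightarrow> 'a \<Rightarrow> real"
  assumes S: "x0 \<in> S" and f: "\<And>x. x \<in> S \<Longrightarrow> f x \<in> S"
    and q: "0 \<le> q" "q < 1" "\<And>x y. x \<in> S \<Longrightarrow> y \<in> S \<Longrightarrow> d (f x) (f y) \<le> q * d x y"
    and d: "\<And>x y. 0 \<le> d x y" "\<And>x y. d x y = d y x" "\<And>x y z. d x z \<le> d x y + d y z"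
      "\<And>x. d x x = 0" "\<And>x y. x \<in> S \<Longrightarrow> y \<in> S \<Longrightarrow> d x y = 0 \<Longrightarrow> x = y"
    and complete: "\<And>X. (\<And>n. X n \<in> S) \<Longrightarrow> (\<And>e. e > 0 \<Longrightarrow> \<exists>N. \<forall>i\<ge>N. \<forall>j\<ge>N. d (X i) (X j) < e) \<Longrightarrow>
      \<exists>l\<in>S. (\<lambda>n. d (X n) l) \<longlonglongrightarrow> 0"
  shows "\<exists>x\<in>S. f x = x"
proof -
  define X where "X n = (f ^^ n) x0" for n
  have XS: "X n \<in> S" for n by (induction n) (auto simp: X_def S f)
  have step: "d (X n) (X (Suc n)) \<le> q ^ n * d (X 0) (X 1)" for n
  proof (induction n)
    case (Suc n)
    have "d (X (Suc n)) (X (Suc (Suc n))) \<le> q * d (X n) (X (Suc n))"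
      using q(3)[OF XS XS, of n "Suc n"] by (simp add: X_def)
    also have "\<dots> \<le> q * (q ^ n * d (X 0) (X 1))" using Suc q(1) by (rule mult_left_mono)
    finally show ?case by simp
  qed simp
  \<comment> \<open>The limit of the geometric series, which makes the bound on partial sums telescope.\<close>
  define c where "c = d (X 0) (X 1) / (1 - q)"
  have c0: "0 \<le> c" using d(1) q by (simp add: c_def)
  have far: "d (X n) (X (n + k)) \<le> c * (q ^ n - q ^ (n + k))" for n k
  proof (induction k)
    case 0
    show ?case using d(4) by simp
  next
    case (Suc k)
    have "d (X n) (X (n + Suc k)) \<le> d (X n) (X (n + k)) + d (X (n + k)) (X (Suc (n + k)))"
      using d(3) by simp
    also have "\<dots> \<le> c * (q ^ n - q ^ (n + k)) + q ^ (n + k) * d (X 0) (X 1)"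
      using Suc step by (intro add_mono)
    also have "d (X 0) (X 1) = c * (1 - q)" using q by (simp add: c_def)
    finally show ?case by (simp add: algebra_simps)
  qed
  have near: "d (X i) (X j) \<le> c * q ^ N" if "N \<le> i" "i \<le> j" for N i j
  proof -
    have "d (X i) (X j) \<le> c * (q ^ i - q ^ j)" using far[of i "j - i"] that by simp
    also have "\<dots> \<le> c * q ^ N"
    proof (rule mult_left_mono[OF _ c0])
      have "q ^ i \<le> q ^ N" "0 \<le> q ^ j" using power_decreasing[OF that(1), of q] q by auto
      then show "q ^ i - q ^ j \<le> q ^ N" by linarith
    qed
    finally show ?thesis .
  qed
  have "\<exists>N. \<forall>i\<ge>N. \<forall>j\<ge>N. d (X i) (X j) < e" if e: "e > 0" for e
  proof -
    have "(\<lambda>n. c * q ^ n) \<longlonglongrightarrow> c * 0" using q by (intro tendsto_intros LIMSEQ_realpow_zero)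
    then have "\<forall>\<^sub>F n in sequentially. c * q ^ n < e" using e by (intro order_tendstoD) auto
    then obtain N where N: "c * q ^ N < e" by (auto simp: eventually_sequentially)
    have "d (X i) (X j) < e" if "N \<le> i" "N \<le> j" for i j
      using near[of N i j] near[of N j i] d(2)[of "X i" "X j"] that N by (cases "i \<le> j") auto
    then show ?thesis by blast
  qed
  from complete[OF XS this] obtain l where l: "l \<in> S" "(\<lambda>n. d (X n) l) \<longlonglongrightarrow> 0" by blast
  have "d (f l) l \<le> q * d (X n) l + d (X (Suc n)) l" for n
  proof -
    have "d (f l) l \<le> d (f l) (f (X n)) + d (f (X n)) l" by (rule d(3))
    also have "d (f l) (f (X n)) \<le> q * d l (X n)" by (rule q(3)[OF l(1) XS])
    finally show ?thesis by (simp add: X_def d(2)[of l])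
  qed
  moreover have "(\<lambda>n. q * d (X n) l + d (X (Suc n)) l) \<longlonglongrightarrow> q * 0 + 0"
    by (intro tendsto_intros l(2) LIMSEQ_Suc)
  ultimately have "d (f l) l \<le> q * 0 + 0" by (intro LIMSEQ_le_const) auto
  then have "d (f l) l = 0" using d(1)[of "f l" l] by simp
  then show ?thesis using d(5)[OF f[OF l(1)] l(1)] l(1) by blast
qed

text \<open>Cauchy sequences converge at every node; the limits are interpolated, with symmetry preserved in
  the limit.\<close>

lemma cball_h_complete:
  assumes D: "mesh_of \<Omega> D" and w: "positive_weights m D" and \<xi>: "unisolvent m \<xi>"
    and X: "\<And>n. X n \<in> cball_h m \<xi> D P r"
    and cauchy: "\<And>e. e > 0 \<Longrightarrow> \<exists>N. \<forall>i\<ge>N. \<forall>j\<ge>N. norm_h m \<xi> D (\<lambda>K x. X i K x - X j K x) < e"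
  shows "\<exists>Q\<in>cball_h m \<xi> D P r. (\<lambda>n. norm_h m \<xi> D (\<lambda>K x. X n K x - Q K x)) \<longlonglongrightarrow> 0"
proof -
  note fin = elems_finite[OF D]
  let ?x = "node \<xi> D"
  have "\<exists>l. (\<lambda>n. X n K (?x K j)) \<longlonglongrightarrow> l" if K: "K \<in> elems D" and j: "j < n_nodes m" for K j
  proof -
    have w0: "0 < sqrt (wt D K j)" using w K j by (simp add: positive_weights_def)
    have "Cauchy (\<lambda>n. X n K (?x K j))"
      unfolding Cauchy_def
    proof (intro allI impI)
      fix e :: real assume "e > 0"
      then have "sqrt (wt D K j) * e > 0" using w0 by simp
      from cauchy[OF this] obtain N where N: "\<And>i j'. i \<ge> N \<Longrightarrow> j' \<ge> N \<Longrightarrow>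
        norm_h m \<xi> D (\<lambda>K x. X i K x - X j' K x) < sqrt (wt D K j) * e" by blast
      have "dist (X i K (?x K j)) (X i' K (?x K j)) < e" if "i \<ge> N" "i' \<ge> N" for i i'
      proof -
        have "sqrt (wt D K j) * norm (X i K (?x K j) - X i' K (?x K j)) < sqrt (wt D K j) * e"
          using node_value_le_norm_h[OF w fin K j, of "\<lambda>K x. X i K x - X i' K x" \<xi>] N[OF that] by simp
        then show ?thesis using w0 by (simp add: dist_norm)
      qed
      then show "\<exists>M. \<forall>i\<ge>M. \<forall>i'\<ge>M. dist (X i K (?x K j)) (X i' K (?x K j)) < e" by blast
    qed
    then show ?thesis by (simp add: Cauchy_convergent_iff convergent_def)
  qed
  then obtain L where L: "\<And>K j. K \<in> elems D \<Longrightarrow> j < n_nodes m \<Longrightarrow> (\<lambda>n. X n K (?x K j)) \<longlonglongrightarrow> L K j"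
    by metis
  have Xs: "X n \<in> broken_sym_poly m D" for n using X by (simp add: cball_h_def)
  have Lsym: "L K j $ a $ b = L K j $ b $ a" if "K \<in> elems D" "j < n_nodes m" for K j a b
  proof -
    have "X n K (?x K j) $ a $ b = X n K (?x K j) $ b $ a" for n
    proof -
      have "transpose (X n K (?x K j)) = X n K (?x K j)" using Xs[of n] by (simp add: broken_sym_poly_def)
      from arg_cong[OF this, of "\<lambda>A. A $ b $ a"] show ?thesis by (simp add: transpose_def)
    qed
    then have "(\<lambda>n. X n K (?x K j) $ a $ b) \<longlonglongrightarrow> L K j $ b $ a"
      using tendsto_vec_nth[OF tendsto_vec_nth[OF L[OF that]], of b a] by simp
    with tendsto_vec_nth[OF tendsto_vec_nth[OF L[OF that]], of a b] show ?thesis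
      by (rule LIMSEQ_unique)
  qed
  define p where "p K a b = (if K \<in> elems D then (THE p. p \<in> Pk m \<and> (\<forall>j<n_nodes m. p (?x K j) = L K j $ a $ b)) else (\<lambda>_. 0))" for K a b
  have p: "p K a b \<in> Pk m" "\<And>j. j < n_nodes m \<Longrightarrow> p K a b (?x K j) = L K j $ a $ b" if "K \<in> elems D" for K a b
    using theI'[OF Pk_nodes_unisolvent[OF D that \<xi>, of "\<lambda>j. L K j $ a $ b"]] that by (auto simp: p_def)
  have psym: "p K a b = p K b a" for K a b
  proof (cases "K \<in> elems D")
    case True
    show ?thesis by (rule Pk_eq_nodes[OF D True \<xi> p(1)[OF True] p(1)[OF True]]) (simp add: p(2)[OF True] Lsym[OF True])
  qed (simp add: p_def)
  define Q :: "mat broken" where "Q K x = (\<chi> a b. p K a b x)" for K x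
  have Qs: "Q \<in> broken_sym_poly m D"
    using p(1) psym by (auto simp: broken_sym_poly_def broken_poly_def Q_def transpose_def vec_eq_iff p_def)
  have Qn: "Q K (?x K j) = L K j" if "K \<in> elems D" "j < n_nodes m" for K j
    using p(2)[OF that(1,2)] by (simp add: Q_def vec_eq_iff)
  have "(\<lambda>n. inner_h m \<xi> D (\<lambda>K x. X n K x - Q K x) (\<lambda>K x. X n K x - Q K x)) \<longlonglongrightarrow>
      (\<Sum>K\<in>elems D. \<Sum>j<n_nodes m. wt D K j * ((L K j - L K j) \<bullet> (L K j - L K j)))"
    unfolding inner_h_def frob_eq_inner
    by (intro tendsto_sum tendsto_mult tendsto_const tendsto_inner tendsto_diff) (auto simp: Qn L)
  then have "(\<lambda>n. inner_h m \<xi> D (\<lambda>K x. X n K x - Q K x) (\<lambda>K x. X n K x - Q K x)) \<longlonglongrightarrow> 0" by simp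
  from tendsto_real_sqrt[OF this]
  have lim: "(\<lambda>n. norm_h m \<xi> D (\<lambda>K x. X n K x - Q K x)) \<longlonglongrightarrow> 0" by (simp add: norm_h_def)
  have "norm_h m \<xi> D (\<lambda>K x. Q K x - P K x) \<le> norm_h m \<xi> D (\<lambda>K x. X n K x - Q K x) + r" for n
  proof -
    have "norm_h m \<xi> D (\<lambda>K x. Q K x - P K x) \<le>
       norm_h m \<xi> D (\<lambda>K x. Q K x - X n K x) + norm_h m \<xi> D (\<lambda>K x. X n K x - P K x)"
      by (rule norm_h_triangle_diff[OF w])
    also have "norm_h m \<xi> D (\<lambda>K x. X n K x - P K x) \<le> r" using X by (simp add: cball_h_def)
    finally show ?thesis by (simp add: norm_h_commute[of _ _ _ Q])
  qed
  moreover have "(\<lambda>n. norm_h m \<xi> D (\<lambda>K x. X n K x - Q K x) + r) \<longlonglongrightarrow> 0 + r"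
    by (intro tendsto_intros lim)
  ultimately have "norm_h m \<xi> D (\<lambda>K x. Q K x - P K x) \<le> 0 + r" by (intro LIMSEQ_le_const) auto
  then have "Q \<in> cball_h m \<xi> D P r" using Qs by (simp add: cball_h_def)
  with lim show ?thesis by blast
qed

lemma norm_h_eq_0:
  assumes D: "mesh_of \<Omega> D" and w: "positive_weights m D" and \<xi>: "unisolvent m \<xi>"
    and Q: "Q \<in> broken_sym_poly m D" "R \<in> broken_sym_poly m D"
    and z: "norm_h m \<xi> D (\<lambda>K x. Q K x - R K x) = 0"
  shows "Q = R"
proof -
  have "inner_h m \<xi> D (\<lambda>K x. Q K x - R K x) (\<lambda>K x. Q K x - R K x) = 0"
    using z norm_h_square[OF w, of \<xi> "\<lambda>K x. Q K x - R K x"] by simp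
  note n0 = inner_h_eq_0[OF w elems_finite[OF D] this]
  have QR: "(\<lambda>K x. Q K x $ a $ b) \<in> broken_poly m D" "(\<lambda>K x. R K x $ a $ b) \<in> broken_poly m D" for a b
    using Q by (auto simp: broken_sym_poly_def)
  have "(\<lambda>x. Q K x $ a $ b) = (\<lambda>x. R K x $ a $ b)" for K a b
  proof (cases "K \<in> elems D")
    case True
    show ?thesis
    proof (rule Pk_eq_nodes[OF D True \<xi>])
      show "(\<lambda>x. Q K x $ a $ b) \<in> Pk m" "(\<lambda>x. R K x $ a $ b) \<in> Pk m"
        using QR[of a b] True by (auto simp: broken_poly_def)
      show "Q K (node \<xi> D K j) $ a $ b = R K (node \<xi> D K j) $ a $ b" if "j < n_nodes m" for j
        using n0[OF True that] by simp
    qed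
  next
    case False
    then show ?thesis using QR[of a b] by (simp add: broken_poly_def)
  qed
  then have "Q K x = R K x" for K x by (simp add: vec_eq_iff fun_eq_iff)
  then show ?thesis by (intro ext)
qed

text \<open>Existence is Banach's theorem for the single-valued selection of \<open>T_h\<close>, uniqueness
  the contraction property. Together they show that the definite description of
  \<open>P_star\<close> denotes.\<close>

lemma P_star_fixed_point:
  assumes D: "mesh_of \<Omega> D" and w: "positive_weights m D" and \<xi>: "unisolvent m \<xi>"
    and P: "P \<in> broken_sym_poly m D" and r: "0 \<le> r" and q: "q < 1"
  defines "S \<equiv> cball_h m \<xi> D P r"
  assumes T: "T_contraction \<Omega> k m \<xi> \<sigma> f D q S"
  shows "P_star \<Omega> k m \<xi> \<sigma> f D S \<in> S"
    and "T_h \<Omega> k m \<xi> \<sigma> f D (P_star \<Omega> k m \<xi> \<sigma> f D S) = {P_star \<Omega> k m \<xi> \<sigma> f D S}"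
proof -
  let ?T = "T_h \<Omega> k m \<xi> \<sigma> f D" and ?d = "\<lambda>Q R. norm_h m \<xi> D (\<lambda>K x. Q K x - R K x)"
  have d0: "?d Q Q = 0" for Q by (simp add: norm_h_def inner_h_def frob_eq_inner)
  have PS: "P \<in> S" using P r d0[of P] by (simp add: S_def cball_h_def)
  \<comment> \<open>\<open>T_h\<close> is set-valued with singleton values on \<open>S\<close>.\<close>
  define g where "g Q = (THE R. ?T Q = {R})" for Q
  have g: "?T Q = {g Q}" "g Q \<in> S" if "Q \<in> S" for Q
  proof -
    obtain R where R: "R \<in> S" "?T Q = {R}" using T \<open>Q \<in> S\<close> unfolding T_contraction_def by blast
    then have "g Q = R" by (simp add: g_def)
    with R show "?T Q = {g Q}" "g Q \<in> S" by simp_all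
  qed
  \<comment> \<open>The bound \<open>q\<close> may be negative, whereas the geometric series needs a
    nonnegative ratio.\<close>
  have contr: "?d (g Q) (g R) \<le> max q 0 * ?d Q R" if "Q \<in> S" "R \<in> S" for Q R
  proof -
    have "?d (g Q) (g R) \<le> q * ?d Q R" using T that g(1) unfolding T_contraction_def by blast
    also have "\<dots> \<le> max q 0 * ?d Q R" using norm_h_nonneg[OF w] by (intro mult_right_mono) auto
    finally show ?thesis .
  qed
  have S: "Q \<in> broken_sym_poly m D" if "Q \<in> S" for Q using that by (simp add: S_def cball_h_def)
  have eq: "Q = R" if "Q \<in> S" "R \<in> S" "?d Q R = 0" for Q R
    by (rule norm_h_eq_0[OF D w \<xi> S[OF that(1)] S[OF that(2)] that(3)])
  have "\<exists>Q\<in>S. g Q = Q"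
  proof (rule contraction_fixed_point[where d = ?d and q = "max q 0", OF PS g(2) _ _ contr])
    show "\<exists>l\<in>S. (\<lambda>n. ?d (X n) l) \<longlonglongrightarrow> 0"
      if "\<And>n. X n \<in> S" "\<And>e. e > 0 \<Longrightarrow> \<exists>N. \<forall>i\<ge>N. \<forall>j\<ge>N. ?d (X i) (X j) < e" for X
      unfolding S_def by (rule cball_h_complete[OF D w \<xi>]) (use that in \<open>auto simp: S_def\<close>)
    show "?d Q Q = 0" for Q by (rule d0)
    show "?d Q R = ?d R Q" for Q R by (rule norm_h_commute)
    show "?d U R \<le> ?d U Q + ?d Q R" for U Q R by (rule norm_h_triangle_diff[OF w])
    show "Q = R" if "Q \<in> S" "R \<in> S" "?d Q R = 0" for Q R using eq[OF that] .
  qed (use q in \<open>simp_all add: norm_h_nonneg[OF w]\<close>)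
  then obtain Q where Q: "Q \<in> S" "g Q = Q" by blast
  note Q = Q(1) g(1)[OF Q(1), unfolded Q(2)]
  have uniq: "R = Q" if R: "R \<in> S \<and> ?T R = {R}" for R
  proof -
    define \<delta> where "\<delta> = ?d R Q"
    have "\<delta> \<le> q * \<delta>"
      unfolding \<delta>_def
      using T[unfolded T_contraction_def, THEN conjunct2, rule_format, OF conjunct1[OF R] Q(1), of R Q] R Q(2)
      by blast
    moreover have "0 \<le> \<delta>" unfolding \<delta>_def by (rule norm_h_nonneg[OF w])
    ultimately have "\<delta> = 0" using mult_strict_right_mono[OF q, of \<delta>] by linarith
    then have "?d R Q = 0" by (simp only: \<delta>_def)
    then show ?thesis by (rule eq[OF conjunct1[OF R] Q(1)])
  qed
  have "P_star \<Omega> k m \<xi> \<sigma> f D S = Q"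
    unfolding P_star_def by (rule the_equality) (rule conjI[OF Q], rule uniq)
  with Q show "P_star \<Omega> k m \<xi> \<sigma> f D S \<in> S" "?T (P_star \<Omega> k m \<xi> \<sigma> f D S) = {P_star \<Omega> k m \<xi> \<sigma> f D S}" by simp_all
qed

section \<open>Bounding the jumps of a small error\<close>

lemma sum_over_edges_le:
  fixes g :: "pt set \<Rightarrow> real"
  assumes D: "mesh_of \<Omega> D" and g: "\<And>K. K \<in> elems D \<Longrightarrow> 0 \<le> g K" and E: "E \<subseteq> edges \<Omega> D"
  shows "(\<Sum>F\<in>E. \<Sum>K | K \<in> elems D \<and> F edge_of K. g K) \<le> 8 * (\<Sum>K\<in>elems D. g K)"
proof -
  have fin: "finite E" using finite_edges[OF D] E finite_subset by blast
  have "(\<Sum>F\<in>E. \<Sum>K | K \<in> elems D \<and> F edge_of K. g K) = (\<Sum>K\<in>elems D. \<Sum>F | F \<in> E \<and> F edge_of K. g K)"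
    by (rule sum.swap_restrict[OF fin elems_finite[OF D]])
  also have "\<dots> \<le> (\<Sum>K\<in>elems D. 8 * g K)"
  proof (rule sum_mono)
    fix K assume K: "K \<in> elems D"
    have "card {F. F \<in> E \<and> F edge_of K} \<le> card {F. F edge_of K}"
      by (rule card_mono) (use finite_elem_edges[OF D K] in auto)
    also have "\<dots> \<le> 8" by (rule card_elem_edges[OF D K])
    finally show "(\<Sum>F | F \<in> E \<and> F edge_of K. g K) \<le> 8 * g K"
      using g[OF K] by (simp add: mult_right_mono)
  qed
  finally show ?thesis by (simp add: sum_distrib_left)
qed

lemma square_sum_le_twice:
  fixes y :: "'a \<Rightarrow> real"
  assumes "card S \<le> 2" "\<And>K. K \<in> S \<Longrightarrow> \<bar>y K\<bar> \<le> b K" "\<bar>t\<bar> \<le> (\<Sum>K\<in>S. \<bar>y K\<bar>)"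
  shows "t\<^sup>2 \<le> 2 * (\<Sum>K\<in>S. (b K)\<^sup>2)"
proof -
  have "\<bar>t\<bar> \<le> (\<Sum>K\<in>S. b K)" using assms(3) sum_mono[of S "\<lambda>K. \<bar>y K\<bar>" b] assms(2) by simp
  then have "t\<^sup>2 \<le> (\<Sum>K\<in>S. b K)\<^sup>2"
    using power_mono[of "\<bar>t\<bar>" "\<Sum>K\<in>S. b K" 2] by simp
  also have "\<dots> \<le> (\<Sum>K\<in>S. (b K)\<^sup>2) * card S" by (rule sum_squared_le_sum_of_squares)
  also have "\<dots> \<le> (\<Sum>K\<in>S. (b K)\<^sup>2) * 2" using assms(1) by (intro mult_left_mono sum_nonneg) auto
  finally show ?thesis by simp
qed

text \<open>At most two elements meet in an edge, so the square of a jump is at most twice the sum of the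
  squares of the traces. The negative powers of the edge length are absorbed by the powers of the
  diameter in the hypotheses, edges being comparable to diameters. The factor \<open>16\<close> is
  two elements per edge times at most eight edges per element.\<close>

lemma J_h_error_bound:
  assumes \<Omega>: "convex_polygonal_domain \<Omega>" and D: "mesh_of \<Omega> D" and e: "C1_broken D e"
    and shape: "\<And>K. K \<in> elems D \<Longrightarrow> \<exists>z r. 0 < r \<and> ball z r \<subseteq> K \<and> diameter K \<le> \<gamma> * r"
    and val: "\<And>K x. K \<in> elems D \<Longrightarrow> x \<in> K \<Longrightarrow> \<bar>e K x\<bar> \<le> \<epsilon> K * (diameter K)\<^sup>2"
    and grad: "\<And>K x. K \<in> elems D \<Longrightarrow> x \<in> K \<Longrightarrow> norm (grad_on K (e K) x) \<le> \<epsilon> K * diameter K"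
  shows "J_h \<Omega> D e e \<le> 16 * (1 + \<gamma>\<^sup>2) * (\<Sum>K\<in>elems D. (\<epsilon> K * diameter K)\<^sup>2)"
proof -
  let ?S = "\<lambda>F. {K. K \<in> elems D \<and> F edge_of K}" and ?b = "\<lambda>K. (\<epsilon> K * diameter K)\<^sup>2"
  have dF: "0 < diameter F" "diameter K \<le> \<gamma> * diameter F" if K: "K \<in> elems D" and F: "F edge_of K" for K F
  proof -
    obtain z r where r: "0 < r" "ball z r \<subseteq> K" "diameter K \<le> \<gamma> * r" using shape[OF K] by blast
    have rF: "r \<le> diameter F" by (rule edge_length_ge_inradius[OF D K F r(1,2)])
    with r show "0 < diameter F" by simp
    have "0 < \<gamma> * r" using r(3) elem_diameter_pos[OF D K] by linarith
    then have "0 \<le> \<gamma>" using r(1) by (simp add: zero_less_mult_iff)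
    then show "diameter K \<le> \<gamma> * diameter F" using r(3) rF mult_left_mono by fastforce
  qed
  have n1: "norm (outer_normal K F) = 1" if "K \<in> ?S F" for K F using norm_outer_normal[OF D] that by blast
  have FK: "x \<in> K" if "K \<in> ?S F" "x \<in> F" for K F x using that edge_of_imp_subset by blast
  have dpos: "0 < diameter F" if "F \<in> edges \<Omega> D" for F
    using that dF(1) by (auto simp: edges_def interior_edges_def boundary_edges_def)
  have A: "inverse (diameter F) * edge_integral F (\<lambda>x. vjump D (bgrad e) F x * vjump D (bgrad e) F x) \<le> (\<Sum>K\<in>?S F. 2 * ?b K)"
    if F: "F \<in> edges \<Omega> D" for F
  proof -
    have "edge_integral F (\<lambda>x. vjump D (bgrad e) F x * vjump D (bgrad e) F x) \<le> diameter F * (2 * (\<Sum>K\<in>?S F. ?b K))"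
    proof (rule edge_integral_nonneg(3)[OF D F continuous_on_mult[OF vjump_continuous[OF e] vjump_continuous[OF e]]])
      fix x assume x: "x \<in> F"
      have "(vjump D (bgrad e) F x)\<^sup>2 \<le> 2 * (\<Sum>K\<in>?S F. ?b K)"
      proof (rule square_sum_le_twice[OF card_edge_elems[OF \<Omega> D F], where y = "\<lambda>K. bgrad e K x \<bullet> outer_normal K F"])
        show "\<bar>bgrad e K x \<bullet> outer_normal K F\<bar> \<le> \<epsilon> K * diameter K" if "K \<in> ?S F" for K
          using Cauchy_Schwarz_ineq2[of "bgrad e K x" "outer_normal K F"] n1[OF that] grad[OF _ FK[OF that x]] that
          by (auto simp: bgrad_def)
        show "\<bar>vjump D (bgrad e) F x\<bar> \<le> (\<Sum>K\<in>?S F. \<bar>bgrad e K x \<bullet> outer_normal K F\<bar>)"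
          unfolding vjump_def by (rule sum_abs)
      qed
      then show "vjump D (bgrad e) F x * vjump D (bgrad e) F x \<le> 2 * (\<Sum>K\<in>?S F. ?b K)" by (simp add: power2_eq_square)
    qed auto
    then have "inverse (diameter F) * edge_integral F (\<lambda>x. vjump D (bgrad e) F x * vjump D (bgrad e) F x) \<le>
        inverse (diameter F) * (diameter F * (2 * (\<Sum>K\<in>?S F. ?b K)))"
      using dpos[OF F] by (intro mult_left_mono) auto
    also have "\<dots> = (\<Sum>K\<in>?S F. 2 * ?b K)"
      unfolding sum_distrib_left[symmetric] using dpos[OF F] by simp
    finally show ?thesis .
  qed
  have B: "inverse (diameter F ^ 3) * edge_integral F (\<lambda>x. jump D e F x \<bullet> jump D e F x) \<le> (\<Sum>K\<in>?S F. 2 * \<gamma>\<^sup>2 * ?b K)"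
    if F: "F \<in> edges \<Omega> D" for F
  proof -
    let ?c = "\<lambda>K. (\<epsilon> K * (diameter K)\<^sup>2)\<^sup>2"
    have "edge_integral F (\<lambda>x. jump D e F x \<bullet> jump D e F x) \<le> diameter F * (2 * (\<Sum>K\<in>?S F. ?c K))"
    proof (rule edge_integral_nonneg(3)[OF D F continuous_on_inner[OF jump_continuous[OF e] jump_continuous[OF e]]])
      fix x assume x: "x \<in> F"
      have "(norm (jump D e F x))\<^sup>2 \<le> 2 * (\<Sum>K\<in>?S F. ?c K)"
      proof (rule square_sum_le_twice[OF card_edge_elems[OF \<Omega> D F], where y = "\<lambda>K. e K x"])
        show "\<bar>e K x\<bar> \<le> \<epsilon> K * (diameter K)\<^sup>2" if "K \<in> ?S F" for K
          using val[OF _ FK[OF that x]] that by auto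
        have "norm (jump D e F x) \<le> (\<Sum>K\<in>?S F. norm (e K x *\<^sub>R outer_normal K F))"
          unfolding jump_def by (rule norm_sum)
        also have "\<dots> = (\<Sum>K\<in>?S F. \<bar>e K x\<bar>)" by (rule sum.cong) (use n1 in auto)
        finally show "\<bar>norm (jump D e F x)\<bar> \<le> (\<Sum>K\<in>?S F. \<bar>e K x\<bar>)" by simp
      qed
      then show "jump D e F x \<bullet> jump D e F x \<le> 2 * (\<Sum>K\<in>?S F. ?c K)" by (simp add: power2_norm_eq_inner)
    qed auto
    then have "inverse (diameter F ^ 3) * edge_integral F (\<lambda>x. jump D e F x \<bullet> jump D e F x) \<le>
        inverse (diameter F ^ 3) * (diameter F * (2 * (\<Sum>K\<in>?S F. ?c K)))"
      using dpos[OF F] by (intro mult_left_mono) auto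
    also have "\<dots> = (\<Sum>K\<in>?S F. 2 * (?c K / (diameter F)\<^sup>2))"
    proof -
      have "(\<Sum>K\<in>?S F. 2 * (?c K / (diameter F)\<^sup>2)) = 2 * ((\<Sum>K\<in>?S F. ?c K) / (diameter F)\<^sup>2)"
        by (simp add: sum_distrib_left sum_divide_distrib)
      then show ?thesis using dpos[OF F] by (simp add: power2_eq_square power3_eq_cube field_simps)
    qed
    also have "\<dots> \<le> (\<Sum>K\<in>?S F. 2 * \<gamma>\<^sup>2 * ?b K)"
    proof (rule sum_mono)
      fix K assume K: "K \<in> ?S F"
      have "?c K = ?b K * (diameter K)\<^sup>2" by (simp add: power2_eq_square)
      also have "\<dots> \<le> ?b K * (\<gamma> * diameter F)\<^sup>2"
        using dF(2)[of K F] K elem_diameter_pos[OF D, of K] by (intro mult_left_mono power_mono) auto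
      also have "\<dots> = (\<gamma>\<^sup>2 * ?b K) * (diameter F)\<^sup>2" by (simp add: power_mult_distrib)
      finally show "2 * (?c K / (diameter F)\<^sup>2) \<le> 2 * \<gamma>\<^sup>2 * ?b K"
        using dpos[OF F] by (simp add: divide_le_eq)
    qed
    finally show ?thesis .
  qed
  have "J_h \<Omega> D e e \<le> (\<Sum>F\<in>interior_edges D. \<Sum>K\<in>?S F. 2 * ?b K) + (\<Sum>F\<in>edges \<Omega> D. \<Sum>K\<in>?S F. 2 * \<gamma>\<^sup>2 * ?b K)"
    unfolding J_h_def by (intro add_mono sum_mono A B) (use interior_edges_subset in blast)+
  also have "\<dots> \<le> 8 * (\<Sum>K\<in>elems D. 2 * ?b K) + 8 * (\<Sum>K\<in>elems D. 2 * \<gamma>\<^sup>2 * ?b K)"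
    by (intro add_mono sum_over_edges_le[OF D]) (auto simp: interior_edges_subset)
  also have "\<dots> = 16 * (1 + \<gamma>\<^sup>2) * (\<Sum>K\<in>elems D. ?b K)"
    by (simp add: sum_distrib_left[symmetric] algebra_simps)
  finally show ?thesis .
qed

section \<open>The error estimate on one mesh\<close>

text \<open>One mesh, with all the constants that are uniform over the family made explicit:
  \<open>\<gamma>\<close> for shape regularity, \<open>\<theta>\<close> for quasi-uniformity,
  \<open>c\<close> and \<open>C\<close> for the weights, \<open>\<Lambda>\<close> for the
  reference nodes, and the weak derivatives \<open>w\<close>. The constants defined below do not
  mention \<open>D\<close>, so outside the locale they are visibly independent of the mesh.\<close>

locale discretization =
  fixes \<Omega> :: "pt set" and m :: nat and \<xi> :: "nat \<Rightarrow> pt" and \<sigma> :: real and D :: disc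
    and \<gamma> \<theta> c C \<Lambda> :: real and u :: "pt \<Rightarrow> real" and w :: "nat \<Rightarrow> pt \<Rightarrow> real"
  assumes \<Omega>: "convex_polygonal_domain \<Omega>" and D: "mesh_of \<Omega> D" and m: "m \<ge> 1" and \<sigma>: "\<sigma> > 0"
    and shape: "\<And>K. K \<in> elems D \<Longrightarrow> \<exists>z r. 0 < r \<and> ball z r \<subseteq> K \<and> diameter K \<le> \<gamma> * r"
    and \<theta>: "\<theta> > 0" and quasi: "\<And>K. K \<in> elems D \<Longrightarrow> \<theta> * mesh_size D \<le> diameter K"
    and \<xi>: "unisolvent m \<xi>" and \<Lambda>: "nodal_bound m \<xi> \<Lambda>"
    and c: "c > 0"
    and weights: "\<And>K j. K \<in> elems D \<Longrightarrow> j < n_nodes m \<Longrightarrow>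
      c * (diameter K)\<^sup>2 \<le> wt D K j \<and> wt D K j \<le> C * (diameter K)\<^sup>2"
    and u: "C2_on (closure \<Omega>) u" and u0: "\<And>x. x \<in> frontier \<Omega> \<Longrightarrow> u x = 0"
    and w: "has_Hm_derivs \<Omega> (m + 3) u w"
begin

abbreviation "h \<equiv> mesh_size D"
abbreviation "Hu \<equiv> hess_on (closure \<Omega>) u"
abbreviation "PH \<equiv> P_hat \<Omega> m \<xi> u D"
abbreviation "nrm V \<equiv> norm_h m \<xi> D V"

lemma h_pos: "0 < h" by (rule mesh_size_pos[OF \<Omega> D])

lemma positive: "positive_weights m D"
  unfolding positive_weights_def
proof (intro ballI allI impI)
  fix K j assume "K \<in> elems D" "j < n_nodes m"
  with weights[OF this] elem_diameter_pos[OF D this(1)] c show "0 < wt D K j"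
    by (metis less_le_trans mult_pos_pos zero_less_power)
qed

lemma elems_ne: "elems D \<noteq> {}"
proof
  assume "elems D = {}"
  then have "closure \<Omega> = {}" using D by (simp add: mesh_of_def)
  then show False using \<Omega> by (simp add: convex_polygonal_domain_def)
qed

lemma C_nonneg: "0 \<le> C"
proof -
  obtain K where K: "K \<in> elems D" using elems_ne by blast
  have "0 < c * (diameter K)\<^sup>2" using elem_diameter_pos[OF D K] c by simp
  also have "\<dots> \<le> C * (diameter K)\<^sup>2" using weights[OF K n_nodes_pos] by linarith
  finally show ?thesis using elem_diameter_pos[OF D K] by (simp add: zero_less_mult_iff)
qed

lemma PH_sym: "PH \<in> broken_sym_poly m D"
  unfolding broken_sym_poly_def
proof (intro CollectI conjI allI)
  have comp: "(\<lambda>x. PH K x $ a $ b) = interp m \<xi> D (\<lambda>y. Hu y $ a $ b) K" for K a b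
    by (simp add: P_hat_def interp_mat_def)
  show "(\<lambda>K x. PH K x $ a $ b) \<in> broken_poly m D" for a b
    unfolding comp broken_poly_def using interp_Pk[OF D _ \<xi>] by (auto simp: interp_def)
  fix K x
  have "interp m \<xi> D (\<lambda>y. Hu y $ b $ a) K = interp m \<xi> D (\<lambda>y. Hu y $ a $ b) K" for a b
  proof (cases "K \<in> elems D")
    case True
    show ?thesis
    proof (rule Pk_eq_nodes[OF D True \<xi> interp_Pk[OF D True \<xi>] interp_Pk[OF D True \<xi>]])
      fix j assume j: "j < n_nodes m"
      have "node \<xi> D K j \<in> closure \<Omega>" using node_mem[OF D True \<xi> j] elem_subset[OF D True] by blast
      from arg_cong[OF hess_symmetric[OF \<Omega> u m w this], of "\<lambda>A. A $ b $ a"]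
      show "interp m \<xi> D (\<lambda>y. Hu y $ b $ a) K (node \<xi> D K j) = interp m \<xi> D (\<lambda>y. Hu y $ a $ b) K (node \<xi> D K j)"
        by (simp add: interp_node[OF D True \<xi> j] transpose_def)
    qed
  qed (simp add: interp_def)
  then show "transpose (PH K x) = PH K x"
    by (simp add: vec_eq_iff transpose_def P_hat_def interp_mat_def)
qed

lemma PH_node: "K \<in> elems D \<Longrightarrow> j < n_nodes m \<Longrightarrow> PH K (node \<xi> D K j) = Hu (node \<xi> D K j)"
  unfolding P_hat_def by (rule interp_mat_node[OF D _ \<xi>])

text \<open>The summand \<open>1\<close> next to the Sobolev term accounts for the slack in the pointwise
  approximation, whose total is chosen to be of the same order.\<close>

definition approx_const :: real where
  "approx_const = 32 * (2 * \<Lambda> + 1)\<^sup>2 *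
     (2 ^ (2 * m + 4) * \<gamma>\<^sup>2 * real (m + 4) * real (n_nodes m + 1) * Hm_energy (m + 3) w \<Omega> + 1)"

lemma approx_const_nonneg: "0 \<le> approx_const"
  unfolding approx_const_def using Hm_energy_nonneg[of "m + 3" w \<Omega>]
  by (intro mult_nonneg_nonneg add_nonneg_nonneg) auto

text \<open>The local approximants of \<open>element_approx\<close> put together. A uniform bound on the
  elementwise errors would lose the square root of the number of elements; the sum of their
  weighted squares has the right order because the Sobolev energies of disjoint elements add up.\<close>

lemma broken_approx:
  obtains v \<epsilon> where "v \<in> broken_poly (m + 2) D"
    "\<And>K. K \<in> elems D \<Longrightarrow> 0 \<le> \<epsilon> K"
    "\<And>K x. K \<in> elems D \<Longrightarrow> x \<in> K \<Longrightarrow> norm (Hu x - H_h v K x) \<le> \<epsilon> K"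
    "\<And>K x. K \<in> elems D \<Longrightarrow> x \<in> K \<Longrightarrow> norm (PH K x - Hu x) \<le> \<epsilon> K"
    "\<And>K x. K \<in> elems D \<Longrightarrow> x \<in> K \<Longrightarrow> norm (grad_on (closure \<Omega>) u x - grad_on UNIV (v K) x) \<le> \<epsilon> K * diameter K"
    "\<And>K x. K \<in> elems D \<Longrightarrow> x \<in> K \<Longrightarrow> \<bar>u x - v K x\<bar> \<le> \<epsilon> K * (diameter K)\<^sup>2"
    "(\<Sum>K\<in>elems D. (\<epsilon> K * diameter K)\<^sup>2) \<le> approx_const * (h ^ (m + 1))\<^sup>2"
proof -
  define N where "N = real (card (elems D))"
  have N: "N > 0" unfolding N_def using elems_ne elems_finite[OF D] by (simp add: card_gt_0_iff)
  \<comment> \<open>The slack is the same on all \<open>N\<close> elements; its squares sum to \<open>(h ^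
    m)\<^sup>2\<close>.\<close>
  define \<delta> where "\<delta> = h ^ m / sqrt N"
  have \<delta>: "\<delta> > 0" using N h_pos by (simp add: \<delta>_def)
  define A where "A = 2 ^ (2 * m + 4) * \<gamma>\<^sup>2 * real (m + 4) * real (n_nodes m + 1)"
  have A: "0 \<le> A" by (simp add: A_def)
  let ?E = "\<lambda>K. Hm_energy (m + 3) w (interior K)"
  have \<Lambda>1: "1 \<le> \<Lambda>" using \<Lambda> by (simp add: nodal_bound_def)
  define \<epsilon> where "\<epsilon> K = 4 * (2 * \<Lambda> + 1) * (sqrt (A * ?E K) * diameter K ^ m + \<delta>)" for K
  have "\<exists>p. p \<in> Pk (m + 2) \<and> (\<forall>x\<in>K. norm (Hu x - hess_on UNIV p x) \<le> \<epsilon> K \<and> norm (PH K x - Hu x) \<le> \<epsilon> K \<and>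
    norm (grad_on (closure \<Omega>) u x - grad_on UNIV p x) \<le> \<epsilon> K * diameter K \<and> \<bar>u x - p x\<bar> \<le> \<epsilon> K * (diameter K)\<^sup>2)"
    if K: "K \<in> elems D" for K
  proof -
    obtain z r where r: "0 < r" "ball z r \<subseteq> K" "diameter K \<le> \<gamma> * r" using shape[OF K] by blast
    from element_approx[OF \<Omega> D K u m w r \<xi> \<Lambda> \<delta>] show ?thesis unfolding \<epsilon>_def A_def by blast
  qed
  then obtain p where p: "\<And>K. K \<in> elems D \<Longrightarrow> p K \<in> Pk (m + 2)"
    "\<And>K x. K \<in> elems D \<Longrightarrow> x \<in> K \<Longrightarrow> norm (Hu x - hess_on UNIV (p K) x) \<le> \<epsilon> K \<and> norm (PH K x - Hu x) \<le> \<epsilon> K \<and>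
    norm (grad_on (closure \<Omega>) u x - grad_on UNIV (p K) x) \<le> \<epsilon> K * diameter K \<and> \<bar>u x - p K x\<bar> \<le> \<epsilon> K * (diameter K)\<^sup>2"
    by metis
  define v where "v K = (if K \<in> elems D then p K else (\<lambda>_. 0))" for K
  have vp: "v \<in> broken_poly (m + 2) D" using p(1) by (simp add: broken_poly_def v_def)
  have \<epsilon>0: "0 \<le> \<epsilon> K" if "K \<in> elems D" for K
    unfolding \<epsilon>_def using \<Lambda>1 \<delta> A Hm_energy_nonneg elem_diameter_pos[OF D that]
    by (intro mult_nonneg_nonneg add_nonneg_nonneg) auto
  have S: "(\<Sum>K\<in>elems D. (\<epsilon> K * diameter K)\<^sup>2) \<le> approx_const * (h ^ (m + 1))\<^sup>2"
  proof -
    let ?L = "32 * (2 * \<Lambda> + 1)\<^sup>2"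
    have "(\<epsilon> K * diameter K)\<^sup>2 \<le> ?L * ((A * ?E K) * (h ^ m)\<^sup>2 + \<delta>\<^sup>2) * h\<^sup>2" if K: "K \<in> elems D" for K
    proof -
      have dK: "0 \<le> diameter K" "diameter K \<le> h"
        using elem_diameter_pos[OF D K] elem_diameter_le[OF D K] by auto
      have AE: "0 \<le> A * ?E K" using A Hm_energy_nonneg by simp
      have s: "(x + y)\<^sup>2 \<le> 2 * (x\<^sup>2 + y\<^sup>2)" for x y :: real
        using zero_le_power2[of "x - y"] by (simp add: power2_eq_square algebra_simps)
      have "(sqrt (A * ?E K) * diameter K ^ m + \<delta>)\<^sup>2 \<le> 2 * ((sqrt (A * ?E K) * diameter K ^ m)\<^sup>2 + \<delta>\<^sup>2)" by (rule s)
      also have "(sqrt (A * ?E K) * diameter K ^ m)\<^sup>2 = (A * ?E K) * (diameter K ^ m)\<^sup>2"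
        using AE by (simp add: power_mult_distrib)
      also have "\<dots> \<le> (A * ?E K) * (h ^ m)\<^sup>2" using AE dK by (intro mult_left_mono power_mono) auto
      finally have 1: "(sqrt (A * ?E K) * diameter K ^ m + \<delta>)\<^sup>2 \<le> 2 * ((A * ?E K) * (h ^ m)\<^sup>2 + \<delta>\<^sup>2)" by simp
      have "(\<epsilon> K)\<^sup>2 = 16 * (2 * \<Lambda> + 1)\<^sup>2 * (sqrt (A * ?E K) * diameter K ^ m + \<delta>)\<^sup>2"
        unfolding \<epsilon>_def by (simp only: power_mult_distrib) simp
      also have "\<dots> \<le> 16 * (2 * \<Lambda> + 1)\<^sup>2 * (2 * ((A * ?E K) * (h ^ m)\<^sup>2 + \<delta>\<^sup>2))"
        by (intro mult_left_mono 1) auto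
      also have "\<dots> = ?L * ((A * ?E K) * (h ^ m)\<^sup>2 + \<delta>\<^sup>2)" by simp
      finally have "(\<epsilon> K)\<^sup>2 \<le> ?L * ((A * ?E K) * (h ^ m)\<^sup>2 + \<delta>\<^sup>2)" .
      then have "(\<epsilon> K)\<^sup>2 * (diameter K)\<^sup>2 \<le> ?L * ((A * ?E K) * (h ^ m)\<^sup>2 + \<delta>\<^sup>2) * h\<^sup>2"
        using dK AE by (intro mult_mono power_mono) (auto intro!: mult_nonneg_nonneg add_nonneg_nonneg)
      then show ?thesis by (simp add: power_mult_distrib)
    qed
    then have "(\<Sum>K\<in>elems D. (\<epsilon> K * diameter K)\<^sup>2) \<le> (\<Sum>K\<in>elems D. ?L * ((A * ?E K) * (h ^ m)\<^sup>2 + \<delta>\<^sup>2) * h\<^sup>2)"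
      by (rule sum_mono)
    also have "\<dots> = ?L * (A * (\<Sum>K\<in>elems D. ?E K) * (h ^ m)\<^sup>2 + N * \<delta>\<^sup>2) * h\<^sup>2"
      by (simp add: sum_distrib_left[symmetric] sum_distrib_right[symmetric] sum.distrib N_def)
    also have "N * \<delta>\<^sup>2 = (h ^ m)\<^sup>2" using N by (simp add: \<delta>_def power_divide)
    also have "?L * (A * (\<Sum>K\<in>elems D. ?E K) * (h ^ m)\<^sup>2 + (h ^ m)\<^sup>2) * h\<^sup>2 \<le>
        ?L * (A * Hm_energy (m + 3) w \<Omega> * (h ^ m)\<^sup>2 + (h ^ m)\<^sup>2) * h\<^sup>2"
    proof -
      have "(\<Sum>K\<in>elems D. ?E K) \<le> Hm_energy (m + 3) w \<Omega>"
        by (rule Hm_energy_sum_le[OF _ w elems_finite[OF D]])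
          (use \<Omega> elem_interior_subset[OF \<Omega> D] elem_interiors_disjoint[OF D] in
            \<open>auto simp: convex_polygonal_domain_def\<close>)
      then show ?thesis using A by (intro mult_right_mono mult_left_mono add_mono) auto
    qed
    also have "\<dots> = approx_const * (h ^ (m + 1))\<^sup>2"
      by (simp add: approx_const_def A_def power_mult_distrib algebra_simps power2_eq_square)
    finally show ?thesis .
  qed
  have vK: "v K = p K" "H_h v K = hess_on UNIV (p K)" if "K \<in> elems D" for K
    using that by (simp_all add: v_def H_h_def)
  show ?thesis
  proof (rule that[OF vp \<epsilon>0 _ _ _ _ S])
    fix K x assume K: "K \<in> elems D" and x: "x \<in> K"
    note px = p(2)[OF K x]
    show "norm (Hu x - H_h v K x) \<le> \<epsilon> K" using px unfolding vK(2)[OF K] by blast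
    show "norm (PH K x - Hu x) \<le> \<epsilon> K" using px by blast
    show "norm (grad_on (closure \<Omega>) u x - grad_on UNIV (v K) x) \<le> \<epsilon> K * diameter K"
      using px unfolding vK(1)[OF K] by blast
    show "\<bar>u x - v K x\<bar> \<le> \<epsilon> K * (diameter K)\<^sup>2" using px unfolding vK(1)[OF K] by blast
  qed
qed

abbreviation "us P \<equiv> u_h \<Omega> (m + 2) m \<xi> \<sigma> D P"

lemma us_solution: "is_solution \<Omega> (m + 2) m \<xi> \<sigma> D P (us P)"
  unfolding u_h_def
  using theI'[OF ex1_is_solution[OF \<Omega> D _ \<sigma>, of "m + 2" \<xi> P]] positive \<xi> by simp

lemma us_poly: "us P \<in> broken_poly (m + 2) D"
  using us_solution[of P] by (simp add: is_solution_def)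

lemma J_exact_right: "C1_broken D v \<Longrightarrow> J_h \<Omega> D (\<lambda>_. u) v = 0"
proof -
  assume v: "C1_broken D v"
  have e: "jump D (\<lambda>_. u) F x = 0" "F \<in> interior_edges D \<Longrightarrow> vjump D (bgrad (\<lambda>_. u)) F x = 0"
    if "F \<in> edges \<Omega> D" "x \<in> F" for F x
    using exact_jumps[where F = F and x = x, OF \<Omega> D u] u0 that by blast+
  have "J_h \<Omega> D (\<lambda>_. u) v = J_h \<Omega> D (\<lambda>_ _. 0) (\<lambda>_ _. 0)"
  proof (rule J_h_cong[OF D])
    have z: "C1_broken D (\<lambda>_ _. 0)"
      by (rule C1_broken_poly[OF D, of _ 0]) (simp add: broken_poly_def Pk_const)
    have g: "grad_on K (\<lambda>_. 0) x = 0" if "K \<in> elems D" "x \<in> K" for K x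
      using grad_on_eq[OF elem_convex[OF D that(1)] elem_interior[OF D that(1)] that(2), of "\<lambda>_. 0" 0] by simp
    show "vjump D (bgrad (\<lambda>_. u)) F x * vjump D (bgrad v) F x = vjump D (bgrad (\<lambda>_ _. 0)) F x * vjump D (bgrad (\<lambda>_ _. 0)) F x"
      if "F \<in> interior_edges D" "x \<in> F" for F x
    proof -
      have "vjump D (bgrad (\<lambda>_ _. 0)) F x = 0"
        unfolding vjump_def bgrad_def
      proof (intro sum.neutral ballI)
        fix K assume K: "K \<in> {K \<in> elems D. F edge_of K}"
        then have "x \<in> K" using edge_of_imp_subset that(2) by blast
        then show "grad_on K (\<lambda>_. 0) x \<bullet> outer_normal K F = 0" using g K by simp
      qed
      moreover have "F \<in> edges \<Omega> D" using that(1) interior_edges_subset by blast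
      ultimately show ?thesis using e(2)[OF _ that(2,1)] by simp
    qed
    show "jump D (\<lambda>_. u) F x \<bullet> jump D v F x = jump D (\<lambda>_ _. 0) F x \<bullet> jump D (\<lambda>_ _. 0) F x"
      if "F \<in> edges \<Omega> D" "x \<in> F" for F x
      using e(1)[OF that] by (simp add: jump_def)
  qed
  also have "\<dots> = 0" using J_h_lincomb[OF D, of "\<lambda>_ _. 0" "\<lambda>_ _. 0" "\<lambda>_ _. 0" "- 1"]
      C1_broken_poly[OF D, of "\<lambda>_ _. 0" 0] by (simp add: broken_poly_def Pk_const)
  finally show ?thesis .
qed

text \<open>The functional minimized by the scheme. The exact solution may be inserted into the jump term
  because its own jumps vanish.\<close>

definition energy :: "mat broken \<Rightarrow> real broken \<Rightarrow> real" where
  "energy P v = (nrm (\<lambda>K x. H_h v K x - P K x))\<^sup>2 + \<sigma> * J_h \<Omega> D (\<lambda>K x. v K x - u x) (\<lambda>K x. v K x - u x)"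

text \<open>Expanding the square around \<open>us P\<close>, the mixed term is the discrete equation tested
  with \<open>v - us P\<close> and vanishes; the remaining square is nonnegative.\<close>

lemma galerkin_best_approximation:
  assumes v: "v \<in> broken_poly (m + 2) D"
  shows "energy P (us P) \<le> energy P v"
proof -
  let ?s = "us P"
  note sX = us_poly[of P]
  define z where "z = (\<lambda>K x. v K x + (- 1) * ?s K x)"
  have zX: "z \<in> broken_poly (m + 2) D" unfolding z_def by (rule broken_poly_lincomb[OF v sX])
  define e where "e = (\<lambda>K x. ?s K x + (- 1) * u x)"
  have U: "C1_broken D (\<lambda>_. u)" by (rule C1_broken_C2[OF \<Omega> D u])
  have eC: "C1_broken D e" unfolding e_def by (rule C1_broken_lincomb[OF D C1_broken_poly[OF D sX] U])
  have zC: "C1_broken D z" by (rule C1_broken_poly[OF D zX])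
  define E where "E = (\<lambda>K x. H_h ?s K x + (- 1) *\<^sub>R P K x)"
  have ez: "(\<lambda>K x. v K x - u x) = (\<lambda>K x. e K x + 1 * z K x)" by (simp add: e_def z_def fun_eq_iff)
  have J: "J_h \<Omega> D (\<lambda>K x. e K x + 1 * z K x) (\<lambda>K x. e K x + 1 * z K x) = J_h \<Omega> D e e + 2 * J_h \<Omega> D e z + J_h \<Omega> D z z"
    using J_h_lincomb[OF D eC zC C1_broken_lincomb[OF D eC zC, of 1], of 1]
      J_h_lincomb[OF D eC zC eC, of 1] J_h_lincomb[OF D eC zC zC, of 1]
    by (simp add: J_h_sym[of \<Omega> D e "\<lambda>K x. e K x + z K x"] J_h_sym[of \<Omega> D z "\<lambda>K x. e K x + z K x"] J_h_sym[of \<Omega> D z e])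
  have Hz: "inner_h m \<xi> D (\<lambda>K x. H_h v K x - P K x) (\<lambda>K x. H_h v K x - P K x) =
     inner_h m \<xi> D (\<lambda>K x. E K x + 1 *\<^sub>R H_h z K x) (\<lambda>K x. E K x + 1 *\<^sub>R H_h z K x)"
  proof -
    have zH: "H_h z K x = H_h v K x - H_h ?s K x" if "K \<in> elems D" for K x
      using H_h_lincomb[OF v sX that, of "- 1" x] by (simp add: z_def)
    show ?thesis by (rule inner_h_cong) (simp_all add: E_def zH)
  qed
  have I: "inner_h m \<xi> D (\<lambda>K x. E K x + 1 *\<^sub>R H_h z K x) (\<lambda>K x. E K x + 1 *\<^sub>R H_h z K x) =
     inner_h m \<xi> D E E + 2 * inner_h m \<xi> D E (H_h z) + inner_h m \<xi> D (H_h z) (H_h z)"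
  proof -
    let ?S = "\<lambda>K x. E K x + 1 *\<^sub>R H_h z K x"
    have l: "inner_h m \<xi> D ?S Z = inner_h m \<xi> D E Z + inner_h m \<xi> D (H_h z) Z" for Z
      using inner_h_linear[of m \<xi> D E 1 "H_h z" Z] by (simp only: mult_1)
    show ?thesis
      using l[of ?S] l[of E] l[of "H_h z"] inner_h_sym[of m \<xi> D E ?S] inner_h_sym[of m \<xi> D "H_h z" ?S]
        inner_h_sym[of m \<xi> D "H_h z" E] by linarith
  qed
  \<comment> \<open>The discrete equation tested with \<open>z\<close>; subtracting \<open>u\<close> does not change the jump term.\<close>
  have "inner_h m \<xi> D E (H_h z) + \<sigma> * J_h \<Omega> D e z = 0"
  proof -
    have "J_h \<Omega> D e z = J_h \<Omega> D ?s z"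
      unfolding e_def using J_h_lincomb[OF D C1_broken_poly[OF D sX] U zC, of "- 1"] J_exact_right[OF zC] by simp
    moreover have "inner_h m \<xi> D E (H_h z) = inner_h m \<xi> D (H_h ?s) (H_h z) - inner_h m \<xi> D P (H_h z)"
      unfolding E_def using inner_h_linear[of m \<xi> D "H_h ?s" "- 1" P "H_h z"] by simp
    moreover have "a_h \<Omega> m \<xi> \<sigma> D ?s z = inner_h m \<xi> D P (H_h z)"
      using us_solution[of P] zX unfolding is_solution_def by blast
    ultimately show ?thesis unfolding a_h_def by simp
  qed
  moreover have "0 \<le> inner_h m \<xi> D (H_h z) (H_h z)" by (rule inner_h_nonneg[OF positive])
  moreover have "0 \<le> \<sigma> * J_h \<Omega> D z z" using J_h_nonneg[OF D zC] \<sigma> by simp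
  ultimately have "inner_h m \<xi> D E E + \<sigma> * J_h \<Omega> D e e \<le>
      (inner_h m \<xi> D E E + 2 * inner_h m \<xi> D E (H_h z) + inner_h m \<xi> D (H_h z) (H_h z)) +
      \<sigma> * (J_h \<Omega> D e e + 2 * J_h \<Omega> D e z + J_h \<Omega> D z z)"
    by (simp add: distrib_left mult.left_commute[of \<sigma> 2])
  then have "inner_h m \<xi> D E E + \<sigma> * J_h \<Omega> D e e \<le> energy P v"
    unfolding energy_def norm_h_square[OF positive] Hz I ez J .
  moreover have "energy P ?s = inner_h m \<xi> D E E + \<sigma> * J_h \<Omega> D e e"
    unfolding energy_def norm_h_square[OF positive] by (simp add: E_def e_def)
  ultimately show ?thesis by simp
qed

lemma jump_error_nonneg:
  assumes "v \<in> broken_poly (m + 2) D"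
  shows "0 \<le> J_h \<Omega> D (\<lambda>K x. v K x - u x) (\<lambda>K x. v K x - u x)"
proof -
  have "C1_broken D (\<lambda>K x. v K x + (- 1) * u x)"
    by (rule C1_broken_lincomb[OF D C1_broken_poly[OF D assms] C1_broken_C2[OF \<Omega> D u]])
  from J_h_nonneg[OF D this] show ?thesis by simp
qed

definition consistency_const :: real where
  "consistency_const = sqrt ((real (n_nodes m) * C + 16 * \<sigma> * (1 + \<gamma>\<^sup>2)) * approx_const)"

lemma consistency_const_nonneg: "0 \<le> consistency_const"
  unfolding consistency_const_def using C_nonneg \<sigma> approx_const_nonneg by simp

text \<open>At the nodes \<open>PH\<close> equals the Hessian of \<open>u\<close>, so the first part of the
  functional only sees the approximation error of the Hessian.\<close>

lemma consistency:
  assumes v: "v \<in> broken_poly (m + 2) D"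
    and \<epsilon>0: "\<And>K. K \<in> elems D \<Longrightarrow> 0 \<le> \<epsilon> K"
    and H: "\<And>K x. K \<in> elems D \<Longrightarrow> x \<in> K \<Longrightarrow> norm (Hu x - H_h v K x) \<le> \<epsilon> K"
    and G: "\<And>K x. K \<in> elems D \<Longrightarrow> x \<in> K \<Longrightarrow> norm (grad_on (closure \<Omega>) u x - grad_on UNIV (v K) x) \<le> \<epsilon> K * diameter K"
    and V: "\<And>K x. K \<in> elems D \<Longrightarrow> x \<in> K \<Longrightarrow> \<bar>u x - v K x\<bar> \<le> \<epsilon> K * (diameter K)\<^sup>2"
    and S: "(\<Sum>K\<in>elems D. (\<epsilon> K * diameter K)\<^sup>2) \<le> approx_const * (h ^ (m + 1))\<^sup>2"
  shows "energy PH v \<le> (consistency_const * h ^ (m + 1))\<^sup>2"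
proof -
  let ?S = "\<Sum>K\<in>elems D. (\<epsilon> K * diameter K)\<^sup>2"
  have "inner_h m \<xi> D (\<lambda>K x. H_h v K x - PH K x) (\<lambda>K x. H_h v K x - PH K x) \<le>
     (\<Sum>K\<in>elems D. \<Sum>j<n_nodes m. C * (\<epsilon> K * diameter K)\<^sup>2)"
    unfolding inner_h_def frob_eq_inner power2_norm_eq_inner[symmetric]
  proof (intro sum_mono)
    fix K j assume K: "K \<in> elems D" and "j \<in> {..<n_nodes m}"
    then have j: "j < n_nodes m" by simp
    have "norm (H_h v K (node \<xi> D K j) - PH K (node \<xi> D K j)) \<le> \<epsilon> K"
      using H[OF K node_mem[OF D K \<xi> j]] by (simp add: PH_node[OF K j] norm_minus_commute)
    then have "(norm (H_h v K (node \<xi> D K j) - PH K (node \<xi> D K j)))\<^sup>2 \<le> (\<epsilon> K)\<^sup>2" by (intro power_mono) auto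
    then have "wt D K j * (norm (H_h v K (node \<xi> D K j) - PH K (node \<xi> D K j)))\<^sup>2 \<le> (C * (diameter K)\<^sup>2) * (\<epsilon> K)\<^sup>2"
      using weights[OF K j] C_nonneg by (intro mult_mono) auto
    then show "wt D K j * (norm (H_h v K (node \<xi> D K j) - PH K (node \<xi> D K j)))\<^sup>2 \<le> C * (\<epsilon> K * diameter K)\<^sup>2"
      by (simp add: power_mult_distrib mult_ac)
  qed
  also have "\<dots> = real (n_nodes m) * C * ?S" by (simp add: sum_distrib_left mult.assoc)
  finally have 1: "inner_h m \<xi> D (\<lambda>K x. H_h v K x - PH K x) (\<lambda>K x. H_h v K x - PH K x) \<le> real (n_nodes m) * C * ?S" .
  note vC = C1_broken_poly[OF D v] and U = C1_broken_C2[OF \<Omega> D u]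
  have "J_h \<Omega> D (\<lambda>K x. v K x + (- 1) * u x) (\<lambda>K x. v K x + (- 1) * u x) \<le> 16 * (1 + \<gamma>\<^sup>2) * ?S"
  proof (rule J_h_error_bound[OF \<Omega> D C1_broken_lincomb[OF D vC U] shape])
    fix K x assume K: "K \<in> elems D" "x \<in> K"
    show "\<bar>v K x + - 1 * u x\<bar> \<le> \<epsilon> K * (diameter K)\<^sup>2" using V[OF K] by (simp add: abs_minus_commute)
    show "norm (grad_on K (\<lambda>x. v K x + - 1 * u x) x) \<le> \<epsilon> K * diameter K"
      unfolding grad_on_lincomb[OF D vC U K, of "- 1"] grad_on_broken_poly[OF D v K] grad_on_C2[OF \<Omega> D u K]
      using G[OF K] by (simp add: norm_minus_commute)
  qed
  then have 2: "\<sigma> * J_h \<Omega> D (\<lambda>K x. v K x - u x) (\<lambda>K x. v K x - u x) \<le> \<sigma> * (16 * (1 + \<gamma>\<^sup>2) * ?S)"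
    using \<sigma> by simp
  have "energy PH v \<le> real (n_nodes m) * C * ?S + \<sigma> * (16 * (1 + \<gamma>\<^sup>2) * ?S)"
    unfolding energy_def norm_h_square[OF positive] using 1 2 by (rule add_mono)
  also have "\<dots> = (real (n_nodes m) * C + 16 * \<sigma> * (1 + \<gamma>\<^sup>2)) * ?S" by (simp add: algebra_simps)
  also have "\<dots> \<le> (real (n_nodes m) * C + 16 * \<sigma> * (1 + \<gamma>\<^sup>2)) * (approx_const * (h ^ (m + 1))\<^sup>2)"
    using C_nonneg \<sigma> by (intro mult_left_mono S) auto
  also have "\<dots> = (consistency_const * h ^ (m + 1))\<^sup>2"
    unfolding consistency_const_def power_mult_distrib using C_nonneg \<sigma> approx_const_nonneg by simp
  finally show ?thesis .
qed

text \<open>\<open>PH\<close> lies in the constraint set and thus competes in the projection: \<open>Q\<close>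
  is at least as near to the discrete Hessian as \<open>PH\<close> is. The triangle inequality
  doubles that distance.\<close>

lemma fixed_point_close:
  assumes Q: "T_h \<Omega> (m + 2) m \<xi> \<sigma> f D PH = {Q}" and PB: "PH \<in> B_h m \<xi> f D"
    and best: "energy PH v \<le> e\<^sup>2" "0 \<le> e" and v: "v \<in> broken_poly (m + 2) D"
  shows "nrm (\<lambda>K x. Q K x - PH K x) \<le> 2 * e"
proof -
  let ?R = "H_h (us PH)"
  have "(nrm (\<lambda>K x. ?R K x - PH K x))\<^sup>2 \<le> energy PH (us PH)"
    using jump_error_nonneg[OF us_poly] \<sigma> by (simp add: energy_def)
  also have "\<dots> \<le> e\<^sup>2" using galerkin_best_approximation[OF v] best(1) by (rule order_trans)
  finally have R: "nrm (\<lambda>K x. ?R K x - PH K x) \<le> e" using best(2) by (rule power2_le_imp_le)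
  have "Q \<in> proj_B m \<xi> f D ?R" using Q by (auto simp: T_h_def R_h_def)
  then have "nrm (\<lambda>K x. ?R K x - Q K x) \<le> nrm (\<lambda>K x. ?R K x - PH K x)" using PB by (auto simp: proj_B_def)
  moreover have "nrm (\<lambda>K x. Q K x - PH K x) \<le> nrm (\<lambda>K x. Q K x - ?R K x) + nrm (\<lambda>K x. ?R K x - PH K x)"
    by (rule norm_h_triangle_diff[OF positive])
  ultimately show ?thesis using R norm_h_commute[of m \<xi> D Q ?R] by linarith
qed

text \<open>The ratio between the error at the fixed point and the best approximation error: \<open>2 / (1 -
  q)\<close> is the distance from the fixed point to \<open>PH\<close>, and the remainder comes
  from comparing the data.\<close>

definition amplification :: "real \<Rightarrow> real" where
  "amplification q = 2 + 2 / (1 - q)"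

definition point_const :: "real \<Rightarrow> real" where
  "point_const q = (4 * \<Lambda> * (2 * amplification q * consistency_const) / sqrt c + sqrt approx_const) / \<theta>"

definition L2_const :: "real \<Rightarrow> real" where
  "L2_const q = sqrt (128 * \<Lambda>\<^sup>2 * (2 * amplification q * consistency_const)\<^sup>2 / c + 8 * approx_const)"

text \<open>The fixed point is within \<open>2 e / (1 - q)\<close> of \<open>PH\<close> by
  \<open>fixed_point_close\<close> and contraction. Then \<open>v\<close> is used again as a
  competitor, now for the datum at the fixed point.\<close>

lemma fixed_point_energy:
  assumes q: "q < 1" and r: "0 \<le> r" and PB: "PH \<in> B_h m \<xi> f D"
    and T: "T_contraction \<Omega> (m + 2) m \<xi> \<sigma> f D q (cball_h m \<xi> D PH r)"
    and best: "energy PH v \<le> e\<^sup>2" "0 \<le> e" and v: "v \<in> broken_poly (m + 2) D"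
  defines "P \<equiv> P_star \<Omega> (m + 2) m \<xi> \<sigma> f D (cball_h m \<xi> D PH r)"
  shows "sqrt \<sigma> * sqrt (J_h \<Omega> D (\<lambda>K x. us P K x - u x) (\<lambda>K x. us P K x - u x)) \<le> amplification q * e"
    and "nrm (\<lambda>K x. H_h (us P) K x - PH K x) \<le> 2 * amplification q * e"
proof -
  let ?S = "cball_h m \<xi> D PH r"
  note P = P_star_fixed_point[OF D positive \<xi> PH_sym r q T, folded P_def]
  have PHS: "PH \<in> ?S" using PH_sym r by (simp add: cball_h_def norm_h_def inner_h_def frob_eq_inner)
  obtain Q where Q: "T_h \<Omega> (m + 2) m \<xi> \<sigma> f D PH = {Q}" using T PHS unfolding T_contraction_def by blast
  define x where "x = nrm (\<lambda>K x. P K x - PH K x)"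
  have "nrm (\<lambda>K x. P K x - Q K x) \<le> q * x"
    unfolding x_def
    using T[unfolded T_contraction_def, THEN conjunct2, rule_format, OF P(1) PHS, of P Q] P(2) Q by blast
  moreover have "nrm (\<lambda>K x. Q K x - PH K x) \<le> 2 * e" by (rule fixed_point_close[OF Q PB best v])
  moreover have "x \<le> nrm (\<lambda>K x. P K x - Q K x) + nrm (\<lambda>K x. Q K x - PH K x)"
    unfolding x_def by (rule norm_h_triangle_diff[OF positive])
  ultimately have "x * (1 - q) \<le> 2 * e" by (simp add: algebra_simps)
  then have x: "x \<le> 2 * e / (1 - q)" using q by (simp add: pos_le_divide_eq)
  \<comment> \<open>\<open>B * e\<close> bounds the distance from \<open>H_h v\<close> to the fixed point; the
    jump term adds one more \<open>e\<close>.\<close>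
  define B where "B = 1 + 2 / (1 - q)"
  have B: "1 \<le> B" "amplification q = B + 1" using q by (auto simp: B_def amplification_def)
  have xB: "x \<le> (B - 1) * e" using x by (simp add: B_def)
  have Jv: "0 \<le> \<sigma> * J_h \<Omega> D (\<lambda>K x. v K x - u x) (\<lambda>K x. v K x - u x)"
    using jump_error_nonneg[OF v] \<sigma> by simp
  have Hv2: "(nrm (\<lambda>K x. H_h v K x - PH K x))\<^sup>2 \<le> e\<^sup>2" using best(1) Jv by (simp add: energy_def)
  then have Hv: "nrm (\<lambda>K x. H_h v K x - PH K x) \<le> e" using best(2) by (rule power2_le_imp_le)
  have "nrm (\<lambda>K x. H_h v K x - P K x) \<le> nrm (\<lambda>K x. H_h v K x - PH K x) + nrm (\<lambda>K x. PH K x - P K x)"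
    by (rule norm_h_triangle_diff[OF positive])
  also have "\<dots> \<le> e + (B - 1) * e" using Hv xB norm_h_commute[of m \<xi> D PH P] by (simp add: x_def)
  finally have "nrm (\<lambda>K x. H_h v K x - P K x) \<le> B * e" by (simp add: algebra_simps)
  then have "(nrm (\<lambda>K x. H_h v K x - P K x))\<^sup>2 \<le> (B * e)\<^sup>2"
    using norm_h_nonneg[OF positive] by (intro power_mono)
  moreover have "\<sigma> * J_h \<Omega> D (\<lambda>K x. v K x - u x) (\<lambda>K x. v K x - u x) \<le> e\<^sup>2"
    using best(1) zero_le_power2[of "nrm (\<lambda>K x. H_h v K x - PH K x)"] unfolding energy_def by linarith
  ultimately have "energy P v \<le> (B * e)\<^sup>2 + e\<^sup>2" unfolding energy_def by (rule add_mono)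
  also have "\<dots> \<le> (amplification q * e)\<^sup>2"
  proof -
    have "0 \<le> 2 * B * (e * e)" using B(1) by simp
    then show ?thesis by (simp add: B(2) power2_eq_square algebra_simps)
  qed
  finally have E: "energy P (us P) \<le> (amplification q * e)\<^sup>2"
    using galerkin_best_approximation[OF v, of P] by linarith
  have a0: "0 \<le> amplification q * e" using B best(2) by simp
  note J = jump_error_nonneg[OF us_poly, of P]
  have "\<sigma> * J_h \<Omega> D (\<lambda>K x. us P K x - u x) (\<lambda>K x. us P K x - u x) \<le> (amplification q * e)\<^sup>2"
    using E zero_le_power2[of "nrm (\<lambda>K x. H_h (us P) K x - P K x)"] unfolding energy_def by linarith
  from real_sqrt_le_mono[OF this]
  show "sqrt \<sigma> * sqrt (J_h \<Omega> D (\<lambda>K x. us P K x - u x) (\<lambda>K x. us P K x - u x)) \<le> amplification q * e"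
    using a0 by (simp add: real_sqrt_mult)
  have "(nrm (\<lambda>K x. H_h (us P) K x - P K x))\<^sup>2 \<le> (amplification q * e)\<^sup>2"
    using E J \<sigma> unfolding energy_def by (smt (verit) mult_nonneg_nonneg)
  then have "nrm (\<lambda>K x. H_h (us P) K x - P K x) \<le> amplification q * e" using a0 by (rule power2_le_imp_le)
  moreover have "x \<le> amplification q * e"
  proof -
    have "(B - 1) * e \<le> (B + 1) * e" using best(2) by (intro mult_right_mono) auto
    then show ?thesis using xB B(2) by simp
  qed
  moreover have "nrm (\<lambda>K x. H_h (us P) K x - PH K x) \<le>
      nrm (\<lambda>K x. H_h (us P) K x - P K x) + nrm (\<lambda>K x. P K x - PH K x)"
    by (rule norm_h_triangle_diff[OF positive])
  ultimately show "nrm (\<lambda>K x. H_h (us P) K x - PH K x) \<le> 2 * amplification q * e" by (simp add: x_def)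
qed

lemma elem_measure_le: "K \<in> elems D \<Longrightarrow> measure lebesgue K \<le> 4 * (diameter K)\<^sup>2"
proof -
  assume K: "K \<in> elems D"
  obtain z where z: "z \<in> K" using elem_interior[OF D K] interior_subset by blast
  let ?d = "diameter K"
  let ?Q = "cbox (z - vec ?d) (z + vec ?d)"
  have d: "0 < ?d" by (rule elem_diameter_pos[OF D K])
  have "K \<subseteq> ?Q"
  proof
    fix x assume "x \<in> K"
    then have "norm (x - z) \<le> ?d"
      using diameter_bounded_bound[OF compact_imp_bounded[OF elem_compact[OF D K]] _ z] by (simp add: dist_norm)
    then have "\<bar>(x - z) $ i\<bar> \<le> ?d" for i using component_le_norm_cart[of "x - z" i] by linarith
    then have "\<bar>x $ i - z $ i\<bar> \<le> ?d" for i by (simp only: vector_minus_component)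
    then have "z $ i - ?d \<le> x $ i \<and> x $ i \<le> z $ i + ?d" for i by (simp only: abs_diff_le_iff)
    then show "x \<in> ?Q" by (simp add: mem_box_cart)
  qed
  then have "measure lebesgue K \<le> measure lebesgue ?Q"
    by (rule measure_mono_fmeasurable) (use elem_compact[OF D K] in \<open>auto simp: compact_imp_closed\<close>)
  also have "\<dots> = 4 * ?d\<^sup>2"
  proof -
    have "z \<in> ?Q" using d by (simp add: mem_box_cart)
    then have "?Q \<noteq> {}" by blast
    then show ?thesis by (simp add: content_cbox_cart power2_eq_square)
  qed
  finally show ?thesis .
qed

text \<open>The difference to \<open>PH\<close> is a polynomial on each element, controlled by its nodal
  values, and \<open>PH\<close> is close to the Hessian of \<open>u\<close> on all of the element.
  The pointwise bound loses one power of \<open>h\<close>, since a single element sees the global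
  nodal norm divided by the square root of a weight.\<close>

lemma error_from_discrete_error:
  assumes s: "s \<in> broken_poly (m + 2) D"
    and b: "nrm (\<lambda>K x. H_h s K x - PH K x) \<le> b * h ^ (m + 1)" "0 \<le> b"
    and \<epsilon>0: "\<And>K. K \<in> elems D \<Longrightarrow> 0 \<le> \<epsilon> K"
    and PHu: "\<And>K x. K \<in> elems D \<Longrightarrow> x \<in> K \<Longrightarrow> norm (PH K x - Hu x) \<le> \<epsilon> K"
    and S: "(\<Sum>K\<in>elems D. (\<epsilon> K * diameter K)\<^sup>2) \<le> approx_const * (h ^ (m + 1))\<^sup>2"
  shows "\<And>K x. K \<in> elems D \<Longrightarrow> x \<in> K \<Longrightarrow> norm (H_h s K x - Hu x) \<le> (4 * \<Lambda> * b / sqrt c + sqrt approx_const) / \<theta> * h ^ m"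
    and "L2_broken_norm D (\<lambda>K x. H_h s K x - Hu x) \<le> sqrt (128 * \<Lambda>\<^sup>2 * b\<^sup>2 / c + 8 * approx_const) * h ^ (m + 1)"
proof -
  note fin = elems_finite[OF D]
  have \<Lambda>1: "1 \<le> \<Lambda>" using \<Lambda> by (simp add: nodal_bound_def)
  let ?Q = "\<lambda>K x. H_h s K x - PH K x"
  define t where "t K = (\<Sum>j<n_nodes m. wt D K j * (norm (?Q K (node \<xi> D K j)))\<^sup>2)" for K
  have t0: "0 \<le> t K" if "K \<in> elems D" for K
    unfolding t_def using positive that
    by (intro sum_nonneg mult_nonneg_nonneg) (auto simp: positive_weights_def intro: less_imp_le)
  have tsum: "(\<Sum>K\<in>elems D. t K) \<le> (b * h ^ (m + 1))\<^sup>2"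
  proof -
    have "(\<Sum>K\<in>elems D. t K) = (nrm ?Q)\<^sup>2"
      unfolding norm_h_square[OF positive] inner_h_def frob_eq_inner t_def power2_norm_eq_inner ..
    also have "\<dots> \<le> (b * h ^ (m + 1))\<^sup>2" using b(1) norm_h_nonneg[OF positive] by (rule power_mono)
    finally show ?thesis .
  qed
  define \<tau> where "\<tau> K = sqrt (t K / (c * (diameter K)\<^sup>2))" for K
  have dK: "0 < diameter K" if "K \<in> elems D" for K by (rule elem_diameter_pos[OF D that])
  have \<tau>0: "0 \<le> \<tau> K" if "K \<in> elems D" for K unfolding \<tau>_def using t0[OF that] c by simp
  have node: "norm (?Q K (node \<xi> D K j)) \<le> \<tau> K" if K: "K \<in> elems D" and j: "j < n_nodes m" for K j
  proof -
    have "c * (diameter K)\<^sup>2 * (norm (?Q K (node \<xi> D K j)))\<^sup>2 \<le> wt D K j * (norm (?Q K (node \<xi> D K j)))\<^sup>2"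
      using weights[OF K j] by (intro mult_right_mono) auto
    also have "\<dots> \<le> t K"
      unfolding t_def using positive K j
      by (intro member_le_sum) (auto simp: positive_weights_def intro!: mult_nonneg_nonneg intro: less_imp_le)
    finally have "(norm (?Q K (node \<xi> D K j)))\<^sup>2 \<le> t K / (c * (diameter K)\<^sup>2)"
      using c dK[OF K] by (simp add: pos_le_divide_eq mult.commute)
    then show ?thesis unfolding \<tau>_def by (rule real_le_rsqrt)
  qed
  have pw: "norm (H_h s K x - Hu x) \<le> 4 * \<Lambda> * \<tau> K + \<epsilon> K" if K: "K \<in> elems D" and x: "x \<in> K" for K x
  proof -
    have "norm (?Q K x) \<le> 4 * (\<Lambda> * \<tau> K)"
    proof (rule norm_mat_le)
      fix a b'
      have "s K \<in> Pk (m + 2)" using s K by (simp add: broken_poly_def)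
      from Pk_hess[OF this, of a b'] have "(\<lambda>x. H_h s K x $ a $ b') \<in> Pk m" by (simp add: H_h_def)
      moreover have "(\<lambda>x. PH K x $ a $ b') \<in> Pk m"
        using PH_sym K by (auto simp: broken_sym_poly_def broken_poly_def)
      ultimately have "(\<lambda>x. ?Q K x $ a $ b') \<in> Pk m" using Pk_diff by fastforce
      then show "\<bar>?Q K x $ a $ b'\<bar> \<le> \<Lambda> * \<tau> K"
        by (rule nodal_bound_elem[OF \<Lambda> D K _ _ x]) (rule order_trans[OF entry_le_norm node[OF K]])
    qed
    moreover have "norm (H_h s K x - Hu x) \<le> norm (?Q K x) + norm (PH K x - Hu x)"
      using norm_triangle_ineq[of "?Q K x" "PH K x - Hu x"] by simp
    ultimately show ?thesis using PHu[OF K x] by linarith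
  qed
  show "norm (H_h s K x - Hu x) \<le> (4 * \<Lambda> * b / sqrt c + sqrt approx_const) / \<theta> * h ^ m"
    if K: "K \<in> elems D" and x: "x \<in> K" for K x
  proof -
    have \<theta>h: "0 < \<theta> * h" using \<theta> h_pos by simp
    have "t K \<le> (\<Sum>K\<in>elems D. t K)" by (rule member_le_sum[OF K]) (use t0 fin in auto)
    then have "t K \<le> (b * h ^ (m + 1))\<^sup>2" using tsum by linarith
    moreover have "c * (\<theta> * h)\<^sup>2 \<le> c * (diameter K)\<^sup>2"
      using quasi[OF K] \<theta>h c by (intro mult_left_mono power_mono) auto
    ultimately have "t K / (c * (diameter K)\<^sup>2) \<le> (b * h ^ (m + 1))\<^sup>2 / (c * (\<theta> * h)\<^sup>2)"
    proof (intro frac_le)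
      have "0 < (\<theta> * h)\<^sup>2" using \<theta>h by (rule zero_less_power)
      then show "0 < c * (\<theta> * h)\<^sup>2" using c by (rule mult_pos_pos[rotated])
    qed (use t0[OF K] in auto)
    from real_sqrt_le_mono[OF this] have "\<tau> K \<le> b * h ^ (m + 1) / (sqrt c * (\<theta> * h))"
      unfolding \<tau>_def using b(2) h_pos \<theta>h by (simp add: real_sqrt_divide real_sqrt_mult)
    also have "\<dots> = b / sqrt c / \<theta> * h ^ m" using h_pos by simp
    finally have 1: "4 * \<Lambda> * \<tau> K \<le> 4 * \<Lambda> * (b / sqrt c / \<theta> * h ^ m)" using \<Lambda>1 by (intro mult_left_mono) auto
    have "(\<epsilon> K * diameter K)\<^sup>2 \<le> (\<Sum>K\<in>elems D. (\<epsilon> K * diameter K)\<^sup>2)"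
      by (rule member_le_sum[OF K]) (use fin in auto)
    then have "(\<epsilon> K * diameter K)\<^sup>2 \<le> approx_const * (h ^ (m + 1))\<^sup>2" using S by linarith
    from real_sqrt_le_mono[OF this] have "\<epsilon> K * diameter K \<le> sqrt approx_const * h ^ (m + 1)"
      using \<epsilon>0[OF K] dK[OF K] h_pos by (simp add: real_sqrt_mult)
    moreover have "\<epsilon> K * (\<theta> * h) \<le> \<epsilon> K * diameter K" using quasi[OF K] \<epsilon>0[OF K] by (rule mult_left_mono)
    ultimately have "\<epsilon> K * (\<theta> * h) \<le> sqrt approx_const * h ^ (m + 1)" by linarith
    then have "\<epsilon> K \<le> sqrt approx_const * h ^ (m + 1) / (\<theta> * h)" by (simp only: pos_le_divide_eq[OF \<theta>h])
    also have "\<dots> = sqrt approx_const / \<theta> * h ^ m" using h_pos by simp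
    finally have "4 * \<Lambda> * \<tau> K + \<epsilon> K \<le> 4 * \<Lambda> * (b / sqrt c / \<theta> * h ^ m) + sqrt approx_const / \<theta> * h ^ m"
      using 1 by linarith
    also have "\<dots> = (4 * \<Lambda> * b / sqrt c + sqrt approx_const) / \<theta> * h ^ m"
      by (simp add: add_divide_distrib distrib_right)
    finally show ?thesis using pw[OF K x] by linarith
  qed
  have "(LINT x:K|lebesgue. (norm (H_h s K x - Hu x))\<^sup>2) \<le> 128 * \<Lambda>\<^sup>2 * (t K / c) + 8 * (\<epsilon> K * diameter K)\<^sup>2"
    if K: "K \<in> elems D" for K
  proof -
    let ?M = "(4 * \<Lambda> * \<tau> K + \<epsilon> K)\<^sup>2"
    have fm: "K \<in> fmeasurable lebesgue" by (rule lmeasurable_compact[OF elem_compact[OF D K]])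
    have "(LINT x:K|lebesgue. (norm (H_h s K x - Hu x))\<^sup>2) \<le> (LINT x|lebesgue. indicator K x *\<^sub>R ?M)"
      unfolding set_lebesgue_integral_def
    proof (rule integral_mono')
      show "integrable lebesgue (\<lambda>x. indicat_real K x *\<^sub>R ?M)"
        using fm by (auto simp: fmeasurable_def)
      fix x
      show "indicat_real K x *\<^sub>R (norm (H_h s K x - Hu x))\<^sup>2 \<le> indicat_real K x *\<^sub>R ?M"
        using pw[OF K] by (auto simp: indicator_def intro!: power_mono)
    qed auto
    also have "\<dots> = measure lebesgue K * ?M" using fm by (simp add: fmeasurable_def)
    also have "\<dots> \<le> 4 * (diameter K)\<^sup>2 * (2 * ((4 * \<Lambda> * \<tau> K)\<^sup>2 + (\<epsilon> K)\<^sup>2))"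
    proof (intro mult_mono elem_measure_le[OF K])
      show "?M \<le> 2 * ((4 * \<Lambda> * \<tau> K)\<^sup>2 + (\<epsilon> K)\<^sup>2)"
        using zero_le_power2[of "4 * \<Lambda> * \<tau> K - \<epsilon> K"] by (simp add: power2_eq_square algebra_simps)
    qed auto
    also have "\<dots> = 128 * \<Lambda>\<^sup>2 * ((diameter K)\<^sup>2 * (\<tau> K)\<^sup>2) + 8 * (\<epsilon> K * diameter K)\<^sup>2"
      by (simp add: power_mult_distrib algebra_simps)
    also have "(diameter K)\<^sup>2 * (\<tau> K)\<^sup>2 = t K / c"
      unfolding \<tau>_def using t0[OF K] c dK[OF K] by simp
    finally show ?thesis .
  qed
  then have "(\<Sum>K\<in>elems D. LINT x:K|lebesgue. (norm (H_h s K x - Hu x))\<^sup>2) \<le>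
      (\<Sum>K\<in>elems D. 128 * \<Lambda>\<^sup>2 * (t K / c) + 8 * (\<epsilon> K * diameter K)\<^sup>2)"
    by (rule sum_mono)
  also have "\<dots> = 128 * \<Lambda>\<^sup>2 * ((\<Sum>K\<in>elems D. t K) / c) + 8 * (\<Sum>K\<in>elems D. (\<epsilon> K * diameter K)\<^sup>2)"
    by (simp add: sum.distrib sum_distrib_left sum_divide_distrib)
  also have "\<dots> \<le> 128 * \<Lambda>\<^sup>2 * ((b * h ^ (m + 1))\<^sup>2 / c) + 8 * (approx_const * (h ^ (m + 1))\<^sup>2)"
    using tsum S c by (intro add_mono mult_left_mono divide_right_mono) auto
  also have "\<dots> = (128 * \<Lambda>\<^sup>2 * b\<^sup>2 / c + 8 * approx_const) * (h ^ (m + 1))\<^sup>2"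
    by (simp only: power_mult_distrib) (simp add: distrib_right)
  finally show "L2_broken_norm D (\<lambda>K x. H_h s K x - Hu x) \<le> sqrt (128 * \<Lambda>\<^sup>2 * b\<^sup>2 / c + 8 * approx_const) * h ^ (m + 1)"
    unfolding L2_broken_norm_def using h_pos
    by (metis (no_types, lifting) real_sqrt_le_mono real_sqrt_mult real_sqrt_abs abs_of_pos zero_less_power)
qed

lemma fixed_point_error:
  assumes q: "q < 1" and r: "0 \<le> r" and PB: "PH \<in> B_h m \<xi> f D"
    and T: "T_contraction \<Omega> (m + 2) m \<xi> \<sigma> f D q (cball_h m \<xi> D PH r)"
  defines "P \<equiv> P_star \<Omega> (m + 2) m \<xi> \<sigma> f D (cball_h m \<xi> D PH r)"
  shows "\<And>K x. K \<in> elems D \<Longrightarrow> x \<in> K \<Longrightarrow> norm (H_h (us P) K x - Hu x) \<le> point_const q * h ^ m"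
    and "L2_broken_norm D (\<lambda>K x. H_h (us P) K x - Hu x) \<le> L2_const q * h ^ (m + 1)"
    and "sqrt \<sigma> * sqrt (J_h \<Omega> D (\<lambda>K x. us P K x - u x) (\<lambda>K x. us P K x - u x)) \<le>
      amplification q * consistency_const * h ^ (m + 1)"
proof -
  obtain v \<epsilon> where v: "v \<in> broken_poly (m + 2) D"
    and \<epsilon>0: "\<And>K. K \<in> elems D \<Longrightarrow> 0 \<le> \<epsilon> K"
    and H: "\<And>K x. K \<in> elems D \<Longrightarrow> x \<in> K \<Longrightarrow> norm (Hu x - H_h v K x) \<le> \<epsilon> K"
    and PHu: "\<And>K x. K \<in> elems D \<Longrightarrow> x \<in> K \<Longrightarrow> norm (PH K x - Hu x) \<le> \<epsilon> K"
    and G: "\<And>K x. K \<in> elems D \<Longrightarrow> x \<in> K \<Longrightarrow> norm (grad_on (closure \<Omega>) u x - grad_on UNIV (v K) x) \<le> \<epsilon> K * diameter K"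
    and V: "\<And>K x. K \<in> elems D \<Longrightarrow> x \<in> K \<Longrightarrow> \<bar>u x - v K x\<bar> \<le> \<epsilon> K * (diameter K)\<^sup>2"
    and S: "(\<Sum>K\<in>elems D. (\<epsilon> K * diameter K)\<^sup>2) \<le> approx_const * (h ^ (m + 1))\<^sup>2"
    by (rule broken_approx) blast
  let ?e = "consistency_const * h ^ (m + 1)"
  have e0: "0 \<le> ?e" using consistency_const_nonneg h_pos by simp
  have E: "energy PH v \<le> ?e\<^sup>2" by (rule consistency[OF v \<epsilon>0 H G V S])
  note F = fixed_point_energy[OF q r PB T E e0 v, folded P_def]
  show "sqrt \<sigma> * sqrt (J_h \<Omega> D (\<lambda>K x. us P K x - u x) (\<lambda>K x. us P K x - u x)) \<le>
      amplification q * consistency_const * h ^ (m + 1)" using F(1) by (simp only: mult.assoc)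
  have b: "nrm (\<lambda>K x. H_h (us P) K x - PH K x) \<le> 2 * amplification q * consistency_const * h ^ (m + 1)"
    using F(2) by (simp only: mult.assoc)
  have b0: "0 \<le> 2 * amplification q * consistency_const"
    using q consistency_const_nonneg by (simp add: amplification_def)
  show "norm (H_h (us P) K x - Hu x) \<le> point_const q * h ^ m" if "K \<in> elems D" "x \<in> K" for K x
    unfolding point_const_def by (rule error_from_discrete_error(1)[OF us_poly b b0 \<epsilon>0 PHu S that])
  show "L2_broken_norm D (\<lambda>K x. H_h (us P) K x - Hu x) \<le> L2_const q * h ^ (m + 1)"
    unfolding L2_const_def by (rule error_from_discrete_error(2)[OF us_poly b b0 \<epsilon>0 PHu S])
qed

end

section \<open>Elementwise convexity\<close>

text \<open>Restrict to segments and use the second derivative criterion on the line.\<close>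

lemma convex_on_if_hess_nonneg:
  assumes p: "p \<in> Pk n" and K: "convex K"
    and pos: "\<And>x z. x \<in> K \<Longrightarrow> 0 \<le> z \<bullet> (hess_on UNIV p x *v z)"
  shows "convex_on K p"
proof (rule convex_onI[OF _ K])
  fix t x y assume t: "0 < t" "t < (1::real)" and x: "x \<in> K" and y: "y \<in> K"
  let ?z = "y - x"
  let ?l = "\<lambda>s. x + s *\<^sub>R ?z"
  let ?g = "grad_on UNIV p" and ?H = "hess_on UNIV p"
  have l: "(?l has_vector_derivative ?z) (at s)" for s by (auto intro!: derivative_eq_intros)
  have d1: "((\<lambda>s. p (?l s)) has_real_derivative ?g (?l s) \<bullet> ?z) (at s)" for s
  proof -
    have "(p has_derivative (\<lambda>d. ?g (?l s) \<bullet> d)) (at (?l s))" using Pk_has_grad[OF p] by simp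
    from vector_derivative_diff_chain_within[OF l[THEN has_vector_derivative_at_within] this[THEN has_derivative_at_withinI]]
    show ?thesis by (simp add: o_def has_real_derivative_iff_has_vector_derivative)
  qed
  have d2: "((\<lambda>s. ?g (?l s) \<bullet> ?z) has_real_derivative ?z \<bullet> (?H (?l s) *v ?z)) (at s)" for s
  proof -
    have "(?g has_derivative (\<lambda>d. ?H (?l s) *v d)) (at (?l s))" using Pk_has_hess[OF p] by simp
    from vector_derivative_diff_chain_within[OF l[THEN has_vector_derivative_at_within] this[THEN has_derivative_at_withinI]]
    have "((\<lambda>s. ?g (?l s)) has_vector_derivative ?H (?l s) *v ?z) (at s)" by (simp add: o_def)
    from bounded_linear.has_vector_derivative[OF bounded_linear_inner_left[of ?z] this]
    show ?thesis by (simp add: has_real_derivative_iff_has_vector_derivative inner_commute)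
  qed
  have "convex_on {0..1} (\<lambda>s. p (?l s))"
  proof (rule f''_ge0_imp_convex[OF _ d1 d2])
    fix s :: real assume s: "s \<in> {0..1}"
    have "?l s = (1 - s) *\<^sub>R x + s *\<^sub>R y" by (simp add: algebra_simps)
    then have "?l s \<in> K" using K x y s by (auto simp: convex_def)
    then show "0 \<le> ?z \<bullet> (?H (?l s) *v ?z)" by (rule pos)
  qed simp
  from convex_onD[OF this, of t 0 1] t
  have "p (?l t) \<le> (1 - t) * p x + t * p y" by simp
  moreover have "?l t = (1 - t) *\<^sub>R x + t *\<^sub>R y" by (simp add: algebra_simps)
  ultimately show "p ((1 - t) *\<^sub>R x + t *\<^sub>R y) \<le> (1 - t) * p x + t * p y" by simp
qed

lemma quadratic_form_le: "\<bar>z \<bullet> ((A :: mat) *v z)\<bar> \<le> norm A * (norm z)\<^sup>2"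
proof -
  have "\<bar>z \<bullet> (A *v z)\<bar> \<le> norm z * norm (A *v z)" by (rule Cauchy_Schwarz_ineq2)
  also have "norm (A *v z) \<le> norm A * norm z"
    unfolding norm_vec_def[of A] norm_vec_def[of "A *v z"] L2_set_left_distrib[OF norm_ge_zero]
    by (intro L2_set_mono) (auto simp: matrix_vector_mul_component Cauchy_Schwarz_ineq2)
  finally have "\<bar>z \<bullet> (A *v z)\<bar> \<le> norm z * (norm A * norm z)" by (simp add: mult_left_mono)
  then show ?thesis by (simp add: power2_eq_square mult.left_commute mult.commute)
qed

text \<open>The hypotheses hold in the open domain, while nodes and element points may lie on the boundary;
  continuity carries them over.\<close>

lemma exact_hessian_closure:
  assumes u: "exact_solution \<Omega> m f u"
  obtains \<nu> where "\<nu> > 0" "\<And>x z. x \<in> closure \<Omega> \<Longrightarrow> \<nu> * (norm z)\<^sup>2 \<le> z \<bullet> (hess_on (closure \<Omega>) u x *v z)"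
    "\<And>x. x \<in> closure \<Omega> \<Longrightarrow> det (hess_on (closure \<Omega>) u x) = f x"
proof -
  let ?H = "hess_on (closure \<Omega>) u"
  have cH: "continuous_on (closure \<Omega>) ?H" using u by (simp add: exact_solution_def C2_on_def)
  obtain \<nu> where \<nu>: "\<nu> > 0" "\<And>x z. x \<in> \<Omega> \<Longrightarrow> \<nu> * (norm z)\<^sup>2 \<le> z \<bullet> (?H x *v z)"
    using u unfolding exact_solution_def by blast
  have "\<nu> * (norm z)\<^sup>2 \<le> z \<bullet> (?H x *v z)" if x: "x \<in> closure \<Omega>" for x z
  proof (rule continuous_ge_on_closure[OF _ x])
    show "continuous_on (closure \<Omega>) (\<lambda>x. z \<bullet> (?H x *v z))"
      unfolding matrix_vector_mult_def inner_vec_def by (intro continuous_intros cH)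
  qed (rule \<nu>(2))
  moreover have "det (?H x) = f x" if x: "x \<in> closure \<Omega>" for x
  proof -
    have "det (?H x) - f x = 0"
    proof (rule continuous_constant_on_closure[OF _ _ x])
      show "continuous_on (closure \<Omega>) (\<lambda>x. det (?H x) - f x)"
        unfolding det_2 using u by (intro continuous_intros cH) (simp add: exact_solution_def)
    qed (use u in \<open>simp add: exact_solution_def\<close>)
    then show ?thesis by simp
  qed
  ultimately show ?thesis using that \<nu>(1) by blast
qed

context discretization
begin

lemma PH_in_B_h:
  assumes f: "exact_solution \<Omega> m f u"
  shows "PH \<in> B_h m \<xi> f D"
proof -
  from f obtain \<nu> where \<nu>: "\<nu> > 0" "\<And>x z. x \<in> closure \<Omega> \<Longrightarrow> \<nu> * (norm z)\<^sup>2 \<le> z \<bullet> (Hu x *v z)"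
    and dt: "\<And>x. x \<in> closure \<Omega> \<Longrightarrow> det (Hu x) = f x" by (rule exact_hessian_closure) blast
  have "posdef (PH K (node \<xi> D K j)) \<and> det (PH K (node \<xi> D K j)) = f (node \<xi> D K j)"
    if K: "K \<in> elems D" and j: "j < n_nodes m" for K j
  proof -
    let ?x = "node \<xi> D K j"
    have x: "?x \<in> closure \<Omega>" using node_mem[OF D K \<xi> j] elem_subset[OF D K] by blast
    have "0 < z \<bullet> (Hu ?x *v z)" if "z \<noteq> 0" for z
      using \<nu>(2)[OF x, of z] \<nu>(1) that by (smt (verit) mult_pos_pos zero_less_norm_iff zero_less_power)
    then show ?thesis
      unfolding PH_node[OF K j] posdef_def using dt[OF x] hess_symmetric[OF \<Omega> u m w x] by simp
  qed
  then show ?thesis unfolding B_h_def using PH_sym by blast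
qed

lemma elementwise_convex_if_hess_close:
  assumes \<nu>: "\<And>x z. x \<in> closure \<Omega> \<Longrightarrow> \<nu> * (norm z)\<^sup>2 \<le> z \<bullet> (Hu x *v z)"
    and s: "s \<in> broken_poly k D"
    and close: "\<And>K x. K \<in> elems D \<Longrightarrow> x \<in> K \<Longrightarrow> norm (H_h s K x - Hu x) \<le> \<nu>"
  shows "elementwise_convex D s"
  unfolding elementwise_convex_def
proof
  fix K assume K: "K \<in> elems D"
  have "s K \<in> Pk k" using s K by (simp add: broken_poly_def)
  then show "convex_on K (s K)"
  proof (rule convex_on_if_hess_nonneg[OF _ elem_convex[OF D K]])
    fix x z assume x: "x \<in> K"
    have "\<bar>z \<bullet> ((H_h s K x - Hu x) *v z)\<bar> \<le> \<nu> * (norm z)\<^sup>2"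
      using quadratic_form_le[of z "H_h s K x - Hu x"] mult_right_mono[OF close[OF K x], of "(norm z)\<^sup>2"] by simp
    moreover have "z \<bullet> ((H_h s K x - Hu x) *v z) = z \<bullet> (H_h s K x *v z) - z \<bullet> (Hu x *v z)"
      by (simp add: matrix_vector_mult_diff_rdistrib inner_diff_right)
    moreover have "\<nu> * (norm z)\<^sup>2 \<le> z \<bullet> (Hu x *v z)" using \<nu> elem_subset[OF D K] x by blast
    ultimately show "0 \<le> z \<bullet> (hess_on UNIV (s K) x *v z)" unfolding H_h_def by linarith
  qed
qed

end

section \<open>The estimate for the mesh family\<close>

theorem corollary5p4:
  fixes \<Omega> :: "(real^2) set" and k m :: nat and \<sigma> :: real
    and \<xi> :: "nat \<Rightarrow> real^2" and mesh :: "'i \<Rightarrow> disc"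
  assumes "convex_polygonal_domain \<Omega>"
    and "k \<ge> 3" and "m = k - 2" and "\<sigma> > 0"
    and "\<And>i. mesh_of \<Omega> (mesh i)"
    and "shape_regular mesh" and "quasi_uniform mesh"
    and "unisolvent m \<xi>" and "uniform_weights m mesh"
  shows "(\<forall>i. well_posed \<Omega> k m \<xi> \<sigma> (mesh i)) \<and>
    (\<forall>f u \<kappa>0 h0 q.
       exact_solution \<Omega> m f u \<and> \<kappa>0 > 0 \<and> h0 > 0 \<and> q < 1 \<and>
       (\<forall>i. mesh_size (mesh i) \<le> h0 \<longrightarrow>
          T_contraction \<Omega> k m \<xi> \<sigma> f (mesh i) q
            (cball_h m \<xi> (mesh i) (P_hat \<Omega> m \<xi> u (mesh i)) (\<kappa>0 * mesh_size (mesh i)))) \<longrightarrow>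
       (\<exists>h1>0. \<exists>C>0. \<forall>i. mesh_size (mesh i) \<le> h1 \<longrightarrow>
          (let D = mesh i; h = mesh_size D;
               P = P_star \<Omega> k m \<xi> \<sigma> f D (cball_h m \<xi> D (P_hat \<Omega> m \<xi> u D) (\<kappa>0 * h));
               us = u_h \<Omega> k m \<xi> \<sigma> D P;
               e = (\<lambda>K x. us K x - u x)
           in elementwise_convex D us \<and>
              L2_broken_norm D (\<lambda>K x. H_h us K x - hess_on (closure \<Omega>) u x)
                + sqrt \<sigma> * sqrt (J_h \<Omega> D e e) \<le> C * h ^ (1 + m))))"
proof (intro conjI allI impI)
  note \<Omega> = assms(1) and D = assms(5) and \<sigma> = assms(4) and \<xi> = assms(8)
  have k: "k = m + 2" and m: "m \<ge> 1" using assms(2,3) by auto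
  obtain \<gamma> where \<gamma>: "\<And>i K. K \<in> elems (mesh i) \<Longrightarrow> \<exists>x r. 0 < r \<and> ball x r \<subseteq> K \<and> diameter K \<le> \<gamma> * r"
    using assms(6) unfolding shape_regular_def by blast
  obtain \<theta> where \<theta>: "\<theta> > 0" "\<And>i K. K \<in> elems (mesh i) \<Longrightarrow> \<theta> * mesh_size (mesh i) \<le> diameter K"
    using assms(7) unfolding quasi_uniform_def by blast
  obtain c Cw where c: "c > 0" and W: "\<And>i K j. K \<in> elems (mesh i) \<Longrightarrow> j < n_nodes m \<Longrightarrow>
      c * (diameter K)\<^sup>2 \<le> wt (mesh i) K j \<and> wt (mesh i) K j \<le> Cw * (diameter K)\<^sup>2"
    using assms(9) unfolding uniform_weights_def by blast
  have pos: "positive_weights m (mesh i)" for i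
    unfolding positive_weights_def
    using W elem_diameter_pos[OF D] c by (metis less_le_trans mult_pos_pos zero_less_power)
  show "well_posed \<Omega> k m \<xi> \<sigma> (mesh i)" for i
    using discrete_problem_well_posed[OF \<Omega> D[of i], of k \<sigma> \<xi>] pos[of i] \<sigma> \<xi> by (simp add: k)
  fix f u \<kappa>0 h0 q
  assume A: "exact_solution \<Omega> m f u \<and> \<kappa>0 > 0 \<and> h0 > 0 \<and> q < 1 \<and>
       (\<forall>i. mesh_size (mesh i) \<le> h0 \<longrightarrow>
          T_contraction \<Omega> k m \<xi> \<sigma> f (mesh i) q
            (cball_h m \<xi> (mesh i) (P_hat \<Omega> m \<xi> u (mesh i)) (\<kappa>0 * mesh_size (mesh i))))"
  then have ex: "exact_solution \<Omega> m f u" and \<kappa>: "\<kappa>0 > 0" and h0: "h0 > 0" and q: "q < 1"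
    and T: "\<And>i. mesh_size (mesh i) \<le> h0 \<Longrightarrow> T_contraction \<Omega> (m + 2) m \<xi> \<sigma> f (mesh i) q
            (cball_h m \<xi> (mesh i) (P_hat \<Omega> m \<xi> u (mesh i)) (\<kappa>0 * mesh_size (mesh i)))"
    unfolding k by blast+
  have u: "C2_on (closure \<Omega>) u" "\<And>x. x \<in> frontier \<Omega> \<Longrightarrow> u x = 0" "u \<in> sobolev_H \<Omega> (m + 3)"
    using ex unfolding exact_solution_def by blast+
  obtain w where w: "has_Hm_derivs \<Omega> (m + 3) u w" using sobolev_H_derivs[OF u(3)] by blast
  obtain \<Lambda> where \<Lambda>: "nodal_bound m \<xi> \<Lambda>" using nodal_bound_exists[OF \<xi>] by blast
  from ex obtain \<nu> where \<nu>: "\<nu> > 0"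
    "\<And>x z. x \<in> closure \<Omega> \<Longrightarrow> \<nu> * (norm z)\<^sup>2 \<le> z \<bullet> (hess_on (closure \<Omega>) u x *v z)"
    by (rule exact_hessian_closure) blast
  have disc: "discretization \<Omega> m \<xi> \<sigma> (mesh i) \<gamma> \<theta> c Cw \<Lambda> u w" for i
    by unfold_locales (use \<Omega> D m \<sigma> \<gamma> \<theta> \<xi> \<Lambda> c W u w in \<open>blast+\<close>)
  \<comment> \<open>These constants do not depend on \<open>i\<close>.\<close>
  define pc where "pc = discretization.point_const \<Omega> m \<sigma> \<gamma> \<theta> c Cw \<Lambda> w q"
  define lc where "lc = discretization.L2_const \<Omega> m \<sigma> \<gamma> c Cw \<Lambda> w q"
  define jc where "jc = discretization.amplification q * discretization.consistency_const \<Omega> m \<sigma> \<gamma> Cw \<Lambda> w"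
  show "\<exists>h1>0. \<exists>C>0. \<forall>i. mesh_size (mesh i) \<le> h1 \<longrightarrow>
          (let D = mesh i; h = mesh_size D;
               P = P_star \<Omega> k m \<xi> \<sigma> f D (cball_h m \<xi> D (P_hat \<Omega> m \<xi> u D) (\<kappa>0 * h));
               us = u_h \<Omega> k m \<xi> \<sigma> D P;
               e = (\<lambda>K x. us K x - u x)
           in elementwise_convex D us \<and>
              L2_broken_norm D (\<lambda>K x. H_h us K x - hess_on (closure \<Omega>) u x)
                + sqrt \<sigma> * sqrt (J_h \<Omega> D e e) \<le> C * h ^ (1 + m))"
  proof (intro exI conjI allI impI)
    \<comment> \<open>Below \<open>h0\<close> the contraction is available, below \<open>1\<close> the power
      \<open>h ^ m\<close> is at most \<open>h\<close>, and the third bound brings the Hessian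
      error under \<open>\<nu>\<close>.\<close>
    show "0 < min h0 (min 1 (\<nu> / (\<bar>pc\<bar> + 1)))" using h0 \<nu>(1) by simp
    show "0 < \<bar>lc\<bar> + \<bar>jc\<bar> + 1" by simp
    fix i assume hi: "mesh_size (mesh i) \<le> min h0 (min 1 (\<nu> / (\<bar>pc\<bar> + 1)))"
    interpret discretization \<Omega> m \<xi> \<sigma> "mesh i" \<gamma> \<theta> c Cw \<Lambda> u w by (rule disc)
    let ?h = "mesh_size (mesh i)"
    let ?P = "P_star \<Omega> (m + 2) m \<xi> \<sigma> f (mesh i) (cball_h m \<xi> (mesh i) (P_hat \<Omega> m \<xi> u (mesh i)) (\<kappa>0 * ?h))"
    have r: "0 \<le> \<kappa>0 * ?h" using \<kappa> h_pos by simp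
    have Ti: "T_contraction \<Omega> (m + 2) m \<xi> \<sigma> f (mesh i) q
        (cball_h m \<xi> (mesh i) (P_hat \<Omega> m \<xi> u (mesh i)) (\<kappa>0 * ?h))" using hi by (intro T) simp
    note E = fixed_point_error[OF q r PH_in_B_h[OF ex] Ti, folded pc_def lc_def jc_def]
    have "pc * ?h ^ m \<le> \<nu>"
    proof -
      have "?h ^ m \<le> ?h" using power_decreasing[OF m, of ?h] h_pos hi by simp
      then have "pc * ?h ^ m \<le> (\<bar>pc\<bar> + 1) * ?h" using h_pos by (intro mult_mono) auto
      also have "\<dots> \<le> (\<bar>pc\<bar> + 1) * (\<nu> / (\<bar>pc\<bar> + 1))" using hi by (intro mult_left_mono) auto
      also have "\<dots> = \<nu>" by (simp add: add_nonneg_eq_0_iff)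
      finally show ?thesis .
    qed
    then have "elementwise_convex (mesh i) (us ?P)"
      using E(1) by (intro elementwise_convex_if_hess_close[OF \<nu>(2) us_poly]) (auto intro: order_trans)
    moreover have "L2_broken_norm (mesh i) (\<lambda>K x. H_h (us ?P) K x - Hu x) +
        sqrt \<sigma> * sqrt (J_h \<Omega> (mesh i) (\<lambda>K x. us ?P K x - u x) (\<lambda>K x. us ?P K x - u x)) \<le>
        (\<bar>lc\<bar> + \<bar>jc\<bar> + 1) * ?h ^ (1 + m)"
    proof -
      have "lc * ?h ^ (m + 1) + jc * ?h ^ (m + 1) \<le> (\<bar>lc\<bar> + \<bar>jc\<bar> + 1) * ?h ^ (m + 1)"
        unfolding distrib_right[symmetric] using h_pos by (intro mult_right_mono) auto
      then show ?thesis using E(2,3) by (simp only: add.commute[of 1 m])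
    qed
    ultimately show "let D = mesh i; h = mesh_size D;
               P = P_star \<Omega> k m \<xi> \<sigma> f D (cball_h m \<xi> D (P_hat \<Omega> m \<xi> u D) (\<kappa>0 * h));
               us = u_h \<Omega> k m \<xi> \<sigma> D P;
               e = (\<lambda>K x. us K x - u x)
           in elementwise_convex D us \<and>
              L2_broken_norm D (\<lambda>K x. H_h us K x - hess_on (closure \<Omega>) u x)
                + sqrt \<sigma> * sqrt (J_h \<Omega> D e e) \<le> (\<bar>lc\<bar> + \<bar>jc\<bar> + 1) * h ^ (1 + m)"
      unfolding Let_def k by blast
  qed
qed

end
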